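(* Let $q=\psi'+\psi^2$ with $\psi\in\mathcal A(I_\pi)$. Then $$\lambda_1(I_\pi,q)\ge 3,$$ with equality if and only if $q(x)=1+2\tan^2x$ (and in this case an eigenfunction is $\cos^2x$).
   Context: $I_\pi:=(-\frac{\pi}{2},\frac{\pi}{2})$. For an open bounded interval $I$ and a nonnegative Borel measure $q$ on $I$, possibly taking the value $+\infty$, $$\lambda_1(I,q):=\inf\Big\{\frac{\int_I|v'|^2dx+\int_I|v|^2\,dq}{\int_I v^2dx}: v\in H^1_0(I)\cap L^2(I,q),\ v\neq0\Big\}$$ (the infimum of the empty set being $+\infty$); an eigenfunction is a minimizer. $\mathcal A(I_\pi)$ is the class of increasing functions $\psi:I_\pi\to\mathbb{R}\cup\{\pm\infty\}$, with finiteness domain $\mathrm{dom}(\psi)=\{x\in I_\pi:\psi(x)\in\mathbb{R}\}$, such that $\psi(y)-\psi(x)\ge 2\tan\big(\frac{y-x}{2}\big)$ whenever $x<y$ belong to $\mathrm{dom}(\psi)$. For $\psi\in\mathcal A(I_\pi)$, $\psi'$ denotes the distributional derivative of $\psi$ (a nonnegative measure on $\mathrm{dom}(\psi)$) and $\psi^2$ denotes the measure $\psi^2\,dx$; both measures are extended to $+\infty$ on $I_\pi\setminus\mathrm{dom}(\psi)$ (so that admissible test functions vanish there). Absolutely continuous measures are identified with their densities. *)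

theory Defs
  imports "HOL-Analysis.Analysis"
begin

abbreviation lebesgue_borel_on :: "real set \<Rightarrow> real measure"
  where "lebesgue_borel_on J \<equiv> restrict_space lborel J"

text \<open>The test functions of class \<open>C\<^sub>c\<^sup>\<infinity>\<close> on an open set \<open>J\<close>, extended by zero to the real line.\<close>

definition test_function :: "real set \<Rightarrow> (real \<Rightarrow> real) \<Rightarrow> bool" where
  "test_function J \<phi> \<longleftrightarrow>
     (\<forall>n x. (deriv ^^ n) \<phi> differentiable (at x)) \<and>
     (\<exists>K. compact K \<and> K \<subseteq> J \<and> (\<forall>x. x \<notin> K \<longrightarrow> \<phi> x = 0))"

text \<open>\<open>has_distributional_derivative J f \<mu>\<close>: the nonnegative Borel measure \<open>\<mu>\<close> on the open set
  \<open>J\<close> is the distributional derivative of the locally integrable function \<open>f\<close>. Finiteness on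
  compact sets makes every test function \<open>\<mu>\<close>-integrable, so that \<open>\<mu>\<close> does define a distribution;
  it also makes \<open>\<mu>\<close> unique.\<close>

definition has_distributional_derivative ::
    "real set \<Rightarrow> (real \<Rightarrow> real) \<Rightarrow> real measure \<Rightarrow> bool" where
  "has_distributional_derivative J f \<mu> \<longleftrightarrow>
     sets \<mu> = sets (restrict_space borel J) \<and>
     (\<forall>K. compact K \<and> K \<subseteq> J \<longrightarrow> set_integrable lborel K f \<and> emeasure \<mu> K < \<infinity>) \<and>
     (\<forall>\<phi>. test_function J \<phi> \<longrightarrow>
        (LINT x|lebesgue_borel_on J. f x * deriv \<phi> x) = - (LINT x|\<mu>. \<phi> x))"

definition L2 :: "real measure \<Rightarrow> (real \<Rightarrow> real) set" where
  "L2 M = {f. f \<in> borel_measurable M \<and> (\<integral>\<^sup>+x. ennreal ((f x)\<^sup>2) \<partial>M) < \<infinity>}"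

text \<open>\<open>H1 J v g\<close>: \<open>v\<close> belongs to \<open>H\<^sup>1(J)\<close> and \<open>g\<close> is (a representative of) its weak derivative.\<close>

definition H1 :: "real set \<Rightarrow> (real \<Rightarrow> real) \<Rightarrow> (real \<Rightarrow> real) \<Rightarrow> bool" where
  "H1 J v g \<longleftrightarrow>
     v \<in> L2 (lebesgue_borel_on J) \<and> g \<in> L2 (lebesgue_borel_on J) \<and>
     (\<forall>\<phi>. test_function J \<phi> \<longrightarrow>
        (LINT x|lebesgue_borel_on J. v x * deriv \<phi> x) =
        - (LINT x|lebesgue_borel_on J. g x * \<phi> x))"

text \<open>\<open>H\<^sup>1\<^sub>0(J)\<close> is the closure of the test functions in the norm of \<open>H\<^sup>1(J)\<close>. Its elements are
  represented by their continuous representatives, because they are integrated against measures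
  that need not be absolutely continuous.\<close>

definition H10 :: "real set \<Rightarrow> (real \<Rightarrow> real) \<Rightarrow> (real \<Rightarrow> real) \<Rightarrow> bool" where
  "H10 J v g \<longleftrightarrow>
     H1 J v g \<and> continuous_on J v \<and>
     (\<exists>\<phi> :: nat \<Rightarrow> real \<Rightarrow> real. (\<forall>n. test_function J (\<phi> n)) \<and>
        (\<lambda>n. (\<integral>\<^sup>+x. ennreal ((\<phi> n x - v x)\<^sup>2) \<partial>lebesgue_borel_on J) +
              (\<integral>\<^sup>+x. ennreal ((deriv (\<phi> n) x - g x)\<^sup>2) \<partial>lebesgue_borel_on J))
          \<longlonglongrightarrow> 0)"

definition admissible :: "real set \<Rightarrow> real measure \<Rightarrow> (real \<Rightarrow> real) \<Rightarrow> (real \<Rightarrow> real) \<Rightarrow> bool" where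
  "admissible J q v g \<longleftrightarrow> H10 J v g \<and> v \<in> L2 q \<and> (\<exists>x\<in>J. v x \<noteq> 0)"

definition rayleigh :: "real set \<Rightarrow> real measure \<Rightarrow> (real \<Rightarrow> real) \<Rightarrow> (real \<Rightarrow> real) \<Rightarrow> ennreal" where
  "rayleigh J q v g =
     ((\<integral>\<^sup>+x. ennreal ((g x)\<^sup>2) \<partial>lebesgue_borel_on J) + (\<integral>\<^sup>+x. ennreal ((v x)\<^sup>2) \<partial>q)) /
     (\<integral>\<^sup>+x. ennreal ((v x)\<^sup>2) \<partial>lebesgue_borel_on J)"

definition lambda1 :: "real set \<Rightarrow> real measure \<Rightarrow> ennreal" where
  "lambda1 J q = Inf {rayleigh J q v g | v g. admissible J q v g}"

definition eigenfunction :: "real set \<Rightarrow> real measure \<Rightarrow> (real \<Rightarrow> real) \<Rightarrow> bool" where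
  "eigenfunction J q v \<longleftrightarrow> (\<exists>g. admissible J q v g \<and> rayleigh J q v g = lambda1 J q)"

abbreviation I_pi :: "real set"
  where "I_pi \<equiv> {- (pi / 2)<..<pi / 2}"

text \<open>Only the values of \<open>\<psi>\<close> on \<open>I_pi\<close> matter.\<close>

definition finite_dom :: "(real \<Rightarrow> ereal) \<Rightarrow> real set" where
  "finite_dom \<psi> = {x \<in> I_pi. \<bar>\<psi> x\<bar> \<noteq> \<infinity>}"

definition class_A :: "(real \<Rightarrow> ereal) set" where
  "class_A = {\<psi>. mono_on I_pi \<psi> \<and>
     (\<forall>x\<in>finite_dom \<psi>. \<forall>y\<in>finite_dom \<psi>. x < y \<longrightarrow>
        real_of_ereal (\<psi> y) - real_of_ereal (\<psi> x) \<ge> 2 * tan ((y - x) / 2))}"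

text \<open>\<open>is_potential \<psi> q\<close>: \<open>q\<close> is the Borel measure \<open>\<psi>' + \<psi>\<^sup>2\<close> on \<open>I_pi\<close>, equal to \<open>\<infinity>\<close> on every Borel
  set that meets the complement of the finiteness domain. The latter is an interval that may contain
  an end point lying in \<open>I_pi\<close>; the derivative is taken in its interior and puts no mass on such an
  end point. The convention there is immaterial: continuous functions in \<open>L2 q\<close> vanish at it.\<close>

definition is_potential :: "(real \<Rightarrow> ereal) \<Rightarrow> real measure \<Rightarrow> bool" where
  "is_potential \<psi> q \<longleftrightarrow>
     sets q = sets (restrict_space borel I_pi) \<and>
     (\<exists>\<mu>. has_distributional_derivative (interior (finite_dom \<psi>)) (\<lambda>x. real_of_ereal (\<psi> x)) \<mu> \<and>
        (\<forall>A\<in>sets q. emeasure q A =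
           (if A \<subseteq> finite_dom \<psi>
            then emeasure \<mu> (A \<inter> interior (finite_dom \<psi>)) +
                 (\<integral>\<^sup>+x\<in>A. ennreal ((real_of_ereal (\<psi> x))\<^sup>2) \<partial>lborel)
            else \<infinity>)))"

end

theory Submission
  imports Defs "HOL-Complex_Analysis.Great_Picard"
begin

text \<open>
  Let \<open>(a, b)\<close> be the interior of the finiteness domain and \<open>u = exp (- \<integral>\<psi>)\<close>, so that
  \<open>u' = - \<psi> u\<close>. Because \<open>q = \<psi>' + \<psi>\<^sup>2\<close>, the quadratic form is a square:
  \<open>\<integral>v'\<^sup>2 + \<integral>v\<^sup>2 dq = \<integral>(v' - \<psi> v)\<^sup>2\<close> (\<open>energy_eq\<close>, proved by Fubini's theorem). Let \<open>v\<close> be a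
  minimiser, with eigenvalue \<open>\<lambda>\<close>. The function \<open>w\<close> with \<open>w' = v / u\<close>, suitably normalised,
  satisfies \<open>- (u\<^sup>2 w')' = \<lambda> u\<^sup>2 w\<close>, and the flux \<open>u\<^sup>2 w' = u v\<close> vanishes at both ends: \<open>w\<close> is a
  Neumann eigenfunction for the weight \<open>u\<^sup>2\<close>. The tangent bound on \<open>\<psi>\<close> says that \<open>log u\<close> is at
  least as concave as \<open>log cos\<close>, in the two-point sense. For the weight \<open>cos\<^sup>2\<close> on \<open>(- \<pi>/2, \<pi>/2)\<close>
  the Neumann eigenfunction is the sine, with eigenvalue 3. So the theorem is a comparison of
  first Neumann eigenvalues, and it is proved by a maximum principle for pairs of points.

  Suppose \<open>\<lambda> \<le> 3\<close> and restrict \<open>w\<close> to a nodal interval of \<open>v\<close>, where it is monotone. Let \<open>osc s\<close>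
  be the largest increment of \<open>w\<close> between two points at distance \<open>2 s\<close>. At a pair of points where
  the increments of \<open>w\<close> are touched from above by a function \<open>2 \<Phi>(s)\<close>, the tangent bound yields
  \<open>2 \<Phi>' tan s \<le> \<Phi>'' + 3 \<Phi>\<close> (\<open>touches_tan\<close>). Hence \<open>osc s / sin s\<close> is a convex function of
  \<open>tan s - cot s\<close> (\<open>osc_convex\<close>). It is bounded as \<open>s\<close> tends to 0, where \<open>tan s - cot s\<close> tends to
  \<open>- \<infinity>\<close>; so it is nondecreasing. On an interval shorter than \<open>\<pi>\<close> this contradicts the Neumann
  condition. If the length is \<open>\<pi>\<close>, convexity at the other end as well forces \<open>osc s = 2 C sin s\<close>.
  Then every distance has a pair of points with equality, at which \<open>\<lambda> = 3\<close>, the tangent bound is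
  an equality, and the first two derivatives of \<open>w\<close> are known. These pairs turn out to be
  symmetric about 0, which determines \<open>w'\<close> and then \<open>\<psi> = tan\<close> (\<open>two_point_rigidity\<close>).

  Since \<open>\<psi>\<close> is only monotone, \<open>w''\<close> exists only off a countable set. The second-order condition at
  a touching pair is therefore replaced by a monotonicity argument that tolerates countable
  exceptional sets.

  The remaining parts connect this with the definitions. Testing the distributional derivative
  with smooth steps gives its mass on intervals (\<open>distributional_derivative_Ioc\<close>). An admissible
  function is an indefinite integral (\<open>H10_primitive\<close>) and vanishes off \<open>(a, b)\<close>, because \<open>q\<close> is
  infinite off the finiteness domain; so its Rayleigh quotient is at least the infimum of the
  quadratic form (\<open>rayleigh_ge\<close>). Conversely, for \<open>\<psi> = tan\<close> the quotient of \<open>cos\<^sup>2\<close> is 3.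
\<close>

section \<open>Derivatives that exist off a countable set\<close>

text \<open>If \<open>f q < f p\<close>, there is a level between the two that \<open>f\<close> does not take on the countable set
  \<open>D\<close>. At the last point where \<open>f\<close> takes this level it has a positive derivative, although \<open>f\<close>
  stays below the level from there on.\<close>

lemma pos_deriv_off_countable_imp_le:
  fixes f :: "real \<Rightarrow> real"
  assumes "p \<le> q" and cont: "continuous_on {p..q} f" and "countable D"
    and deriv: "\<And>x. p < x \<Longrightarrow> x < q \<Longrightarrow> x \<notin> D \<Longrightarrow> \<exists>d>0. (f has_real_derivative d) (at x)"
  shows "f p \<le> f q"
proof (rule ccontr)
  assume "\<not> f p \<le> f q"
  then have lt: "f q < f p" by simp
  have "uncountable {f q<..<f p}" using lt by (simp add: uncountable_open_interval)
  moreover have "countable (f ` D)" using \<open>countable D\<close> by simp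
  ultimately have "\<not> {f q<..<f p} \<subseteq> f ` D" using countable_subset by blast
  then obtain g where g: "f q < g" "g < f p" "g \<notin> f ` D" unfolding subset_iff greaterThanLessThan_iff by blast
  define S where "S = {x \<in> {p..q}. g \<le> f x}"
  have "closed S" unfolding S_def
    using continuous_closed_preimage[OF cont, of "{g..}"] by (simp add: vimage_def Int_def conj_commute)
  have pS: "p \<in> S" using g \<open>p \<le> q\<close> by (simp add: S_def)
  have bdd: "bdd_above S" by (auto simp: S_def intro!: bdd_aboveI[of _ q])
  define x where "x = Sup S"
  have xS: "x \<in> S" unfolding x_def by (rule closed_contains_Sup) (use pS bdd \<open>closed S\<close> in auto)
  have above: "f y < g" if "x < y" "y \<le> q" for y
  proof (rule ccontr)
    assume "\<not> f y < g"
    with that xS have "y \<in> S" by (auto simp: S_def)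
    then have "y \<le> x" unfolding x_def by (rule cSup_upper) (rule bdd)
    with that show False by simp
  qed
  have xq: "x < q" using xS g by (cases "x = q") (auto simp: S_def)
  have fx: "f x = g"
  proof (rule antisym)
    show "g \<le> f x" using xS by (simp add: S_def)
    show "f x \<le> g"
    proof (rule ccontr)
      assume "\<not> f x \<le> g"
      then have "\<exists>z\<ge>x. z \<le> q \<and> f z = g"
        using xq xS g by (intro IVT2') (auto intro!: continuous_on_subset[OF cont] simp: S_def)
      then obtain z where "x \<le> z" "z \<le> q" "f z = g" by auto
      with above[of z] \<open>\<not> f x \<le> g\<close> show False by (cases "x = z") auto
    qed
  qed
  have px: "p < x" using fx g xS by (cases "x = p") (auto simp: S_def)
  have "x \<notin> D" using fx g by auto
  then obtain d where "d > 0" "(f has_real_derivative d) (at x)" using deriv px xq by blast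
  then obtain e where e: "e > 0" "\<And>h. 0 < h \<Longrightarrow> h < e \<Longrightarrow> f x < f (x + h)"
    using DERIV_pos_inc_right by blast
  define h where "h = min (e/2) (q - x)"
  have "f x < f (x + h)" using e xq by (intro e) (auto simp: h_def)
  moreover have "f (x + h) < g" using e xq by (intro above) (auto simp: h_def)
  ultimately show False using fx by simp
qed

text \<open>Adding a small multiple of the identity makes the derivative positive.\<close>

lemma nonneg_deriv_off_countable_imp_le:
  fixes f :: "real \<Rightarrow> real"
  assumes "p \<le> q" and cont: "continuous_on {p..q} f" and "countable D"
    and deriv: "\<And>x. p < x \<Longrightarrow> x < q \<Longrightarrow> x \<notin> D \<Longrightarrow> \<exists>d\<ge>0. (f has_real_derivative d) (at x)"
  shows "f p \<le> f q"
proof -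
  have "f p \<le> f q + e * (q - p)" if "e > 0" for e
  proof -
    have "f p + e * p \<le> f q + e * q"
    proof (rule pos_deriv_off_countable_imp_le[where D = D and f = "\<lambda>x. f x + e * x"])
      fix x assume "p < x" "x < q" "x \<notin> D"
      then obtain d where "d \<ge> 0" "(f has_real_derivative d) (at x)" using deriv by blast
      then show "\<exists>d>0. ((\<lambda>x. f x + e * x) has_real_derivative d) (at x)"
        using \<open>e > 0\<close> by (intro exI[of _ "d + e"]) (auto intro!: derivative_eq_intros)
    qed (use assms in \<open>auto intro!: continuous_intros\<close>)
    then show ?thesis by (simp add: algebra_simps)
  qed
  from this[of "r / (q - p + 1)" for r] have *: "f p \<le> f q + r / (q - p + 1) * (q - p)" if "r > 0" for r
    using that \<open>p \<le> q\<close> by simp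
  show ?thesis
  proof (rule field_le_epsilon)
    fix r :: real assume "r > 0"
    then have "r / (q - p + 1) * (q - p) \<le> r" using \<open>p \<le> q\<close> by (simp add: field_simps)
    then show "f p \<le> f q + r" using *[OF \<open>r > 0\<close>] by simp
  qed
qed

lemma zero_deriv_off_countable_imp_eq:
  fixes f :: "real \<Rightarrow> real"
  assumes "p \<le> q" and cont: "continuous_on {p..q} f" and "countable D"
    and deriv: "\<And>x. p < x \<Longrightarrow> x < q \<Longrightarrow> x \<notin> D \<Longrightarrow> (f has_real_derivative 0) (at x)"
  shows "f p = f q"
proof -
  have *: "g p \<le> g q" if "continuous_on {p..q} g"
    "\<And>x. p < x \<Longrightarrow> x < q \<Longrightarrow> x \<notin> D \<Longrightarrow> (g has_real_derivative 0) (at x)" for g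
    using nonneg_deriv_off_countable_imp_le[OF \<open>p \<le> q\<close> that(1) \<open>countable D\<close>] that(2) by blast
  have "f p \<le> f q" by (rule *[OF cont deriv])
  moreover have "- f p \<le> - f q"
    using DERIV_minus[OF deriv] by (intro *) (auto intro: continuous_on_minus cont)
  ultimately show ?thesis by simp
qed

text \<open>Second-order necessary condition at a maximum, for a function that is twice differentiable
  only at the maximum point.\<close>

lemma second_deriv_nonpos_at_max:
  fixes f :: "real \<Rightarrow> real"
  assumes "d > 0" and f': "\<And>t. \<bar>t\<bar> < d \<Longrightarrow> (f has_real_derivative f' t) (at t)"
    and f'': "(f' has_real_derivative c) (at 0)" and "f' 0 = 0"
    and max: "\<And>t. \<bar>t\<bar> < d \<Longrightarrow> f t \<le> f 0"
  shows "c \<le> 0"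
proof (rule ccontr)
  assume "\<not> c \<le> 0"
  then obtain e where e: "e > 0" "\<And>h. 0 < h \<Longrightarrow> h < e \<Longrightarrow> f' 0 < f' (0 + h)"
    using DERIV_pos_inc_right[OF f''] by auto
  define h where "h = min d e / 2"
  have h: "0 < h" "h < d" "h < e" using e \<open>d > 0\<close> by (auto simp: h_def)
  have "f 0 < f h"
  proof (rule DERIV_pos_imp_increasing_open[OF h(1)])
    fix t assume "0 < t" "t < h"
    then show "\<exists>y. DERIV f t :> y \<and> y > 0"
      using e(2)[of t] f'[of t] h \<open>f' 0 = 0\<close> by auto
  next
    show "continuous_on {0..h} f"
      using h by (intro DERIV_continuous_on[where D = f'] has_field_derivative_at_within[OF f']) auto
  qed
  with max[of h] h show False by simp
qed

section \<open>The increasing Neumann solution and its behaviour at the ends\<close>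

text \<open>The function \<open>w\<close> is an increasing solution of the Neumann problem \<open>- (u\<^sup>2 w')' = lam u\<^sup>2 w\<close>
  with derivative \<open>k\<close>, and \<open>- psi\<close> is the logarithmic derivative of \<open>u\<close>. The boundary condition is
  imposed on the flux \<open>u\<^sup>2 k\<close>, because \<open>u\<close> may vanish at the ends, as \<open>cos\<close> does. The bound
  \<open>psi_tan\<close> is the modulus of concavity of \<open>log u\<close>; it is an equality for \<open>psi = tan\<close> at pairs
  symmetric about 0.\<close>

locale two_point =
  fixes a b lam :: real and psi u w k :: "real \<Rightarrow> real"
  assumes ab: "a < b" "- (pi/2) \<le> a" "b \<le> pi/2"
    and lam: "0 < lam" "lam \<le> 3"
    and psi_mono: "\<And>x y. a < x \<Longrightarrow> x \<le> y \<Longrightarrow> y < b \<Longrightarrow> psi x \<le> psi y"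
    and psi_tan: "\<And>x y. a < x \<Longrightarrow> x < y \<Longrightarrow> y < b \<Longrightarrow> 2 * tan ((y - x) / 2) \<le> psi y - psi x"
    and u_pos: "\<And>x. a < x \<Longrightarrow> x < b \<Longrightarrow> 0 < u x"
    and u_cont: "continuous_on {a<..<b} u"
    and u_deriv: "\<And>x. a < x \<Longrightarrow> x < b \<Longrightarrow> isCont psi x \<Longrightarrow> (u has_real_derivative - psi x * u x) (at x)"
    and w_deriv: "\<And>x. a < x \<Longrightarrow> x < b \<Longrightarrow> (w has_real_derivative k x) (at x)"
    and k_pos: "\<And>x. a < x \<Longrightarrow> x < b \<Longrightarrow> 0 < k x"
    and flux: "\<And>x. a < x \<Longrightarrow> x < b \<Longrightarrow>
        ((\<lambda>x. (u x)\<^sup>2 * k x) has_real_derivative - lam * (u x)\<^sup>2 * w x) (at x)"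
    and flux_a: "((\<lambda>x. (u x)\<^sup>2 * k x) \<longlongrightarrow> 0) (at_right a)"
    and flux_b: "((\<lambda>x. (u x)\<^sup>2 * k x) \<longlongrightarrow> 0) (at_left b)"
begin

text \<open>The reflection \<open>x \<mapsto> - x\<close> maps the problem to itself, so statements about the end \<open>b\<close> carry
  over to \<open>a\<close>.\<close>

lemma reflection:
  "two_point (- b) (- a) lam (\<lambda>x. - psi (- x)) (\<lambda>x. u (- x)) (\<lambda>x. - w (- x)) (\<lambda>x. k (- x))"
proof
  show "((\<lambda>x. (u (-x))\<^sup>2 * k (-x)) \<longlongrightarrow> 0) (at_right (-b))"
    using flux_b by (simp add: filterlim_at_left_to_right)
  show "((\<lambda>x. (u (-x))\<^sup>2 * k (-x)) \<longlongrightarrow> 0) (at_left (-a))"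
    using flux_a by (simp add: filterlim_at_left_to_right)
  show "continuous_on {- b<..<- a} (\<lambda>x. u (- x))"
    by (intro continuous_on_compose2[OF u_cont]) (auto intro!: continuous_intros)
next
  fix x y assume "- b < x" "x < y" "y < - a"
  then show "2 * tan ((y - x) / 2) \<le> - psi (- y) - - psi (- x)"
    using psi_tan[of "-y" "-x"] by simp
next
  fix x assume x: "- b < x" "x < - a" "isCont (\<lambda>x. - psi (- x)) x"
  have "isCont (\<lambda>y. - psi (- (- y))) (- x)"
    by (rule isCont_o2[where g = "\<lambda>x. - psi (- x)" and f = uminus]) (use x(3) in \<open>simp_all\<close>)
  from continuous_minus[OF this] have "isCont psi (- x)" by simp
  then have "(u has_real_derivative - psi (- x) * u (- x)) (at (- x))"
    using x by (intro u_deriv) auto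
  then show "((\<lambda>x. u (- x)) has_real_derivative - (- psi (- x)) * u (- x)) (at x)"
    by (simp add: DERIV_mirror)
next
  fix x assume x: "- b < x" "x < - a"
  have "(w has_real_derivative k (- x)) (at (- x))"
    using x by (intro w_deriv) auto
  then have "((\<lambda>x. w (- x)) has_real_derivative - k (- x)) (at x)"
    by (simp add: DERIV_mirror)
  from DERIV_minus[OF this]
  show "((\<lambda>x. - w (- x)) has_real_derivative k (- x)) (at x)" by simp
  have "((\<lambda>x. (u x)\<^sup>2 * k x) has_real_derivative - lam * (u (-x))\<^sup>2 * w (-x)) (at (-x))"
    using x by (intro flux) auto
  then show "((\<lambda>x. (u (- x))\<^sup>2 * k (- x)) has_real_derivative - lam * (u (-x))\<^sup>2 * - w (-x)) (at x)"
    by (simp add: DERIV_mirror)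
qed (use ab lam psi_mono u_pos k_pos in auto)

definition "disc = {x \<in> {a<..<b}. \<not> isCont psi x}"

lemma countable_disc: "countable disc"
  unfolding disc_def
  by (rule mono_on_ctble_discont_open) (auto simp: mono_on_def intro: psi_mono)

lemma isCont_psi: "a < x \<Longrightarrow> x < b \<Longrightarrow> x \<notin> disc \<Longrightarrow> isCont psi x"
  by (auto simp: disc_def)

lemma w_cont: "continuous_on {a<..<b} w"
  by (intro DERIV_continuous_on[where D = k] has_field_derivative_at_within[OF w_deriv]) auto

lemma flux_cont: "continuous_on {a<..<b} (\<lambda>x. (u x)\<^sup>2 * k x)"
  by (intro DERIV_continuous_on[where D = "\<lambda>x. - lam * (u x)\<^sup>2 * w x"]
       has_field_derivative_at_within[OF flux]) auto

lemma k_cont: "continuous_on {a<..<b} k"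
proof -
  have "continuous_on {a<..<b} (\<lambda>x. ((u x)\<^sup>2 * k x) / (u x)\<^sup>2)"
    by (intro continuous_intros flux_cont u_cont) (use u_pos in force)
  then show ?thesis
    by (rule continuous_on_eq) (use u_pos in force)
qed

lemma usq_deriv:
  assumes "a < x" "x < b" "isCont psi x"
  shows "((\<lambda>x. (u x)\<^sup>2) has_real_derivative - 2 * psi x * (u x)\<^sup>2) (at x)"
  by (rule DERIV_cong[OF DERIV_power[OF u_deriv[OF assms], of 2]]) (simp add: power2_eq_square)

lemma k_deriv:
  assumes "a < x" "x < b" "isCont psi x"
  shows "(k has_real_derivative 2 * psi x * k x - lam * w x) (at x)"
proof -
  note pos = u_pos[OF assms(1,2)]
  from DERIV_divide[OF flux[OF assms(1,2)] usq_deriv[OF assms]]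
  have "((\<lambda>x. ((u x)\<^sup>2 * k x) / (u x)\<^sup>2) has_real_derivative 2 * psi x * k x - lam * w x) (at x)"
    by (rule DERIV_cong) (use pos in \<open>auto simp: power2_eq_square field_simps\<close>)
  then show ?thesis
    by (rule has_field_derivative_transform_within_open[where S = "{a<..<b}"]) (use assms u_pos in force)+
qed

lemma w_strict_mono: "a < x \<Longrightarrow> x < y \<Longrightarrow> y < b \<Longrightarrow> w x < w y"
proof (rule DERIV_pos_imp_increasing_open[of x y w])
  fix z assume "a < x" "x < z" "z < y" "y < b"
  then show "\<exists>d. (w has_real_derivative d) (at z) \<and> 0 < d"
    using w_deriv[of z] k_pos[of z] by auto
qed (auto intro!: continuous_on_subset[OF w_cont])

text \<open>At the right end the flux \<open>u\<^sup>2 k\<close> decreases to zero from positive values, so \<open>w\<close> has to become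
  positive.\<close>

lemma w_eventually_pos: "\<exists>c. a < c \<and> c < b \<and> (\<forall>x. c \<le> x \<longrightarrow> x < b \<longrightarrow> 0 < w x)"
proof -
  have "\<exists>c. a < c \<and> c < b \<and> 0 < w c"
  proof (rule ccontr)
    assume "\<not> ?thesis"
    then have neg: "w c \<le> 0" if "a < c" "c < b" for c using that by (meson not_le)
    define m where "m = (a + b) / 2"
    have m: "a < m" "m < b" using ab by (auto simp: m_def)
    have ge: "(u m)\<^sup>2 * k m \<le> (u x)\<^sup>2 * k x" if "m \<le> x" "x < b" for x
    proof (rule DERIV_nonneg_imp_nondecreasing[OF that(1)])
      fix y assume "m \<le> y" "y \<le> x"
      then show "\<exists>z. ((\<lambda>x. (u x)\<^sup>2 * k x) has_real_derivative z) (at y) \<and> 0 \<le> z"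
        using flux[of y] neg[of y] m that lam
        by (intro exI[of _ "- lam * (u y)\<^sup>2 * w y"]) (auto simp: mult_nonneg_nonpos)
    qed
    have "(u m)\<^sup>2 * k m \<le> 0"
    proof (rule tendsto_lowerbound[OF flux_b])
      show "\<forall>\<^sub>F x in at_left b. (u m)\<^sup>2 * k m \<le> (u x)\<^sup>2 * k x"
        using eventually_at_left_real[OF m(2)] by eventually_elim (rule ge, auto)
    qed simp
    with k_pos[OF m] u_pos[OF m] show False by (simp add: mult_le_0_iff)
  qed
  then obtain c where c: "a < c" "c < b" "0 < w c" by blast
  moreover have "0 < w x" if "c \<le> x" "x < b" for x
    using w_strict_mono[of c x] c that by (cases "c = x") auto
  ultimately show ?thesis by blast
qed

text \<open>The bound \<open>k \<le> 2 \<lambda> (b - x) w\<close> near the right end singles out the bounded solutions: it says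
  that \<open>w\<close> grows at most by a factor \<open>exp (\<lambda> (b - x)\<^sup>2)\<close>, however singular \<open>psi\<close> is at \<open>b\<close>. The
  defect of the bound, multiplied by \<open>u\<^sup>2\<close> and by a Gaussian factor, increases up to a nonpositive
  limit.\<close>

lemma k_le_near_b:
  "\<exists>c. a < c \<and> c < b \<and> (\<forall>x. c \<le> x \<longrightarrow> x < b \<longrightarrow> 0 < w x \<and> k x \<le> 2 * lam * (b - x) * w x)"
proof -
  obtain c0 where c0: "a < c0" "c0 < b" and wpos: "\<And>x. c0 \<le> x \<Longrightarrow> x < b \<Longrightarrow> 0 < w x"
    using w_eventually_pos by blast
  \<comment> \<open>\<open>psi\<close> is bounded below by \<open>- M\<close> on the right of \<open>c0\<close>, and within \<open>d\<close> of \<open>b\<close> this makes the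
    derivative of the defect \<open>G\<close> nonnegative\<close>
  define M where "M = \<bar>psi c0\<bar>"
  define d where "d = min (b - c0) (min (1 / (8 * (M + 1))) (1 / 24))"
  have "M \<ge> 0" by (simp add: M_def)
  then have d: "0 < d" using c0 by (simp add: d_def)
  have d: "0 < d" "d \<le> b - c0" "d \<le> 1 / (8 * (M + 1))" "d \<le> 1 / 24"
    using d unfolding d_def by (meson min.cobounded1 min.cobounded2 order_trans)+
  define c where "c = b - d"
  have c: "c0 \<le> c" "c < b" using d by (auto simp: c_def)
  define G where "G x = ((u x)\<^sup>2 * k x - 2 * lam * (b - x) * ((u x)\<^sup>2 * w x)) * exp (- lam * (b - x)\<^sup>2)" for x
  have G_mono: "G x \<le> G y" if xy: "c \<le> x" "x \<le> y" "y < b" for x y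
  proof (rule nonneg_deriv_off_countable_imp_le[OF xy(2) _ countable_disc])
    have "continuous_on {a<..<b} G" unfolding G_def
      by (intro continuous_intros u_cont w_cont k_cont)
    then show "continuous_on {x..y} G" by (rule continuous_on_subset) (use c c0 xy in auto)
    fix z assume z: "x < z" "z < y" "z \<notin> disc"
    then have zab: "a < z" "z < b" "c0 \<le> z" using c c0 xy by auto
    then have "isCont psi z" using z isCont_psi by blast
    note uD = usq_deriv[OF zab(1,2) this]
    have e1: "1 + 4 * (b - z) * psi z - 4 * lam * (b - z)\<^sup>2 \<ge> 0"
    proof -
      have bz: "0 \<le> b - z" "b - z \<le> d" using z xy c zab by (auto simp: c_def)
      have "psi z \<ge> - M" using psi_mono[of c0 z] c0 zab by (auto simp: M_def)
      then have "(b - z) * psi z \<ge> (b - z) * (- M)" using bz by (intro mult_left_mono) auto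
      moreover have "(b - z) * M \<le> d * (M + 1)" using bz \<open>M \<ge> 0\<close> d by (intro mult_mono) auto
      moreover have "d * (M + 1) \<le> 1 / 8" using d(3) \<open>M \<ge> 0\<close> by (simp add: field_simps)
      moreover have "lam * (b - z)\<^sup>2 \<le> 3 * (d * d)"
        unfolding power2_eq_square using bz lam by (intro mult_mono) auto
      moreover have "d * d \<le> 1/24 * (1/24)" using d by (intro mult_mono) auto
      ultimately show ?thesis by (simp add: algebra_simps)
    qed
    have "(G has_real_derivative lam * (u z)\<^sup>2 * w z * (1 + 4 * (b - z) * psi z - 4 * lam * (b - z)\<^sup>2)
            * exp (- lam * (b - z)\<^sup>2)) (at z)"
    proof -
      have "((\<lambda>x. b - x) has_real_derivative - 1) (at z)"
        by (auto intro!: derivative_eq_intros)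
      from DERIV_diff[OF flux[OF zab(1,2)] DERIV_mult[OF DERIV_cmult[OF this, of "2 * lam"]
            DERIV_mult[OF uD w_deriv[OF zab(1,2)]]]]
      have D: "((\<lambda>x. (u x)\<^sup>2 * k x - 2 * lam * (b - x) * ((u x)\<^sup>2 * w x)) has_real_derivative
          lam * (u z)\<^sup>2 * w z + 4 * lam * (b - z) * psi z * (u z)\<^sup>2 * w z
            - 2 * lam * (b - z) * (u z)\<^sup>2 * k z) (at z)"
        by (rule DERIV_cong) algebra
      have "((\<lambda>x. exp (- lam * (b - x)\<^sup>2)) has_real_derivative
          exp (- lam * (b - z)\<^sup>2) * (2 * lam * (b - z))) (at z)"
        by (auto intro!: derivative_eq_intros simp: algebra_simps)
      from DERIV_mult[OF D this] show ?thesis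
        unfolding G_def by (rule DERIV_cong) (simp only: power2_eq_square algebra_simps)
    qed
    moreover have "lam * (u z)\<^sup>2 * w z * (1 + 4 * (b - z) * psi z - 4 * lam * (b - z)\<^sup>2)
            * exp (- lam * (b - z)\<^sup>2) \<ge> 0"
      using lam wpos[OF zab(3,2)] e1 by (intro mult_nonneg_nonneg) auto
    ultimately show "\<exists>d\<ge>0. (G has_real_derivative d) (at z)" by blast
  qed
  have "k x \<le> 2 * lam * (b - x) * w x" if x: "c \<le> x" "x < b" for x
  proof -
    have "G x \<le> 0"
    proof (rule tendsto_lowerbound[OF flux_b])
      show "\<forall>\<^sub>F y in at_left b. G x \<le> (u y)\<^sup>2 * k y"
        using eventually_at_left_real[OF x(2)]
      proof eventually_elim
        case (elim y)
        then have y: "x \<le> y" "y < b" "a < y" "c0 \<le> y" using x c c0 by auto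
        have "G x \<le> G y" using y x by (intro G_mono) auto
        also have "\<dots> \<le> (u y)\<^sup>2 * k y * exp (- lam * (b - y)\<^sup>2)"
          unfolding G_def using wpos[OF y(4,2)] y lam by (intro mult_right_mono) (auto intro!: mult_nonneg_nonneg)
        also have "\<dots> \<le> (u y)\<^sup>2 * k y * 1"
          using k_pos[OF y(3,2)] lam by (intro mult_left_mono) auto
        finally show ?case by simp
      qed
    qed simp
    then have "(u x)\<^sup>2 * k x - 2 * lam * (b - x) * ((u x)\<^sup>2 * w x) \<le> 0"
      unfolding G_def by (meson exp_gt_zero mult_le_0_iff not_le)
    then have "(u x)\<^sup>2 * (k x - 2 * lam * (b - x) * w x) \<le> 0"
      by (simp add: algebra_simps)
    then show ?thesis using u_pos[of x] x c c0 by (simp add: mult_le_0_iff)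
  qed
  then show ?thesis using c c0 wpos by (intro exI[of _ c]) auto
qed

text \<open>By \<open>k_le_near_b\<close> the product \<open>w exp (lam (b - x)\<^sup>2)\<close> decreases, so \<open>w\<close> stays bounded and \<open>k\<close>
  tends to 0.\<close>

lemma end_b:
  "(k \<longlongrightarrow> 0) (at_left b) \<and> (\<exists>L. (w \<longlongrightarrow> L) (at_left b))"
proof -
  obtain c where c: "a < c" "c < b" and wpos: "\<And>x. c \<le> x \<Longrightarrow> x < b \<Longrightarrow> 0 < w x"
    and k_le: "\<And>x. c \<le> x \<Longrightarrow> x < b \<Longrightarrow> k x \<le> 2 * lam * (b - x) * w x"
    using k_le_near_b by blast
  define B where "B = w c * exp (lam * (b - c)\<^sup>2)"
  have w_le: "w x \<le> B" if x: "c \<le> x" "x < b" for x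
  proof -
    have "w x \<le> w x * exp (lam * (b - x)\<^sup>2)"
      using wpos[OF x] lam mult_left_mono[of 1 "exp (lam * (b - x)\<^sup>2)" "w x"] by simp
    also have "\<dots> \<le> B" unfolding B_def
    proof (rule DERIV_nonpos_imp_nonincreasing[OF x(1)])
      fix y assume y: "c \<le> y" "y \<le> x"
      then have yab: "a < y" "y < b" using x c by auto
      have "((\<lambda>y. w y * exp (lam * (b - y)\<^sup>2)) has_real_derivative
          (k y - 2 * lam * (b - y) * w y) * exp (lam * (b - y)\<^sup>2)) (at y)"
        by (auto intro!: derivative_eq_intros w_deriv yab simp: algebra_simps)
      moreover have "(k y - 2 * lam * (b - y) * w y) * exp (lam * (b - y)\<^sup>2) \<le> 0"
        using k_le[OF y(1) yab(2)] by (simp add: mult_le_0_iff)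
      ultimately show "\<exists>z. ((\<lambda>y. w y * exp (lam * (b - y)\<^sup>2)) has_real_derivative z) (at y) \<and> z \<le> 0"
        by blast
    qed
    finally show ?thesis .
  qed
  have "(k \<longlongrightarrow> 0) (at_left b)"
  proof (rule tendsto_sandwich[where f = "\<lambda>_. 0" and h = "\<lambda>x. 2 * lam * (b - x) * B"])
    show "\<forall>\<^sub>F x in at_left b. 0 \<le> k x"
      using eventually_at_left_real[OF c(2)] by eventually_elim (use k_pos c in \<open>auto intro: less_imp_le\<close>)
    show "\<forall>\<^sub>F x in at_left b. k x \<le> 2 * lam * (b - x) * B"
      using eventually_at_left_real[OF c(2)]
    proof eventually_elim
      case (elim x)
      then have "k x \<le> 2 * lam * (b - x) * w x" by (intro k_le) auto
      also have "\<dots> \<le> 2 * lam * (b - x) * B" using elim lam w_le[of x] by (intro mult_left_mono) auto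
      finally show ?case .
    qed
    have "((\<lambda>x. 2 * lam * (b - x) * B) \<longlongrightarrow> 2 * lam * (b - b) * B) (at_left b)"
      by (intro tendsto_intros)
    then show "((\<lambda>x. 2 * lam * (b - x) * B) \<longlongrightarrow> 0) (at_left b)" by simp
  qed simp
  moreover have "(w \<longlongrightarrow> Sup (w ` {c..<b})) (at_left b)"
  proof (rule order_tendstoI)
    have bdd: "bdd_above (w ` {c..<b})" using w_le by (auto intro!: bdd_aboveI[of _ B])
    fix e assume "e < Sup (w ` {c..<b})"
    then obtain x where x: "c \<le> x" "x < b" "e < w x"
      using less_cSup_iff[OF _ bdd] c by auto
    show "\<forall>\<^sub>F y in at_left b. e < w y"
      using eventually_at_left_real[OF x(2)] 
      by eventually_elim (use w_strict_mono[of x] x c in force)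
  next
    have bdd: "bdd_above (w ` {c..<b})" using w_le by (auto intro!: bdd_aboveI[of _ B])
    fix e assume e: "Sup (w ` {c..<b}) < e"
    show "\<forall>\<^sub>F y in at_left b. w y < e"
      using eventually_at_left_real[OF c(2)]
    proof eventually_elim
      case (elim y)
      then have "w y \<le> Sup (w ` {c..<b})" by (intro cSup_upper bdd) auto
      with e show ?case by simp
    qed
  qed
  ultimately show ?thesis by blast
qed

lemma end_a:
  "(k \<longlongrightarrow> 0) (at_right a) \<and> (\<exists>L. (w \<longlongrightarrow> L) (at_right a))"
proof -
  interpret r: two_point "- b" "- a" lam "\<lambda>x. - psi (- x)" "\<lambda>x. u (- x)" "\<lambda>x. - w (- x)" "\<lambda>x. k (- x)"
    by (rule reflection)
  obtain L where "((\<lambda>x. k (- x)) \<longlongrightarrow> 0) (at_left (-a))" "((\<lambda>x. - w (- x)) \<longlongrightarrow> L) (at_left (-a))"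
    using r.end_b by blast
  then have "(k \<longlongrightarrow> 0) (at_right a)" "((\<lambda>x. - w x) \<longlongrightarrow> L) (at_right a)"
    by (simp_all add: filterlim_at_left_to_right)
  from this(1) tendsto_minus[OF this(2)] show ?thesis by auto
qed

text \<open>The extensions of \<open>w\<close> and \<open>k\<close> to the closed interval. They are continuous, and \<open>K\<close> vanishes
  at the ends: the weighted Neumann condition is an ordinary one.\<close>

definition "wa = Lim (at_right a) w"
definition "wb = Lim (at_left b) w"
definition "W x = (if x \<le> a then wa else if b \<le> x then wb else w x)"
definition "K x = (if a < x \<and> x < b then k x else 0)"

lemma w_lim_a: "(w \<longlongrightarrow> wa) (at_right a)"
  using end_a tendsto_Lim[of "at_right a" w] unfolding wa_def by force

lemma w_lim_b: "(w \<longlongrightarrow> wb) (at_left b)"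
  using end_b tendsto_Lim[of "at_left b" w] unfolding wb_def by force

lemma W_deriv:
  assumes "a < x" "x < b"
  shows "(W has_real_derivative K x) (at x)"
proof -
  have "(w has_real_derivative K x) (at x)" using w_deriv[OF assms] assms by (simp add: K_def)
  then show ?thesis
    by (rule has_field_derivative_transform_within_open[where S = "{a<..<b}"]) (use assms in \<open>auto simp: W_def\<close>)
qed

lemma W_cont: "continuous_on {a..b} W"
proof -
  have "isCont W x" if "a < x" "x < b" for x
    using W_deriv[OF that] by (rule DERIV_isCont)
  moreover have "(W \<longlongrightarrow> W a) (at_right a)"
  proof -
    have "(w \<longlongrightarrow> W a) (at_right a)" using w_lim_a ab by (simp add: W_def)
    then show ?thesis
      by (rule Lim_transform_eventually) (use ab in \<open>auto simp: W_def eventually_at_right intro!: exI[of _ b]\<close>)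
  qed
  moreover have "(W \<longlongrightarrow> W b) (at_left b)"
  proof -
    have "(w \<longlongrightarrow> W b) (at_left b)" using w_lim_b ab by (simp add: W_def)
    then show ?thesis
      by (rule Lim_transform_eventually) (use ab in \<open>auto simp: W_def eventually_at_left intro!: exI[of _ a]\<close>)
  qed
  ultimately show ?thesis
    using ab by (intro continuous_on_IccI) (auto simp: isCont_def)
qed

lemma K_cont: "continuous_on {a..b} K"
proof -
  have "continuous_on {a<..<b} K"
    using k_cont by (rule continuous_on_eq) (simp add: K_def)
  then have "isCont K x" if "a < x" "x < b" for x
    using that by (simp add: continuous_on_eq_continuous_at)
  moreover have "(K \<longlongrightarrow> K a) (at_right a)"
  proof -
    have "(k \<longlongrightarrow> K a) (at_right a)" using end_a ab by (simp add: K_def)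
    then show ?thesis
      by (rule Lim_transform_eventually) (use ab in \<open>auto simp: K_def eventually_at_right intro!: exI[of _ b]\<close>)
  qed
  moreover have "(K \<longlongrightarrow> K b) (at_left b)"
  proof -
    have "(k \<longlongrightarrow> K b) (at_left b)" using end_b ab by (simp add: K_def)
    then show ?thesis
      by (rule Lim_transform_eventually) (use ab in \<open>auto simp: K_def eventually_at_left intro!: exI[of _ a]\<close>)
  qed
  ultimately show ?thesis
    using ab by (intro continuous_on_IccI) (auto simp: isCont_def)
qed

lemma K_ends [simp]: "K a = 0" "K b = 0" by (auto simp: K_def)

lemma K_pos: "a < x \<Longrightarrow> x < b \<Longrightarrow> 0 < K x" by (simp add: K_def k_pos)

lemma K_deriv:
  assumes "a < x" "x < b" "isCont psi x"
  shows "(K has_real_derivative 2 * psi x * K x - lam * W x) (at x)"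
proof -
  have "(k has_real_derivative 2 * psi x * K x - lam * W x) (at x)"
    using k_deriv[OF assms] assms by (simp add: K_def W_def)
  then show ?thesis
    by (rule has_field_derivative_transform_within_open[where S = "{a<..<b}"]) (use assms in \<open>auto simp: K_def\<close>)
qed

lemma W_strict_mono: "a \<le> x \<Longrightarrow> x < y \<Longrightarrow> y \<le> b \<Longrightarrow> W x < W y"
proof (rule DERIV_pos_imp_increasing_open[of x y W])
  fix z assume "a \<le> x" "x < z" "z < y" "y \<le> b"
  then show "\<exists>d. (W has_real_derivative d) (at z) \<and> 0 < d"
    using W_deriv[of z] K_pos[of z] by auto
qed (auto intro!: continuous_on_subset[OF W_cont])

end

section \<open>Functions touching the increments from above\<close>

context two_point begin

lemma isCont_W: "a < x \<Longrightarrow> x < b \<Longrightarrow> isCont W x"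
  using W_deriv DERIV_isCont by blast

lemma isCont_K: "a < x \<Longrightarrow> x < b \<Longrightarrow> isCont K x"
  using continuous_on_interior[OF K_cont, of x] by simp

text \<open>The increments \<open>W y' - W x'\<close> lie below \<open>2 \<Phi> ((y' - x') / 2)\<close> near the pair \<open>(x, y)\<close>, with
  equality there; \<open>Phi1\<close> and \<open>Phi2\<close> are the derivatives of \<open>\<Phi>\<close>.\<close>

definition touches :: "(real \<Rightarrow> real) \<Rightarrow> (real \<Rightarrow> real) \<Rightarrow> (real \<Rightarrow> real) \<Rightarrow> real \<Rightarrow> real \<Rightarrow> bool" where
  "touches Phi Phi1 Phi2 x y \<longleftrightarrow> a < x \<and> x < y \<and> y < b \<and> W y - W x = 2 * Phi ((y - x) / 2) \<and>
     isCont Phi2 ((y - x) / 2) \<and>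
     (\<exists>d>0. (\<forall>t. \<bar>t - (y - x) / 2\<bar> < d \<longrightarrow> (Phi has_real_derivative Phi1 t) (at t) \<and>
                                       (Phi1 has_real_derivative Phi2 t) (at t)) \<and>
       (\<forall>x' y'. \<bar>x' - x\<bar> < d \<longrightarrow> \<bar>y' - y\<bar> < d \<longrightarrow> a < x' \<longrightarrow> x' < b \<longrightarrow> a < y' \<longrightarrow> y' < b \<longrightarrow>
          W y' - W x' \<le> 2 * Phi ((y' - x') / 2)))"

text \<open>The first-order conditions in \<open>x\<close> and in \<open>y\<close> give the values of \<open>K\<close>. The second-order
  condition comes from moving the points apart symmetrically. Formally it reads
  \<open>K' y - K' x \<le> 2 \<Phi>''\<close>, and \<open>K' = 2 psi K - lam W\<close> turns it into a bound on \<open>psi y - psi x\<close>. As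
  \<open>psi\<close> may jump at \<open>x\<close> or \<open>y\<close>, the bound is asserted at some arbitrarily close pair.\<close>

lemma
  assumes touch: "touches Phi Phi1 Phi2 x y" and s: "s = (y - x) / 2"
  shows touches_K: "K x = Phi1 s" "K y = Phi1 s"
    and touches_psi: "\<And>eta. 0 < eta \<Longrightarrow> \<exists>t. 0 < t \<and> t < eta \<and> a < x - t \<and> y + t < b \<and>
       Phi1 s * (psi (y + t) - psi (x - t)) \<le> Phi2 s + lam * Phi s + eta"
proof -
  obtain d where xy: "a < x" "x < y" "y < b" and d: "d > 0"
    and Phi: "\<And>t. \<bar>t - s\<bar> < d \<Longrightarrow> (Phi has_real_derivative Phi1 t) (at t)"
    and Phi1: "\<And>t. \<bar>t - s\<bar> < d \<Longrightarrow> (Phi1 has_real_derivative Phi2 t) (at t)"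
    and Phi2: "isCont Phi2 s"
    and max: "\<And>x' y'. \<bar>x' - x\<bar> < d \<Longrightarrow> \<bar>y' - y\<bar> < d \<Longrightarrow> a < x' \<Longrightarrow> x' < b \<Longrightarrow> a < y' \<Longrightarrow> y' < b \<Longrightarrow>
       W y' - W x' \<le> 2 * Phi ((y' - x') / 2)"
    and eq: "W y - W x = 2 * Phi s"
    using touch unfolding touches_def s by blast
  have D0: "(Phi has_real_derivative Phi1 s) (at s)" using d by (intro Phi) simp
  have "((\<lambda>z. Phi ((z - x) / 2)) has_real_derivative Phi1 s * (1 / 2)) (at y)"
    by (rule DERIV_chain2[where f = Phi and g = "\<lambda>z. (z - x) / 2"])
       (simp add: D0 flip: s, auto intro!: derivative_eq_intros)
  then have "((\<lambda>z. W z - W x - 2 * Phi ((z - x) / 2)) has_real_derivative K y - Phi1 s) (at y)"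
    using xy by (auto intro!: derivative_eq_intros W_deriv)
  then have "K y - Phi1 s = 0"
  proof (rule DERIV_local_max)
    show "0 < min d (min (y - a) (b - y))" using d xy by auto
    show "\<forall>z. \<bar>y - z\<bar> < min d (min (y - a) (b - y)) \<longrightarrow>
        W z - W x - 2 * Phi ((z - x) / 2) \<le> W y - W x - 2 * Phi ((y - x) / 2)"
    proof (intro allI impI)
      fix z assume "\<bar>y - z\<bar> < min d (min (y - a) (b - y))"
      then have "W z - W x \<le> 2 * Phi ((z - x) / 2)" using xy d by (intro max) auto
      then show "W z - W x - 2 * Phi ((z - x) / 2) \<le> W y - W x - 2 * Phi ((y - x) / 2)"
        using eq s by simp
    qed
  qed
  then show Ky: "K y = Phi1 s" by simp
  have "((\<lambda>z. Phi ((y - z) / 2)) has_real_derivative Phi1 s * (- 1 / 2)) (at x)"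
    by (rule DERIV_chain2[where f = Phi and g = "\<lambda>z. (y - z) / 2"])
       (simp add: D0 flip: s, auto intro!: derivative_eq_intros)
  then have "((\<lambda>z. W y - W z - 2 * Phi ((y - z) / 2)) has_real_derivative - K x + Phi1 s) (at x)"
    using xy by (auto intro!: derivative_eq_intros W_deriv)
  then have "- K x + Phi1 s = 0"
  proof (rule DERIV_local_max)
    show "0 < min d (min (x - a) (b - x))" using d xy by auto
    show "\<forall>z. \<bar>x - z\<bar> < min d (min (x - a) (b - x)) \<longrightarrow>
        W y - W z - 2 * Phi ((y - z) / 2) \<le> W y - W x - 2 * Phi ((y - x) / 2)"
    proof (intro allI impI)
      fix z assume "\<bar>x - z\<bar> < min d (min (x - a) (b - x))"
      then have "W y - W z \<le> 2 * Phi ((y - z) / 2)" using xy d by (intro max) auto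
      then show "W y - W z - 2 * Phi ((y - z) / 2) \<le> W y - W x - 2 * Phi ((y - x) / 2)"
        using eq s by simp
    qed
  qed
  then show Kx: "K x = Phi1 s" by simp
  fix eta :: real assume eta: "0 < eta"
  show "\<exists>t. 0 < t \<and> t < eta \<and> a < x - t \<and> y + t < b \<and>
       Phi1 s * (psi (y + t) - psi (x - t)) \<le> Phi2 s + lam * Phi s + eta"
  proof (rule ccontr)
    assume contra: "\<not> ?thesis"
    define c where "c = Phi1 s"
    define m where "m = min eta (min d (min (x - a) (b - y)))"
    define e where "e = m / 2"
    have "0 < m" "m \<le> eta" "m \<le> d" "m \<le> x - a" "m \<le> b - y"
      using eta d xy by (auto simp: m_def min_le_iff_disj)
    then have e: "0 < e" "e < eta" "e < d" "a < x - e" "y + e < b"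
      by (auto simp: e_def field_simps)
    have slack: "Phi2 s + lam * Phi s + eta < c * (psi (y + t) - psi (x - t))" if "0 < t" "t < e" for t
    proof -
      have "t < eta" "a < x - t" "y + t < b" using that e by auto
      then show ?thesis using contra that(1) unfolding c_def by (meson not_le)
    qed
    define M where "M = \<bar>psi (x - e)\<bar> + \<bar>psi (y + e)\<bar>"
    have M: "\<bar>psi z\<bar> \<le> M" if "x - e \<le> z" "z \<le> y + e" for z
      using psi_mono[of "x - e" z] psi_mono[of z "y + e"] that e by (auto simp: M_def)
    have "M \<ge> 0" by (simp add: M_def)
    define r where "r t = 2 * M * \<bar>K (y + t) - c\<bar> + 2 * M * \<bar>K (x - t) - c\<bar> + lam * \<bar>W (y + t) - W y\<bar>
        + lam * \<bar>W (x - t) - W x\<bar> + 2 * \<bar>Phi2 (s + t) - Phi2 s\<bar>" for t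
    have "isCont r 0"
      unfolding r_def using xy Phi2
      by (intro continuous_intros isCont_o2[where f = "\<lambda>t. y + t"] isCont_o2[where f = "\<lambda>t. x - t"]
          isCont_o2[where f = "\<lambda>t. s + t"] isCont_K isCont_W) auto
    moreover have "r 0 = 0" using Kx Ky by (simp add: r_def c_def)
    ultimately have "(r \<longlongrightarrow> 0) (at 0)" by (simp add: isCont_def)
    then have "\<forall>\<^sub>F t in at 0. r t < eta" using eta by (rule order_tendstoD)
    then obtain e1 where e1: "e1 > 0" "\<And>t. t \<noteq> 0 \<Longrightarrow> \<bar>t\<bar> < e1 \<Longrightarrow> r t < eta"
      by (auto simp: eventually_at dist_real_def)
    define e2 where "e2 = min e e1"
    have e2: "0 < e2" "e2 \<le> e" "e2 \<le> e1" using e e1 by (auto simp: e2_def)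
    define F1 where "F1 t = K (y + t) + K (x - t) - 2 * Phi1 (s + t)" for t
    have F1_ge: "eta * t \<le> F1 t" if t: "0 \<le> t" "t < e2" for t
    proof -
      let ?D = "(\<lambda>z. z - y) ` disc \<union> (\<lambda>z. x - z) ` disc"
      have "F1 0 - eta * 0 \<le> F1 t - eta * t"
      proof (rule nonneg_deriv_off_countable_imp_le[of 0 t "\<lambda>t. F1 t - eta * t" ?D])
        show "countable ?D" using countable_disc by simp
        have "isCont (\<lambda>t. F1 t - eta * t) z" if "0 \<le> z" "z \<le> t" for z
          unfolding F1_def using xy e2 e that t
          by (intro continuous_intros isCont_o2[where f = "\<lambda>t. y + t"] isCont_o2[where f = "\<lambda>t. x - t"]
            isCont_o2[where f = "\<lambda>t. s + t"] isCont_K DERIV_isCont[OF Phi1]) auto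
        then show "continuous_on {0..t} (\<lambda>t. F1 t - eta * t)"
          by (intro continuous_at_imp_continuous_on) auto
        fix z assume z: "0 < z" "z < t" "z \<notin> ?D"
        have zz: "a < y + z" "y + z < b" "a < x - z" "x - z < b" "z < e" using z t e2 e xy by auto
        have "y + z \<notin> disc" "x - z \<notin> disc" using z(3) by (auto simp: image_iff)
        then have "(K has_real_derivative 2 * psi (y+z) * K (y+z) - lam * W (y+z)) (at (y+z))"
            "(K has_real_derivative 2 * psi (x-z) * K (x-z) - lam * W (x-z)) (at (x-z))"
          using zz by (auto intro!: K_deriv isCont_psi)
        moreover have "(Phi1 has_real_derivative Phi2 (s+z)) (at (s+z))"
          using z t e2 e by (intro Phi1) auto
        ultimately have "((\<lambda>t. F1 t - eta * t) has_real_derivative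
            (2 * psi (y+z) * K (y+z) - lam * W (y+z)) - (2 * psi (x-z) * K (x-z) - lam * W (x-z))
            - 2 * Phi2 (s+z) - eta) (at z)" (is "(_ has_real_derivative ?v) _")
          unfolding F1_def
          by (auto intro!: derivative_eq_intros DERIV_chain2[where g = "\<lambda>t. y + t"]
              DERIV_chain2[where g = "\<lambda>t. x - t"] DERIV_chain2[where g = "\<lambda>t. s + t"])
        moreover have "?v \<ge> 0"
        proof -
          have p: "p * (q - c) \<ge> - (M * \<bar>q - c\<bar>)" if "\<bar>p\<bar> \<le> M" for p q
          proof -
            have "\<bar>p * (q - c)\<bar> \<le> M * \<bar>q - c\<bar>" using that by (simp add: abs_mult mult_right_mono)
            then show ?thesis by linarith
          qed
          have q: "p * (q - c) \<le> M * \<bar>q - c\<bar>" if "\<bar>p\<bar> \<le> M" for p q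
          proof -
            have "\<bar>p * (q - c)\<bar> \<le> M * \<bar>q - c\<bar>" using that by (simp add: abs_mult mult_right_mono)
            then show ?thesis by linarith
          qed
          have "\<bar>psi (y+z)\<bar> \<le> M" "\<bar>psi (x-z)\<bar> \<le> M" using zz z xy by (auto intro!: M)
          note A = p[OF this(1), of "K (y+z)"] q[OF this(2), of "K (x-z)"]
          have B: "lam * (W (y+z) - W y) \<le> lam * \<bar>W (y+z) - W y\<bar>" "lam * (W x - W (x-z)) \<le> lam * \<bar>W (x-z) - W x\<bar>"
            using lam by (auto intro!: mult_left_mono)
          have "lam * (W y - W x) = 2 * (lam * Phi s)" using eq by simp
          moreover have "r z < eta" using e1(2)[of z] z t e2 by auto
          moreover define q2 where "q2 = \<bar>Phi2 (s + z) - Phi2 s\<bar>"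
          moreover from this have "Phi2 (s + z) \<le> Phi2 s + q2" by linarith
          ultimately show ?thesis
            using A B slack[OF z(1) zz(5)] unfolding r_def q2_def[symmetric] by (simp add: algebra_simps)
        qed
        ultimately show "\<exists>v\<ge>0. ((\<lambda>t. F1 t - eta * t) has_real_derivative v) (at z)" by blast
      qed (use t in auto)
      moreover have "F1 0 = 0" using Kx Ky by (simp add: F1_def)
      ultimately show ?thesis by simp
    qed
    define h where "h = e2 / 2"
    have h: "0 < h" "h < e2" using e2 by (auto simp: h_def)
    define F where "F t = W (y + t) - W (x - t) - 2 * Phi (s + t)" for t
    have FD: "(F has_real_derivative F1 t) (at t)" if "0 \<le> t" "t \<le> h" for t
    proof -
      have "(W has_real_derivative K (y+t)) (at (y+t))" "(W has_real_derivative K (x-t)) (at (x-t))"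
        "(Phi has_real_derivative Phi1 (s+t)) (at (s+t))"
        using that h e2 e xy by (auto intro!: W_deriv Phi)
      then show ?thesis unfolding F_def F1_def
        by (auto intro!: derivative_eq_intros DERIV_chain2[where g = "\<lambda>t. y + t"]
              DERIV_chain2[where g = "\<lambda>t. x - t"] DERIV_chain2[where g = "\<lambda>t. s + t"])
    qed
    have "F 0 < F h"
    proof (rule DERIV_pos_imp_increasing_open[OF h(1)])
      fix t assume t: "0 < t" "t < h"
      have "0 < eta * t" using eta t by simp
      also have "\<dots> \<le> F1 t" using t h by (intro F1_ge) auto
      finally show "\<exists>v. (F has_real_derivative v) (at t) \<and> 0 < v" using FD[of t] t by auto
    next
      show "continuous_on {0..h} F"
        by (intro DERIV_continuous_on[where D = F1] has_field_derivative_at_within[OF FD]) auto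
    qed
    moreover have "F 0 = 0" using eq by (simp add: F_def)
    moreover have "F h \<le> 0"
    proof -
      have "W (y + h) - W (x - h) \<le> 2 * Phi ((y + h - (x - h)) / 2)"
        using h e2 e xy by (intro max) auto
      moreover have "(y + h - (x - h)) / 2 = s + h" by (simp add: s field_simps)
      ultimately show ?thesis unfolding F_def by (simp only:)
    qed
    ultimately show False by simp
  qed
qed

lemma touches_tan:
  assumes touch: "touches Phi Phi1 Phi2 x y" and s: "s = (y - x) / 2"
  shows "2 * Phi1 s * tan s \<le> Phi2 s + lam * Phi s"
proof (rule field_le_epsilon)
  fix eta :: real assume "eta > 0"
  then obtain t where t: "0 < t" "a < x - t" "y + t < b"
      "Phi1 s * (psi (y + t) - psi (x - t)) \<le> Phi2 s + lam * Phi s + eta"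
    using touches_psi[OF assms] by blast
  have xy: "a < x" "x < y" "y < b" using touch by (auto simp: touches_def)
  have "Phi1 s > 0" using touches_K[OF assms] K_pos[of x] xy by auto
  have "2 * tan s \<le> 2 * tan ((y + t - (x - t)) / 2)"
    using t xy ab s by (intro mult_left_mono tan_mono_le) auto
  also have "\<dots> \<le> psi (y + t) - psi (x - t)" using t xy by (intro psi_tan) auto
  finally have "Phi1 s * (2 * tan s) \<le> Phi1 s * (psi (y + t) - psi (x - t))"
    using \<open>Phi1 s > 0\<close> by (intro mult_left_mono) auto
  with t(4) show "2 * Phi1 s * tan s \<le> Phi2 s + lam * Phi s + eta" by simp
qed

end

text \<open>This is \<open>tan s - cot s\<close>. The operator \<open>\<Phi>'' - 2 tan \<Phi>' + 3 \<Phi>\<close> annihilates \<open>sin s\<close> and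
  \<open>sin s tau s\<close>, so \<open>tau\<close> is the natural coordinate for the quotient \<open>osc s / sin s\<close>.\<close>

definition tau :: "real \<Rightarrow> real" where
  "tau s = sin s / cos s - cos s / sin s"

lemma tau_deriv:
  assumes "0 < s" "s < pi/2"
  shows "(tau has_real_derivative 1 / (cos s)\<^sup>2 + 1 / (sin s)\<^sup>2) (at s)"
proof -
  have S: "sin s > 0" "cos s > 0" using assms by (auto intro: sin_gt_zero cos_gt_zero)
  have id: "(cos s)\<^sup>2 + (sin s)\<^sup>2 = 1" by simp
  have "((\<lambda>s. sin s / cos s - cos s / sin s) has_real_derivative
     (cos s * cos s - sin s * - sin s) / (cos s * cos s) - (- sin s * sin s - cos s * cos s) / (sin s * sin s)) (at s)"
    using S by (auto intro!: derivative_eq_intros)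
  moreover have alg: "(C * C - R * - R) / (C * C) - (- R * R - C * C) / (R * R)
      = (C\<^sup>2 + R\<^sup>2) / C\<^sup>2 + (C\<^sup>2 + R\<^sup>2) / R\<^sup>2" for C R :: real
    by (simp add: power2_eq_square diff_divide_distrib add_divide_distrib)
  ultimately show ?thesis unfolding tau_def[abs_def] alg id by (simp only:)
qed

lemma tau_mono:
  assumes "0 < s" "s < t" "t < pi/2"
  shows "tau s < tau t"
proof (rule DERIV_pos_imp_increasing[OF assms(2)])
  fix x assume "s \<le> x" "x \<le> t"
  then show "\<exists>y. (tau has_real_derivative y) (at x) \<and> 0 < y"
    using tau_deriv[of x] cos_gt_zero[of x] sin_gt_zero[of x] assms
    by (intro exI[of _ "1 / (cos x)\<^sup>2 + 1 / (sin x)\<^sup>2"]) (auto intro: add_pos_pos)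
qed

text \<open>Writing \<open>\<Phi> = sin \<cdot> (f \<circ> tau)\<close> turns the operator \<open>\<Phi>'' - 2 tan \<Phi>' + 3 \<Phi>\<close>, which annihilates
  the sine, into a positive multiple of the second derivative of \<open>f\<close>.\<close>

lemma barrier_deriv:
  fixes p q e :: real
  assumes f_def: "f = (\<lambda>s. p + q * tau s - e * (tau s)\<^sup>2)" and f1_def: "f1 = (\<lambda>s. q - 2 * e * tau s)"
    and Phi1_def: "Phi1 = (\<lambda>s. cos s * f s + f1 s / (sin s * (cos s)\<^sup>2))"
    and Phi2_def: "Phi2 = (\<lambda>s. - sin s * f s + f1 s * (1 / (cos s)\<^sup>2 + 1 / (sin s)\<^sup>2) * cos s
     + (- 2 * e * (1 / (cos s)\<^sup>2 + 1 / (sin s)\<^sup>2) / (sin s * (cos s)\<^sup>2)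
        - f1 s * ((cos s)\<^sup>2 - 2 * (sin s)\<^sup>2) / ((sin s)\<^sup>2 * (cos s)^3)))"
    and s: "0 < s" "s < pi/2"
  shows "((\<lambda>s. sin s * f s) has_real_derivative Phi1 s) (at s)"
    and "(Phi1 has_real_derivative Phi2 s) (at s)" and "isCont Phi2 s"
    and "e > 0 \<Longrightarrow> Phi2 s + 3 * (sin s * f s) < 2 * Phi1 s * tan s"
proof -
  have S: "sin s > 0" "cos s > 0" using s by (auto intro: sin_gt_zero cos_gt_zero)
  then have S0: "sin s \<noteq> 0" "cos s \<noteq> 0" by auto
  note tD = tau_deriv[OF s]
  have fD: "(f has_real_derivative f1 s * (1 / (cos s)\<^sup>2 + 1 / (sin s)\<^sup>2)) (at s)"
    unfolding f_def f1_def by (auto intro!: derivative_eq_intros tD simp: algebra_simps)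
  have f1D: "(f1 has_real_derivative - 2 * e * (1 / (cos s)\<^sup>2 + 1 / (sin s)\<^sup>2)) (at s)"
    unfolding f1_def by (auto intro!: derivative_eq_intros tD simp: algebra_simps)
  have tau': "1 / (cos s)\<^sup>2 + 1 / (sin s)\<^sup>2 = 1 / ((sin s)\<^sup>2 * (cos s)\<^sup>2)"
  proof -
    have "1 / (cos s)\<^sup>2 + 1 / (sin s)\<^sup>2 = ((sin s)\<^sup>2 + (cos s)\<^sup>2) / ((sin s)\<^sup>2 * (cos s)\<^sup>2)"
    proof -
      have "1 / C\<^sup>2 + 1 / R\<^sup>2 = (R\<^sup>2 + C\<^sup>2) / (R\<^sup>2 * C\<^sup>2)" if "R \<noteq> 0" "C \<noteq> 0" for R C :: real
        using that by (simp add: field_simps)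
      from this[OF S0] show ?thesis .
    qed
    then show ?thesis by (simp only: sin_cos_squared_add)
  qed
  have "((\<lambda>s. sin s * f s) has_real_derivative cos s * f s + f1 s * (1 / (cos s)\<^sup>2 + 1 / (sin s)\<^sup>2) * sin s) (at s)"
    using DERIV_mult[OF DERIV_sin fD] by simp
  then show "((\<lambda>s. sin s * f s) has_real_derivative Phi1 s) (at s)"
  proof (rule DERIV_cong)
    have "g * (1 / (R\<^sup>2 * C\<^sup>2)) * R = g / (R * C\<^sup>2)" if "R \<noteq> 0" for R C g :: real
      using that by (simp add: power2_eq_square)
    from this[of "sin s" "f1 s" "cos s"] S
    show "cos s * f s + f1 s * (1 / (cos s)\<^sup>2 + 1 / (sin s)\<^sup>2) * sin s = Phi1 s"
      unfolding tau' Phi1_def by simp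
  qed
  have gD: "((\<lambda>s. sin s * (cos s)\<^sup>2) has_real_derivative cos s * ((cos s)\<^sup>2 - 2 * (sin s)\<^sup>2)) (at s)"
    by (auto intro!: derivative_eq_intros simp: algebra_simps power2_eq_square)
  have "((\<lambda>s. f1 s / (sin s * (cos s)\<^sup>2)) has_real_derivative
      - 2 * e * (1 / (cos s)\<^sup>2 + 1 / (sin s)\<^sup>2) / (sin s * (cos s)\<^sup>2)
     - f1 s * ((cos s)\<^sup>2 - 2 * (sin s)\<^sup>2) / ((sin s)\<^sup>2 * (cos s)^3)) (at s)"
  proof (rule DERIV_cong[OF DERIV_divide[OF f1D gD]])
    show "sin s * (cos s)\<^sup>2 \<noteq> 0" using S by simp
    have "(- 2 * e * T * (R * C\<^sup>2) - g * (C * (C\<^sup>2 - 2 * R\<^sup>2))) / (R * C\<^sup>2 * (R * C\<^sup>2))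
      = - 2 * e * T / (R * C\<^sup>2) - g * (C\<^sup>2 - 2 * R\<^sup>2) / (R\<^sup>2 * C^3)"
      if "R \<noteq> 0" "C \<noteq> 0" for R C g T :: real
      using that by (simp add: divide_simps) algebra
    from this[OF S0] show "(- 2 * e * (1 / (cos s)\<^sup>2 + 1 / (sin s)\<^sup>2) * (sin s * (cos s)\<^sup>2)
        - f1 s * (cos s * ((cos s)\<^sup>2 - 2 * (sin s)\<^sup>2))) / (sin s * (cos s)\<^sup>2 * (sin s * (cos s)\<^sup>2))
      = - 2 * e * (1 / (cos s)\<^sup>2 + 1 / (sin s)\<^sup>2) / (sin s * (cos s)\<^sup>2)
        - f1 s * ((cos s)\<^sup>2 - 2 * (sin s)\<^sup>2) / ((sin s)\<^sup>2 * (cos s)^3)"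
      .
  qed
  from DERIV_add[OF DERIV_mult[OF DERIV_cos fD] this]
  show "(Phi1 has_real_derivative Phi2 s) (at s)"
    unfolding Phi1_def Phi2_def .
  have "isCont tau s" using tD by (rule DERIV_isCont)
  then show "isCont Phi2 s" unfolding Phi2_def f_def f1_def
    using S by (intro continuous_intros) auto
  assume "e > 0"
  have 1: "f1 s * (1 / ((sin s)\<^sup>2 * (cos s)\<^sup>2)) * cos s - f1 s * ((cos s)\<^sup>2 - 2 * (sin s)\<^sup>2) / ((sin s)\<^sup>2 * (cos s)^3)
     = 2 * (f1 s / (sin s * (cos s)\<^sup>2)) * (sin s / cos s)"
  proof -
    have "g * (1 / (R\<^sup>2 * C\<^sup>2)) * C - g * (C\<^sup>2 - 2 * R\<^sup>2) / (R\<^sup>2 * C^3) = 2 * (g / (R * C\<^sup>2)) * (R / C)"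
      if "R \<noteq> 0" "C \<noteq> 0" for R C g :: real
      using that by (simp add: divide_simps) algebra
    from this[OF S0] show ?thesis .
  qed
  have 2: "2 * (cos s * f s) * (sin s / cos s) = 2 * sin s * f s" using S by simp
  have "- 2 * e * (1 / ((sin s)\<^sup>2 * (cos s)\<^sup>2)) / (sin s * (cos s)\<^sup>2) < 0" using S \<open>e > 0\<close> by simp
  moreover have "2 * Phi1 s * tan s = 2 * sin s * f s + 2 * (f1 s / (sin s * (cos s)\<^sup>2)) * (sin s / cos s)"
    unfolding Phi1_def tan_def 2[symmetric] by (simp only: distrib_left distrib_right)
  ultimately show "Phi2 s + 3 * (sin s * f s) < 2 * Phi1 s * tan s"
    using 1 unfolding Phi2_def tau' by linarith
qed

section \<open>The modulus of oscillation\<close>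

context two_point begin

definition osc :: "real \<Rightarrow> real" where
  "osc s = Sup ((\<lambda>m. W (m + s) - W (m - s)) ` {a + s..b - s})"

lemma shift_cont:
  fixes f :: "real \<Rightarrow> real"
  assumes "0 \<le> s" and f: "continuous_on {a..b} f"
  shows "continuous_on {a + s..b - s} (\<lambda>m. f (m + s) - f (m - s))"
proof -
  have "continuous_on {a + s..b - s} (\<lambda>m. f (m + s))"
    by (rule continuous_on_compose2[OF f]) (use assms(1) in \<open>auto intro!: continuous_intros\<close>)
  moreover have "continuous_on {a + s..b - s} (\<lambda>m. f (m - s))"
    by (rule continuous_on_compose2[OF f]) (use assms(1) in \<open>auto intro!: continuous_intros\<close>)
  ultimately show ?thesis by (rule continuous_on_diff)
qed

lemma osc_attained:
  assumes "0 \<le> s" "s \<le> (b - a) / 2"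
  shows "\<exists>m\<in>{a + s..b - s}. osc s = W (m + s) - W (m - s)"
    and "\<And>m. m \<in> {a + s..b - s} \<Longrightarrow> W (m + s) - W (m - s) \<le> osc s"
proof -
  have ne: "{a + s..b - s} \<noteq> {}" using assms by (auto simp: field_simps)
  obtain m where m: "m \<in> {a + s..b - s}"
      "\<And>m'. m' \<in> {a + s..b - s} \<Longrightarrow> W (m' + s) - W (m' - s) \<le> W (m + s) - W (m - s)"
    using continuous_attains_sup[OF compact_Icc ne shift_cont[OF assms(1) W_cont]] by blast
  have "osc s = W (m + s) - W (m - s)"
    unfolding osc_def by (rule cSup_eq_maximum) (use m in auto)
  with m show "\<exists>m\<in>{a + s..b - s}. osc s = W (m + s) - W (m - s)"
    and "\<And>m. m \<in> {a + s..b - s} \<Longrightarrow> W (m + s) - W (m - s) \<le> osc s" by auto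
qed

lemma osc_ge:
  assumes "a \<le> x" "x \<le> y" "y \<le> b"
  shows "W y - W x \<le> osc ((y - x) / 2)"
proof -
  have "(y + x) / 2 + (y - x) / 2 = y" "(y + x) / 2 - (y - x) / 2 = x" by (auto simp: field_simps)
  moreover have "(y + x) / 2 \<in> {a + (y - x) / 2..b - (y - x) / 2}" using assms by (simp add: field_simps)
  ultimately show ?thesis
    using osc_attained(2)[of "(y - x) / 2" "(y + x) / 2"] assms by simp
qed

text \<open>Since \<open>K\<close> vanishes at the ends of the interval and is positive inside, a pair that maximises
  the increment of \<open>W\<close> at a given distance stays away from both ends.\<close>

lemma max_interior:
  assumes s: "0 < s" "s < (b - a) / 2" and m: "m \<in> {a + s..b - s}"
    and max: "\<And>m'. m' \<in> {a + s..b - s} \<Longrightarrow> W (m' + s) - W (m' - s) \<le> W (m + s) - W (m - s)"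
  shows "a + s < m" "m < b - s"
proof -
  define g where "g m = W (m + s) - W (m - s)" for m
  define g' where "g' m = K (m + s) - K (m - s)" for m
  have cont: "continuous_on {a + s..b - s} g" "continuous_on {a + s..b - s} g'"
    unfolding g_def g'_def using shift_cont[OF _ W_cont] shift_cont[OF _ K_cont] s by auto
  have gD: "(g has_real_derivative g' z) (at z)" if "a + s < z" "z < b - s" for z
  proof -
    have "(W has_real_derivative K (z + s)) (at (z + s))" "(W has_real_derivative K (z - s)) (at (z - s))"
      using that s by (auto intro!: W_deriv)
    then show ?thesis unfolding g_def g'_def
      by (auto intro!: derivative_eq_intros DERIV_chain2[where g = "\<lambda>t. t + s"] DERIV_chain2[where g = "\<lambda>t. t - s"])
  qed
  have lt: "a + s < b - s" using s by (simp add: field_simps)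
  have "m \<noteq> b - s"
  proof
    assume mb: "m = b - s"
    have "(g' \<longlongrightarrow> g' (b - s)) (at_left (b - s))"
      using cont(2) lt by (simp add: continuous_on_Icc_at_leftD)
    moreover have "g' (b - s) < 0" unfolding g'_def using K_pos[of "b - s - s"] s by (simp add: field_simps)
    ultimately have "\<forall>\<^sub>F z in at_left (b - s). g' z < 0" by (rule order_tendstoD)
    then obtain c where c: "c < b - s" "\<And>z. c < z \<Longrightarrow> z < b - s \<Longrightarrow> g' z < 0"
      by (auto simp: eventually_at_left_field)
    define c' where "c' = max c (a + s)"
    have c': "c' < b - s" "c \<le> c'" "a + s \<le> c'" using c lt by (auto simp: c'_def)
    have "g c' > g (b - s)"
    proof (rule DERIV_neg_imp_decreasing_open[OF c'(1)])
      fix z assume "c' < z" "z < b - s"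
      then show "\<exists>v. (g has_real_derivative v) (at z) \<and> v < 0" using gD[of z] c(2)[of z] c' by auto
    qed (use c' in \<open>auto intro: continuous_on_subset[OF cont(1)]\<close>)
    with max[of c'] c' mb show False by (auto simp: g_def)
  qed
  then show "m < b - s" using m by auto
  have "m \<noteq> a + s"
  proof
    assume mb: "m = a + s"
    have "(g' \<longlongrightarrow> g' (a + s)) (at_right (a + s))"
      using cont(2) lt by (simp add: continuous_on_Icc_at_rightD)
    moreover have "g' (a + s) > 0" unfolding g'_def using K_pos[of "a + s + s"] s by (simp add: field_simps)
    ultimately have "\<forall>\<^sub>F z in at_right (a + s). g' z > 0" by (rule order_tendstoD)
    then obtain c where c: "c > a + s" "\<And>z. a + s < z \<Longrightarrow> z < c \<Longrightarrow> g' z > 0"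
      by (auto simp: eventually_at_right_field)
    define c' where "c' = min c (b - s)"
    have c': "a + s < c'" "c' \<le> c" "c' \<le> b - s" using c lt by (auto simp: c'_def)
    have "g (a + s) < g c'"
    proof (rule DERIV_pos_imp_increasing_open[OF c'(1)])
      fix z assume "a + s < z" "z < c'"
      then show "\<exists>v. (g has_real_derivative v) (at z) \<and> 0 < v" using gD[of z] c(2)[of z] c' by auto
    qed (use c' in \<open>auto intro: continuous_on_subset[OF cont(1)]\<close>)
    with max[of c'] c' mb show False by (auto simp: g_def)
  qed
  then show "a + s < m" using m by auto
qed

text \<open>\<open>osc s / sin s\<close> is a convex function of \<open>tau s\<close>: otherwise a barrier that is strictly
  concave in \<open>tau\<close> would touch the increments of \<open>W\<close> from above.\<close>

lemma osc_convex:
  assumes s: "0 < s1" "s1 < s2" "s2 < s3" "s3 \<le> (b - a) / 2" "s3 < pi / 2"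
    and A1: "osc s1 \<le> 2 * sin s1 * A1" and A3: "osc s3 \<le> 2 * sin s3 * A3"
  shows "(tau s3 - tau s1) * osc s2 \<le> 2 * sin s2 * ((tau s3 - tau s2) * A1 + (tau s2 - tau s1) * A3)"
proof (rule ccontr)
  assume contra: "\<not> ?thesis"
  define T1 T2 T3 where "T1 = tau s1" and "T2 = tau s2" and "T3 = tau s3"
  have T: "T1 < T2" "T2 < T3" using s tau_mono by (auto simp: T1_def T2_def T3_def)
  define B where "B = (A3 - A1) / (T3 - T1)"
  define l where "l r = A1 + B * (r - T1)" for r
  have l: "l T1 = A1" "l T3 = A3" using T by (auto simp: l_def B_def)
  have S: "0 < sin t" if "s1 \<le> t" "t \<le> s3" for t
    using that s by (intro sin_gt_zero) auto
  have "(T3 - T1) * B = A3 - A1" using T by (simp add: B_def)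
  then have "(T3 - T1) * l T2 = (T3 - T2) * A1 + (T2 - T1) * A3" unfolding l_def by algebra
  then have "(T3 - T1) * (2 * sin s2 * l T2) = 2 * sin s2 * ((T3 - T2) * A1 + (T2 - T1) * A3)"
    by (metis mult.left_commute)
  also have "\<dots> < (T3 - T1) * osc s2"
    using contra unfolding T1_def T2_def T3_def by (simp only: not_le)
  finally have "(T3 - T1) * (2 * sin s2 * l T2) < (T3 - T1) * osc s2" .
  then have "2 * sin s2 * l T2 < osc s2" using T by simp
  then have gap: "0 < osc s2 / (2 * sin s2) - l T2" using S[of s2] s by (simp add: field_simps)
  \<comment> \<open>\<open>l\<close> is the chord in the coordinate \<open>tau\<close>. It is replaced by the parabola \<open>G\<close>, which is strictly concave
    in \<open>tau\<close>; \<open>e\<close> is so small that \<open>osc\<close> still exceeds it at \<open>s2\<close>\<close>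
  define e where "e = (osc s2 / (2 * sin s2) - l T2) / (2 * ((T2 - T1) * (T3 - T2)))"
  have e: "e > 0" "e * ((T2 - T1) * (T3 - T2)) < osc s2 / (2 * sin s2) - l T2"
    using gap T by (auto simp: e_def)
  define G where "G t = l (tau t) + e * ((tau t - T1) * (T3 - tau t))" for t
  define R where "R = {z \<in> {a..b} \<times> {a..b}. 2 * s1 \<le> snd z - fst z \<and> snd z - fst z \<le> 2 * s3}"
  define h where "h z = (W (snd z) - W (fst z)) / (2 * sin ((snd z - fst z) / 2)) - G ((snd z - fst z) / 2)" for z
  have "compact R"
  proof -
    have "R = ({a..b} \<times> {a..b}) \<inter> ({z. 2 * s1 \<le> snd z - fst z} \<inter> {z. snd z - fst z \<le> 2 * s3})"
      by (auto simp: R_def)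
    moreover have "compact ({a..b} \<times> {a..b})" by (intro compact_Times compact_Icc)
    moreover have "closed ({z :: real \<times> real. 2 * s1 \<le> snd z - fst z} \<inter> {z. snd z - fst z \<le> 2 * s3})"
      by (intro closed_Int closed_Collect_le continuous_intros)
    ultimately show ?thesis by (simp add: compact_Int_closed)
  qed
  have tau_cont: "continuous_on {s1..s3} tau"
    by (intro DERIV_continuous_on[where D = "\<lambda>s. 1 / (cos s)\<^sup>2 + 1 / (sin s)\<^sup>2"]
        has_field_derivative_at_within[OF tau_deriv]) (use s in auto)
  have h_cont: "continuous_on R h"
  proof -
    have "sin ((snd z - fst z) / 2) \<noteq> 0" if "z \<in> R" for z
      using S[of "(snd z - fst z) / 2"] that by (auto simp: R_def)
    then show ?thesis unfolding h_def G_def l_def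
      by (intro continuous_intros continuous_on_compose2[OF W_cont] continuous_on_compose2[OF tau_cont])
         (auto simp: R_def)
  qed
  obtain m2 where m2: "m2 \<in> {a + s2..b - s2}" "osc s2 = W (m2 + s2) - W (m2 - s2)"
    using osc_attained(1)[of s2] s by auto
  have z2: "(m2 - s2, m2 + s2) \<in> R" using m2 s by (auto simp: R_def)
  have h2: "h (m2 - s2, m2 + s2) > 0" using e(2) m2(2) by (simp add: h_def G_def T2_def)
  obtain z0 where z0: "z0 \<in> R" and z0max: "\<And>z. z \<in> R \<Longrightarrow> h z \<le> h z0"
    using continuous_attains_sup[OF \<open>compact R\<close> _ h_cont] z2 by blast
  define x y where "x = fst z0" and "y = snd z0"
  define t where "t = (y - x) / 2"
  define M where "M = h z0"
  have M0: "M > 0" using z0max[OF z2] h2 by (simp add: M_def)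
  have xy: "a \<le> x" "y \<le> b" "s1 \<le> t" "t \<le> s3" using z0 by (auto simp: R_def x_def y_def t_def)
  have hM: "M = (W y - W x) / (2 * sin t) - G t" by (simp add: M_def h_def x_def y_def t_def)
  have osc_t: "W y - W x \<le> osc t" unfolding t_def using xy s by (intro osc_ge) (auto simp: t_def)
  have "t \<noteq> s1"
  proof
    assume [simp]: "t = s1"
    have "W y - W x \<le> 2 * sin s1 * A1" using osc_t A1 by simp
    then have "M \<le> 0" using S[of s1] s l unfolding hM G_def by (simp add: T1_def[symmetric] field_simps)
    with M0 show False by simp
  qed
  moreover have "t \<noteq> s3"
  proof
    assume [simp]: "t = s3"
    have "W y - W x \<le> 2 * sin s3 * A3" using osc_t A3 by simp
    then have "M \<le> 0" using S[of s3] s l unfolding hM G_def by (simp add: T3_def[symmetric] field_simps)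
    with M0 show False by simp
  qed
  ultimately have t: "s1 < t" "t < s3" using xy by auto
  define m where "m = (x + y) / 2"
  have mt: "m - t = x" "m + t = y" by (auto simp: m_def t_def field_simps)
  have m_in: "m \<in> {a + t..b - t}" using xy mt by auto
  have "W (m' + t) - W (m' - t) \<le> W (m + t) - W (m - t)" if "m' \<in> {a + t..b - t}" for m'
  proof -
    have "(m' - t, m' + t) \<in> R" using that t s by (auto simp: R_def)
    from z0max[OF this] have "(W (m' + t) - W (m' - t)) / (2 * sin t) \<le> (W y - W x) / (2 * sin t)"
      using hM by (simp add: M_def h_def)
    then show ?thesis using S[of t] t mt by (simp add: divide_le_cancel)
  qed
  from max_interior[OF _ _ m_in this] have xy_in: "a < x" "y < b" using t s mt by auto
  \<comment> \<open>\<open>f\<close> is \<open>G\<close>, raised by the maximum \<open>M\<close> of the excess, so that \<open>sin s f s\<close> touches at the maximising pair\<close>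
  define f f1 where "f = (\<lambda>s. (A1 - B * T1 - e * T1 * T3 + M) + (B + e * (T1 + T3)) * tau s - e * (tau s)\<^sup>2)"
    and "f1 = (\<lambda>s. (B + e * (T1 + T3)) - 2 * e * tau s)"
  define Phi1 where "Phi1 = (\<lambda>s. cos s * f s + f1 s / (sin s * (cos s)\<^sup>2))"
  define Phi2 where "Phi2 = (\<lambda>s. - sin s * f s + f1 s * (1 / (cos s)\<^sup>2 + 1 / (sin s)\<^sup>2) * cos s
     + (- 2 * e * (1 / (cos s)\<^sup>2 + 1 / (sin s)\<^sup>2) / (sin s * (cos s)\<^sup>2)
        - f1 s * ((cos s)\<^sup>2 - 2 * (sin s)\<^sup>2) / ((sin s)\<^sup>2 * (cos s)^3)))"
  note bd = barrier_deriv[OF f_def f1_def Phi1_def Phi2_def]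
  have fG: "f r = G r + M" for r
    by (simp add: f_def G_def l_def algebra_simps power2_eq_square)
  have Wt: "W y - W x = 2 * (sin t * f t)"
    using hM S[of t] t by (simp add: fG field_simps)
  have "touches (\<lambda>s. sin s * f s) Phi1 Phi2 x y"
    unfolding touches_def t_def[symmetric]
  proof (intro conjI exI[of _ "min (t - s1) (s3 - t)"] allI impI)
    show "a < x" "y < b" "W y - W x = 2 * (sin t * f t)" by fact+
    show "x < y" using t s by (simp add: t_def)
    show "isCont Phi2 t" using t s by (intro bd(3)) auto
    show "min (t - s1) (s3 - t) > 0" using t by simp
    fix r assume "\<bar>r - t\<bar> < min (t - s1) (s3 - t)"
    then have "0 < r" "r < pi / 2" using s by auto
    then show "((\<lambda>s. sin s * f s) has_real_derivative Phi1 r) (at r)"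
      "(Phi1 has_real_derivative Phi2 r) (at r)" by (rule bd(1,2))+
  next
    fix x' y' assume *: "\<bar>x' - x\<bar> < min (t - s1) (s3 - t)" "\<bar>y' - y\<bar> < min (t - s1) (s3 - t)"
      "a < x'" "x' < b" "a < y'" "y' < b"
    have "\<bar>(y' - x') / 2 - (y - x) / 2\<bar> < D" if "\<bar>x' - x\<bar> < D" "\<bar>y' - y\<bar> < D" for D
    proof -
      have eq: "(y' - x') / 2 - (y - x) / 2 = ((y' - y) - (x' - x)) / 2" by (simp add: field_simps)
      show ?thesis unfolding eq using that abs_triangle_ineq4[of "y' - y" "x' - x"] by simp
    qed
    from this[OF *(1,2)] have "\<bar>(y' - x') / 2 - t\<bar> < min (t - s1) (s3 - t)" by (simp only: t_def)
    then have r: "s1 < (y' - x') / 2" "(y' - x') / 2 < s3" by (simp_all only: min_less_iff_conj abs_less_iff) linarith+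
    then have "(x', y') \<in> R" using * by (auto simp: R_def)
    from z0max[OF this] have "(W y' - W x') / (2 * sin ((y' - x') / 2)) \<le> f ((y' - x') / 2)"
      by (simp add: h_def fG M_def)
    then show "W y' - W x' \<le> 2 * (sin ((y' - x') / 2) * f ((y' - x') / 2))"
      using S[of "(y' - x') / 2"] r by (simp add: field_simps)
  qed
  from touches_tan[OF this t_def] have "2 * Phi1 t * tan t \<le> Phi2 t + lam * (sin t * f t)" .
  also have "lam * (sin t * f t) \<le> 3 * (sin t * f t)"
    using lam Wt W_strict_mono[of x y] xy_in t s by (intro mult_right_mono) (auto simp: t_def)
  also have "Phi2 t + 3 * (sin t * f t) < 2 * Phi1 t * tan t"
    using t s e by (intro bd(4)) auto
  finally show False by simp
qed

end

section \<open>The modulus of oscillation is a multiple of the sine\<close>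

lemma half_le_sin:
  fixes s :: real
  assumes "0 \<le> s" "s \<le> pi / 2"
  shows "s / 2 \<le> sin s"
proof (cases "s = 0")
  case False
  then have s: "0 < s / 2" using assms by simp
  have "\<exists>z. 0 < z \<and> z < s / 2 \<and> sin (s / 2) - sin 0 = (s / 2 - 0) * cos z"
    by (rule MVT2[OF s]) (auto intro!: derivative_eq_intros)
  then obtain z where z: "0 < z" "z < s / 2" "sin (s / 2) = s / 2 * cos z" by auto
  have c: "cos (pi / 4) \<le> cos z" "cos (pi / 4) \<le> cos (s / 2)"
    using z assms s by (auto intro!: cos_monotone_0_pi_le)
  have c0: "0 \<le> cos z" using z assms by (intro cos_ge_zero) auto
  have "s / 2 = s * (cos (pi / 4) * cos (pi / 4))" by (simp add: cos_45)
  also have "\<dots> \<le> s * (cos z * cos (s / 2))"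
    using assms c c0 by (intro mult_left_mono mult_mono) (auto simp: cos_45)
  also have "\<dots> = 2 * sin (s / 2) * cos (s / 2)" using z(3) by simp
  also have "\<dots> = sin s" using sin_double[of "s / 2"] by simp
  finally show ?thesis .
qed simp

lemma inverse_tau_diff:
  "((\<lambda>s. 1 / (T - tau s)) \<longlongrightarrow> 0) (at_right 0)"
  "((\<lambda>s. 1 / (tau s - T)) \<longlongrightarrow> 0) (at_left (pi / 2))"
proof -
  have eq: "1 / (T - tau s) = sin s * cos s / (T * sin s * cos s - (sin s)\<^sup>2 + (cos s)\<^sup>2)"
           "1 / (tau s - T) = sin s * cos s / ((sin s)\<^sup>2 - (cos s)\<^sup>2 - T * sin s * cos s)"
    if "0 < s" "s < pi / 2" for s
  proof -
    have "sin s > 0" "cos s > 0" using that by (auto intro: sin_gt_zero cos_gt_zero)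
    then have t: "tau s * (sin s * cos s) = (sin s)\<^sup>2 - (cos s)\<^sup>2" and n: "sin s * cos s \<noteq> 0"
      by (auto simp: tau_def field_simps power2_eq_square)
    have "1 / (T - tau s) = (sin s * cos s) / ((T - tau s) * (sin s * cos s))" using n by simp
    also have "(T - tau s) * (sin s * cos s) = T * sin s * cos s - (sin s)\<^sup>2 + (cos s)\<^sup>2"
      using t by (simp add: algebra_simps)
    finally show "1 / (T - tau s) = sin s * cos s / (T * sin s * cos s - (sin s)\<^sup>2 + (cos s)\<^sup>2)" .
    have "1 / (tau s - T) = (sin s * cos s) / ((tau s - T) * (sin s * cos s))" using n by simp
    also have "(tau s - T) * (sin s * cos s) = (sin s)\<^sup>2 - (cos s)\<^sup>2 - T * sin s * cos s"
      using t by (simp add: algebra_simps)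
    finally show "1 / (tau s - T) = sin s * cos s / ((sin s)\<^sup>2 - (cos s)\<^sup>2 - T * sin s * cos s)" .
  qed
  have "((\<lambda>s. sin s * cos s / (T * sin s * cos s - (sin s)\<^sup>2 + (cos s)\<^sup>2)) \<longlongrightarrow>
      sin 0 * cos 0 / (T * sin 0 * cos 0 - (sin 0)\<^sup>2 + (cos 0)\<^sup>2)) (at_right 0)"
    by (intro tendsto_intros) auto
  then have 1: "((\<lambda>s. sin s * cos s / (T * sin s * cos s - (sin s)\<^sup>2 + (cos s)\<^sup>2)) \<longlongrightarrow> 0) (at_right 0)"
    by simp
  show "((\<lambda>s. 1 / (T - tau s)) \<longlongrightarrow> 0) (at_right 0)"
    by (rule Lim_transform_eventually[OF 1])
       (use eventually_at_right_real[of 0 "pi / 2"] in \<open>auto elim!: eventually_mono simp: eq\<close>)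
  have "((\<lambda>s. sin s * cos s / ((sin s)\<^sup>2 - (cos s)\<^sup>2 - T * sin s * cos s)) \<longlongrightarrow>
      sin (pi/2) * cos (pi/2) / ((sin (pi/2))\<^sup>2 - (cos (pi/2))\<^sup>2 - T * sin (pi/2) * cos (pi/2))) (at_left (pi/2))"
    by (intro tendsto_intros) auto
  then have 2: "((\<lambda>s. sin s * cos s / ((sin s)\<^sup>2 - (cos s)\<^sup>2 - T * sin s * cos s)) \<longlongrightarrow> 0) (at_left (pi/2))"
    by simp
  show "((\<lambda>s. 1 / (tau s - T)) \<longlongrightarrow> 0) (at_left (pi / 2))"
    by (rule Lim_transform_eventually[OF 2])
       (use eventually_at_left_real[of 0 "pi / 2"] in \<open>auto elim!: eventually_mono simp: eq\<close>)
qed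

context two_point begin

text \<open>The mean value theorem bounds the increments by \<open>2 s max K\<close>.\<close>

lemma osc_bound: "\<exists>B. \<forall>s. 0 < s \<longrightarrow> s \<le> (b - a) / 2 \<longrightarrow> osc s \<le> 2 * sin s * B"
proof -
  have "{a..b} \<noteq> {}" using ab by simp
  then obtain xm where xm: "\<And>x. x \<in> {a..b} \<Longrightarrow> K x \<le> K xm"
    using continuous_attains_sup[OF compact_Icc _ K_cont] by blast
  have "K xm \<ge> 0" using xm[of a] ab by simp
  have "osc s \<le> 2 * sin s * (2 * K xm)" if s: "0 < s" "s \<le> (b - a) / 2" for s
  proof -
    obtain m where m: "m \<in> {a + s..b - s}" "osc s = W (m + s) - W (m - s)"
      using osc_attained(1)[of s] s by auto
    have "\<exists>z. m - s < z \<and> z < m + s \<and> W (m + s) - W (m - s) = (m + s - (m - s)) * K z"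
    proof -
      have "continuous_on {m - s..m + s} W" by (rule continuous_on_subset[OF W_cont]) (use m s in auto)
      moreover have WD: "(W has_real_derivative K z) (at z)" if "m - s < z" "z < m + s" for z
        using that m s by (intro W_deriv) auto
      then have "W differentiable (at z)" if "m - s < z" "z < m + s" for z
        using that real_differentiable_def by blast
      ultimately obtain l z where z: "m - s < z" "z < m + s" "(W has_real_derivative l) (at z)"
          "W (m + s) - W (m - s) = (m + s - (m - s)) * l"
        using MVT[of "m - s" "m + s" W] s by auto
      then have "l = K z" using WD DERIV_unique by blast
      with z show ?thesis by blast
    qed
    then obtain z where "m - s < z" "z < m + s" "osc s = 2 * s * K z" using m by auto
    then have "osc s \<le> 2 * s * K xm" using xm[of z] m s by (auto intro!: mult_left_mono)
    also have "\<dots> \<le> 2 * (2 * sin s) * K xm"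
      using half_le_sin[of s] s ab \<open>K xm \<ge> 0\<close> by (intro mult_right_mono) auto
    finally show ?thesis by simp
  qed
  then show ?thesis by blast
qed

text \<open>A convex function of \<open>tau\<close> that is bounded above near \<open>tau = - \<infinity>\<close> is nondecreasing: in
  \<open>osc_convex\<close> let \<open>s1\<close> tend to 0.\<close>

lemma osc_mono:
  assumes s: "0 < s2" "s2 < s3" "s3 \<le> (b - a) / 2" "s3 < pi / 2"
  shows "sin s3 * osc s2 \<le> sin s2 * osc s3"
proof -
  obtain B where B: "\<And>s. 0 < s \<Longrightarrow> s \<le> (b - a) / 2 \<Longrightarrow> osc s \<le> 2 * sin s * B"
    using osc_bound by blast
  have S: "0 < sin s2" "0 < sin s3" using s by (auto intro: sin_gt_zero)
  define A where "A = osc s3 / (2 * sin s3)"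
  have "((\<lambda>s1. 2 * sin s2 * (A + (tau s3 - tau s2) * (B - A) * (1 / (tau s3 - tau s1)))) \<longlongrightarrow>
      2 * sin s2 * (A + (tau s3 - tau s2) * (B - A) * 0)) (at_right 0)"
    by (intro tendsto_intros inverse_tau_diff)
  moreover have "\<forall>\<^sub>F s1 in at_right 0. osc s2 \<le> 2 * sin s2 * (A + (tau s3 - tau s2) * (B - A) * (1 / (tau s3 - tau s1)))"
    using eventually_at_right_real[OF s(1)]
  proof eventually_elim
    case (elim s1)
    then have "tau s1 < tau s3" using s by (intro tau_mono) auto
    have "(tau s3 - tau s1) * osc s2 \<le> 2 * sin s2 * ((tau s3 - tau s2) * B + (tau s2 - tau s1) * A)"
      using elim s S by (intro osc_convex B) (auto simp: A_def)
    then have "osc s2 \<le> 2 * sin s2 * ((tau s3 - tau s2) * B + (tau s2 - tau s1) * A) / (tau s3 - tau s1)"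
      using \<open>tau s1 < tau s3\<close> by (simp add: field_simps)
    also have "(tau s3 - tau s2) * B + (tau s2 - tau s1) * A
        = (tau s3 - tau s1) * A + (tau s3 - tau s2) * (B - A)" by (simp add: algebra_simps)
    also have "2 * sin s2 * ((tau s3 - tau s1) * A + (tau s3 - tau s2) * (B - A)) / (tau s3 - tau s1)
        = 2 * sin s2 * (A + (tau s3 - tau s2) * (B - A) * (1 / (tau s3 - tau s1)))"
      using \<open>tau s1 < tau s3\<close> by (simp add: add_divide_distrib distrib_left)
    finally show ?case .
  qed
  ultimately have "osc s2 \<le> 2 * sin s2 * (A + (tau s3 - tau s2) * (B - A) * 0)"
    by (rule tendsto_lowerbound) simp
  then show ?thesis using S by (simp add: A_def field_simps)
qed

lemma osc_full: "osc ((b - a) / 2) = W b - W a"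
proof -
  obtain m where m: "m \<in> {a + (b - a) / 2..b - (b - a) / 2}"
      "osc ((b - a) / 2) = W (m + (b - a) / 2) - W (m - (b - a) / 2)"
    using osc_attained(1)[of "(b - a) / 2"] ab by auto
  moreover have "a + (b - a) / 2 = (a + b) / 2" "b - (b - a) / 2 = (a + b) / 2" by (simp_all add: field_simps)
  ultimately have "m = (a + b) / 2" by simp
  moreover have "(a + b) / 2 + (b - a) / 2 = b" "(a + b) / 2 - (b - a) / 2 = a" by (simp_all add: field_simps)
  ultimately show ?thesis using m by metis
qed

text \<open>Let \<open>m\<close> be the midpoint of the interval. At \<open>s = (b - a) / 2\<close> the increment
  \<open>W (m + s) - W (m - s)\<close> is stationary because \<open>K\<close> vanishes at the ends. If
  \<open>(b - a) / 2 < \<pi> / 2\<close>, the sine still increases there, so that the quotient of the two would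
  decrease, against \<open>osc_mono\<close>.\<close>

lemma length_eq_pi: "b - a = pi"
proof (rule ccontr)
  assume "b - a \<noteq> pi"
  then have L: "(b - a) / 2 < pi / 2" using ab by auto
  define h where "h = (b - a) / 2"
  define m where "m = (a + b) / 2"
  have h: "0 < h" "h < pi / 2" using ab L by (auto simp: h_def)
  have mh: "m + h = b" "m - h = a" by (auto simp: m_def h_def field_simps)
  have Sh: "sin h > 0" "cos h > 0" using h by (auto intro: sin_gt_zero cos_gt_zero)
  have Om: "W b - W a > 0" using W_strict_mono[of a b] ab by simp
  define c where "c = (W b - W a) / sin h"
  have "c > 0" using Om Sh by (simp add: c_def)
  define G where "G s = W (m + s) - W (m - s) - c * sin s" for s
  define G' where "G' s = K (m + s) + K (m - s) - c * cos s" for s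
  have G_le: "G s \<le> 0" if "0 < s" "s < h" for s
  proof -
    have "W (m + s) - W (m - s) \<le> osc s" using that mh by (intro osc_attained(2)) (auto simp: h_def[symmetric])
    moreover have "sin h * osc s \<le> sin s * (W b - W a)"
      using osc_mono[of s h] that h osc_full by (simp add: h_def)
    ultimately have "sin h * (W (m + s) - W (m - s)) \<le> sin s * (W b - W a)"
      using Sh by (meson mult_left_mono less_imp_le order_trans)
    then show ?thesis using Sh by (simp add: G_def c_def field_simps)
  qed
  have cont: "continuous_on {0..h} (\<lambda>s. f (m + s))" "continuous_on {0..h} (\<lambda>s. f (m - s))"
    if "continuous_on {a..b} f" for f :: "real \<Rightarrow> real"
    by (rule continuous_on_compose2[OF that]; use mh h in \<open>auto intro!: continuous_intros\<close>)+
  have G'_cont: "continuous_on {0..h} G'" unfolding G'_def by (intro continuous_intros cont K_cont)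
  have G_cont: "continuous_on {0..h} G" unfolding G_def by (intro continuous_intros cont W_cont)
  have GD: "(G has_real_derivative G' z) (at z)" if "0 < z" "z < h" for z
  proof -
    have "a < m + z" "m + z < b" "a < m - z" "m - z < b" using that mh by linarith+
    then have "(W has_real_derivative K (m + z)) (at (m + z))" "(W has_real_derivative K (m - z)) (at (m - z))"
      by (auto intro!: W_deriv)
    then show ?thesis unfolding G_def G'_def
      by (auto intro!: derivative_eq_intros DERIV_chain2[where g = "\<lambda>t. m + t"] DERIV_chain2[where g = "\<lambda>t. m - t"])
  qed
  have "(G' \<longlongrightarrow> G' h) (at_left h)" using G'_cont h by (simp add: continuous_on_Icc_at_leftD)
  moreover have "G' h < 0" using mh \<open>c > 0\<close> Sh by (simp add: G'_def)
  ultimately have "\<forall>\<^sub>F z in at_left h. G' z < 0" by (rule order_tendstoD)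
  then obtain e where e: "e < h" "\<And>z. e < z \<Longrightarrow> z < h \<Longrightarrow> G' z < 0" by (auto simp: eventually_at_left_field)
  define e' where "e' = max e (h / 2)"
  have e': "e' < h" "e \<le> e'" "0 < e'" using e h by (auto simp: e'_def)
  have "G e' > G h"
  proof (rule DERIV_neg_imp_decreasing_open[OF e'(1)])
    fix z assume "e' < z" "z < h"
    then show "\<exists>v. (G has_real_derivative v) (at z) \<and> v < 0" using GD[of z] e(2)[of z] e' by auto
  qed (use e' in \<open>auto intro: continuous_on_subset[OF G_cont]\<close>)
  moreover have "G h = 0" using mh Sh by (simp add: G_def c_def)
  ultimately show False using G_le[of e'] e' by simp
qed

lemma a_eq: "a = - (pi / 2)" and b_eq: "b = pi / 2"
  using length_eq_pi ab by auto

definition "C = (W b - W a) / 2"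

lemma C_pos: "C > 0"
  using W_strict_mono[of a b] ab by (simp add: C_def)

text \<open>Monotonicity bounds \<open>osc s / sin s\<close> by its limit \<open>2 C\<close> at \<open>\<pi> / 2\<close>. As \<open>tau\<close> tends to \<open>\<infinity>\<close>
  there, a convex function of \<open>tau\<close> that is bounded above is also nonincreasing, which gives the
  other inequality.\<close>

lemma osc_eq:
  assumes s: "0 < s" "s < pi / 2"
  shows "osc s = 2 * C * sin s"
proof (rule antisym)
  have full: "osc t \<le> 2 * C" if "0 \<le> t" "t \<le> pi / 2" for t
  proof -
    have t: "0 \<le> t" "t \<le> (b - a) / 2" using that length_eq_pi by auto
    obtain m where m: "m \<in> {a + t..b - t}" "osc t = W (m + t) - W (m - t)"
      using osc_attained(1)[OF t] by blast
    have "W (m + t) \<le> W b" using W_strict_mono[of "m + t" b] m that by (cases "m + t = b") auto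
    moreover have "W a \<le> W (m - t)" using W_strict_mono[of a "m - t"] m that by (cases "m - t = a") auto
    ultimately show ?thesis using m by (simp add: C_def)
  qed
  have ev: "\<forall>\<^sub>F t in at_left (pi / 2). s < t \<and> t < pi / 2"
    using eventually_at_left_real[OF s(2)] by eventually_elim auto
  show "osc s \<le> 2 * C * sin s"
  proof (rule tendsto_upperbound)
    have "((\<lambda>t. sin t * osc s) \<longlongrightarrow> sin (pi / 2) * osc s) (at_left (pi / 2))" by (intro tendsto_intros)
    then show "((\<lambda>t. sin t * osc s) \<longlongrightarrow> osc s) (at_left (pi / 2))" by simp
    show "\<forall>\<^sub>F t in at_left (pi / 2). sin t * osc s \<le> 2 * C * sin s"
      using ev
    proof eventually_elim
      case (elim t)
      then have "sin t * osc s \<le> sin s * osc t" using s length_eq_pi by (intro osc_mono) auto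
      also have "\<dots> \<le> sin s * (2 * C)" using elim s by (intro mult_left_mono full) (auto intro: sin_ge_zero)
      finally show ?case by (simp add: mult_ac)
    qed
  qed simp
  obtain B where B: "\<And>s. 0 < s \<Longrightarrow> s \<le> (b - a) / 2 \<Longrightarrow> osc s \<le> 2 * sin s * B"
    using osc_bound by blast
  have Ss: "0 < sin s" using s by (auto intro: sin_gt_zero)
  define A where "A = osc s / (2 * sin s)"
  have A_ge: "osc s2 \<le> 2 * sin s2 * A" if s2: "s < s2" "s2 < pi / 2" for s2
  proof -
    have "((\<lambda>s3. 2 * sin s2 * (A + (tau s2 - tau s) * (B - A) * (1 / (tau s3 - tau s)))) \<longlongrightarrow>
        2 * sin s2 * (A + (tau s2 - tau s) * (B - A) * 0)) (at_left (pi / 2))"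
      by (intro tendsto_intros inverse_tau_diff)
    moreover have "\<forall>\<^sub>F s3 in at_left (pi / 2).
        osc s2 \<le> 2 * sin s2 * (A + (tau s2 - tau s) * (B - A) * (1 / (tau s3 - tau s)))"
      using eventually_at_left_real[OF s2(2)]
    proof eventually_elim
      case (elim s3)
      then have "tau s < tau s3" using s s2 by (intro tau_mono) auto
      have "(tau s3 - tau s) * osc s2 \<le> 2 * sin s2 * ((tau s3 - tau s2) * A + (tau s2 - tau s) * B)"
        using elim s s2 Ss length_eq_pi by (intro osc_convex B) (auto simp: A_def)
      then have "osc s2 \<le> 2 * sin s2 * ((tau s3 - tau s2) * A + (tau s2 - tau s) * B) / (tau s3 - tau s)"
        using \<open>tau s < tau s3\<close> by (simp add: field_simps)
      also have "(tau s3 - tau s2) * A + (tau s2 - tau s) * B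
          = (tau s3 - tau s) * A + (tau s2 - tau s) * (B - A)" by (simp add: algebra_simps)
      also have "2 * sin s2 * ((tau s3 - tau s) * A + (tau s2 - tau s) * (B - A)) / (tau s3 - tau s)
          = 2 * sin s2 * (A + (tau s2 - tau s) * (B - A) * (1 / (tau s3 - tau s)))"
        using \<open>tau s < tau s3\<close> by (simp add: add_divide_distrib distrib_left)
      finally show ?case .
    qed
    ultimately have "osc s2 \<le> 2 * sin s2 * (A + (tau s2 - tau s) * (B - A) * 0)"
      by (rule tendsto_lowerbound) simp
    then show ?thesis by simp
  qed
  have "2 * C \<le> 2 * A"
  proof (rule tendsto_le[OF _ _ _ eventually_mono[OF ev]])
    have "((\<lambda>t. 2 * sin t * A) \<longlongrightarrow> 2 * sin (pi / 2) * A) (at_left (pi / 2))" by (intro tendsto_intros)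
    then show "((\<lambda>t. 2 * sin t * A) \<longlongrightarrow> 2 * A) (at_left (pi / 2))" by simp
    have "(W \<longlongrightarrow> W b) (at_left b)" using W_cont ab by (simp add: continuous_on_Icc_at_leftD)
    moreover have "(W \<longlongrightarrow> W a) (at_right a)" using W_cont ab by (simp add: continuous_on_Icc_at_rightD)
    then have "((\<lambda>t. W (- t)) \<longlongrightarrow> W a) (at_left b)"
      unfolding b_eq a_eq by (simp add: filterlim_at_left_to_right)
    ultimately have "((\<lambda>t. W t - W (- t)) \<longlongrightarrow> W b - W a) (at_left b)" by (intro tendsto_diff)
    moreover have "at_left b = at_left (pi / 2)" "W b - W a = 2 * C" by (simp only: b_eq) (simp add: C_def)
    ultimately show "((\<lambda>t. W t - W (- t)) \<longlongrightarrow> 2 * C) (at_left (pi / 2))" by simp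
    fix t assume t: "s < t \<and> t < pi / 2"
    then have "a \<le> - t" "- t \<le> t" "t \<le> b" using s a_eq b_eq by linarith+
    from osc_ge[OF this] have "W t - W (- t) \<le> osc t" by simp
    also have "\<dots> \<le> 2 * sin t * A" using t by (intro A_ge) auto
    finally show "W t - W (- t) \<le> 2 * sin t * A" .
  qed simp
  then show "2 * C * sin s \<le> osc s" using Ss by (simp add: A_def field_simps)
qed

end

section \<open>Extremal pairs and rigidity\<close>

lemma DERIV_of_composite:
  fixes f y :: "real \<Rightarrow> real"
  assumes f: "(f has_real_derivative c) (at (y s))" "c \<noteq> 0" and y: "isCont y s"
    and fy: "((\<lambda>t. f (y t)) has_real_derivative g) (at s)"
  shows "(y has_real_derivative g / c) (at s)"
proof -
  obtain q where q: "\<And>z. f z - f (y s) = q z * (z - y s)" "isCont q (y s)" "q (y s) = c"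
    using f(1) CARAT_DERIV by metis
  have qy: "isCont (\<lambda>t. q (y t)) s" by (rule isCont_o2[OF y q(2)])
  have "((\<lambda>t. (f (y t) - f (y s)) / (t - s)) \<longlongrightarrow> g) (at s)"
    using fy by (simp add: has_field_derivative_iff)
  moreover have "((\<lambda>t. q (y t)) \<longlongrightarrow> c) (at s)" using qy q(3) by (simp add: isCont_def)
  ultimately have "((\<lambda>t. (f (y t) - f (y s)) / (t - s) / q (y t)) \<longlongrightarrow> g / c) (at s)"
    using f(2) by (intro tendsto_divide)
  moreover have "\<forall>\<^sub>F t in at s. q (y t) \<noteq> 0"
    using \<open>((\<lambda>t. q (y t)) \<longlongrightarrow> c) (at s)\<close> f(2) by (rule tendsto_imp_eventually_ne)
  then have "\<forall>\<^sub>F t in at s. (f (y t) - f (y s)) / (t - s) / q (y t) = (y t - y s) / (t - s)"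
    by eventually_elim (simp add: q(1))
  ultimately have "((\<lambda>t. (y t - y s) / (t - s)) \<longlongrightarrow> g / c) (at s)"
    by (rule Lim_transform_eventually)
  then show ?thesis by (simp add: has_field_derivative_iff)
qed

lemma linear_term_zero:
  fixes p q :: real
  assumes "\<And>r. r * p + r\<^sup>2 * q \<le> 0"
  shows "p = 0"
proof (rule ccontr)
  assume "p \<noteq> 0"
  define n where "n = \<bar>q\<bar> + 1"
  have n: "n > 0" "n + q > 0" by (auto simp: n_def)
  have "(p / n) * p + (p / n)\<^sup>2 * q = p\<^sup>2 * (n + q) / n\<^sup>2"
    using n by (simp add: field_simps power2_eq_square)
  moreover have "p\<^sup>2 * (n + q) / n\<^sup>2 > 0" using n \<open>p \<noteq> 0\<close> by simp
  ultimately show False using assms[of "p / n"] by simp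
qed

locale two_point_pi = two_point "- (pi / 2)" "pi / 2" lam psi u w k for lam psi u w k
begin

lemma le_sin:
  assumes "- (pi / 2) \<le> x" "x \<le> y" "y \<le> pi / 2"
  shows "W y - W x \<le> 2 * C * sin ((y - x) / 2)"
proof -
  consider "x = y" | "(y - x) / 2 = pi / 2" | "0 < (y - x) / 2" "(y - x) / 2 < pi / 2"
    using assms by fastforce
  then show ?thesis
  proof cases
    case 2
    then have eq: "x = - (pi / 2)" "y = pi / 2" using assms by auto
    show ?thesis unfolding eq by (simp add: C_def)
  next
    case 3
    then show ?thesis using osc_ge[OF assms] osc_eq by simp
  qed simp
qed

definition "extremal x y \<longleftrightarrow> - (pi / 2) \<le> x \<and> x < y \<and> y \<le> pi / 2 \<and> W y - W x = 2 * C * sin ((y - x) / 2)"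

lemma extremal_ex:
  assumes "0 < s" "s < pi / 2"
  shows "\<exists>m. extremal (m - s) (m + s)"
proof -
  obtain m where "m \<in> {- (pi / 2) + s..pi / 2 - s}" "osc s = W (m + s) - W (m - s)"
    using osc_attained(1)[of s] assms by auto
  then have "extremal (m - s) (m + s)"
    using osc_eq[OF assms] assms by (simp add: extremal_def)
  then show ?thesis by blast
qed

lemma extremal_interior:
  assumes e: "extremal x y" and "y - x < pi"
  shows "- (pi / 2) < x" "y < pi / 2"
proof -
  define s m where "s = (y - x) / 2" and "m = (x + y) / 2"
  have ms: "m - s = x" "m + s = y" by (auto simp: s_def m_def field_simps)
  have s: "0 < s" "s < (pi / 2 - - (pi / 2)) / 2" using assms by (auto simp: s_def extremal_def)
  have m: "m \<in> {- (pi / 2) + s..pi / 2 - s}" using e ms by (auto simp: extremal_def)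
  have max: "W (m' + s) - W (m' - s) \<le> W (m + s) - W (m - s)" if "m' \<in> {- (pi / 2) + s..pi / 2 - s}" for m'
  proof -
    have "- (pi / 2) \<le> m' - s" "m' - s \<le> m' + s" "m' + s \<le> pi / 2" using that s by auto
    from le_sin[OF this] have "W (m' + s) - W (m' - s) \<le> 2 * C * sin s" by simp
    also have "\<dots> = W y - W x" using e by (simp add: extremal_def s_def)
    finally show ?thesis unfolding ms .
  qed
  show "- (pi / 2) < x" "y < pi / 2" using max_interior[OF s m max] ms by auto
qed

lemma extremal_touches:
  assumes e: "extremal x y" and "y - x < pi"
  shows "touches (\<lambda>s. C * sin s) (\<lambda>s. C * cos s) (\<lambda>s. - (C * sin s)) x y"
  unfolding touches_def
proof (intro conjI exI[of _ "(y - x) / 2"] allI impI)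
  show "- (pi / 2) < x" "y < pi / 2" using extremal_interior[OF assms] by auto
  show "x < y" "W y - W x = 2 * (C * sin ((y - x) / 2))" "(y - x) / 2 > 0" using e by (auto simp: extremal_def)
  show "isCont (\<lambda>s. - (C * sin s)) ((y - x) / 2)" by (intro continuous_intros)
  fix t
  show "((\<lambda>s. C * sin s) has_real_derivative C * cos t) (at t)"
    "((\<lambda>s. C * cos s) has_real_derivative - (C * sin t)) (at t)"
    by (auto intro!: derivative_eq_intros)
next
  fix x' y' assume *: "\<bar>x' - x\<bar> < (y - x) / 2" "\<bar>y' - y\<bar> < (y - x) / 2"
      "- (pi / 2) < x'" "x' < pi / 2" "- (pi / 2) < y'" "y' < pi / 2"
  have "x' < x + (y - x) / 2" "y - (y - x) / 2 < y'" using *(1,2) by (simp_all only: abs_less_iff) linarith+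
  moreover have "x + (y - x) / 2 = y - (y - x) / 2" by (simp add: field_simps)
  ultimately have "x' \<le> y'" by linarith
  then show "W y' - W x' \<le> 2 * (C * sin ((y' - x') / 2))" using le_sin[of x' y'] * by simp
qed

lemma extremal_K:
  assumes e: "extremal x y" and "y - x < pi"
  shows "K x = C * cos ((y - x) / 2)" "K y = C * cos ((y - x) / 2)"
  using touches_K[OF extremal_touches[OF assms] refl] by auto

text \<open>At an extremal pair \<open>touches_tan\<close> reads \<open>2 sin s \<le> (lam - 1) sin s\<close>.\<close>

lemma lam_eq: "lam = 3"
proof -
  obtain m where e: "extremal (m - pi / 4) (m + pi / 4)" using extremal_ex[of "pi / 4"] by auto
  have "2 * (C * cos (pi / 4)) * tan (pi / 4) \<le> - (C * sin (pi / 4)) + lam * (C * sin (pi / 4))"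
    using touches_tan[OF extremal_touches[OF e] refl] by simp
  then have "2 * (C * sin (pi / 4)) \<le> (lam - 1) * (C * sin (pi / 4))"
    by (simp add: cos_45 sin_45 tan_45 algebra_simps)
  then have "2 \<le> lam - 1" using C_pos by (simp add: sin_45)
  then show ?thesis using lam by simp
qed

text \<open>Slightly outside an extremal pair the increment of \<open>psi\<close> exceeds the tangent by at most
  an arbitrarily small amount, according to \<open>touches_psi\<close>. Slightly inside the pair the tangent is a
  lower bound. This leaves no room for a jump of \<open>psi\<close> at the points of the pair.\<close>

lemma extremal_psi_gap:
  assumes e: "extremal x y" and yx: "y - x < pi" and "eps > 0"
  shows "\<exists>t>0. - (pi / 2) < x - t \<and> y + t < pi / 2 \<and> x + t < y - t \<and>
     psi (y + t) - psi (x - t) < 2 * tan ((y - x) / 2) + eps \<and>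
     psi (y + t) - psi (x - t) < psi (y - t) - psi (x + t) + eps"
proof -
  define s where "s = (y - x) / 2"
  have s: "0 < s" "s < pi / 2" using e yx by (auto simp: s_def extremal_def)
  define c where "c = C * cos s"
  have c: "c > 0" using s C_pos by (simp add: c_def cos_gt_zero)
  have "((\<lambda>h. h / c + 2 * tan s - 2 * tan (s - h)) \<longlongrightarrow> 0 / c + 2 * tan s - 2 * tan (s - 0)) (at_right 0)"
    using s c cos_gt_zero[of s] by (intro tendsto_intros) auto
  then have "\<forall>\<^sub>F h in at_right 0. h / c + 2 * tan s - 2 * tan (s - h) < eps"
    using \<open>eps > 0\<close> by (intro order_tendstoD(2)) auto
  then obtain h0 where h0: "h0 > 0" "\<And>h. 0 < h \<Longrightarrow> h < h0 \<Longrightarrow> h / c + 2 * tan s - 2 * tan (s - h) < eps"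
    by (auto simp: eventually_at_right_field)
  define h where "h = min h0 s / 2"
  have h: "0 < h" "h < s" "h < h0" using h0(1) s by (auto simp: h_def min_def)
  note h = h h0(2)[OF h(1,3)]
  from touches_psi[OF extremal_touches[OF e yx] s_def h(1)]
  obtain t where t: "0 < t" "t < h" "- (pi / 2) < x - t" "y + t < pi / 2"
    and le: "c * (psi (y + t) - psi (x - t)) \<le> - (C * sin s) + 3 * (C * sin s) + h"
    unfolding c_def lam_eq by blast
  have "- (C * sin s) + 3 * (C * sin s) = c * (2 * tan s)"
    using s cos_gt_zero[of s] by (simp add: c_def tan_def)
  then have "c * (psi (y + t) - psi (x - t)) \<le> c * (2 * tan s + h / c)"
    using le c by (simp add: distrib_left)
  then have 1: "psi (y + t) - psi (x - t) \<le> 2 * tan s + h / c" using c by simp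
  have ts: "t < s" using t h by simp
  have inner: "x + t < y - t" using ts by (simp add: s_def field_simps)
  have st: "(y - t - (x + t)) / 2 = s - t" by (simp add: s_def field_simps)
  have "2 * tan ((y - t - (x + t)) / 2) \<le> psi (y - t) - psi (x + t)"
    using inner t e by (intro psi_tan) (auto simp: extremal_def)
  then have "2 * tan (s - t) \<le> psi (y - t) - psi (x + t)" unfolding st .
  moreover have "tan (s - h) \<le> tan (s - t)" using t h s by (intro tan_mono_le) auto
  moreover have "tan (s - h) < tan s" using h s by (intro tan_monotone) auto
  ultimately show ?thesis using 1 t inner h(4) unfolding s_def[symmetric]
    by (intro exI[of _ t]) auto
qed

lemma extremal_psi:
  assumes e: "extremal x y" and yx: "y - x < pi"
  shows "isCont psi x" "isCont psi y" "psi y - psi x = 2 * tan ((y - x) / 2)"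
proof -
  have xy: "- (pi / 2) < x" "x < y" "y < pi / 2" using extremal_interior[OF assms] e by (auto simp: extremal_def)
  have cont: "isCont psi z" if z: "z = x \<or> z = y" for z
    unfolding isCont_def tendsto_iff eventually_at dist_real_def
  proof (intro allI impI)
    fix eps :: real assume "eps > 0"
    from extremal_psi_gap[OF assms this] obtain t where t: "t > 0" "- (pi / 2) < x - t" "y + t < pi / 2" "x + t < y - t"
        "psi (y + t) - psi (x - t) < psi (y - t) - psi (x + t) + eps" by blast
    have m: "psi (x - t) \<le> psi (x + t)" "psi (y - t) \<le> psi (y + t)" using t xy by (auto intro!: psi_mono)
    have "\<bar>psi z' - psi z\<bar> < eps" if "\<bar>z' - z\<bar> < t" for z'
    proof -
      have "psi (z - t) \<le> psi z'" "psi z' \<le> psi (z + t)" "psi (z - t) \<le> psi z" "psi z \<le> psi (z + t)"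
        using that t xy z by (auto intro!: psi_mono)
      moreover have "psi (z + t) - psi (z - t) < eps" using z m t by auto
      ultimately show ?thesis by linarith
    qed
    with t(1) show "\<exists>d>0. \<forall>z'\<in>UNIV. z' \<noteq> z \<and> \<bar>z' - z\<bar> < d \<longrightarrow> \<bar>psi z' - psi z\<bar> < eps" by blast
  qed
  show "isCont psi x" "isCont psi y" using cont by auto
  show "psi y - psi x = 2 * tan ((y - x) / 2)"
  proof (rule antisym)
    show "2 * tan ((y - x) / 2) \<le> psi y - psi x" using xy by (intro psi_tan)
    show "psi y - psi x \<le> 2 * tan ((y - x) / 2)"
    proof (rule field_le_epsilon)
      fix eps :: real assume "eps > 0"
      from extremal_psi_gap[OF assms this] obtain t where t: "t > 0" "- (pi / 2) < x - t" "y + t < pi / 2"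
        "psi (y + t) - psi (x - t) < 2 * tan ((y - x) / 2) + eps" by blast
      have "psi (x - t) \<le> psi x" "psi y \<le> psi (y + t)" using t xy by (auto intro!: psi_mono)
      with t show "psi y - psi x \<le> 2 * tan ((y - x) / 2) + eps" by simp
    qed
  qed
qed

text \<open>The second variation at an extremal pair is a nonpositive quadratic form in the velocities
  of the two points. It vanishes in the direction that moves them apart symmetrically, so its
  gradient vanishes there too. This is one equation more than the differential equation provides.\<close>

lemma extremal_K_deriv:
  assumes e: "extremal x y" and yx: "y - x < pi"
  shows "(K has_real_derivative C * sin ((y - x) / 2)) (at x)"
    and "(K has_real_derivative - (C * sin ((y - x) / 2))) (at y)"
proof -
  define s where "s = (y - x) / 2"
  have s: "0 < s" "s < pi / 2" using e yx by (auto simp: s_def extremal_def)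
  have xy: "- (pi / 2) < x" "x < y" "y < pi / 2" using extremal_interior[OF assms] e by (auto simp: extremal_def)
  define dx dy where "dx = 2 * psi x * K x - lam * W x" and "dy = 2 * psi y * K y - lam * W y"
  have Kx: "(K has_real_derivative dx) (at x)" unfolding dx_def
    by (rule K_deriv) (use xy extremal_psi[OF assms] in auto)
  have Ky: "(K has_real_derivative dy) (at y)" unfolding dy_def
    by (rule K_deriv) (use xy extremal_psi[OF assms] in auto)
  have Kc: "K x = C * cos s" "K y = C * cos s" using extremal_K[OF assms] by (auto simp: s_def)
  have "dy - dx = 2 * (psi y - psi x) * (C * cos s) - 3 * (W y - W x)"
    by (simp add: dx_def dy_def Kc lam_eq algebra_simps)
  also have "\<dots> = 4 * (C * sin s) - 6 * (C * sin s)"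
    using extremal_psi(3)[OF assms] e cos_gt_zero[of s] s by (simp add: extremal_def s_def[symmetric] tan_def)
  finally have diff: "dy - dx = - 2 * (C * sin s)" by simp
  have "r * (2 * dy + 2 * (C * sin s)) + r\<^sup>2 * (dy + C * sin s / 2) \<le> 0" for r
  proof -
    \<comment> \<open>a perturbation of the symmetric direction \<open>r = 0\<close>\<close>
    define f where "f t = W (y + (1 + r) * t) - W (x - t) - 2 * C * sin (s + (2 + r) * t / 2)" for t
    define f' where "f' t = (1 + r) * K (y + (1 + r) * t) + K (x - t) - C * (2 + r) * cos (s + (2 + r) * t / 2)" for t
    have "\<forall>\<^sub>F t in nhds 0. - (pi / 2) < x - t" "\<forall>\<^sub>F t in nhds 0. x - t < pi / 2"
        "\<forall>\<^sub>F t in nhds 0. y + (1 + r) * t < pi / 2" "\<forall>\<^sub>F t in nhds 0. - (pi / 2) < y + (1 + r) * t"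
        "\<forall>\<^sub>F t in nhds 0. x - t < y + (1 + r) * t"
    proof -
      have T: "((\<lambda>t. x - t) \<longlongrightarrow> x - 0) (nhds 0)" "((\<lambda>t. y + (1 + r) * t) \<longlongrightarrow> y + (1 + r) * 0) (nhds 0)"
        by (intro tendsto_intros filterlim_ident)+
      have T': "((\<lambda>t. x - t) \<longlongrightarrow> x) (nhds 0)" "((\<lambda>t. y + (1 + r) * t) \<longlongrightarrow> y) (nhds 0)" using T by auto
      show "\<forall>\<^sub>F t in nhds 0. - (pi / 2) < x - t" "\<forall>\<^sub>F t in nhds 0. x - t < pi / 2"
        by (rule order_tendstoD[OF T'(1)]; use xy in linarith)+
      show "\<forall>\<^sub>F t in nhds 0. y + (1 + r) * t < pi / 2" "\<forall>\<^sub>F t in nhds 0. - (pi / 2) < y + (1 + r) * t"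
        by (rule order_tendstoD[OF T'(2)]; use xy in linarith)+
      have "((\<lambda>t. (y + (1 + r) * t) - (x - t)) \<longlongrightarrow> y - x) (nhds 0)" by (rule tendsto_diff[OF T'(2,1)])
      then have "\<forall>\<^sub>F t in nhds 0. 0 < (y + (1 + r) * t) - (x - t)" by (rule order_tendstoD) (use xy in linarith)
      then show "\<forall>\<^sub>F t in nhds 0. x - t < y + (1 + r) * t" by eventually_elim linarith
    qed
    then have "\<forall>\<^sub>F t in nhds 0. - (pi / 2) < x - t \<and> x - t < pi / 2 \<and>
        y + (1 + r) * t < pi / 2 \<and> - (pi / 2) < y + (1 + r) * t \<and> x - t < y + (1 + r) * t"
      by eventually_elim auto
    then obtain d where d: "d > 0" "\<And>t. \<bar>t\<bar> < d \<Longrightarrow> - (pi / 2) < x - t \<and> x - t < pi / 2 \<and>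
        y + (1 + r) * t < pi / 2 \<and> - (pi / 2) < y + (1 + r) * t \<and> x - t < y + (1 + r) * t"
      by (auto simp: eventually_nhds_metric dist_real_def)
    have f'0: "(f' has_real_derivative (1 + r) * ((1 + r) * dy) - dx + C * (2 + r) * ((2 + r) / 2) * sin s) (at 0)"
    proof -
      have "((\<lambda>t. K (y + (1 + r) * t)) has_real_derivative dy * (1 + r)) (at 0)"
        by (rule DERIV_chain2[where f = K and g = "\<lambda>t. y + (1 + r) * t"])
           (use Ky in \<open>auto intro!: derivative_eq_intros\<close>)
      moreover have "((\<lambda>t. K (x - t)) has_real_derivative dx * (- 1)) (at 0)"
        by (rule DERIV_chain2[where f = K and g = "\<lambda>t. x - t"])
           (use Kx in \<open>auto intro!: derivative_eq_intros\<close>)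
      ultimately show ?thesis unfolding f'_def by (auto intro!: derivative_eq_intros)
    qed
    have "(1 + r) * ((1 + r) * dy) - dx + C * (2 + r) * ((2 + r) / 2) * sin s \<le> 0"
    proof (rule second_deriv_nonpos_at_max[OF d(1) _ f'0])
      show "f' 0 = 0" by (simp add: f'_def Kc algebra_simps)
      fix t assume td: "\<bar>t\<bar> < d"
      note b = d(2)[OF td]
      have "((\<lambda>t. W (y + (1 + r) * t)) has_real_derivative K (y + (1 + r) * t) * (1 + r)) (at t)"
        by (rule DERIV_chain2[where f = W and g = "\<lambda>t. y + (1 + r) * t"])
           (use b in \<open>auto intro!: derivative_eq_intros W_deriv\<close>)
      moreover have "((\<lambda>t. W (x - t)) has_real_derivative K (x - t) * (- 1)) (at t)"
        by (rule DERIV_chain2[where f = W and g = "\<lambda>t. x - t"])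
           (use b in \<open>auto intro!: derivative_eq_intros W_deriv\<close>)
      ultimately show "(f has_real_derivative f' t) (at t)"
        unfolding f_def f'_def by (auto intro!: derivative_eq_intros)
      have "W (y + (1 + r) * t) - W (x - t) \<le> 2 * C * sin ((y + (1 + r) * t - (x - t)) / 2)"
        using b by (intro le_sin) auto
      moreover have "(y + (1 + r) * t - (x - t)) / 2 = s + (2 + r) * t / 2" by (simp add: s_def field_simps)
      moreover have "f 0 = 0" using e by (simp add: f_def extremal_def s_def)
      ultimately show "f t \<le> f 0" by (simp add: f_def)
    qed
    moreover have "(1 + r) * ((1 + r) * dy) - dx + C * (2 + r) * ((2 + r) / 2) * sin s
        = r * (2 * dy + 2 * (C * sin s)) + r\<^sup>2 * (dy + C * sin s / 2) + (dy - dx + 2 * (C * sin s))"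
      by (simp add: field_simps power2_eq_square)
    ultimately show ?thesis using diff by simp
  qed
  then have "2 * dy + 2 * (C * sin s) = 0" by (rule linear_term_zero)
  then have "dy = - (C * sin s)" "dx = C * sin s" using diff by auto
  with Kx Ky show "(K has_real_derivative C * sin ((y - x) / 2)) (at x)"
    "(K has_real_derivative - (C * sin ((y - x) / 2))) (at y)"
    by (auto simp: s_def)
qed

text \<open>Exchanging the right points of two crossing extremal pairs does not change the sum of the
  increments of \<open>W\<close>, but it lowers the sum of the bounds because the sine is strictly concave.\<close>

lemma extremal_no_crossing:
  assumes e1: "extremal x1 y1" and e2: "extremal x2 y2" and less: "x1 < x2" "x2 \<le> y1" "y1 < y2"
  shows False
proof -
  define s1 s2 p q where "s1 = (y1 - x1) / 2" and "s2 = (y2 - x2) / 2"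
    and "p = (y2 - x1) / 2" and "q = (y1 - x2) / 2"
  have bnd: "- (pi / 2) \<le> x1" "y2 \<le> pi / 2" "x1 < y1" "x2 < y2" using e1 e2 by (auto simp: extremal_def)
  have "W y2 - W x1 \<le> 2 * C * sin p" unfolding p_def using bnd less by (intro le_sin) auto
  moreover have "W y1 - W x2 \<le> 2 * C * sin q" unfolding q_def using bnd less by (intro le_sin) auto
  moreover have "W y1 - W x1 = 2 * C * sin s1" "W y2 - W x2 = 2 * C * sin s2"
    using e1 e2 by (auto simp: extremal_def s1_def s2_def)
  ultimately have "2 * C * (sin s1 + sin s2) \<le> 2 * C * (sin p + sin q)" by (simp only: distrib_left)
  then have le: "sin s1 + sin s2 \<le> sin p + sin q" using C_pos by simp
  define h where "h = (s1 + s2) / 2"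
  have pq: "p + q = s1 + s2" by (simp add: p_def q_def s1_def s2_def field_simps)
  have h: "0 < h" "h < pi" using bnd less by (auto simp: h_def s1_def s2_def field_simps)
  have d: "\<bar>s1 - s2\<bar> < p - q" "p - q \<le> 2 * pi"
    using bnd less by (auto simp: p_def q_def s1_def s2_def field_simps abs_less_iff)
  have "cos ((p - q) / 2) < cos (\<bar>s1 - s2\<bar> / 2)" using d by (intro cos_monotone_0_pi) auto
  also have "\<bar>s1 - s2\<bar> / 2 = \<bar>(s1 - s2) / 2\<bar>" by simp
  also have "cos \<dots> = cos ((s1 - s2) / 2)" by (rule cos_abs_real)
  finally have "2 * sin h * cos ((p - q) / 2) < 2 * sin h * cos ((s1 - s2) / 2)"
    using h by (intro mult_strict_left_mono) (auto intro: sin_gt_zero)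
  moreover have "sin p + sin q = 2 * sin h * cos ((p - q) / 2)" "sin s1 + sin s2 = 2 * sin h * cos ((s1 - s2) / 2)"
    by (simp_all add: sin_plus_sin pq h_def)
  ultimately show False using le by simp
qed

text \<open>The statement to be propagated from \<open>S = \<pi> / 2\<close> to \<open>S = 0\<close> by repeated halving.\<close>

definition "cosine_tails S \<longleftrightarrow> (\<forall>t\<in>{S..pi / 2}. K t = C * cos t \<and> K (- t) = C * cos t)"

text \<open>On each tail \<open>W - C sin\<close> is constant, and \<open>W b - W a = 2 C\<close> makes the two constants equal.\<close>

lemma W_tails:
  assumes tails: "cosine_tails S" and t: "0 \<le> t" "S \<le> t" "t \<le> pi / 2"
  shows "W t = C * sin t + (W (pi / 2) - C)" "W (- t) = - C * sin t + (W (pi / 2) - C)"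
proof -
  have eq: "W v - C * sin v = W u - C * sin u"
    if uv: "- (pi / 2) \<le> u" "u \<le> v" "v \<le> pi / 2" and K: "\<And>z. u < z \<Longrightarrow> z < v \<Longrightarrow> K z = C * cos z" for u v
  proof -
    have "W u - C * sin u = W v - C * sin v"
    proof (rule zero_deriv_off_countable_imp_eq[OF uv(2), where D = "{}" and f = "\<lambda>z. W z - C * sin z"])
      show "continuous_on {u..v} (\<lambda>z. W z - C * sin z)"
        by (intro continuous_intros continuous_on_subset[OF W_cont]) (use uv in auto)
      fix z assume z: "u < z" "z < v"
      have "(W has_real_derivative K z) (at z)" using z uv by (intro W_deriv) auto
      then have "(W has_real_derivative C * cos z) (at z)" using K[OF z] by simp
      then show "((\<lambda>z. W z - C * sin z) has_real_derivative 0) (at z)"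
        by (auto intro!: derivative_eq_intros)
    qed simp
    then show ?thesis by simp
  qed
  have "W (pi / 2) - C * sin (pi / 2) = W t - C * sin t"
    using t tails by (intro eq) (auto simp: cosine_tails_def)
  then show "W t = C * sin t + (W (pi / 2) - C)" by simp
  have "W (- t) - C * sin (- t) = W (- (pi / 2)) - C * sin (- (pi / 2))"
  proof (rule eq)
    fix z assume "- (pi / 2) < z" "z < - t"
    then show "K z = C * cos z" using tails t unfolding cosine_tails_def by (auto dest!: bspec[of _ _ "- z"])
  qed (use t in auto)
  then show "W (- t) = - C * sin t + (W (pi / 2) - C)" by (simp add: C_def field_simps)
qed

lemma tails_extremal:
  assumes tails: "cosine_tails S" and t: "0 < t" "S \<le> t" "t \<le> pi / 2"
  shows "extremal (- t) t"
  using W_tails[OF tails, of t] t by (simp add: extremal_def)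

text \<open>An extremal pair that leaves \<open>[- S, S]\<close> either crosses the extremal pair \<open>(- S, S)\<close> or lies
  in a tail, where \<open>W\<close> is a multiple of the sine plus a constant and only symmetric pairs are
  extremal.\<close>

lemma tails_contain:
  assumes tails: "cosine_tails S" and S: "0 < S" "S \<le> pi / 2"
    and e: "extremal x y" and le: "y - x \<le> 2 * S"
  shows "- S \<le> x" "y \<le> S"
proof -
  have bnd: "- (pi / 2) \<le> x" "y \<le> pi / 2" "x < y" using e by (auto simp: extremal_def)
  note eS = tails_extremal[OF tails S(1) order_refl S(2)]
  have outer: False
    if "W y - W x = C * sin y - C * sin x" "0 < \<bar>(y + x) / 2\<bar>"
  proof -
    have "\<bar>(y + x) / 2\<bar> \<le> pi" using bnd by (simp add: abs_le_iff)
    then have "cos \<bar>(y + x) / 2\<bar> < cos 0" using that(2) by (intro cos_monotone_0_pi) auto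
    then have c: "cos ((y + x) / 2) < 1" by (simp add: abs_if split: if_splits)
    have s: "sin ((y - x) / 2) > 0" using bnd pi_gt_zero by (intro sin_gt_zero) (auto simp: field_simps)
    have "2 * C * sin ((y - x) / 2) = C * (sin y - sin x)" using e that(1) by (simp add: extremal_def right_diff_distrib)
    also have "\<dots> = 2 * C * sin ((y - x) / 2) * cos ((y + x) / 2)" by (simp add: sin_diff_sin)
    finally show False using c s C_pos by simp
  qed
  show "y \<le> S"
  proof (rule ccontr)
    assume "\<not> y \<le> S"
    then have "S < y" "- S < x" using le by auto
    show False
    proof (cases "x \<le> S")
      case True
      then show False using extremal_no_crossing[OF eS e] \<open>S < y\<close> \<open>- S < x\<close> by simp
    next
      case False
      then show False using W_tails(1)[OF tails, of x] W_tails(1)[OF tails, of y] S bnd \<open>S < y\<close>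
        by (intro outer) auto
    qed
  qed
  show "- S \<le> x"
  proof (rule ccontr)
    assume "\<not> - S \<le> x"
    then have "x < - S" "y < S" using le by auto
    show False
    proof (cases "- S \<le> y")
      case True
      then show False using extremal_no_crossing[OF e eS] \<open>x < - S\<close> \<open>y < S\<close> by simp
    next
      case False
      then show False using W_tails(2)[OF tails, of "- x"] W_tails(2)[OF tails, of "- y"] S bnd \<open>x < - S\<close>
        by (intro outer) auto
    qed
  qed
qed

text \<open>Below \<open>S\<close> the extremal pairs form a nested, hence continuous, family. Along it \<open>K\<close> takes the
  value \<open>C cos s\<close> and has the derivative \<open>- C sin s\<close> at the right point of the pair, so that this
  point moves with unit speed and the midpoint does not move.\<close>

lemma tails_half:
  assumes tails: "cosine_tails S" and S: "0 < S" "S \<le> pi / 2"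
  shows "cosine_tails (S / 2)"
proof -
  have "\<exists>m. extremal (m - s) (m + s)" if "S / 2 \<le> s" "s \<le> S" for s
  proof (cases "s < pi / 2")
    case True
    then show ?thesis using extremal_ex[of s] that S by auto
  next
    case False
    then have "s = S" using that S by simp
    then show ?thesis using tails_extremal[OF tails, of S] S by (intro exI[of _ 0]) simp
  qed
  then obtain m where m: "\<And>s. S / 2 \<le> s \<Longrightarrow> s \<le> S \<Longrightarrow> extremal (m s - s) (m s + s)" by metis
  have inside: "- S \<le> m s - s" "m s + s \<le> S" if "S / 2 \<le> s" "s \<le> S" for s
    using tails_contain[OF tails S m[OF that]] that by auto
  have mS: "m S = 0" using inside[of S] S by simp
  have nested: "\<bar>m s - m s'\<bar> \<le> s' - s" if "S / 2 \<le> s" "s \<le> s'" "s' \<le> S" for s s'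
  proof -
    have s: "S / 2 \<le> s" "s \<le> S" and s': "S / 2 \<le> s'" "s' \<le> S" using that by auto
    note * = inside[OF s] inside[OF s'] S
    have "m s - m s' \<le> s' - s"
    proof (rule ccontr)
      assume "\<not> m s - m s' \<le> s' - s"
      then show False using extremal_no_crossing[OF m[OF s'] m[OF s]] * that by auto
    qed
    moreover have "m s' - m s \<le> s' - s"
    proof (rule ccontr)
      assume "\<not> m s' - m s \<le> s' - s"
      then show False using extremal_no_crossing[OF m[OF s] m[OF s']] * that by auto
    qed
    ultimately show ?thesis by simp
  qed
  have lip: "\<bar>m s - m s'\<bar> \<le> \<bar>s - s'\<bar>" if "s \<in> {S / 2..S}" "s' \<in> {S / 2..S}" for s s'
    using nested[of s s'] nested[of s' s] that by (cases "s \<le> s'") (auto simp: abs_minus_commute)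
  have cont: "continuous_on {S / 2..S} m"
    unfolding continuous_on_iff
  proof (intro ballI allI impI)
    fix s eps assume "s \<in> {S / 2..S}" "(0::real) < eps"
    then show "\<exists>d>0. \<forall>s'\<in>{S / 2..S}. dist s' s < d \<longrightarrow> dist (m s') (m s) < eps"
      using lip by (intro exI[of _ eps]) (force simp: dist_real_def)
  qed
  have "m s = 0" if s: "S / 2 \<le> s" "s \<le> S" for s
  proof -
    have "m s = m S"
    proof (rule zero_deriv_off_countable_imp_eq[OF s(2), where D = "{}"])
      show "continuous_on {s..S} m" by (rule continuous_on_subset[OF cont]) (use s in auto)
      fix t assume t: "s < t" "t < S"
      then have t': "S / 2 \<le> t" "t \<le> S" "t < pi / 2" "0 < t" using s S by auto
      have len: "m t + t - (m t - t) < pi" using t' by simp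
      have "isCont m t" using continuous_on_interior[OF cont, of t] t s by simp
      then have "isCont (\<lambda>t. m t + t) t" by (intro continuous_intros)
      moreover have "(K has_real_derivative - (C * sin t)) (at (m t + t))"
        using extremal_K_deriv(2)[OF m[OF t'(1,2)] len] by simp
      moreover have "- (C * sin t) \<noteq> 0" using C_pos sin_gt_zero[of t] t' by auto
      moreover have "((\<lambda>t. K (m t + t)) has_real_derivative - (C * sin t)) (at t)"
      proof -
        have "((\<lambda>t. C * cos t) has_real_derivative - (C * sin t)) (at t)" by (auto intro!: derivative_eq_intros)
        then show ?thesis
        proof (rule has_field_derivative_transform_within_open[where S = "{s<..<S}"])
          fix r assume r: "r \<in> {s<..<S}"
          then have r': "S / 2 \<le> r" "r \<le> S" "m r + r - (m r - r) < pi" using s S by auto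
          show "C * cos r = K (m r + r)" using extremal_K(2)[OF m[OF r'(1,2)] r'(3)] by simp
        qed (use t in auto)
      qed
      ultimately have "((\<lambda>t. m t + t) has_real_derivative - (C * sin t) / - (C * sin t)) (at t)"
        by (intro DERIV_of_composite[where f = K])
      moreover have "- (C * sin t) / - (C * sin t) = 1"
        using \<open>- (C * sin t) \<noteq> 0\<close> by (rule divide_self)
      ultimately have "((\<lambda>t. m t + t) has_real_derivative 1) (at t)" by (simp only:)
      from DERIV_diff[OF this DERIV_ident] show "(m has_real_derivative 0) (at t)" by simp
    qed simp
    then show ?thesis using mS by simp
  qed
  then have e: "extremal (- s) s" if "S / 2 \<le> s" "s \<le> S" for s using m[OF that] that by simp
  show ?thesis unfolding cosine_tails_def
  proof (intro ballI)
    fix t assume t: "t \<in> {S / 2..pi / 2}"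
    show "K t = C * cos t \<and> K (- t) = C * cos t"
    proof (cases "t \<le> S \<and> t < pi / 2")
      case True
      then show ?thesis using extremal_K[OF e[of t]] t by auto
    next
      case False
      then have "S \<le> t" using t S by auto
      then show ?thesis using tails t unfolding cosine_tails_def by auto
    qed
  qed
qed

lemma cosine_tails_0:
  assumes "0 < t" "t \<le> pi / 2"
  shows "K t = C * cos t" "K (- t) = C * cos t" "cosine_tails t"
proof -
  have "cosine_tails (pi / 2 / 2 ^ n)" for n
  proof (induction n)
    case 0
    then show ?case by (auto simp: cosine_tails_def)
  next
    case (Suc n)
    have "pi / 2 / 2 ^ n \<le> pi / 2 / 1" by (intro divide_left_mono) auto
    with tails_half[OF Suc] show ?case by (simp add: mult_ac)
  qed
  moreover obtain n where "pi / 2 / t < 2 ^ n" using real_arch_pow[of 2 "pi / 2 / t"] by auto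
  then have "pi / 2 / 2 ^ n \<le> t" using assms by (simp add: field_simps)
  ultimately show "K t = C * cos t" "K (- t) = C * cos t" "cosine_tails t"
    using assms unfolding cosine_tails_def by (meson atLeastAtMost_iff order_trans)+
qed

text \<open>The differential equation for \<open>K = C cos\<close> determines \<open>psi\<close> up to the constant of integration
  in \<open>W\<close>: \<open>psi t = tan t + c / cos t\<close> for a constant \<open>c\<close>, which the tangent bound forces to
  vanish.\<close>

lemma psi_eq_tan:
  assumes "- (pi / 2) < x" "x < pi / 2"
  shows "psi x = tan x"
proof -
  define E where "E = 3 * (W (pi / 2) - C)"
  define c where "c = E / (2 * C)"
  have psi_pm: "psi t = tan t + c / cos t" "psi (- t) = - tan t + c / cos t" if t: "0 < t" "t < pi / 2" for t
  proof -
    have cs: "cos t > 0" using t by (intro cos_gt_zero) auto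
    have e: "extremal (- t) t" by (rule tails_extremal[OF cosine_tails_0(3)]) (use t in auto)
    have len: "t - - t < pi" using t by simp
    note We = W_tails[OF cosine_tails_0(3)[of t] _ order_refl]
    have "(K has_real_derivative 2 * psi t * K t - lam * W t) (at t)"
      by (rule K_deriv) (use extremal_psi[OF e len] t in auto)
    moreover have "(K has_real_derivative - (C * sin t)) (at t)" using extremal_K_deriv[OF e len] by simp
    ultimately have "2 * psi t * K t - lam * W t = - (C * sin t)" by (rule DERIV_unique)
    then have "2 * psi t * (C * cos t) = 2 * C * sin t + E"
      using cosine_tails_0[of t] We t lam_eq by (simp add: E_def algebra_simps)
    then show "psi t = tan t + c / cos t" using cs C_pos by (simp add: c_def tan_def field_simps)
    have "(K has_real_derivative 2 * psi (- t) * K (- t) - lam * W (- t)) (at (- t))"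
      by (rule K_deriv) (use extremal_psi[OF e len] t in auto)
    moreover have "(K has_real_derivative C * sin t) (at (- t))" using extremal_K_deriv[OF e len] by simp
    ultimately have "2 * psi (- t) * K (- t) - lam * W (- t) = C * sin t" by (rule DERIV_unique)
    then have "2 * psi (- t) * (C * cos t) = - (2 * C * sin t) + E"
      using cosine_tails_0[of t] We t lam_eq by (simp add: E_def algebra_simps)
    then show "psi (- t) = - tan t + c / cos t" using cs C_pos by (simp add: c_def tan_def field_simps)
  qed
  \<comment> \<open>With the point \<open>- pi / 4\<close> fixed, the tangent bound is attained at \<open>pi / 4\<close>, so the slack is stationary
    there; its derivative is a multiple of \<open>c\<close>.\<close>
  have "c = 0"
  proof -
    define f where "f y = tan y + c / cos y - psi (- (pi / 4)) - 2 * tan ((y + pi / 4) / 2)" for y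
    have "(f has_real_derivative c * sin (pi / 4) / (cos (pi / 4))\<^sup>2) (at (pi / 4))"
      unfolding f_def
      by (auto intro!: derivative_eq_intros simp: cos_45 sin_45 field_simps power2_eq_square)
    moreover have "0 < pi / 8" by simp
    moreover have "\<forall>y. \<bar>pi / 4 - y\<bar> < pi / 8 \<longrightarrow> f (pi / 4) \<le> f y"
    proof (intro allI impI)
      fix y assume "\<bar>pi / 4 - y\<bar> < pi / 8"
      then have y: "0 < y" "y < pi / 2" by (simp_all only: abs_less_iff) linarith+
      have "2 * tan ((y - - (pi / 4)) / 2) \<le> psi y - psi (- (pi / 4))" using y by (intro psi_tan) auto
      then have "0 \<le> f y" using psi_pm(1)[OF y] by (simp add: f_def)
      moreover have "f (pi / 4) = 0" using psi_pm[of "pi / 4"] by (simp add: f_def tan_45)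
      ultimately show "f (pi / 4) \<le> f y" by simp
    qed
    ultimately have "c * sin (pi / 4) / (cos (pi / 4))\<^sup>2 = 0" by (rule DERIV_local_min)
    then show ?thesis by (simp add: cos_45 sin_45)
  qed
  consider "x = 0" | "0 < x" | "0 < - x" by linarith
  then show ?thesis
  proof cases
    case 1
    have "((\<lambda>t::real. tan t) \<longlongrightarrow> tan 0) (at_right 0)" by (intro tendsto_intros) auto
    then have lim: "((\<lambda>t::real. tan t) \<longlongrightarrow> 0) (at_right 0)" by simp
    have ev: "\<forall>\<^sub>F t in at_right 0. (0::real) < t \<and> t < pi / 2"
      using eventually_at_right_real[of 0 "pi / 2"] by (auto elim!: eventually_mono)
    have "psi 0 \<le> 0"
    proof (rule tendsto_lowerbound[OF lim])
      show "\<forall>\<^sub>F t in at_right 0. psi 0 \<le> tan t" using ev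
      proof eventually_elim
        case (elim t)
        then have "psi 0 \<le> psi t" by (intro psi_mono) auto
        then show ?case using psi_pm(1)[of t] elim \<open>c = 0\<close> by simp
      qed
    qed simp
    moreover have "- psi 0 \<le> 0"
    proof (rule tendsto_lowerbound[OF lim])
      show "\<forall>\<^sub>F t in at_right 0. - psi 0 \<le> tan t" using ev
      proof eventually_elim
        case (elim t)
        then have "psi (- t) \<le> psi 0" by (intro psi_mono) auto
        then show ?case using psi_pm(2)[of t] elim \<open>c = 0\<close> by simp
      qed
    qed simp
    ultimately show ?thesis using 1 by simp
  next
    case 2
    then show ?thesis using psi_pm(1)[of x] assms \<open>c = 0\<close> by simp
  next
    case 3
    then show ?thesis using psi_pm(2)[of "- x"] assms \<open>c = 0\<close> by simp
  qed
qed

end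

theorem two_point_rigidity:
  assumes "two_point a b lam psi u w k"
  shows "a = - (pi / 2)" "b = pi / 2" "lam = 3" "\<And>x. - (pi / 2) < x \<Longrightarrow> x < pi / 2 \<Longrightarrow> psi x = tan x"
proof -
  interpret two_point a b lam psi u w k by fact
  show ab: "a = - (pi / 2)" "b = pi / 2" by (rule a_eq, rule b_eq)
  interpret p: two_point_pi lam psi u w k
    using assms unfolding ab two_point_pi_def .
  show "lam = 3" by (rule p.lam_eq)
  show "\<And>x. - (pi / 2) < x \<Longrightarrow> x < pi / 2 \<Longrightarrow> psi x = tan x" by (rule p.psi_eq_tan)
qed

section \<open>Square integrable functions and integration by parts\<close>

lemma integrable_mult_L2:
  fixes f g :: "'a \<Rightarrow> real"
  assumes [measurable]: "f \<in> borel_measurable M" "g \<in> borel_measurable M"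
    and "integrable M (\<lambda>x. (f x)\<^sup>2)" "integrable M (\<lambda>x. (g x)\<^sup>2)"
  shows "integrable M (\<lambda>x. f x * g x)"
proof (rule Bochner_Integration.integrable_bound)
  show "integrable M (\<lambda>x. (f x)\<^sup>2 + (g x)\<^sup>2)" using assms by simp
  show "AE x in M. norm (f x * g x) \<le> norm ((f x)\<^sup>2 + (g x)\<^sup>2)"
  proof (rule AE_I2)
    fix x
    have "2 * (\<bar>f x\<bar> * \<bar>g x\<bar>) \<le> (f x)\<^sup>2 + (g x)\<^sup>2"
      using sum_squares_bound[of "\<bar>f x\<bar>" "\<bar>g x\<bar>"] by simp
    moreover have "0 \<le> \<bar>f x\<bar> * \<bar>g x\<bar>" by simp
    ultimately have "\<bar>f x\<bar> * \<bar>g x\<bar> \<le> (f x)\<^sup>2 + (g x)\<^sup>2" by linarith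
    then show "norm (f x * g x) \<le> norm ((f x)\<^sup>2 + (g x)\<^sup>2)" by (simp add: abs_mult)
  qed
qed simp

lemma
  fixes f :: "real \<Rightarrow> real"
  assumes [measurable]: "f \<in> borel_measurable borel" and int: "integrable lborel (\<lambda>x. (f x)\<^sup>2)"
  shows set_integrable_Icc_L2: "set_integrable lborel {x..y} f"
    and Icc_integral_square_le: "x \<le> y \<Longrightarrow> (LBINT t:{x..y}. f t)\<^sup>2 \<le> (y - x) * (LINT t|lborel. (f t)\<^sup>2)"
proof -
  have ind: "integrable lborel (indicator {x..y} :: real \<Rightarrow> real)"
    by (simp add: integrable_indicator_iff emeasure_lborel_Icc_eq)
  then have ind2: "integrable lborel (\<lambda>t. (indicator {x..y} t :: real)\<^sup>2)"
  proof -
    have "(\<lambda>t. (indicator {x..y} t :: real)\<^sup>2) = indicator {x..y}" by (rule ext) (simp add: indicator_def)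
    then show ?thesis using ind by simp
  qed
  have "integrable lborel (\<lambda>t. indicator {x..y} t * f t)"
    by (rule integrable_mult_L2[OF _ _ ind2 int]) auto
  then show si: "set_integrable lborel {x..y} f" by (simp add: set_integrable_def)
  assume "x \<le> y"
  show "(LBINT t:{x..y}. f t)\<^sup>2 \<le> (y - x) * (LINT t|lborel. (f t)\<^sup>2)"
  proof (cases "x = y")
    case True
    have "(LBINT t:{x..y}. f t) = integral {x..y} f" by (rule set_borel_integral_eq_integral(2)[OF si])
    then show ?thesis using True by simp
  next
    case False
    define A where "A = (LBINT t:{x..y}. f t)"
    define m where "m = A / (y - x)"
    have L: "y - x > 0" using False \<open>x \<le> y\<close> by simp
    have i1: "integrable lborel (\<lambda>t. 2 * m * (indicator {x..y} t * f t))"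
      using si by (simp add: set_integrable_def)
    have i2: "integrable lborel (\<lambda>t. m\<^sup>2 * indicator {x..y} t)" using ind by simp
    have "0 \<le> (LINT t|lborel. (f t - m * indicator {x..y} t)\<^sup>2)" by simp
    also have "(\<lambda>t. (f t - m * indicator {x..y} t)\<^sup>2) =
        (\<lambda>t. (f t)\<^sup>2 - 2 * m * (indicator {x..y} t * f t) + m\<^sup>2 * indicator {x..y} t)"
      by (rule ext) (simp add: indicator_def power2_eq_square algebra_simps)
    also have "(LINT t|lborel. (f t)\<^sup>2 - 2 * m * (indicator {x..y} t * f t) + m\<^sup>2 * indicator {x..y} t)
       = (LINT t|lborel. (f t)\<^sup>2) - 2 * m * A + m\<^sup>2 * (y - x)"
      using int i1 i2 \<open>x \<le> y\<close> by (simp add: A_def set_lebesgue_integral_def)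
    also have "\<dots> = (LINT t|lborel. (f t)\<^sup>2) - A\<^sup>2 / (y - x)"
    proof -
      have "- 2 * (A / d) * A + (A / d)\<^sup>2 * d = - (A\<^sup>2 / d)" if "d > 0" for d
        using that by (simp add: field_simps power2_eq_square)
      from this[OF L] show ?thesis by (simp add: m_def)
    qed
    finally show ?thesis using L by (simp add: A_def field_simps)
  qed
qed

text \<open>Integration by parts for indefinite Lebesgue integrals: Fubini's theorem on the two triangles
  into which the diagonal divides a square.\<close>

lemma indefinite_integral_by_parts:
  fixes f f' h h' :: "real \<Rightarrow> real"
  assumes pq: "p \<le> q"
    and f': "set_integrable lborel {p..q} f'" and h': "set_integrable lborel {p..q} h'"
    and f: "\<And>x. p \<le> x \<Longrightarrow> x \<le> q \<Longrightarrow> f x = f p + (LBINT t:{p..x}. f' t)"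
    and h: "\<And>x. p \<le> x \<Longrightarrow> x \<le> q \<Longrightarrow> h x = h p + (LBINT t:{p..x}. h' t)"
  shows "(LBINT x:{p..q}. f' x * h x) + (LBINT x:{p..q}. f x * h' x) = f q * h q - f p * h p"
proof -
  define F where "F x = indicator {p..q} x * f' x" for x
  define H where "H x = indicator {p..q} x * h' x" for x
  have F: "integrable lborel F" and H: "integrable lborel H"
    using f' h' by (auto simp: F_def[abs_def] H_def[abs_def] set_integrable_def)
  have [measurable]: "F \<in> borel_measurable borel" "H \<in> borel_measurable borel"
    using borel_measurable_integrable[OF F] borel_measurable_integrable[OF H] by auto
  have hx: "h x = h p + (LINT t|lborel. (if t \<le> x then H t else 0))" if "p \<le> x" "x \<le> q" for x
    unfolding h[OF that] set_lebesgue_integral_def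
    by (intro arg_cong2[where f = "(+)"] Bochner_Integration.integral_cong refl)
       (use that in \<open>auto simp: H_def indicator_def\<close>)
  have fx: "f x = f p + (LINT t|lborel. (if t < x then F t else 0))" if "p \<le> x" "x \<le> q" for x
  proof -
    have "(LBINT t:{p..x}. f' t) = (LINT t|lborel. (if t < x then F t else 0))"
      unfolding set_lebesgue_integral_def
    proof (rule integral_cong_AE)
      have "AE t in lborel. t \<noteq> x" by (rule AE_lborel_singleton)
      then show "AE t in lborel. indicator {p..x} t *\<^sub>R f' t = (if t < x then F t else 0)"
        by eventually_elim (use that in \<open>auto simp: F_def indicator_def\<close>)
      have "set_integrable lborel {p..x} f'" using that by (intro set_integrable_subset[OF f']) auto
      then show "(\<lambda>t. indicator {p..x} t *\<^sub>R f' t) \<in> borel_measurable lborel"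
        unfolding set_integrable_def by (rule borel_measurable_integrable)
    qed simp
    then show ?thesis using f[OF that] by simp
  qed
  have FH: "integrable (lborel \<Otimes>\<^sub>M lborel) (\<lambda>(x, t). F x * H t)"
  proof (rule lborel_pair.Fubini_integrable)
    show "integrable lborel (\<lambda>x. LINT t|lborel. norm (case (x, t) of (x, t) \<Rightarrow> F x * H t))"
      using F H by (simp add: abs_mult)
    show "AE x in lborel. integrable lborel (\<lambda>t. case (x, t) of (x, t) \<Rightarrow> F x * H t)"
      using H by simp
  qed simp
  have k1: "integrable (lborel \<Otimes>\<^sub>M lborel) (\<lambda>(x, t). (if t \<le> x then F x * H t else 0))"
    by (rule Bochner_Integration.integrable_bound[OF FH]) auto
  have k2: "integrable (lborel \<Otimes>\<^sub>M lborel) (\<lambda>(x, t). (if x < t then F x * H t else 0))"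
    by (rule Bochner_Integration.integrable_bound[OF FH]) auto
  have e1: "F x * (h x - h p) = (LINT t|lborel. (if t \<le> x then F x * H t else 0))" for x
  proof (cases "p \<le> x \<and> x \<le> q")
    case True
    have "(LINT t|lborel. (if t \<le> x then F x * H t else 0)) = (LINT t|lborel. F x * (if t \<le> x then H t else 0))"
      by (intro Bochner_Integration.integral_cong) auto
    then show ?thesis using hx[of x] True by simp
  qed (auto simp: F_def cong: if_cong)
  have e2: "H t * (f t - f p) = (LINT x|lborel. (if x < t then F x * H t else 0))" for t
  proof (cases "p \<le> t \<and> t \<le> q")
    case True
    have "(LINT x|lborel. (if x < t then F x * H t else 0)) = (LINT x|lborel. H t * (if x < t then F x else 0))"
      by (intro Bochner_Integration.integral_cong) auto
    then show ?thesis using fx[of t] True by simp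
  qed (auto simp: H_def cong: if_cong)
  have i1: "integrable lborel (\<lambda>x. F x * (h x - h p))"
    unfolding e1 by (rule lborel_pair.integrable_fst[OF k1])
  have i2: "integrable lborel (\<lambda>t. H t * (f t - f p))"
    unfolding e2 by (rule lborel_pair.integrable_snd[OF k2])
  have "(LINT x|lborel. F x * (h x - h p)) + (LINT t|lborel. H t * (f t - f p))
      = integral\<^sup>L (lborel \<Otimes>\<^sub>M lborel) (\<lambda>(x, t). (if t \<le> x then F x * H t else 0))
       + integral\<^sup>L (lborel \<Otimes>\<^sub>M lborel) (\<lambda>(x, t). (if x < t then F x * H t else 0))"
    unfolding e1 e2 lborel_pair.integral_fst[OF k1] lborel_pair.integral_snd[OF k2] ..
  also have "\<dots> = integral\<^sup>L (lborel \<Otimes>\<^sub>M lborel) (\<lambda>z. (case z of (x, t) \<Rightarrow> if t \<le> x then F x * H t else 0)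
       + (case z of (x, t) \<Rightarrow> if x < t then F x * H t else 0))"
    by (rule Bochner_Integration.integral_add[OF k1 k2, symmetric])
  also have "\<dots> = integral\<^sup>L (lborel \<Otimes>\<^sub>M lborel) (\<lambda>(x, t). F x * H t)"
    by (intro Bochner_Integration.integral_cong) auto
  also have "\<dots> = (LINT x|lborel. (LINT t|lborel. F x * H t))"
    by (rule lborel_pair.integral_fst[OF FH, symmetric])
  also have "\<dots> = (LINT x|lborel. F x) * (LINT t|lborel. H t)" by simp
  finally have main: "(LINT x|lborel. F x * (h x - h p)) + (LINT t|lborel. H t * (f t - f p))
      = (LINT x|lborel. F x) * (LINT t|lborel. H t)" .
  have FI: "(LINT x|lborel. F x) = f q - f p" "(LINT x|lborel. H x) = h q - h p"
    using f[OF pq order_refl] h[OF pq order_refl]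
    by (simp_all add: F_def[abs_def] H_def[abs_def] set_lebesgue_integral_def)
  have j1: "integrable lborel (\<lambda>x. F x * h x)"
    using Bochner_Integration.integrable_add[OF i1 integrable_mult_left[OF F, of "h p"]] by (simp add: algebra_simps)
  have j2: "integrable lborel (\<lambda>x. H x * f x)"
    using Bochner_Integration.integrable_add[OF i2 integrable_mult_left[OF H, of "f p"]] by (simp add: algebra_simps)
  have I1: "(LINT x|lborel. F x * (h x - h p)) = (LINT x|lborel. F x * h x) - h p * (f q - f p)"
    using j1 F FI by (simp add: right_diff_distrib) (simp add: algebra_simps)
  have I2: "(LINT x|lborel. H x * (f x - f p)) = (LINT x|lborel. H x * f x) - f p * (h q - h p)"
    using j2 H FI by (simp add: right_diff_distrib) (simp add: algebra_simps)
  have "(LBINT x:{p..q}. f' x * h x) = (LINT x|lborel. F x * h x)"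
    "(LBINT x:{p..q}. f x * h' x) = (LINT x|lborel. H x * f x)"
    unfolding set_lebesgue_integral_def F_def H_def
    by (intro Bochner_Integration.integral_cong; simp)+
  then show "(LBINT x:{p..q}. f' x * h x) + (LBINT x:{p..q}. f x * h' x) = f q * h q - f p * h p"
    using main unfolding I1 I2 FI by (simp add: algebra_simps)
qed

section \<open>The quadratic form as the square of a first-order operator\<close>

text \<open>Monotonicity is local to \<open>(a, b)\<close>, whereas \<open>psi\<close> is defined and measurable on the whole
  line: integrals over the interval are integrals over the line of functions that vanish outside.\<close>

locale monotone_function =
  fixes a b :: real and psi :: "real \<Rightarrow> real"
  assumes ab: "a < b"
    and psi_mono: "\<And>x y. a < x \<Longrightarrow> x \<le> y \<Longrightarrow> y < b \<Longrightarrow> psi x \<le> psi y"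
    and psi_measurable [measurable]: "psi \<in> borel_measurable borel"
begin

lemma countable_discont: "countable {x \<in> {a<..<b}. \<not> isCont psi x}"
  by (rule mono_on_ctble_discont_open) (auto simp: mono_on_def intro: psi_mono)

lemma ex_continuity_point:
  assumes "a \<le> x" "x < y" "y \<le> b"
  shows "\<exists>z. x < z \<and> z < y \<and> isCont psi z"
proof (rule ccontr)
  assume "\<not> ?thesis"
  then have "{x<..<y} \<subseteq> {x \<in> {a<..<b}. \<not> isCont psi x}" using assms by auto
  then have "countable {x<..<y}" using countable_discont countable_subset by blast
  then show False using assms uncountable_open_interval by blast
qed

lemma psi_integrable:
  assumes "a < p" "q < b"
  shows "psi integrable_on {p..q}"
  by (rule integrable_on_mono_on) (use assms in \<open>auto simp: mono_on_def intro!: psi_mono\<close>)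

definition Psi :: "real \<Rightarrow> real" where
  "Psi x = integral {(a + b) / 2..x} psi - integral {x..(a + b) / 2} psi"

lemma Psi_diff:
  assumes "a < x" "x \<le> y" "y < b"
  shows "Psi y - Psi x = integral {x..y} psi"
proof -
  define c where "c = (a + b) / 2"
  have c: "a < c" "c < b" using ab by (auto simp: c_def)
  have comb: "integral {p..q} psi + integral {q..r} psi = integral {p..r} psi"
    if "a < p" "p \<le> q" "q \<le> r" "r < b" for p q r
    using that psi_integrable by (intro Henstock_Kurzweil_Integration.integral_combine) auto
  have sub: "integral {q..p} psi = 0" if "p \<le> q" for p q
    using that by (cases "p = q") auto
  consider "y \<le> c" | "c \<le> x" | "x \<le> c" "c \<le> y" by linarith
  then show ?thesis
  proof cases
    case 1
    then show ?thesis using comb[of x y c] sub[of x c] sub[of y c] assms c by (simp add: Psi_def c_def[symmetric])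
  next
    case 2
    then show ?thesis using comb[of c x y] sub[of c x] sub[of c y] assms c by (simp add: Psi_def c_def[symmetric])
  next
    case 3
    then show ?thesis using comb[of x c y] sub[of x c] sub[of c y] assms c by (simp add: Psi_def c_def[symmetric])
  qed
qed

lemma Psi_local:
  assumes "a < p" "p < x" "x < q" "q < b"
  shows "continuous (at x) Psi" and "isCont psi x \<Longrightarrow> (Psi has_real_derivative psi x) (at x)"
proof -
  have eq: "Psi p + integral {p..z} psi = Psi z" if "z \<in> {p<..<q}" for z
    using Psi_diff[of p z] that assms by auto
  have int: "psi integrable_on {p..q}" using assms by (intro psi_integrable) auto
  have "continuous_on {p..q} (\<lambda>z. integral {p..z} psi)"
    by (rule indefinite_integral_continuous_1[OF int])
  then have "continuous_on {p<..<q} (\<lambda>z. Psi p + integral {p..z} psi)"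
    by (intro continuous_intros) (rule continuous_on_subset, auto)
  then have "continuous_on {p<..<q} Psi" by (rule continuous_on_eq) (rule eq)
  then show "continuous (at x) Psi" using assms by (simp add: continuous_on_eq_continuous_at)
  assume "isCont psi x"
  have "((\<lambda>z. integral {p..z} psi) has_vector_derivative psi x) (at x within {p..q} - {})"
    using assms \<open>isCont psi x\<close>
    by (intro integral_has_vector_derivative_continuous_at[OF int])
       (auto intro: continuous_at_imp_continuous_at_within)
  then have "((\<lambda>z. integral {p..z} psi) has_real_derivative psi x) (at x)"
    using assms by (simp add: has_real_derivative_iff_has_vector_derivative at_within_Icc_at)
  then have "((\<lambda>z. Psi p + integral {p..z} psi) has_real_derivative psi x) (at x)"
    by (auto intro!: derivative_eq_intros)
  then show "(Psi has_real_derivative psi x) (at x)"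
    by (rule has_field_derivative_transform_within_open[where S = "{p<..<q}"]) (use assms eq in auto)
qed

definition u :: "real \<Rightarrow> real" where "u x = exp (- Psi x)"

lemma u_pos: "0 < u x" by (simp add: u_def)

lemma isCont_u:
  assumes "a < x" "x < b"
  shows "isCont u x"
  unfolding u_def
  by (intro continuous_intros Psi_local(1)[of "(a + x) / 2" x "(x + b) / 2"]) (use assms in auto)

lemma u_cont: "continuous_on {a<..<b} u"
  by (intro continuous_at_imp_continuous_on) (auto intro: isCont_u)

lemma u_deriv:
  assumes "a < x" "x < b" "isCont psi x"
  shows "(u has_real_derivative - psi x * u x) (at x)"
proof -
  have "(Psi has_real_derivative psi x) (at x)"
    by (rule Psi_local(2)[of "(a + x) / 2" x "(x + b) / 2"]) (use assms in auto)
  then show ?thesis unfolding u_def[abs_def] by (auto intro!: derivative_eq_intros)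
qed

text \<open>\<open>Psi\<close> is convex, so it lies above one of its supporting lines.\<close>

lemma u_bounded: "\<exists>B>0. \<forall>x. a < x \<longrightarrow> x < b \<longrightarrow> u x \<le> B"
proof -
  define c where "c = (a + b) / 2"
  have c: "a < c" "c < b" using ab by (auto simp: c_def)
  have "Psi x - Psi c \<ge> - (\<bar>psi c\<bar> * (b - a))" if x: "a < x" "x < b" for x
  proof (cases "c \<le> x")
    case True
    have "(x - c) * psi c = integral {c..x} (\<lambda>_. psi c)" using True by simp
    also have "\<dots> \<le> integral {c..x} psi"
      using c x True by (intro integral_le psi_integrable) (auto intro: psi_mono)
    finally have "(x - c) * psi c \<le> Psi x - Psi c" using Psi_diff[of c x] c x True by simp
    moreover have "\<bar>(x - c) * psi c\<bar> \<le> (b - a) * \<bar>psi c\<bar>"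
      unfolding abs_mult using c x True by (intro mult_right_mono) auto
    ultimately show ?thesis by (simp add: mult.commute)
  next
    case False
    have "integral {x..c} psi \<le> integral {x..c} (\<lambda>_. psi c)"
      using c x False by (intro integral_le psi_integrable) (auto intro: psi_mono)
    also have "\<dots> = (c - x) * psi c" using False by simp
    finally have "Psi c - Psi x \<le> (c - x) * psi c" using Psi_diff[of x c] c x False by simp
    moreover have "\<bar>(c - x) * psi c\<bar> \<le> (b - a) * \<bar>psi c\<bar>"
      unfolding abs_mult using c x False by (intro mult_right_mono) auto
    ultimately show ?thesis by (simp add: mult.commute)
  qed
  then have "\<forall>x. a < x \<longrightarrow> x < b \<longrightarrow> u x \<le> exp (- Psi c + \<bar>psi c\<bar> * (b - a))"
    unfolding u_def by (fastforce simp: algebra_simps)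
  then show ?thesis by (intro exI[of _ "exp (- Psi c + \<bar>psi c\<bar> * (b - a))"]) auto
qed

text \<open>The form domain consists of functions in \<open>H\<^sup>1\<close> that vanish outside \<open>(a, b)\<close>, with \<open>psi v\<close>
  square integrable. That \<open>v\<close> is square integrable with respect to the derivative of \<open>psi\<close>, too,
  is a consequence.\<close>

definition form_domain :: "(real \<Rightarrow> real) \<Rightarrow> (real \<Rightarrow> real) \<Rightarrow> bool" where
  "form_domain v g \<longleftrightarrow> g \<in> borel_measurable borel \<and> integrable lborel (\<lambda>x. (g x)\<^sup>2) \<and>
     (\<forall>x. x \<notin> {a<..<b} \<longrightarrow> g x = 0 \<and> v x = 0) \<and>
     (\<forall>x y. x \<le> y \<longrightarrow> v y - v x = (LBINT t:{x..y}. g t)) \<and>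
     integrable lborel (\<lambda>x. (psi x * v x)\<^sup>2)"

definition energy :: "(real \<Rightarrow> real) \<Rightarrow> (real \<Rightarrow> real) \<Rightarrow> real" where
  "energy v g = (LINT x|lborel. (g x - psi x * v x)\<^sup>2)"

definition mass :: "(real \<Rightarrow> real) \<Rightarrow> real" where
  "mass v = (LINT x|lborel. (v x)\<^sup>2)"

context
  fixes v g :: "real \<Rightarrow> real"
  assumes dom: "form_domain v g"
begin

lemma dom_g: "g \<in> borel_measurable borel"
  and dom_g2: "integrable lborel (\<lambda>x. (g x)\<^sup>2)"
  and dom_out: "x \<notin> {a<..<b} \<Longrightarrow> g x = 0" "x \<notin> {a<..<b} \<Longrightarrow> v x = 0"
  and dom_diff: "x \<le> y \<Longrightarrow> v y - v x = (LBINT t:{x..y}. g t)"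
  and dom_psi: "integrable lborel (\<lambda>x. (psi x * v x)\<^sup>2)"
  using dom unfolding form_domain_def by blast+

lemma dom_holder: "(v y - v x)\<^sup>2 \<le> \<bar>y - x\<bar> * (LINT t|lborel. (g t)\<^sup>2)"
proof (cases "x \<le> y")
  case True
  then show ?thesis using Icc_integral_square_le[OF dom_g dom_g2 True] dom_diff[OF True] by simp
next
  case False
  then have "y \<le> x" by simp
  have "(v y - v x)\<^sup>2 = (v x - v y)\<^sup>2" by (rule power2_commute)
  also have "\<dots> \<le> (x - y) * (LINT t|lborel. (g t)\<^sup>2)"
    using Icc_integral_square_le[OF dom_g dom_g2 \<open>y \<le> x\<close>] dom_diff[OF \<open>y \<le> x\<close>] by simp
  also have "x - y = \<bar>y - x\<bar>" using \<open>y \<le> x\<close> by simp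
  finally show ?thesis .
qed

lemma dom_bounded: "(v x)\<^sup>2 \<le> (b - a) * (LINT t|lborel. (g t)\<^sup>2)"
proof (cases "x \<in> {a<..<b}")
  case True
  have "(v x)\<^sup>2 \<le> \<bar>x - a\<bar> * (LINT t|lborel. (g t)\<^sup>2)" using dom_holder[of x a] dom_out(2)[of a] by simp
  also have "\<dots> \<le> (b - a) * (LINT t|lborel. (g t)\<^sup>2)" using True by (intro mult_right_mono) auto
  finally show ?thesis .
qed (use ab dom_out in auto)

lemma dom_isCont: "isCont v x"
proof -
  have "((\<lambda>y. \<bar>y - x\<bar> * (LINT t|lborel. (g t)\<^sup>2)) \<longlongrightarrow> \<bar>x - x\<bar> * (LINT t|lborel. (g t)\<^sup>2)) (at x)"
    by (intro tendsto_intros)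
  then have lim: "((\<lambda>y. \<bar>y - x\<bar> * (LINT t|lborel. (g t)\<^sup>2)) \<longlongrightarrow> 0) (at x)" by simp
  have "((\<lambda>y. (v y - v x)\<^sup>2) \<longlongrightarrow> 0) (at x)"
    by (rule tendsto_sandwich[OF _ _ tendsto_const lim]) (simp_all add: dom_holder)
  then have "((\<lambda>y. sqrt ((v y - v x)\<^sup>2)) \<longlongrightarrow> sqrt 0) (at x)" by (rule tendsto_real_sqrt)
  then have "((\<lambda>y. v y - v x) \<longlongrightarrow> 0) (at x)" by (simp add: tendsto_rabs_zero_iff)
  then show ?thesis by (simp add: isCont_def LIM_zero_iff)
qed

lemma dom_v: "v \<in> borel_measurable borel"
  by (intro borel_measurable_continuous_onI continuous_at_imp_continuous_on) (simp add: dom_isCont)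

lemma dom_v2: "integrable lborel (\<lambda>x. (v x)\<^sup>2)"
  supply dom_v [measurable]
proof (rule Bochner_Integration.integrable_bound)
  show "integrable lborel (\<lambda>x. indicator {a..b} x *\<^sub>R ((b - a) * (LINT t|lborel. (g t)\<^sup>2)))"
    by (rule integrable_scaleR_left, rule integrable_real_indicator) (use ab in \<open>simp_all add: emeasure_lborel_Icc_eq\<close>)
  show "AE x in lborel. norm ((v x)\<^sup>2) \<le> norm (indicator {a..b} x *\<^sub>R ((b - a) * (LINT t|lborel. (g t)\<^sup>2)))"
  proof (rule AE_I2)
    fix x
    show "norm ((v x)\<^sup>2) \<le> norm (indicator {a..b} x *\<^sub>R ((b - a) * (LINT t|lborel. (g t)\<^sup>2)))"
      using dom_bounded[of x] dom_out(2)[of x] by (auto simp: indicator_def abs_mult)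
  qed
qed simp

lemma dom_g_integrable: "set_integrable lborel {x..y} g"
  by (rule set_integrable_Icc_L2[OF dom_g dom_g2])

lemma dom_vg: "integrable lborel (\<lambda>x. v x * g x)"
  by (rule integrable_mult_L2[OF _ _ dom_v2 dom_g2]) (simp_all add: dom_v dom_g)

lemma dom_psi_vg: "integrable lborel (\<lambda>x. psi x * v x * g x)"
  supply dom_v [measurable] dom_g [measurable]
  by (rule integrable_mult_L2[OF _ _ dom_psi dom_g2]) simp_all

lemma dom_square_diff:
  assumes "x \<le> y"
  shows "(v y)\<^sup>2 - (v x)\<^sup>2 = (LBINT t:{x..y}. 2 * (v t * g t))"
proof -
  have eq: "v z = v x + (LBINT t:{x..z}. g t)" if "x \<le> z" for z using dom_diff[OF that] by simp
  have "(LBINT t:{x..y}. g t * v t) + (LBINT t:{x..y}. v t * g t) = v y * v y - v x * v x"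
    by (rule indefinite_integral_by_parts[OF assms dom_g_integrable dom_g_integrable eq eq])
  moreover have "set_integrable lborel {x..y} (\<lambda>t. v t * g t)"
    unfolding set_integrable_def using dom_vg by (rule integrable_mult_indicator[rotated]) simp
  ultimately show ?thesis by (simp add: mult.commute power2_eq_square)
qed

lemma energy_expand:
  "energy v g = (LINT x|lborel. (g x)\<^sup>2) + (LINT x|lborel. (psi x * v x)\<^sup>2) - 2 * (LINT x|lborel. psi x * v x * g x)"
proof -
  have "energy v g = (LINT x|lborel. (g x)\<^sup>2 + (psi x * v x)\<^sup>2 - 2 * (psi x * v x * g x))"
    unfolding energy_def by (intro Bochner_Integration.integral_cong) (auto simp: power2_eq_square algebra_simps)
  then show ?thesis using dom_g2 dom_psi dom_psi_vg by simp
qed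

end

end

text \<open>\<open>M\<close> is the derivative of \<open>psi\<close> as a Stieltjes measure. Intervals with end points at jumps of
  \<open>psi\<close> are left out, because there the mass depends on the one-sided limits.\<close>

locale stieltjes_derivative = monotone_function +
  fixes M :: "real measure"
  assumes sets_M [measurable_cong]: "sets M = sets borel"
    and M_Ioc: "\<And>s t. a < s \<Longrightarrow> s < t \<Longrightarrow> t < b \<Longrightarrow> isCont psi s \<Longrightarrow> isCont psi t \<Longrightarrow>
       emeasure M {s<..t} = ennreal (psi t - psi s)"
    and M_out: "emeasure M (- {a<..<b}) = 0"
begin

lemma space_M [simp]: "space M = UNIV"
  using sets_eq_imp_space_eq[OF sets_M] by simp

text \<open>Continuity points of \<open>psi\<close> approach both ends, and \<open>M\<close> is finite between any two of them.\<close>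

lemma sigma_finite_M: "sigma_finite_measure M"
proof -
  define d where "d n = (b - a) / 2 * inverse (real (Suc n))" for n :: nat
  have d: "0 < d n" "d n \<le> (b - a) / 2" for n
  proof -
    have "(b - a) / 2 * inverse (real (Suc n)) \<le> (b - a) / 2 * 1"
      using ab by (intro mult_left_mono) (auto intro: inverse_le_1_iff[THEN iffD2])
    then show "0 < d n" "d n \<le> (b - a) / 2" using ab by (simp_all add: d_def)
  qed
  have d0: "d \<longlonglongrightarrow> 0" unfolding d_def[abs_def]
    by (intro tendsto_mult_right_zero LIMSEQ_inverse_real_of_nat)
  have "\<exists>s. a < s \<and> s < a + d n \<and> isCont psi s" for n
    using ex_continuity_point[of a "a + d n"] d[of n] ab by auto
  then obtain s where s: "\<And>n. a < s n" "\<And>n. s n < a + d n" "\<And>n. isCont psi (s n)" by metis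
  have "\<exists>t. b - d n < t \<and> t < b \<and> isCont psi t" for n
    using ex_continuity_point[of "b - d n" b] d[of n] ab by auto
  then obtain t where t: "\<And>n. b - d n < t n" "\<And>n. t n < b" "\<And>n. isCont psi (t n)" by metis
  have st: "s n < t n" for n using s(2)[of n] t(1)[of n] d(2)[of n] by (simp add: field_simps)
  let ?A = "insert (- {a<..<b}) (range (\<lambda>n. {s n<..t n}))"
  have "x \<in> \<Union>?A" for x
  proof (cases "a < x \<and> x < b")
    case True
    from d0 have "\<forall>\<^sub>F n in sequentially. d n < min (x - a) (b - x)" by (rule order_tendstoD) (use True in auto)
    then obtain n where "d n < min (x - a) (b - x)" by (auto simp: eventually_sequentially)
    then have "x \<in> {s n<..t n}" using s(2)[of n] t(1)[of n] by auto
    then show ?thesis by blast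
  qed auto
  then have "\<Union>?A = UNIV" by blast
  moreover have "emeasure M A \<noteq> \<infinity>" if "A \<in> ?A" for A
    using that M_out M_Ioc[OF s(1) st t(2) s(3) t(3)] by auto
  moreover have "countable ?A" "?A \<subseteq> sets M" by (auto simp: sets_M)
  ultimately show ?thesis by (intro sigma_finite_measure.intro exI[of _ ?A]) auto
qed

text \<open>Fubini's theorem for \<open>v\<^sup>2 (x) = \<integral> 2 v g\<close>, where the indefinite integral starts at the end of
  the interval that lies on the same side of a fixed point as \<open>x\<close>.\<close>

lemma
  assumes dom: "form_domain v g"
  shows square_integrable_M: "integrable M (\<lambda>x. (v x)\<^sup>2)"
    and square_integral_M: "(LINT x|M. (v x)\<^sup>2) = - 2 * (LINT x|lborel. psi x * v x * g x)"
proof -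
  note [measurable] = dom_g[OF dom] dom_v[OF dom]
  obtain c where c: "a < c" "c < b" "isCont psi c" using ex_continuity_point[of a b] ab by auto
  define G where "G t = 2 * (v t * g t)" for t
  have [measurable]: "G \<in> borel_measurable borel" unfolding G_def[abs_def] by measurable
  have sq: "(LBINT t:{x..y}. G t) = (v y)\<^sup>2 - (v x)\<^sup>2" if "x \<le> y" for x y
    using dom_square_diff[OF dom that] unfolding G_def by (rule sym)
  have G_int: "integrable lborel G" unfolding G_def[abs_def] using dom_vg[OF dom] by simp
  have Gpsi: "integrable lborel (\<lambda>t. G t * psi t)"
    using integrable_mult_right[OF dom_psi_vg[OF dom], of 2] by (simp add: G_def mult_ac)
  have G_out: "G t = 0" if "t \<notin> {a<..<b}" for t using dom_out[OF dom that] by (simp add: G_def)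
  define k where "k t x = G t * (if t < x \<and> x \<le> c then 1 else if c < x \<and> x \<le> t then - 1 else 0)" for t x
  interpret M: sigma_finite_measure M by (rule sigma_finite_M)
  interpret P: pair_sigma_finite lborel M ..
  have k_meas [measurable]: "case_prod k \<in> borel_measurable (lborel \<Otimes>\<^sub>M M)"
    unfolding k_def[abs_def] by measurable
  have inner: "integrable M (k t) \<and> (LINT x|M. k t x) = G t * (psi c - psi t) \<and>
      (LINT x|M. norm (k t x)) = \<bar>G t * (psi c - psi t)\<bar>"
    if t: "t \<notin> {x \<in> {a<..<b}. \<not> isCont psi x}" "t \<noteq> c" for t
  proof (cases "t \<in> {a<..<b}")
    case False
    then show ?thesis using G_out by (simp add: k_def[abs_def])
  next
    case True
    then have ct: "isCont psi t" using t by blast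
    show ?thesis
    proof (cases "t < c")
      case True
      have e: "emeasure M {t<..c} = ennreal (psi c - psi t)"
        using True \<open>t \<in> {a<..<b}\<close> c ct by (intro M_Ioc) auto
      have pp: "psi t \<le> psi c" using True \<open>t \<in> {a<..<b}\<close> c by (intro psi_mono) auto
      have "k t = (\<lambda>x. G t * indicator {t<..c} x)"
        using True by (auto simp: k_def fun_eq_iff indicator_def)
      then show ?thesis using e pp
        by (simp add: integrable_indicator_iff sets_M measure_def abs_mult)
    next
      case False
      then have "c < t" using t by simp
      have e: "emeasure M {c<..t} = ennreal (psi t - psi c)"
        using \<open>c < t\<close> \<open>t \<in> {a<..<b}\<close> c ct by (intro M_Ioc) auto
      have pp: "psi c \<le> psi t" using \<open>c < t\<close> \<open>t \<in> {a<..<b}\<close> c by (intro psi_mono) auto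
      have "k t = (\<lambda>x. - G t * indicator {c<..t} x)"
        using \<open>c < t\<close> by (auto simp: k_def fun_eq_iff indicator_def)
      moreover have "\<bar>G t * (psi c - psi t)\<bar> = \<bar>G t\<bar> * (psi t - psi c)" "G t * (psi c - psi t) = - G t * (psi t - psi c)"
        unfolding abs_mult using pp by (simp, simp add: algebra_simps)
      ultimately show ?thesis using e pp
        by (simp only:) (simp add: integrable_indicator_iff sets_M measure_def abs_mult)
    qed
  qed
  have [measurable]: "(\<lambda>t. LINT x|M. norm (k t x)) \<in> borel_measurable lborel"
    "(\<lambda>t. LINT x|M. k t x) \<in> borel_measurable lborel"
    by (rule M.borel_measurable_lebesgue_integral, measurable)+
  have AE_t: "AE t in lborel. t \<notin> {x \<in> {a<..<b}. \<not> isCont psi x} \<and> t \<noteq> c"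
    using AE_not_in[OF countable_imp_null_set_lborel[OF countable_discont]] AE_lborel_singleton[of c]
    by eventually_elim blast
  have GI: "integrable lborel (\<lambda>t. G t * (psi c - psi t))"
    using G_int Gpsi by (simp add: right_diff_distrib)
  have kI: "integrable (lborel \<Otimes>\<^sub>M M) (case_prod k)"
  proof (rule P.Fubini_integrable)
    have "integrable lborel (\<lambda>t. LINT x|M. norm (k t x)) \<longleftrightarrow> integrable lborel (\<lambda>t. \<bar>G t * (psi c - psi t)\<bar>)"
    proof (rule integrable_cong_AE)
      show "AE t in lborel. (LINT x|M. norm (k t x)) = \<bar>G t * (psi c - psi t)\<bar>"
        using AE_t by eventually_elim (use inner in auto)
    qed measurable
    then show "integrable lborel (\<lambda>t. LINT x|M. norm (case (t, x) of (t, x) \<Rightarrow> k t x))"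
      using integrable_abs[OF GI] by simp
    show "AE t in lborel. integrable M (\<lambda>x. case (t, x) of (t, x) \<Rightarrow> k t x)"
      using AE_t by eventually_elim (use inner in auto)
  qed measurable
  have v2: "(LINT t|lborel. k t x) = (v x)\<^sup>2" if x: "x \<in> {a<..<b}" for x
  proof (cases "x \<le> c")
    case True
    have m1: "(\<lambda>t. k t x) \<in> borel_measurable lborel" unfolding k_def by measurable
    have m2: "(\<lambda>t. indicator {a..x} t *\<^sub>R G t) \<in> borel_measurable lborel"
      using integrable_mult_indicator[OF _ G_int, of "{a..x}"] by (intro borel_measurable_integrable) simp
    have "(LINT t|lborel. k t x) = (LINT t|lborel. indicator {a..x} t *\<^sub>R G t)"
    proof (rule integral_cong_AE)
      show "AE t in lborel. k t x = indicator {a..x} t *\<^sub>R G t"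
        using AE_lborel_singleton[of x]
        by eventually_elim (use True x G_out in \<open>auto simp: k_def indicator_def\<close>)
    qed (fact m1 m2)+
    also have "\<dots> = (v x)\<^sup>2 - (v a)\<^sup>2"
      using sq[of a x] x by (simp add: set_lebesgue_integral_def)
    finally show ?thesis using dom_out[OF dom, of a] by simp
  next
    case False
    have "(LINT t|lborel. k t x) = (LINT t|lborel. - (indicator {x..b} t *\<^sub>R G t))"
      by (intro Bochner_Integration.integral_cong) (use False x G_out in \<open>auto simp: k_def indicator_def\<close>)
    also have "\<dots> = - ((v b)\<^sup>2 - (v x)\<^sup>2)"
      using sq[of x b] x by (simp add: set_lebesgue_integral_def)
    finally show ?thesis using dom_out[OF dom, of b] by simp
  qed
  have AE_x: "AE x in M. (LINT t|lborel. k t x) = (v x)\<^sup>2"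
  proof (rule AE_I[where N = "- {a<..<b}"])
    show "{x \<in> space M. (LINT t|lborel. k t x) \<noteq> (v x)\<^sup>2} \<subseteq> - {a<..<b}" using v2 by auto
  qed (auto simp: M_out sets_M)
  have meas: "(\<lambda>x. LINT t|lborel. k t x) \<in> borel_measurable M"
    using P.integrable_snd[OF kI] by (rule borel_measurable_integrable)
  have "(\<lambda>x. (v x)\<^sup>2) \<in> borel_measurable M" by measurable
  then show "integrable M (\<lambda>x. (v x)\<^sup>2)"
    using P.integrable_snd[OF kI] integrable_cong_AE[OF meas _ AE_x] by blast
  have "(LINT x|M. (v x)\<^sup>2) = (LINT x|M. (LINT t|lborel. k t x))"
    using AE_x by (intro integral_cong_AE[symmetric] meas) measurable
  also have "\<dots> = (LINT t|lborel. (LINT x|M. k t x))"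
    unfolding P.integral_snd[OF kI] P.integral_fst[OF kI] by simp
  also have "\<dots> = (LINT t|lborel. G t * (psi c - psi t))"
  proof (rule integral_cong_AE)
    show "AE t in lborel. (LINT x|M. k t x) = G t * (psi c - psi t)"
      using AE_t by eventually_elim (use inner in auto)
  qed measurable
  also have "\<dots> = psi c * (LINT t|lborel. G t) - (LINT t|lborel. G t * psi t)"
    using G_int Gpsi by (simp add: right_diff_distrib mult.commute)
  also have "(LINT t|lborel. G t) = (LBINT t:{a..b}. G t)"
    unfolding set_lebesgue_integral_def
  proof (intro Bochner_Integration.integral_cong refl)
    fix t show "G t = indicator {a..b} t *\<^sub>R G t"
      using G_out[of t] by (cases "t \<in> {a<..<b}") auto
  qed
  also have "\<dots> = 0"
    using sq[of a b] ab dom_out[OF dom, of a] dom_out[OF dom, of b] by simp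
  also have "(\<lambda>t. G t * psi t) = (\<lambda>t. 2 * (psi t * v t * g t))" by (auto simp: G_def)
  finally show "(LINT x|M. (v x)\<^sup>2) = - 2 * (LINT x|lborel. psi x * v x * g x)" by simp
qed

text \<open>The mixed term of the square is the integral of \<open>v\<^sup>2\<close> against the derivative of \<open>psi\<close>.\<close>

lemma energy_eq:
  assumes "form_domain v g"
  shows "energy v g = (LINT x|lborel. (g x)\<^sup>2) + (LINT x|lborel. (psi x * v x)\<^sup>2) + (LINT x|M. (v x)\<^sup>2)"
  unfolding energy_expand[OF assms] square_integral_M[OF assms] by simp

lemma energy_ge:
  assumes "form_domain v g"
  shows "(LINT x|lborel. (g x)\<^sup>2) \<le> energy v g"
  unfolding energy_eq[OF assms] by (simp add: add_nonneg_nonneg)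

end

section \<open>The first eigenvalue of the quadratic form\<close>

text \<open>The Cauchy-Schwarz inequality for a nonnegative quadratic form, on the line through two
  vectors.\<close>

lemma nonneg_quadratic_discriminant:
  fixes e B c :: real
  assumes "c \<ge> 0" and q: "\<And>t. 0 \<le> e + 2 * t * B + t\<^sup>2 * c"
  shows "B\<^sup>2 \<le> e * c"
proof (cases "c = 0")
  case True
  have "B = 0"
  proof (rule ccontr)
    assume "B \<noteq> 0"
    then have "e + 2 * (- (e + 1) / (2 * B)) * B = - 1" by (simp add: field_simps)
    with q[of "- (e + 1) / (2 * B)"] True show False by simp
  qed
  then show ?thesis using True by simp
next
  case False
  then have c: "c > 0" using assms by simp
  have "e + 2 * (- B / c) * B + (- B / c)\<^sup>2 * c = e - B\<^sup>2 / c"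
    using c by (simp add: field_simps power2_eq_square)
  with q[of "- B / c"] have "B\<^sup>2 / c \<le> e" by simp
  then show ?thesis using c by (simp add: field_simps)
qed

lemma integrable_bounded_support:
  fixes f :: "real \<Rightarrow> real"
  assumes [measurable]: "f \<in> borel_measurable borel"
    and B: "\<And>x. x \<in> {c..d} \<Longrightarrow> \<bar>f x\<bar> \<le> B" and out: "\<And>x. x \<notin> {c..d} \<Longrightarrow> f x = 0"
  shows "integrable lborel f"
proof (rule Bochner_Integration.integrable_bound)
  have "emeasure lborel {c..d} < \<infinity>" by (simp add: emeasure_lborel_Icc_eq)
  then show "integrable lborel (\<lambda>x. indicator {c..d} x *\<^sub>R B)"
    by (intro integrable_scaleR_left integrable_real_indicator) auto
  show "AE x in lborel. norm (f x) \<le> norm (indicator {c..d} x *\<^sub>R B)"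
  proof (rule AE_I2)
    fix x show "norm (f x) \<le> norm (indicator {c..d} x *\<^sub>R B)"
      using B[of x] out[of x] by (cases "x \<in> {c..d}") auto
  qed
qed simp

lemma continuous_on_Icc_bounded:
  fixes f :: "real \<Rightarrow> real"
  assumes "continuous_on {c..d} f"
  shows "\<exists>B\<ge>0. \<forall>x\<in>{c..d}. \<bar>f x\<bar> \<le> B"
proof -
  have "bounded (f ` {c..d})" by (intro compact_imp_bounded compact_continuous_image assms) simp
  then obtain B where "\<forall>x\<in>{c..d}. \<bar>f x\<bar> \<le> B" by (auto simp: bounded_iff)
  then show ?thesis by (intro exI[of _ "max 0 B"]) (auto simp: max_def intro: order_trans)
qed

text \<open>The fundamental theorem of calculus for functions such as \<open>1 / u\<close>, whose derivative is
  bounded but exists only where \<open>psi\<close> is continuous.\<close>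

lemma lborel_integral_Icc_off_countable:
  fixes f f' :: "real \<Rightarrow> real"
  assumes [measurable]: "f' \<in> borel_measurable borel"
    and B: "\<And>x. x \<in> {c..d} \<Longrightarrow> \<bar>f' x\<bar> \<le> B"
    and f: "continuous_on {c..d} f" and "countable D"
    and deriv: "\<And>x. c < x \<Longrightarrow> x < d \<Longrightarrow> x \<notin> D \<Longrightarrow> (f has_real_derivative f' x) (at x) \<and> isCont f' x"
    and x: "c \<le> x" "x \<le> d"
  shows "f x = f c + (LBINT t:{c..x}. f' t)"
proof -
  have int: "integrable lborel (\<lambda>t. indicator {c..d} t *\<^sub>R f' t)"
    by (rule integrable_bounded_support[where c = c and d = d and B = B]) (use B in auto)
  then have si: "set_integrable lborel {c..d} f'" by (simp add: set_integrable_def)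
  have hk: "f' integrable_on {c..d}" by (rule set_borel_integral_eq_integral(1)[OF si])
  have "f c - integral {c..c} f' = f x - integral {c..x} f'"
  proof (rule zero_deriv_off_countable_imp_eq[OF x(1) _ \<open>countable D\<close>, where f = "\<lambda>z. f z - integral {c..z} f'"])
    show "continuous_on {c..x} (\<lambda>z. f z - integral {c..z} f')"
      by (intro continuous_intros continuous_on_subset[OF f]
          continuous_on_subset[OF indefinite_integral_continuous_1[OF hk]]) (use x in auto)
    fix z assume z: "c < z" "z < x" "z \<notin> D"
    then have d: "(f has_real_derivative f' z) (at z)" "isCont f' z" using deriv x by auto
    have "((\<lambda>z. integral {c..z} f') has_vector_derivative f' z) (at z within {c..d} - {})"
      using z x d(2) by (intro integral_has_vector_derivative_continuous_at[OF hk])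
        (auto intro: continuous_at_imp_continuous_at_within)
    then have "((\<lambda>z. integral {c..z} f') has_real_derivative f' z) (at z)"
      using z x by (simp add: has_real_derivative_iff_has_vector_derivative at_within_Icc_at)
    from DERIV_diff[OF d(1) this] show "((\<lambda>z. f z - integral {c..z} f') has_real_derivative 0) (at z)" by simp
  qed
  moreover have "set_integrable lborel {c..x} f'" using x by (intro set_integrable_subset[OF si]) auto
  then have "(LBINT t:{c..x}. f' t) = integral {c..x} f'" by (rule set_borel_integral_eq_integral(2))
  ultimately show ?thesis by simp
qed

lemma ex_antiderivative_Ioo:
  fixes f :: "real \<Rightarrow> real"
  assumes f: "continuous_on {a<..<b} f"
  shows "\<exists>F. \<forall>x\<in>{a<..<b}. (F has_real_derivative f x) (at x)"
proof (cases "a < b")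
  case True
  define m where "m = (a + b) / 2"
  have m: "a < m" "m < b" using True by (auto simp: m_def)
  define F where "F x = integral {m..x} f - integral {x..m} f" for x
  have int: "f integrable_on {p..q}" if "a < p" "q < b" for p q
    using that by (intro integrable_continuous_real continuous_on_subset[OF f]) auto
  have "(F has_real_derivative f x) (at x)" if x: "a < x" "x < b" for x
  proof -
    define p q where "p = (a + min x m) / 2" and "q = (b + max x m) / 2"
    have pq: "a < p" "p < x" "p < m" "x < q" "m < q" "q < b"
      using x m by (auto simp: p_def q_def min_def max_def)
    have "((\<lambda>z. integral {p..z} f) has_real_derivative f x) (at x within {p..q})"
      using pq by (intro integral_has_real_derivative continuous_on_subset[OF f]) auto
    then have "((\<lambda>z. integral {p..z} f - integral {p..m} f) has_real_derivative f x) (at x)"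
      using pq by (auto intro!: derivative_eq_intros simp: at_within_Icc_at)
    then show ?thesis
    proof (rule has_field_derivative_transform_within_open[where S = "{p<..<q}"])
      fix z assume z: "z \<in> {p<..<q}"
      show "integral {p..z} f - integral {p..m} f = F z"
      proof (cases "m \<le> z")
        case True
        have "integral {p..m} f + integral {m..z} f = integral {p..z} f"
          using True z pq by (intro Henstock_Kurzweil_Integration.integral_combine int) auto
        moreover have "integral {z..m} f = 0" using True by (cases "z = m") auto
        ultimately show ?thesis by (simp add: F_def)
      next
        case False
        have "integral {p..z} f + integral {z..m} f = integral {p..m} f"
          using False z pq by (intro Henstock_Kurzweil_Integration.integral_combine int) auto
        then show ?thesis using False by (simp add: F_def)
      qed
    qed (use pq in auto)
  qed
  then show ?thesis by (intro exI[of _ F]) auto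
qed auto

lemma integral_by_parts_zero:
  fixes F F' G G' :: "real \<Rightarrow> real"
  assumes "c \<le> d" and cont: "continuous_on {c..d} F" "continuous_on {c..d} F'" "continuous_on {c..d} G" "continuous_on {c..d} G'"
    and D: "\<And>x. c < x \<Longrightarrow> x < d \<Longrightarrow> (F has_real_derivative F' x) (at x)"
      "\<And>x. c < x \<Longrightarrow> x < d \<Longrightarrow> (G has_real_derivative G' x) (at x)"
    and "G c = 0" "G d = 0"
  shows "integral {c..d} (\<lambda>x. F' x * G x) = - integral {c..d} (\<lambda>x. F x * G' x)"
proof -
  have "((\<lambda>x. F' x * G x + F x * G' x) has_integral (F d * G d - F c * G c)) {c..d}"
  proof (rule fundamental_theorem_of_calculus_interior[OF \<open>c \<le> d\<close>])
    show "continuous_on {c..d} (\<lambda>x. F x * G x)" by (intro continuous_intros cont)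
    fix x assume "x \<in> {c<..<d}"
    then have "((\<lambda>x. F x * G x) has_real_derivative F' x * G x + F x * G' x) (at x)"
      using DERIV_mult[OF D(1)[of x] D(2)[of x]] by (simp add: mult.commute add.commute)
    then show "((\<lambda>x. F x * G x) has_vector_derivative F' x * G x + F x * G' x) (at x)"
      by (simp add: has_real_derivative_iff_has_vector_derivative)
  qed
  then have "integral {c..d} (\<lambda>x. F' x * G x + F x * G' x) = 0" using assms by (simp add: integral_unique)
  moreover have "integral {c..d} (\<lambda>x. F' x * G x + F x * G' x)
      = integral {c..d} (\<lambda>x. F' x * G x) + integral {c..d} (\<lambda>x. F x * G' x)"
    by (intro integral_add integrable_continuous_real continuous_intros cont)
  ultimately show ?thesis by simp
qed

text \<open>The lemma of du Bois-Reymond with two constraints: the difference of \<open>f\<close> and its orthogonal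
  projection onto the span of \<open>1\<close> and \<open>S\<close> is itself an admissible test function.\<close>

lemma du_bois_reymond_two:
  fixes f S :: "real \<Rightarrow> real"
  assumes cd: "c < d" and f: "continuous_on {c..d} f" and S: "continuous_on {c..d} S"
    and ne: "S c \<noteq> S d"
    and orth: "\<And>tau. continuous_on {c..d} tau \<Longrightarrow> integral {c..d} tau = 0 \<Longrightarrow>
        integral {c..d} (\<lambda>x. S x * tau x) = 0 \<Longrightarrow> integral {c..d} (\<lambda>x. f x * tau x) = 0"
  shows "\<exists>al be. \<forall>x\<in>{c..d}. f x = al + be * S x"
proof -
  note int = integrable_continuous_real
  define n where "n = d - c"
  have n: "n > 0" using cd by (simp add: n_def)
  define Sm where "Sm = integral {c..d} S / n"
  define S0 where "S0 x = S x - Sm" for x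
  have S0: "continuous_on {c..d} S0" unfolding S0_def by (intro continuous_intros S)
  have iS0: "integral {c..d} S0 = 0"
    unfolding S0_def using n by (simp add: integral_diff int S Sm_def n_def)
  have S0pos: "integral {c..d} (\<lambda>x. S0 x * S0 x) \<noteq> 0"
  proof
    assume "integral {c..d} (\<lambda>x. S0 x * S0 x) = 0"
    then have "\<forall>x\<in>{c..d}. S0 x * S0 x = 0"
      using cd S0 by (subst (asm) integral_eq_0_iff) (auto intro!: continuous_intros)
    then have "S0 c = 0" "S0 d = 0" using cd by auto
    then show False using ne by (simp add: S0_def)
  qed
  define al where "al = integral {c..d} f / n"
  define be where "be = integral {c..d} (\<lambda>x. f x * S0 x) / integral {c..d} (\<lambda>x. S0 x * S0 x)"
  define tau where "tau x = f x - al - be * S0 x" for x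
  have tau: "continuous_on {c..d} tau" unfolding tau_def by (intro continuous_intros f S0)
  have t1: "integral {c..d} tau = 0"
    unfolding tau_def using n by (simp add: integral_diff int f S0 iS0 continuous_intros al_def n_def)
  have "integral {c..d} (\<lambda>x. tau x * S0 x)
      = integral {c..d} (\<lambda>x. f x * S0 x - al * S0 x - be * (S0 x * S0 x))"
    by (intro Henstock_Kurzweil_Integration.integral_cong) (simp add: tau_def algebra_simps)
  also have "\<dots> = integral {c..d} (\<lambda>x. f x * S0 x) - al * integral {c..d} S0 - be * integral {c..d} (\<lambda>x. S0 x * S0 x)"
    by (simp add: integral_diff int f S0 continuous_intros)
  also have "\<dots> = 0" using S0pos iS0 by (simp add: be_def)
  finally have t2: "integral {c..d} (\<lambda>x. tau x * S0 x) = 0" .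
  have "integral {c..d} (\<lambda>x. S x * tau x) = integral {c..d} (\<lambda>x. tau x * S0 x + Sm * tau x)"
    by (intro Henstock_Kurzweil_Integration.integral_cong) (simp add: S0_def algebra_simps)
  also have "\<dots> = 0" by (simp add: integral_add int tau S0 continuous_intros t1 t2)
  finally have "integral {c..d} (\<lambda>x. f x * tau x) = 0" by (rule orth[OF tau t1])
  moreover have "integral {c..d} (\<lambda>x. tau x * tau x)
      = integral {c..d} (\<lambda>x. f x * tau x - al * tau x - be * (tau x * S0 x))"
    by (intro Henstock_Kurzweil_Integration.integral_cong) (simp add: tau_def algebra_simps)
  then have "integral {c..d} (\<lambda>x. tau x * tau x) = integral {c..d} (\<lambda>x. f x * tau x) - al * integral {c..d} tau
      - be * integral {c..d} (\<lambda>x. tau x * S0 x)"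
    by (simp add: integral_diff int f S0 tau continuous_intros)
  ultimately have "integral {c..d} (\<lambda>x. tau x * tau x) = 0" using t1 t2 by simp
  then have "\<forall>x\<in>{c..d}. tau x * tau x = 0"
    using cd tau by (subst (asm) integral_eq_0_iff) (auto intro!: continuous_intros)
  then have "\<forall>x\<in>{c..d}. tau x = 0" by simp
  then have "\<forall>x\<in>{c..d}. f x = (al - be * Sm) + be * S x" by (auto simp: tau_def S0_def algebra_simps)
  then show ?thesis by blast
qed

lemma nodal_interval:
  fixes v :: "real \<Rightarrow> real"
  assumes v: "continuous_on {a..b} v" and "v a = 0" "v b = 0" and x0: "a < x0" "x0 < b" "v x0 > 0"
  shows "\<exists>p q. a \<le> p \<and> p < q \<and> q \<le> b \<and> v p = 0 \<and> v q = 0 \<and> (\<forall>x. p < x \<longrightarrow> x < q \<longrightarrow> 0 < v x)"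
proof -
  define A where "A = {x \<in> {a..x0}. v x = 0}"
  define B where "B = {x \<in> {x0..b}. v x = 0}"
  have clA: "closed A" unfolding A_def
    by (rule continuous_closed_preimage_constant[OF continuous_on_subset[OF v]]) (use x0 in auto)
  have clB: "closed B" unfolding B_def
    by (rule continuous_closed_preimage_constant[OF continuous_on_subset[OF v]]) (use x0 in auto)
  have ne: "a \<in> A" "b \<in> B" using assms by (auto simp: A_def B_def)
  have bdd: "bdd_above A" "bdd_below B" by (auto simp: A_def B_def)
  define p q where "p = Sup A" and "q = Inf B"
  have p: "p \<in> A" unfolding p_def by (rule closed_contains_Sup[OF _ bdd(1) clA]) (use ne in auto)
  have q: "q \<in> B" unfolding q_def by (rule closed_contains_Inf[OF _ bdd(2) clB]) (use ne in auto)
  have pos: "0 < v x" if x: "p < x" "x < q" for x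
  proof (rule ccontr)
    assume neg: "\<not> 0 < v x"
    show False
    proof (cases "x \<le> x0")
      case True
      have "\<exists>z\<ge>x. z \<le> x0 \<and> v z = 0"
        using neg x0 True p x by (intro IVT') (auto intro!: continuous_on_subset[OF v] simp: A_def)
      then obtain z where "x \<le> z" "z \<in> A" using p x by (auto simp: A_def)
      then have "x \<le> p" unfolding p_def using cSup_upper[OF _ bdd(1)] by (meson order_trans)
      with x show False by simp
    next
      case False
      have "\<exists>z\<ge>x0. z \<le> x \<and> v z = 0"
        using neg x0 False q x by (intro IVT2') (auto intro!: continuous_on_subset[OF v] simp: B_def)
      then obtain z where "z \<le> x" "z \<in> B" using q x by (auto simp: B_def)
      then have "q \<le> x" unfolding q_def using cInf_lower[OF _ bdd(2)] by (meson order_trans)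
      with x show False by simp
    qed
  qed
  have "p \<noteq> x0" "q \<noteq> x0" using p q x0 by (auto simp: A_def B_def)
  then have "p < q" using p q by (auto simp: A_def B_def)
  then show ?thesis using p q pos by (intro exI[of _ p] exI[of _ q]) (auto simp: A_def B_def)
qed

context stieltjes_derivative begin

lemma form_domain_lincomb:
  assumes 1: "form_domain v g" and 2: "form_domain e h"
  shows "form_domain (\<lambda>x. v x + t * e x) (\<lambda>x. g x + t * h x)"
proof -
  note [measurable] = dom_g[OF 1] dom_g[OF 2] dom_v[OF 1] dom_v[OF 2]
  have "integrable lborel (\<lambda>x. (g x)\<^sup>2 + 2 * t * (g x * h x) + t\<^sup>2 * (h x)\<^sup>2)"
    using dom_g2[OF 1] dom_g2[OF 2] integrable_mult_L2[OF _ _ dom_g2[OF 1] dom_g2[OF 2]] by simp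
  then have g2: "integrable lborel (\<lambda>x. (g x + t * h x)\<^sup>2)"
    by (rule back_subst[where P = "integrable lborel"]) (auto simp: fun_eq_iff power2_eq_square algebra_simps)
  have "integrable lborel (\<lambda>x. (psi x * v x)\<^sup>2 + 2 * t * ((psi x * v x) * (psi x * e x)) + t\<^sup>2 * (psi x * e x)\<^sup>2)"
    using dom_psi[OF 1] dom_psi[OF 2] integrable_mult_L2[OF _ _ dom_psi[OF 1] dom_psi[OF 2]] by simp
  then have p2: "integrable lborel (\<lambda>x. (psi x * (v x + t * e x))\<^sup>2)"
    by (rule back_subst[where P = "integrable lborel"]) (auto simp: fun_eq_iff power2_eq_square algebra_simps)
  have "(v y + t * e y) - (v x + t * e x) = (LBINT z:{x..y}. g z + t * h z)" if "x \<le> y" for x y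
    using dom_diff[OF 1 that] dom_diff[OF 2 that] dom_g_integrable[OF 1, of x y] dom_g_integrable[OF 2, of x y]
    by (simp add: set_integral_add algebra_simps)
  then show ?thesis
    unfolding form_domain_def using g2 p2 dom_out[OF 1] dom_out[OF 2] by simp
qed

lemma form_domain_zero: "form_domain (\<lambda>_. 0) (\<lambda>_. 0)"
  by (simp add: form_domain_def set_lebesgue_integral_def)

lemma form_domain_scale: "form_domain v g \<Longrightarrow> form_domain (\<lambda>x. t * v x) (\<lambda>x. t * g x)"
  using form_domain_lincomb[OF form_domain_zero, of v g t] by simp

definition energy_form :: "(real \<Rightarrow> real) \<Rightarrow> (real \<Rightarrow> real) \<Rightarrow> (real \<Rightarrow> real) \<Rightarrow> (real \<Rightarrow> real) \<Rightarrow> real" where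
  "energy_form v g e h = (LINT x|lborel. (g x - psi x * v x) * (h x - psi x * e x))"

lemma dom_resid:
  assumes "form_domain v g"
  shows "(\<lambda>x. g x - psi x * v x) \<in> borel_measurable borel" "integrable lborel (\<lambda>x. (g x - psi x * v x)\<^sup>2)"
proof -
  note [measurable] = dom_g[OF assms] dom_v[OF assms]
  show "(\<lambda>x. g x - psi x * v x) \<in> borel_measurable borel" by measurable
  have "integrable lborel (\<lambda>x. (g x)\<^sup>2 + (psi x * v x)\<^sup>2 - 2 * (psi x * v x * g x))"
    using dom_g2[OF assms] dom_psi[OF assms] dom_psi_vg[OF assms] by simp
  then show "integrable lborel (\<lambda>x. (g x - psi x * v x)\<^sup>2)"
    by (rule back_subst[where P = "integrable lborel"]) (auto simp: fun_eq_iff power2_eq_square algebra_simps)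
qed

lemma energy_lincomb:
  assumes 1: "form_domain v g" and 2: "form_domain e h"
  shows "energy (\<lambda>x. v x + t * e x) (\<lambda>x. g x + t * h x) = energy v g + 2 * t * energy_form v g e h + t\<^sup>2 * energy e h"
    and "mass (\<lambda>x. v x + t * e x) = mass v + 2 * t * (LINT x|lborel. v x * e x) + t\<^sup>2 * mass e"
proof -
  note r = dom_resid[OF 1] dom_resid[OF 2]
  have i: "integrable lborel (\<lambda>x. (g x - psi x * v x) * (h x - psi x * e x))"
    by (rule integrable_mult_L2) (use r in simp_all)
  have "energy (\<lambda>x. v x + t * e x) (\<lambda>x. g x + t * h x)
      = (LINT x|lborel. (g x - psi x * v x)\<^sup>2 + 2 * t * ((g x - psi x * v x) * (h x - psi x * e x)) + t\<^sup>2 * (h x - psi x * e x)\<^sup>2)"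
    unfolding energy_def by (intro Bochner_Integration.integral_cong) (auto simp: power2_eq_square algebra_simps)
  then show "energy (\<lambda>x. v x + t * e x) (\<lambda>x. g x + t * h x) = energy v g + 2 * t * energy_form v g e h + t\<^sup>2 * energy e h"
    using r i by (simp add: energy_def energy_form_def)
  have j: "integrable lborel (\<lambda>x. v x * e x)"
    by (rule integrable_mult_L2) (use dom_v[OF 1] dom_v[OF 2] dom_v2[OF 1] dom_v2[OF 2] in simp_all)
  have "mass (\<lambda>x. v x + t * e x) = (LINT x|lborel. (v x)\<^sup>2 + 2 * t * (v x * e x) + t\<^sup>2 * (e x)\<^sup>2)"
    unfolding mass_def by (intro Bochner_Integration.integral_cong) (auto simp: power2_eq_square algebra_simps)
  then show "mass (\<lambda>x. v x + t * e x) = mass v + 2 * t * (LINT x|lborel. v x * e x) + t\<^sup>2 * mass e"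
    using dom_v2[OF 1] dom_v2[OF 2] j by (simp add: mass_def)
qed

lemma energy_mass_scale:
  "energy (\<lambda>x. t * v x) (\<lambda>x. t * g x) = t\<^sup>2 * energy v g" "mass (\<lambda>x. t * v x) = t\<^sup>2 * mass v"
proof -
  have "(\<lambda>x. (t * g x - psi x * (t * v x))\<^sup>2) = (\<lambda>x. t\<^sup>2 * (g x - psi x * v x)\<^sup>2)"
    by (auto simp: fun_eq_iff power2_eq_square algebra_simps)
  then show "energy (\<lambda>x. t * v x) (\<lambda>x. t * g x) = t\<^sup>2 * energy v g" by (simp add: energy_def)
  show "mass (\<lambda>x. t * v x) = t\<^sup>2 * mass v" by (simp add: mass_def power_mult_distrib)
qed

lemma energy_nonneg: "0 \<le> energy v g" by (simp add: energy_def)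
lemma mass_nonneg: "0 \<le> mass v" by (simp add: mass_def)

text \<open>A Poincare inequality, which makes the infimum \<open>lam0\<close> positive.\<close>

lemma mass_le:
  assumes "form_domain v g"
  shows "mass v \<le> (b - a)\<^sup>2 * energy v g"
proof -
  define G where "G = (LINT t|lborel. (g t)\<^sup>2)"
  have "mass v \<le> (LINT x|lborel. indicator {a..b} x *\<^sub>R ((b - a) * G))"
    unfolding mass_def
  proof (rule integral_mono)
    have "emeasure lborel {a..b} < \<infinity>" by (simp add: emeasure_lborel_Icc_eq)
    then show "integrable lborel (\<lambda>x. indicator {a..b} x *\<^sub>R ((b - a) * G))"
      by (intro integrable_scaleR_left integrable_real_indicator) auto
    fix x show "(v x)\<^sup>2 \<le> indicator {a..b} x *\<^sub>R ((b - a) * G)"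
      using dom_bounded[OF assms, of x] dom_out(2)[OF assms, of x] by (cases "x \<in> {a..b}") (auto simp: G_def)
  qed (rule dom_v2[OF assms])
  also have "\<dots> = (b - a)\<^sup>2 * G" using ab by (simp add: power2_eq_square)
  also have "\<dots> \<le> (b - a)\<^sup>2 * energy v g"
    using energy_ge[OF assms] by (intro mult_left_mono) (auto simp: G_def)
  finally show ?thesis .
qed

definition lam0 :: real where
  "lam0 = Inf {energy v g / mass v | v g. form_domain v g \<and> 0 < mass v}"

lemma lam0_le:
  assumes "form_domain v g"
  shows "lam0 * mass v \<le> energy v g"
proof (cases "mass v = 0")
  case False
  then have m: "0 < mass v" using mass_nonneg[of v] by simp
  have "lam0 \<le> energy v g / mass v" unfolding lam0_def
    by (rule cInf_lower) (use assms m energy_nonneg mass_nonneg in \<open>auto intro!: bdd_belowI[of _ 0]\<close>)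
  then show ?thesis using m by (simp add: field_simps)
qed (simp add: energy_nonneg)

end

section \<open>Existence of a minimiser\<close>

context stieltjes_derivative begin

text \<open>The Euler-Lagrange equation tested with \<open>H / u\<close>, where \<open>H' = u\<^sup>2 theta\<close> and \<open>theta' = tau\<close>.
  For these test functions \<open>(H / u)' - psi H / u = u theta\<close> is absolutely continuous, although
  \<open>psi\<close> is not, so an integration by parts removes the derivative of \<open>v\<close>.\<close>

definition weak_equation :: "(real \<Rightarrow> real) \<Rightarrow> bool" where
  "weak_equation v \<longleftrightarrow>
     (\<forall>c d tau theta H. a < c \<longrightarrow> c < d \<longrightarrow> d < b \<longrightarrow> continuous_on {c..d} tau \<longrightarrow>
        (\<forall>x\<in>{c..d}. theta x = integral {c..x} tau) \<longrightarrow> theta d = 0 \<longrightarrow>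
        (\<forall>x\<in>{c..d}. H x = integral {c..x} (\<lambda>x. (u x)\<^sup>2 * theta x)) \<longrightarrow> H d = 0 \<longrightarrow>
        integral {c..d} (\<lambda>x. v x * (u x * tau x + lam0 * (H x / u x))) = 0)"

context
  assumes nontrivial: "\<exists>v g. form_domain v g \<and> 0 < mass v"
begin

lemma lam0_pos: "0 < lam0"
proof -
  have "1 / (b - a)\<^sup>2 \<le> lam0" unfolding lam0_def
  proof (rule cInf_greatest)
    show "{energy v g / mass v | v g. form_domain v g \<and> 0 < mass v} \<noteq> {}" using nontrivial by blast
    fix r assume "r \<in> {energy v g / mass v | v g. form_domain v g \<and> 0 < mass v}"
    then obtain v g where vg: "r = energy v g / mass v" "form_domain v g" "0 < mass v" by blast
    have "mass v * (1 / (b - a)\<^sup>2) \<le> energy v g"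
      using mass_le[OF vg(2)] ab by (simp add: pos_divide_le_eq mult.commute)
    then show "1 / (b - a)\<^sup>2 \<le> r" using vg(1,3) by (simp add: pos_le_divide_eq mult.commute)
  qed
  moreover have "0 < 1 / (b - a)\<^sup>2" using ab by simp
  ultimately show ?thesis by linarith
qed

lemma minimising_sequence:
  "\<exists>v g. \<forall>n::nat. form_domain (v n) (g n) \<and> mass (v n) = 1 \<and> energy (v n) (g n) \<le> lam0 + 1 / (real n + 1)"
proof -
  have "\<exists>v g. form_domain v g \<and> mass v = 1 \<and> energy v g \<le> lam0 + 1 / (real n + 1)" for n :: nat
  proof -
    have "\<exists>r\<in>{energy v g / mass v | v g. form_domain v g \<and> 0 < mass v}. r < lam0 + 1 / (real n + 1)"
      using nontrivial unfolding lam0_def by (intro cInf_lessD) auto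
    then obtain v g where vg: "form_domain v g" "0 < mass v" "energy v g / mass v < lam0 + 1 / (real n + 1)"
      by blast
    define t where "t = 1 / sqrt (mass v)"
    have t: "t\<^sup>2 = 1 / mass v" using vg(2) by (simp add: t_def power_divide)
    show ?thesis
      by (rule exI[of _ "\<lambda>x. t * v x"], rule exI[of _ "\<lambda>x. t * g x"])
         (use vg t in \<open>simp add: form_domain_scale energy_mass_scale\<close>)
  qed
  then show ?thesis by metis
qed

text \<open>A minimising sequence is bounded in \<open>H\<^sup>1\<close>, hence equicontinuous. The first variation of the
  energy along it tends to zero by the Cauchy-Schwarz inequality for the nonnegative form
  \<open>energy - lam0 mass\<close>, and uniform convergence of the functions carries it to the limit.\<close>

lemma ex_weak_minimiser:
  "\<exists>v. continuous_on {a..b} v \<and> (\<forall>x. x \<notin> {a<..<b} \<longrightarrow> v x = 0) \<and> (\<exists>x. v x \<noteq> 0) \<and> weak_equation v"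
proof -
  obtain v g where dom: "\<And>n::nat. form_domain (v n) (g n)" and mass: "\<And>n. mass (v n) = 1"
    and en: "\<And>n. energy (v n) (g n) \<le> lam0 + 1 / (real n + 1)"
    using minimising_sequence by blast
  define L where "L = lam0 + 1"
  have L: "L > 0" using lam0_pos by (simp add: L_def)
  have "1 / (real n + 1) \<le> 1" for n by simp
  then have g2: "(LINT x|lborel. (g n x)\<^sup>2) \<le> L" for n
    using energy_ge[OF dom, of n] en[of n] unfolding L_def by (meson add_left_mono order_trans)
  have holder: "(v n y - v n x)\<^sup>2 \<le> \<bar>y - x\<bar> * L" for n x y
    using dom_holder[OF dom] mult_left_mono[OF g2, of "\<bar>y - x\<bar>" n] by (meson abs_ge_zero order_trans)
  have bound: "\<bar>v n x\<bar> \<le> sqrt ((b - a) * L)" for n x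
  proof (rule real_le_rsqrt[of "\<bar>v n x\<bar>", simplified])
    show "(v n x)\<^sup>2 \<le> (b - a) * L"
      using dom_bounded[OF dom, of n x] mult_left_mono[OF g2, of "b - a" n] ab by linarith
  qed
  obtain w0 r where w0: "continuous_on {a..b} w0" and r: "strict_mono (r :: nat \<Rightarrow> nat)"
    and unif0: "\<And>e. 0 < e \<Longrightarrow> \<exists>N. \<forall>n x. n \<ge> N \<and> x \<in> {a..b} \<longrightarrow> norm (v (r n) x - w0 x) < e"
  proof (rule Arzela_Ascoli[of "{a..b}" v "sqrt ((b - a) * L)"])
    show "norm (v n x) \<le> sqrt ((b - a) * L)" for n x using bound by simp
    fix x e :: real assume "0 < e"
    define d where "d = e\<^sup>2 / L"
    have d: "d > 0" using \<open>0 < e\<close> L by (simp add: d_def)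
    have "norm (v n x - v n y) < e" if "norm (x - y) < d" for n y
    proof -
      have "\<bar>y - x\<bar> * L < d * L" using that L by (intro mult_strict_right_mono) (auto simp: abs_minus_commute)
      then have "(v n y - v n x)\<^sup>2 < e\<^sup>2" using holder[of n y x] L by (simp add: d_def)
      then have "\<bar>v n y - v n x\<bar> < \<bar>e\<bar>" by (meson abs_le_square_iff not_le)
      then show ?thesis using \<open>0 < e\<close> by (simp add: abs_minus_commute)
    qed
    with d show "\<exists>d>0. \<forall>n y. y \<in> {a..b} \<and> norm (x - y) < d \<longrightarrow> norm (v n x - v n y) < e" by blast
  qed (auto simp: that)
  define V where "V x = (if x \<in> {a..b} then w0 x else 0)" for x
  have unif: "\<exists>N. \<forall>n\<ge>N. \<forall>x. \<bar>v (r n) x - V x\<bar> < e" if e: "0 < e" for e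
  proof -
    from unif0[OF e] obtain N where N: "\<forall>n x. n \<ge> N \<and> x \<in> {a..b} \<longrightarrow> norm (v (r n) x - w0 x) < e" by blast
    have "\<bar>v (r n) x - V x\<bar> < e" if "n \<ge> N" for n x
    proof (cases "x \<in> {a..b}")
      case False
      then show ?thesis using dom_out(2)[OF dom, of x "r n"] e by (auto simp: V_def)
    qed (use N that in \<open>auto simp: V_def\<close>)
    then show ?thesis by blast
  qed
  have V_cont: "continuous_on {a..b} V" using w0 by (rule continuous_on_eq) (simp add: V_def)
  have V_out: "V x = 0" if "x \<notin> {a<..<b}" for x
  proof (rule ccontr)
    assume "V x \<noteq> 0"
    then obtain N where "\<forall>n\<ge>N. \<forall>y. \<bar>v (r n) y - V y\<bar> < \<bar>V x\<bar>" using unif[of "\<bar>V x\<bar>"] by auto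
    then have "\<bar>v (r N) x - V x\<bar> < \<bar>V x\<bar>" by blast
    then show False using dom_out(2)[OF dom that] by simp
  qed
  have "\<exists>x. V x \<noteq> 0"
  proof (rule ccontr)
    assume "\<not> ?thesis"
    then have V0: "V x = 0" for x by simp
    define e where "e = 1 / sqrt (2 * (b - a))"
    have e: "e > 0" "e\<^sup>2 * (b - a) < 1" using ab by (auto simp: e_def power_divide)
    obtain N where "\<forall>n\<ge>N. \<forall>x. \<bar>v (r n) x - V x\<bar> < e" using unif[OF e(1)] by blast
    then have N: "\<bar>v (r N) x\<bar> < e" for x using V0 by simp
    have "mass (v (r N)) \<le> (LINT x|lborel. indicator {a..b} x *\<^sub>R e\<^sup>2)"
      unfolding mass_def
    proof (rule integral_mono)
      have "emeasure lborel {a..b} < \<infinity>" by (simp add: emeasure_lborel_Icc_eq)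
      then show "integrable lborel (\<lambda>x. indicator {a..b} x *\<^sub>R e\<^sup>2)"
        by (intro integrable_scaleR_left integrable_real_indicator) auto
      fix x show "(v (r N) x)\<^sup>2 \<le> indicator {a..b} x *\<^sub>R e\<^sup>2"
      proof (cases "x \<in> {a..b}")
        case True
        have "\<bar>v (r N) x\<bar>\<^sup>2 \<le> e\<^sup>2" using N[of x] by (intro power_mono) auto
        then show ?thesis using True by simp
      next
        case False
        then show ?thesis using dom_out(2)[OF dom, of x "r N"] by auto
      qed
    qed (rule dom_v2[OF dom])
    also have "\<dots> = e\<^sup>2 * (b - a)" using ab by simp
    finally show False using mass[of "r N"] e by simp
  qed
  moreover have weak: "integral {c..d} (\<lambda>x. V x * (u x * tau x + lam0 * (H x / u x))) = 0"
    if cd: "a < c" "c < d" "d < b" and tau: "continuous_on {c..d} tau"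
      and theta: "\<forall>x\<in>{c..d}. theta x = integral {c..x} tau" and theta_d: "theta d = 0"
      and H: "\<forall>x\<in>{c..d}. H x = integral {c..x} (\<lambda>x. (u x)\<^sup>2 * theta x)" and H_d: "H d = 0"
    for c d tau theta H
  proof -
    have uc: "continuous_on {c..d} u" by (rule continuous_on_subset[OF u_cont]) (use cd in auto)
    have theta_c: "theta c = 0" and H_c: "H c = 0" using theta H cd by auto
    have th: "continuous_on {c..d} theta"
      using indefinite_integral_continuous_1[OF integrable_continuous_real[OF tau]]
      by (rule continuous_on_eq) (use theta in auto)
    have uth: "continuous_on {c..d} (\<lambda>x. (u x)\<^sup>2 * theta x)" by (intro continuous_intros uc th)
    have Hc: "continuous_on {c..d} H"
      using indefinite_integral_continuous_1[OF integrable_continuous_real[OF uth]]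
      by (rule continuous_on_eq) (use H in auto)
    have thD: "(theta has_real_derivative tau x) (at x)" if x: "c < x" "x < d" for x
    proof -
      have "((\<lambda>z. integral {c..z} tau) has_real_derivative tau x) (at x within {c..d})"
        using x by (intro integral_has_real_derivative tau) auto
      then have "((\<lambda>z. integral {c..z} tau) has_real_derivative tau x) (at x)"
        using x by (simp add: at_within_Icc_at)
      then show ?thesis
        by (rule has_field_derivative_transform_within_open[where S = "{c<..<d}"]) (use x theta in auto)
    qed
    have HD: "(H has_real_derivative (u x)\<^sup>2 * theta x) (at x)" if x: "c < x" "x < d" for x
    proof -
      have "((\<lambda>z. integral {c..z} (\<lambda>x. (u x)\<^sup>2 * theta x)) has_real_derivative (u x)\<^sup>2 * theta x) (at x within {c..d})"
        using x by (intro integral_has_real_derivative uth) auto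
      then have "((\<lambda>z. integral {c..z} (\<lambda>x. (u x)\<^sup>2 * theta x)) has_real_derivative (u x)\<^sup>2 * theta x) (at x)"
        using x by (simp add: at_within_Icc_at)
      then show ?thesis
        by (rule has_field_derivative_transform_within_open[where S = "{c<..<d}"]) (use x H in auto)
    qed
    define D where "D = {x \<in> {a<..<b}. \<not> isCont psi x}"
    have "countable D" unfolding D_def by (rule countable_discont)
    define M0 where "M0 = \<bar>psi c\<bar> + \<bar>psi d\<bar>"
    have psi_bd: "\<bar>psi x\<bar> \<le> M0" if "x \<in> {c..d}" for x
      using psi_mono[of c x] psi_mono[of x d] that cd by (auto simp: M0_def)
    have "M0 \<ge> 0" by (simp add: M0_def)
    \<comment> \<open>The test function \<open>E = H / u\<close> has the derivative \<open>T + psi E\<close>, and \<open>T\<close> has the derivative \<open>U - psi T\<close>.\<close>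
    define E where "E x = indicator {c..d} x *\<^sub>R (H x / u x)" for x
    define T where "T x = indicator {c..d} x *\<^sub>R (u x * theta x)" for x
    define U where "U x = indicator {c..d} x *\<^sub>R (u x * tau x)" for x
    have Ec: "continuous_on {c..d} (\<lambda>x. H x / u x)" using u_pos by (intro continuous_intros uc Hc) (auto simp: less_imp_neq[symmetric])
    have Tc: "continuous_on {c..d} (\<lambda>x. u x * theta x)" by (intro continuous_intros uc th)
    have Uc: "continuous_on {c..d} (\<lambda>x. u x * tau x)" by (intro continuous_intros uc tau)
    have meas [measurable]: "E \<in> borel_measurable borel" "T \<in> borel_measurable borel" "U \<in> borel_measurable borel"
      unfolding E_def[abs_def] T_def[abs_def] U_def[abs_def]
      by (rule borel_measurable_continuous_on_indicator; use Ec Tc Uc in simp)+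
    obtain BE where BE: "BE \<ge> 0" "\<forall>x\<in>{c..d}. \<bar>H x / u x\<bar> \<le> BE" using continuous_on_Icc_bounded[OF Ec] by blast
    obtain BT where BT: "BT \<ge> 0" "\<forall>x\<in>{c..d}. \<bar>u x * theta x\<bar> \<le> BT" using continuous_on_Icc_bounded[OF Tc] by blast
    obtain BU where BU: "BU \<ge> 0" "\<forall>x\<in>{c..d}. \<bar>u x * tau x\<bar> \<le> BU" using continuous_on_Icc_bounded[OF Uc] by blast
    have E_bd: "\<bar>E x\<bar> \<le> BE" and T_bd: "\<bar>T x\<bar> \<le> BT" and U_bd: "\<bar>U x\<bar> \<le> BU" for x
      using BE BT BU by (cases "x \<in> {c..d}"; simp add: E_def T_def U_def)+
    have U_out: "U x = 0" if "x \<notin> {c..d}" for x using that by (simp add: U_def)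
    have E_out: "E x = 0" and T_out: "T x = 0" if "x \<notin> {c<..<d}" for x
      using that H_c H_d theta_c theta_d by (cases "x = c"; cases "x = d"; auto simp: E_def T_def)+
    define h where "h x = T x + psi x * E x" for x
    define q where "q x = U x - psi x * T x" for x
    have [measurable]: "h \<in> borel_measurable borel" "q \<in> borel_measurable borel"
      unfolding h_def[abs_def] q_def[abs_def] by measurable
    have psiE: "\<bar>psi x * E x\<bar> \<le> M0 * BE" for x
    proof (cases "x \<in> {c..d}")
      case True
      then show ?thesis unfolding abs_mult using psi_bd E_bd \<open>M0 \<ge> 0\<close> by (intro mult_mono) auto
    qed (use \<open>M0 \<ge> 0\<close> BE in \<open>auto simp: E_def\<close>)
    have psiT: "\<bar>psi x * T x\<bar> \<le> M0 * BT" for x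
    proof (cases "x \<in> {c..d}")
      case True
      then show ?thesis unfolding abs_mult using psi_bd T_bd \<open>M0 \<ge> 0\<close> by (intro mult_mono) auto
    qed (use \<open>M0 \<ge> 0\<close> BT in \<open>auto simp: T_def\<close>)
    have h_bd: "\<bar>h x\<bar> \<le> BT + M0 * BE" for x
      unfolding h_def using abs_triangle_ineq[of "T x" "psi x * E x"] T_bd[of x] psiE[of x] by linarith
    have q_bd: "\<bar>q x\<bar> \<le> BU + M0 * BT" for x
      unfolding q_def using abs_triangle_ineq4[of "U x" "psi x * T x"] U_bd[of x] psiT[of x] by linarith
    have h_out: "h x = 0" if "x \<notin> {c<..<d}" for x using E_out[OF that] T_out[OF that] by (simp add: h_def)
    have loc: "\<forall>\<^sub>F z in nhds x. z \<in> {c<..<d}" if "c < x" "x < d" for x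
      using that by (intro eventually_nhds_in_open) auto
    have isC: "isCont E x" "isCont T x" "isCont U x" if x: "c < x" "x < d" for x
    proof -
      have cg: "isCont F x" if "continuous_on {c..d} f" "\<And>z. z \<in> {c<..<d} \<Longrightarrow> F z = f z" for F f :: "real \<Rightarrow> real"
      proof -
        have "isCont f x" using continuous_on_interior[OF that(1), of x] x by simp
        moreover have "\<forall>\<^sub>F z in nhds x. F z = f z" using loc[OF x] by eventually_elim (rule that(2))
        ultimately show ?thesis using isCont_cong by blast
      qed
      show "isCont E x" by (rule cg[OF Ec]) (simp add: E_def)
      show "isCont T x" by (rule cg[OF Tc]) (simp add: T_def)
      show "isCont U x" by (rule cg[OF Uc]) (simp add: U_def)
    qed
    have E_int: "E x = E c + (LBINT t:{c..x}. h t)" if "c \<le> x" "x \<le> d" for x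
    proof (rule lborel_integral_Icc_off_countable[OF _ _ _ \<open>countable D\<close> _ that])
      show "continuous_on {c..d} E" using Ec by (rule continuous_on_eq) (simp add: E_def)
      fix x assume x: "c < x" "x < d" "x \<notin> D"
      then have px: "isCont psi x" using cd by (auto simp: D_def)
      have "((\<lambda>z. H z / u z) has_real_derivative
          ((u x)\<^sup>2 * theta x * u x - H x * (- psi x * u x)) / (u x * u x)) (at x)"
        by (rule DERIV_divide[OF HD u_deriv]) (use x px cd u_pos[of x] in auto)
      then have "((\<lambda>z. H z / u z) has_real_derivative h x) (at x)"
        by (rule DERIV_cong) (use x u_pos[of x] in \<open>simp add: h_def E_def T_def field_simps power2_eq_square\<close>)
      then have "(E has_real_derivative h x) (at x)"
        by (rule has_field_derivative_transform_within_open[where S = "{c<..<d}"]) (use x in \<open>auto simp: E_def\<close>)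
      moreover have "isCont h x" unfolding h_def by (intro continuous_intros isC px x)
      ultimately show "(E has_real_derivative h x) (at x) \<and> isCont h x" by blast
    qed (use h_bd in auto)
    have T_int: "T x = T c + (LBINT t:{c..x}. q t)" if "c \<le> x" "x \<le> d" for x
    proof (rule lborel_integral_Icc_off_countable[OF _ _ _ \<open>countable D\<close> _ that])
      show "continuous_on {c..d} T" using Tc by (rule continuous_on_eq) (simp add: T_def)
      fix x assume x: "c < x" "x < d" "x \<notin> D"
      then have px: "isCont psi x" using cd by (auto simp: D_def)
      have "((\<lambda>z. u z * theta z) has_real_derivative (- psi x * u x) * theta x + tau x * u x) (at x)"
        by (rule DERIV_mult[OF u_deriv thD]) (use x px cd in auto)
      then have "((\<lambda>z. u z * theta z) has_real_derivative q x) (at x)"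
        by (rule DERIV_cong) (use x in \<open>simp add: q_def U_def T_def algebra_simps\<close>)
      then have "(T has_real_derivative q x) (at x)"
        by (rule has_field_derivative_transform_within_open[where S = "{c<..<d}"]) (use x in \<open>auto simp: T_def\<close>)
      moreover have "isCont q x" unfolding q_def by (intro continuous_intros isC px x)
      ultimately show "(T has_real_derivative q x) (at x) \<and> isCont q x" by blast
    qed (use q_bd in auto)
    have h_integrable: "integrable lborel h"
      by (rule integrable_bounded_support[where c = c and d = d]) (use h_bd h_out in auto)
    have domE: "form_domain E h"
      unfolding form_domain_def
    proof (intro conjI allI impI)
      show "integrable lborel (\<lambda>x. (h x)\<^sup>2)"
      proof (rule integrable_bounded_support[where c = c and d = d and B = "(BT + M0 * BE)\<^sup>2"])
        fix x show "\<bar>(h x)\<^sup>2\<bar> \<le> (BT + M0 * BE)\<^sup>2" using power_mono[OF h_bd[of x], of 2] by simp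
      qed (use h_out in auto)
      show "integrable lborel (\<lambda>x. (psi x * E x)\<^sup>2)"
      proof (rule integrable_bounded_support[where c = c and d = d and B = "(M0 * BE)\<^sup>2"])
        fix x show "\<bar>(psi x * E x)\<^sup>2\<bar> \<le> (M0 * BE)\<^sup>2" using power_mono[OF psiE[of x], of 2] by simp
      qed (use E_out in auto)
      fix x assume "x \<notin> {a<..<b}"
      then have "x \<notin> {c<..<d}" using cd by auto
      then show "h x = 0" "E x = 0" using h_out E_out by auto
    next
      define I where "I x = (LINT t|lborel. indicator {..x} t * h t)" for x
      have i: "integrable lborel (\<lambda>t. indicator {..x} t * h t)" for x
        using integrable_mult_indicator[OF _ h_integrable, of "{..x}"] by simp
      have EI: "E x = I x" for x
      proof -
        consider "x < c" | "c \<le> x" "x \<le> d" | "d < x" by linarith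
        then show ?thesis
        proof cases
          case 1
          then have "(\<lambda>t. indicator {..x} t * h t) = (\<lambda>_. 0)" using h_out by (auto simp: fun_eq_iff indicator_def)
          then show ?thesis using E_out[of x] 1 by (simp add: I_def)
        next
          case 2
          have "(LBINT t:{c..x}. h t) = I x" unfolding I_def set_lebesgue_integral_def
          proof (intro Bochner_Integration.integral_cong refl)
            fix t show "indicator {c..x} t *\<^sub>R h t = indicator {..x} t * h t"
              using h_out[of t] by (cases "t < c") (auto simp: indicator_def)
          qed
          then show ?thesis using E_int[OF 2] E_out[of c] by simp
        next
          case 3
          have "(LBINT t:{c..d}. h t) = I x" unfolding I_def set_lebesgue_integral_def
          proof (intro Bochner_Integration.integral_cong refl)
            fix t show "indicator {c..d} t *\<^sub>R h t = indicator {..x} t * h t"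
              using h_out[of t] 3 by (cases "t \<in> {c<..<d}") (auto simp: indicator_def)
          qed
          then show ?thesis using E_int[of d] E_out[of c] E_out[of d] E_out[of x] 3 cd by simp
        qed
      qed
      fix x y :: real assume "x \<le> y"
      have "I y - I x = (LINT t|lborel. indicator {..y} t * h t - indicator {..x} t * h t)"
        unfolding I_def using i by simp
      also have "\<dots> = (LBINT t:{x..y}. h t)"
        unfolding set_lebesgue_integral_def
      proof (rule integral_cong_AE)
        show "AE t in lborel. indicator {..y} t * h t - indicator {..x} t * h t = indicator {x..y} t *\<^sub>R h t"
          using AE_lborel_singleton[of x] by eventually_elim (use \<open>x \<le> y\<close> in \<open>auto simp: indicator_def\<close>)
      qed simp_all
      finally show "E y - E x = (LBINT t:{x..y}. h t)" by (simp add: EI)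
    qed simp
    define Q where "Q x = U x + lam0 * E x" for x
    have [measurable]: "Q \<in> borel_measurable borel" unfolding Q_def[abs_def] by measurable
    have Q_int: "integrable lborel Q"
    proof (rule integrable_bounded_support[where c = c and d = d and B = "BU + lam0 * BE"])
      fix x
      have "\<bar>lam0 * E x\<bar> \<le> lam0 * BE" using lam0_pos E_bd[of x] by (simp add: abs_mult)
      then show "\<bar>Q x\<bar> \<le> BU + lam0 * BE"
        unfolding Q_def using abs_triangle_ineq[of "U x" "lam0 * E x"] U_bd[of x] by linarith
    qed (auto simp: Q_def U_def E_def)
    have bdd_int: "integrable lborel (\<lambda>x. f x * F x)"
      if [measurable]: "f \<in> borel_measurable borel" "F \<in> borel_measurable borel"
        and "\<And>x. \<bar>f x\<bar> \<le> B1" "\<And>x. \<bar>F x\<bar> \<le> B2" "\<And>x. x \<notin> {c..d} \<Longrightarrow> F x = 0" for f F :: "real \<Rightarrow> real" and B1 B2 :: real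
    proof (rule integrable_bounded_support[where c = c and d = d and B = "B1 * B2"])
      fix x show "\<bar>f x * F x\<bar> \<le> B1 * B2"
        unfolding abs_mult using that(3,4)[of x] by (intro mult_mono) (auto intro: order_trans[OF abs_ge_zero])
    qed (use that in auto)
    have B_eq: "energy_form (v n) (g n) E h - lam0 * (LINT x|lborel. v n x * E x) = - (LINT x|lborel. v n x * Q x)" for n
    proof -
      note [measurable] = dom_g[OF dom, of n] dom_v[OF dom, of n]
      note vb = bound[of n]
      have gT: "integrable lborel (\<lambda>x. g n x * T x)"
      proof (rule integrable_mult_L2[OF _ _ dom_g2[OF dom]])
        show "integrable lborel (\<lambda>x. (T x)\<^sup>2)"
        proof (rule integrable_bounded_support[where c = c and d = d and B = "BT\<^sup>2"])
          fix x show "\<bar>(T x)\<^sup>2\<bar> \<le> BT\<^sup>2" using power_mono[OF T_bd[of x], of 2] by simp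
        qed (use T_out in auto)
      qed simp_all
      have vpT: "integrable lborel (\<lambda>x. v n x * (psi x * T x))"
        by (rule bdd_int[OF _ _ vb psiT]) (use T_out in auto)
      have vU: "integrable lborel (\<lambda>x. v n x * U x)"
        by (rule bdd_int[OF _ _ vb U_bd]) (use U_out in auto)
      have vE: "integrable lborel (\<lambda>x. v n x * E x)"
        by (rule bdd_int[OF _ _ vb E_bd]) (use E_out in auto)
      have eqv: "v n z = v n c + (LBINT t:{c..z}. g n t)" if "c \<le> z" "z \<le> d" for z using dom_diff[OF dom[of n] that(1)] by simp
      have q_int: "set_integrable lborel {c..d} q"
        unfolding set_integrable_def
        by (rule integrable_bounded_support[where c = c and d = d and B = "BU + M0 * BT"]) (use q_bd in auto)
      have "(LBINT x:{c..d}. g n x * T x) + (LBINT x:{c..d}. v n x * q x) = v n d * T d - v n c * T c"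
        by (rule indefinite_integral_by_parts[OF _ dom_g_integrable[OF dom] q_int eqv T_int]) (use cd in auto)
      moreover have "(LBINT x:{c..d}. g n x * T x) = (LINT x|lborel. g n x * T x)"
        unfolding set_lebesgue_integral_def
      proof (intro Bochner_Integration.integral_cong refl)
        fix x show "indicator {c..d} x *\<^sub>R (g n x * T x) = g n x * T x"
          using T_out[of x] by (cases "x \<in> {c<..<d}") auto
      qed
      moreover have "(LBINT x:{c..d}. v n x * q x) = (LINT x|lborel. v n x * U x - v n x * (psi x * T x))"
        unfolding set_lebesgue_integral_def
      proof (intro Bochner_Integration.integral_cong refl)
        fix x show "indicator {c..d} x *\<^sub>R (v n x * q x) = v n x * U x - v n x * (psi x * T x)"
          using T_out[of x] U_out[of x] by (cases "x \<in> {c..d}") (auto simp: q_def right_diff_distrib)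
      qed
      ultimately have parts: "(LINT x|lborel. g n x * T x) - (LINT x|lborel. v n x * (psi x * T x)) = - (LINT x|lborel. v n x * U x)"
        using T_out[of c] T_out[of d] vU vpT by simp
      have "energy_form (v n) (g n) E h = (LINT x|lborel. g n x * T x - v n x * (psi x * T x))"
        unfolding energy_form_def by (intro Bochner_Integration.integral_cong) (auto simp: h_def algebra_simps)
      then have "energy_form (v n) (g n) E h = - (LINT x|lborel. v n x * U x)" using parts gT vpT by simp
      moreover have "(LINT x|lborel. v n x * Q x) = (LINT x|lborel. v n x * U x + lam0 * (v n x * E x))"
        by (intro Bochner_Integration.integral_cong) (auto simp: Q_def algebra_simps)
      ultimately show ?thesis using vU vE by simp
    qed
    define K where "K = energy E h - lam0 * mass E"
    have K: "K \<ge> 0" using lam0_le[OF domE] by (simp add: K_def)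
    have B_le: "(LINT x|lborel. v n x * Q x)\<^sup>2 \<le> 1 / (real n + 1) * K" for n
    proof -
      have "(energy_form (v n) (g n) E h - lam0 * (LINT x|lborel. v n x * E x))\<^sup>2 \<le> (energy (v n) (g n) - lam0 * mass (v n)) * K"
      proof (rule nonneg_quadratic_discriminant[OF K])
        fix t
        have "lam0 * mass (\<lambda>x. v n x + t * E x) \<le> energy (\<lambda>x. v n x + t * E x) (\<lambda>x. g n x + t * h x)"
          by (rule lam0_le[OF form_domain_lincomb[OF dom domE]])
        then show "0 \<le> energy (v n) (g n) - lam0 * mass (v n) + 2 * t *
           (energy_form (v n) (g n) E h - lam0 * (LINT x|lborel. v n x * E x)) + t\<^sup>2 * K"
          unfolding energy_lincomb[OF dom domE] K_def by (simp add: algebra_simps)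
      qed
      also have "\<dots> \<le> 1 / (real n + 1) * K" using en[of n] K mass[of n] by (intro mult_right_mono) auto
      finally show ?thesis unfolding B_eq by simp
    qed
    have lim0: "(\<lambda>n. LINT x|lborel. v (r n) x * Q x) \<longlonglongrightarrow> 0"
    proof -
      have "(\<lambda>n. inverse (real (Suc n)) * K) \<longlonglongrightarrow> 0"
        by (intro tendsto_mult_left_zero LIMSEQ_inverse_real_of_nat)
      then have up: "(\<lambda>n. inverse (real (Suc (r n))) * K) \<longlonglongrightarrow> 0"
        by (rule LIMSEQ_subseq_LIMSEQ[unfolded o_def, OF _ r])
      have "(\<lambda>n. (LINT x|lborel. v (r n) x * Q x)\<^sup>2) \<longlonglongrightarrow> 0"
        by (rule tendsto_sandwich[OF _ _ tendsto_const up])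
           (use B_le in \<open>simp_all add: inverse_eq_divide add.commute\<close>)
      then have "(\<lambda>n. sqrt ((LINT x|lborel. v (r n) x * Q x)\<^sup>2)) \<longlonglongrightarrow> sqrt 0" by (rule tendsto_real_sqrt)
      then show ?thesis by (simp add: tendsto_rabs_zero_iff)
    qed
    have VQ_eq: "(\<lambda>x. V x * Q x) = (\<lambda>x. indicator {c..d} x *\<^sub>R (V x * (u x * tau x + lam0 * (H x / u x))))"
      by (auto simp: fun_eq_iff Q_def U_def E_def indicator_def)
    have Vcd: "continuous_on {c..d} V" by (rule continuous_on_subset[OF V_cont]) (use cd in auto)
    have si: "set_integrable lborel {c..d} (\<lambda>x. V x * (u x * tau x + lam0 * (H x / u x)))"
      by (intro borel_integrable_atLeastAtMost' continuous_intros Vcd Uc Ec)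
    then have VQ_int: "integrable lborel (\<lambda>x. V x * Q x)" unfolding VQ_eq by (simp add: set_integrable_def)
    have lim1: "(\<lambda>n. LINT x|lborel. v (r n) x * Q x) \<longlonglongrightarrow> (LINT x|lborel. V x * Q x)"
    proof (rule LIMSEQ_I)
      fix e :: real assume "0 < e"
      define m where "m = (LINT x|lborel. \<bar>Q x\<bar>)"
      have m: "m \<ge> 0" by (simp add: m_def)
      obtain N where N: "\<And>n x. n \<ge> N \<Longrightarrow> \<bar>v (r n) x - V x\<bar> < e / (m + 1)"
        using unif[of "e / (m + 1)"] \<open>0 < e\<close> m by auto
      have "norm ((LINT x|lborel. v (r n) x * Q x) - (LINT x|lborel. V x * Q x)) < e" if n: "n \<ge> N" for n
      proof -
        note [measurable] = dom_v[OF dom, of "r n"]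
        have vQ: "integrable lborel (\<lambda>x. v (r n) x * Q x)"
        proof (rule Bochner_Integration.integrable_bound)
          show "integrable lborel (\<lambda>x. sqrt ((b - a) * L) * Q x)" using Q_int by simp
          show "AE x in lborel. norm (v (r n) x * Q x) \<le> norm (sqrt ((b - a) * L) * Q x)"
            unfolding real_norm_def abs_mult
            by (intro AE_I2 mult_right_mono order_trans[OF bound abs_ge_self] abs_ge_zero)
        qed simp
        have "(LINT x|lborel. v (r n) x * Q x) - (LINT x|lborel. V x * Q x) = (LINT x|lborel. v (r n) x * Q x - V x * Q x)"
          using vQ VQ_int by simp
        also have "norm \<dots> \<le> (LINT x|lborel. norm (v (r n) x * Q x - V x * Q x))" by (rule integral_norm_bound)
        also have "\<dots> \<le> (LINT x|lborel. e / (m + 1) * \<bar>Q x\<bar>)"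
        proof (rule integral_mono)
          show "integrable lborel (\<lambda>x. norm (v (r n) x * Q x - V x * Q x))" using vQ VQ_int by simp
          show "integrable lborel (\<lambda>x. e / (m + 1) * \<bar>Q x\<bar>)" using Q_int by simp
          fix x
          have "norm (v (r n) x * Q x - V x * Q x) = \<bar>v (r n) x - V x\<bar> * \<bar>Q x\<bar>"
            by (simp add: left_diff_distrib[symmetric] abs_mult)
          also have "\<dots> \<le> e / (m + 1) * \<bar>Q x\<bar>" using N[OF n, of x] by (intro mult_right_mono) auto
          finally show "norm (v (r n) x * Q x - V x * Q x) \<le> e / (m + 1) * \<bar>Q x\<bar>" .
        qed
        also have "\<dots> = e / (m + 1) * m" by (simp add: m_def)
        also have "\<dots> < e" using \<open>0 < e\<close> m by (simp add: field_simps)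
        finally show ?thesis .
      qed
      then show "\<exists>N. \<forall>n\<ge>N. norm ((LINT x|lborel. v (r n) x * Q x) - (LINT x|lborel. V x * Q x)) < e" by blast
    qed
    have "(LINT x|lborel. V x * Q x) = 0" using LIMSEQ_unique[OF lim1 lim0] .
    then show ?thesis
      using set_borel_integral_eq_integral(2)[OF si] unfolding VQ_eq by (simp add: set_lebesgue_integral_def)
  qed
  moreover have "weak_equation V"
    unfolding weak_equation_def by (intro allI impI) (rule weak)
  ultimately show ?thesis using V_cont V_out by blast
qed

end

end

section \<open>The Neumann problem solved by the minimiser\<close>

context stieltjes_derivative begin

text \<open>Let \<open>P' = v / u\<close>, \<open>R' = lam0 P u\<^sup>2\<close> and \<open>S' = u\<^sup>2\<close>. By the weak equation, \<open>u v + R\<close> is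
  orthogonal to every \<open>tau\<close> that is orthogonal to \<open>1\<close> and \<open>S\<close>, since these are the conditions for
  \<open>theta\<close> and \<open>H\<close> to vanish at both ends. Hence \<open>u v + R\<close> is a combination \<open>al + be S\<close>, and
  differentiating it shows that \<open>w = P - be / lam0\<close> is the right normalisation.\<close>

lemma ex_eigenfunction:
  assumes nontrivial: "\<exists>v g. form_domain v g \<and> 0 < mass v"
  shows "\<exists>v w. continuous_on {a..b} v \<and> v a = 0 \<and> v b = 0 \<and> (\<exists>x. a < x \<and> x < b \<and> v x \<noteq> 0) \<and>
     (\<forall>x. a < x \<longrightarrow> x < b \<longrightarrow> (w has_real_derivative v x / u x) (at x) \<and>
        ((\<lambda>x. u x * v x) has_real_derivative - lam0 * (u x)\<^sup>2 * w x) (at x))"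
proof -
  obtain v x0 where v: "continuous_on {a..b} v" and out: "\<And>x. x \<notin> {a<..<b} \<Longrightarrow> v x = 0" and x0: "v x0 \<noteq> 0"
    and EL: "weak_equation v"
    using ex_weak_minimiser[OF nontrivial] by blast
  have u_ne: "u x \<noteq> 0" for x using u_pos[of x] by simp
  have vI: "continuous_on {a<..<b} v" by (rule continuous_on_subset[OF v]) auto
  obtain S where S: "\<And>x. x \<in> {a<..<b} \<Longrightarrow> (S has_real_derivative (u x)\<^sup>2) (at x)"
    using ex_antiderivative_Ioo[OF continuous_on_power[OF u_cont, of 2]] by blast
  obtain P where P: "\<And>x. x \<in> {a<..<b} \<Longrightarrow> (P has_real_derivative v x / u x) (at x)"
    using ex_antiderivative_Ioo[OF continuous_on_divide[OF vI u_cont]] u_ne by blast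
  have PI: "continuous_on {a<..<b} P"
    by (rule DERIV_continuous_on[where D = "\<lambda>x. v x / u x"]) (rule has_field_derivative_at_within[OF P])
  have SI: "continuous_on {a<..<b} S"
    by (rule DERIV_continuous_on[where D = "\<lambda>x. (u x)\<^sup>2"]) (rule has_field_derivative_at_within[OF S])
  have "continuous_on {a<..<b} (\<lambda>x. lam0 * P x * (u x)\<^sup>2)" by (intro continuous_intros PI u_cont)
  from ex_antiderivative_Ioo[OF this] obtain R where R: "\<And>x. x \<in> {a<..<b} \<Longrightarrow> (R has_real_derivative lam0 * P x * (u x)\<^sup>2) (at x)" by blast
  have RI: "continuous_on {a<..<b} R"
    by (rule DERIV_continuous_on[where D = "\<lambda>x. lam0 * P x * (u x)\<^sup>2"]) (rule has_field_derivative_at_within[OF R])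
  have S_mono: "S x < S y" if "a < x" "x < y" "y < b" for x y
  proof (rule DERIV_pos_imp_increasing[OF that(2)])
    fix z assume "x \<le> z" "z \<le> y"
    then show "\<exists>d. (S has_real_derivative d) (at z) \<and> 0 < d"
      using S[of z] that u_pos[of z] by (intro exI[of _ "(u z)\<^sup>2"]) auto
  qed
  define f where "f x = v x * u x + R x" for x
  have local: "\<exists>al be. \<forall>x\<in>{c..d}. f x = al + be * S x" if cd: "a < c" "c < d" "d < b" for c d
  proof (rule du_bois_reymond_two[OF cd(2)])
    have sub: "{c..d} \<subseteq> {a<..<b}" using cd by auto
    note cont = continuous_on_subset[OF vI sub] continuous_on_subset[OF u_cont sub] continuous_on_subset[OF RI sub]
      continuous_on_subset[OF SI sub] continuous_on_subset[OF PI sub]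
    show "continuous_on {c..d} f" unfolding f_def by (intro continuous_intros cont)
    show "continuous_on {c..d} S" by (rule cont)
    show "S c \<noteq> S d" using S_mono[OF cd] by simp
    fix tau assume tau: "continuous_on {c..d} tau" "integral {c..d} tau = 0" "integral {c..d} (\<lambda>x. S x * tau x) = 0"
    define theta where "theta x = integral {c..x} tau" for x
    define H where "H x = integral {c..x} (\<lambda>x. (u x)\<^sup>2 * theta x)" for x
    have th: "continuous_on {c..d} theta" unfolding theta_def
      by (rule indefinite_integral_continuous_1[OF integrable_continuous_real[OF tau(1)]])
    have uth: "continuous_on {c..d} (\<lambda>x. (u x)\<^sup>2 * theta x)" by (intro continuous_intros cont th)
    have Hc: "continuous_on {c..d} H" unfolding H_def
      by (rule indefinite_integral_continuous_1[OF integrable_continuous_real[OF uth]])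
    have D: "((\<lambda>z. integral {c..z} F) has_real_derivative F x) (at x)"
      if "continuous_on {c..d} F" "c < x" "x < d" for F x
      using integral_has_real_derivative[OF that(1), of x] that by (simp add: at_within_Icc_at)
    have thD: "(theta has_real_derivative tau x) (at x)" if "c < x" "x < d" for x
      unfolding theta_def[abs_def] by (rule D[OF tau(1) that])
    have HD: "(H has_real_derivative (u x)\<^sup>2 * theta x) (at x)" if "c < x" "x < d" for x
      unfolding H_def[abs_def] by (rule D[OF uth that])
    have ends: "theta c = 0" "theta d = 0" "H c = 0" using tau by (auto simp: theta_def H_def)
    have inI: "x \<in> {a<..<b}" if "c < x" "x < d" for x using that cd by auto
    have "integral {c..d} (\<lambda>x. (u x)\<^sup>2 * theta x) = - integral {c..d} (\<lambda>x. S x * tau x)"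
      using cd by (intro integral_by_parts_zero cont continuous_intros th tau S thD inI ends) auto
    then have Hd: "H d = 0" using tau by (simp add: H_def)
    have "integral {c..d} (\<lambda>x. v x / u x * H x) = - integral {c..d} (\<lambda>x. P x * ((u x)\<^sup>2 * theta x))"
      using cd u_ne by (intro integral_by_parts_zero cont continuous_intros th Hc P HD inI ends Hd) auto
    moreover have "integral {c..d} (\<lambda>x. lam0 * P x * (u x)\<^sup>2 * theta x) = - integral {c..d} (\<lambda>x. R x * tau x)"
      using cd by (intro integral_by_parts_zero cont continuous_intros th tau R thD inI ends) auto
    moreover have "integral {c..d} (\<lambda>x. lam0 * P x * (u x)\<^sup>2 * theta x) = lam0 * integral {c..d} (\<lambda>x. P x * ((u x)\<^sup>2 * theta x))"
      by (simp add: mult.assoc)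
    ultimately have e1: "lam0 * integral {c..d} (\<lambda>x. v x / u x * H x) = integral {c..d} (\<lambda>x. R x * tau x)" by simp
    have "integral {c..d} (\<lambda>x. v x * (u x * tau x + lam0 * (H x / u x))) = 0"
      using EL[unfolded weak_equation_def, rule_format, where tau = tau and theta = theta and H = H and c = c and d = d,
          OF cd tau(1) theta_def ends(2) H_def Hd] .
    moreover have "integral {c..d} (\<lambda>x. v x * (u x * tau x + lam0 * (H x / u x)))
        = integral {c..d} (\<lambda>x. v x * u x * tau x + lam0 * (v x / u x * H x))"
      by (intro Henstock_Kurzweil_Integration.integral_cong) (simp add: algebra_simps)
    moreover have "\<dots> = integral {c..d} (\<lambda>x. v x * u x * tau x) + integral {c..d} (\<lambda>x. lam0 * (v x / u x * H x))"
      by (intro integral_add integrable_continuous_real continuous_intros cont tau Hc) (use u_ne in auto)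
    moreover have "integral {c..d} (\<lambda>x. f x * tau x) = integral {c..d} (\<lambda>x. v x * u x * tau x + R x * tau x)"
      by (intro Henstock_Kurzweil_Integration.integral_cong) (simp add: f_def algebra_simps)
    moreover have "\<dots> = integral {c..d} (\<lambda>x. v x * u x * tau x) + integral {c..d} (\<lambda>x. R x * tau x)"
      by (intro integral_add integrable_continuous_real continuous_intros cont tau)
    moreover have "integral {c..d} (\<lambda>x. lam0 * (v x / u x * H x)) = lam0 * integral {c..d} (\<lambda>x. v x / u x * H x)"
      by (rule integral_mult_right)
    ultimately show "integral {c..d} (\<lambda>x. f x * tau x) = 0" using e1 by linarith
  qed
  \<comment> \<open>the coefficients do not depend on the compact interval, as \<open>S\<close> is injective on the smallest one\<close>
  define c0 d0 where "c0 = (2 * a + b) / 3" and "d0 = (a + 2 * b) / 3"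
  have cd0: "a < c0" "c0 < d0" "d0 < b" using ab by (auto simp: c0_def d0_def)
  obtain al be where albe: "\<And>x. x \<in> {c0..d0} \<Longrightarrow> f x = al + be * S x" using local[OF cd0] by blast
  have glob: "f x = al + be * S x" if x: "a < x" "x < b" for x
  proof -
    define c d where "c = min c0 x" and "d = max d0 x"
    have cd: "a < c" "c < d" "d < b" "c0 \<in> {c..d}" "d0 \<in> {c..d}" "x \<in> {c..d}"
      using cd0 x by (auto simp: c_def d_def min_def max_def)
    obtain al' be' where *: "\<And>x. x \<in> {c..d} \<Longrightarrow> f x = al' + be' * S x" using local[OF cd(1-3)] by blast
    have e: "al' + be' * S c0 = al + be * S c0" "al' + be' * S d0 = al + be * S d0"
      using *[OF cd(4)] *[OF cd(5)] albe[of c0] albe[of d0] cd0 by auto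
    then have "(be' - be) * (S d0 - S c0) = 0" by (simp add: algebra_simps)
    then have "be' = be" using S_mono[OF cd0] by simp
    with e *[OF cd(6)] show ?thesis by simp
  qed
  have "\<exists>x. a < x \<and> x < b \<and> v x \<noteq> 0" using x0 out[of x0] by auto
  moreover have "((\<lambda>x. P x - be / lam0) has_real_derivative v x / u x) (at x) \<and>
        ((\<lambda>x. u x * v x) has_real_derivative - lam0 * (u x)\<^sup>2 * (P x - be / lam0)) (at x)" if x: "a < x" "x < b" for x
  proof
    have xI: "x \<in> {a<..<b}" using x by simp
    show "((\<lambda>x. P x - be / lam0) has_real_derivative v x / u x) (at x)"
      using P[OF xI] by (auto intro!: derivative_eq_intros)
    have "((\<lambda>x. al + be * S x - R x) has_real_derivative be * (u x)\<^sup>2 - lam0 * P x * (u x)\<^sup>2) (at x)"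
      using S[OF xI] R[OF xI] by (auto intro!: derivative_eq_intros)
    then have "((\<lambda>x. al + be * S x - R x) has_real_derivative - lam0 * (u x)\<^sup>2 * (P x - be / lam0)) (at x)"
      by (rule DERIV_cong) (use lam0_pos[OF nontrivial] in \<open>simp add: field_simps\<close>)
    then show "((\<lambda>x. u x * v x) has_real_derivative - lam0 * (u x)\<^sup>2 * (P x - be / lam0)) (at x)"
    proof (rule has_field_derivative_transform_within_open[where S = "{a<..<b}"])
      fix z assume "z \<in> {a<..<b}"
      then show "al + be * S z - R z = u z * v z" using glob[of z] by (simp add: f_def mult.commute)
    qed (use x in auto)
  qed
  ultimately show ?thesis using v out[of a] out[of b]
    by (intro exI[of _ v] exI[of _ "\<lambda>x. P x - be / lam0"]) auto
qed

text \<open>On a nodal interval of a minimiser, \<open>k = v / u\<close> has a sign, and the flux \<open>u v\<close> vanishes at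
  both ends because \<open>u\<close> is bounded. The nodal interval has length \<open>\<pi>\<close>, hence it is the whole
  interval.\<close>

theorem lam0_le_3_rigidity:
  assumes nontrivial: "\<exists>v g. form_domain v g \<and> 0 < mass v"
    and bounds: "- (pi / 2) \<le> a" "b \<le> pi / 2"
    and psi_tan: "\<And>x y. a < x \<Longrightarrow> x < y \<Longrightarrow> y < b \<Longrightarrow> 2 * tan ((y - x) / 2) \<le> psi y - psi x"
    and le: "lam0 \<le> 3"
  shows "lam0 = 3" "a = - (pi / 2)" "b = pi / 2" "\<And>x. - (pi / 2) < x \<Longrightarrow> x < pi / 2 \<Longrightarrow> psi x = tan x"
proof -
  obtain v w where v: "continuous_on {a..b} v" "v a = 0" "v b = 0" and ne: "\<exists>x. a < x \<and> x < b \<and> v x \<noteq> 0"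
    and eqs: "\<forall>x. a < x \<longrightarrow> x < b \<longrightarrow> (w has_real_derivative v x / u x) (at x) \<and>
        ((\<lambda>x. u x * v x) has_real_derivative - lam0 * (u x)\<^sup>2 * w x) (at x)"
    using ex_eigenfunction[OF nontrivial] by blast
  obtain x0 where x0: "a < x0" "x0 < b" "v x0 \<noteq> 0" using ne by blast
  have w: "\<And>x. a < x \<Longrightarrow> x < b \<Longrightarrow> (w has_real_derivative v x / u x) (at x)"
    and uv: "\<And>x. a < x \<Longrightarrow> x < b \<Longrightarrow> ((\<lambda>x. u x * v x) has_real_derivative - lam0 * (u x)\<^sup>2 * w x) (at x)"
    using eqs by blast+
  define s where "s = sgn (v x0)"
  have s: "s * v x0 > 0" using x0 by (simp add: s_def sgn_if)
  obtain p q where pq: "a \<le> p" "p < q" "q \<le> b" "s * v p = 0" "s * v q = 0"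
    and pos: "\<And>x. p < x \<Longrightarrow> x < q \<Longrightarrow> 0 < s * v x"
    using nodal_interval[OF continuous_on_mult_left[OF v(1)] _ _ x0(1,2) s] v(2,3) by auto
  have u_ne: "u x \<noteq> 0" for x using u_pos[of x] by simp
  obtain B where B: "B > 0" "\<And>x. a < x \<Longrightarrow> x < b \<Longrightarrow> u x \<le> B" using u_bounded by blast
  have flux_eq: "(u x)\<^sup>2 * (s * v x / u x) = s * (u x * v x)" for x
    using u_ne[of x] by (simp add: power2_eq_square)
  have lim: "((\<lambda>x. (u x)\<^sup>2 * (s * v x / u x)) \<longlongrightarrow> 0) F"
    if F: "((\<lambda>x. s * v x) \<longlongrightarrow> 0) F" "\<forall>\<^sub>F x in F. p < x \<and> x < q" for F
  proof (rule Lim_null_comparison)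
    show "((\<lambda>x. B * (s * v x)) \<longlongrightarrow> 0) F" using tendsto_mult_right_zero[OF F(1), of B] by simp
    show "\<forall>\<^sub>F x in F. norm ((u x)\<^sup>2 * (s * v x / u x)) \<le> B * (s * v x)"
      using F(2)
    proof eventually_elim
      case (elim x)
      have "u x * (s * v x) \<le> B * (s * v x)" using pos[of x] elim B(2)[of x] pq by (intro mult_right_mono) auto
      moreover have "0 \<le> u x * (s * v x)" using pos[of x] elim u_pos[of x] by simp
      ultimately show ?case unfolding flux_eq by (simp add: mult.left_commute)
    qed
  qed
  have sv: "continuous_on {p..q} (\<lambda>x. s * v x)"
    by (intro continuous_intros continuous_on_subset[OF v(1)]) (use pq in auto)
  have "two_point p q lam0 psi u (\<lambda>x. s * w x) (\<lambda>x. s * v x / u x)"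
  proof
    show "((\<lambda>x. (u x)\<^sup>2 * (s * v x / u x)) \<longlongrightarrow> 0) (at_right p)"
    proof (rule lim)
      show "((\<lambda>x. s * v x) \<longlongrightarrow> 0) (at_right p)" using continuous_on_Icc_at_rightD[OF sv] pq by simp
      show "\<forall>\<^sub>F x in at_right p. p < x \<and> x < q"
        using eventually_at_right_real[OF pq(2)] by eventually_elim auto
    qed
    show "((\<lambda>x. (u x)\<^sup>2 * (s * v x / u x)) \<longlongrightarrow> 0) (at_left q)"
    proof (rule lim)
      show "((\<lambda>x. s * v x) \<longlongrightarrow> 0) (at_left q)" using continuous_on_Icc_at_leftD[OF sv] pq by simp
      show "\<forall>\<^sub>F x in at_left q. p < x \<and> x < q"
        using eventually_at_left_real[OF pq(2)] by eventually_elim auto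
    qed
    show "continuous_on {p<..<q} u" by (rule continuous_on_subset[OF u_cont]) (use pq in auto)
    fix x assume x: "p < x" "x < q"
    then have xI: "a < x" "x < b" using pq by auto
    show "((\<lambda>x. s * w x) has_real_derivative s * v x / u x) (at x)"
      using DERIV_cmult[OF w[OF xI], of s] by simp
    show "((\<lambda>x. (u x)\<^sup>2 * (s * v x / u x)) has_real_derivative - lam0 * (u x)\<^sup>2 * (s * w x)) (at x)"
      unfolding flux_eq by (rule DERIV_cong[OF DERIV_cmult[OF uv[OF xI]]]) simp
    show "0 < s * v x / u x" using pos[OF x] u_pos[of x] by simp
  qed (use pq bounds lam0_pos[OF nontrivial] le u_pos psi_mono psi_tan u_deriv in auto)
  note rig = two_point_rigidity[OF this]
  show "lam0 = 3" "a = - (pi / 2)" "b = pi / 2" using rig(1-3) pq bounds by auto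
  show "\<And>x. - (pi / 2) < x \<Longrightarrow> x < pi / 2 \<Longrightarrow> psi x = tan x" by (rule rig(4))
qed

end

section \<open>Smooth steps\<close>

text \<open>The recursion takes the derivative first, unlike \<open>(deriv ^^ n) f\<close>, so that closure
  properties follow by induction on \<open>n\<close> for all functions simultaneously.\<close>

fun times_differentiable :: "nat \<Rightarrow> (real \<Rightarrow> real) \<Rightarrow> bool" where
  "times_differentiable 0 f \<longleftrightarrow> True"
| "times_differentiable (Suc n) f \<longleftrightarrow> (\<forall>x. f differentiable (at x)) \<and> times_differentiable n (deriv f)"

definition smooth :: "(real \<Rightarrow> real) \<Rightarrow> bool" where
  "smooth f \<longleftrightarrow> (\<forall>n. times_differentiable n f)"

lemma times_differentiable_Suc_iff:
  "times_differentiable (Suc n) f \<longleftrightarrow> (\<exists>f'. (\<forall>x. (f has_real_derivative f' x) (at x)) \<and> times_differentiable n f')"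
proof
  assume "times_differentiable (Suc n) f"
  then show "\<exists>f'. (\<forall>x. (f has_real_derivative f' x) (at x)) \<and> times_differentiable n f'"
    by (intro exI[of _ "deriv f"]) (auto simp: DERIV_deriv_iff_real_differentiable)
next
  assume "\<exists>f'. (\<forall>x. (f has_real_derivative f' x) (at x)) \<and> times_differentiable n f'"
  then obtain f' where f': "\<And>x. (f has_real_derivative f' x) (at x)" "times_differentiable n f'" by blast
  then have "deriv f = f'" using DERIV_imp_deriv by blast
  then show "times_differentiable (Suc n) f" using f' real_differentiable_def by auto
qed

lemma times_differentiable_SucI:
  assumes "\<And>x. (f has_real_derivative f' x) (at x)" "times_differentiable n f'"
  shows "times_differentiable (Suc n) f"
  unfolding times_differentiable_Suc_iff using assms by blast

lemma times_differentiable_mono: "times_differentiable (Suc n) f \<Longrightarrow> times_differentiable n f"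
  by (induction n arbitrary: f) auto

lemma times_differentiable_iter: "times_differentiable (Suc n) f \<Longrightarrow> (deriv ^^ n) f differentiable (at x)"
proof (induction n arbitrary: f)
  case (Suc n)
  have "times_differentiable (Suc n) (deriv f)" using Suc.prems by simp
  then show ?case using Suc.IH[of "deriv f"] by (simp add: funpow_swap1 del: times_differentiable.simps)
qed simp

lemma smooth_iter: "smooth f \<Longrightarrow> (deriv ^^ n) f differentiable (at x)"
  using times_differentiable_iter unfolding smooth_def by blast

lemma smooth_DERIV: "smooth f \<Longrightarrow> (f has_real_derivative deriv f x) (at x)"
  using smooth_iter[of f 0 x] by (simp add: DERIV_deriv_iff_real_differentiable)

lemma smooth_deriv: "smooth f \<Longrightarrow> smooth (deriv f)"
  unfolding smooth_def by (metis times_differentiable.simps(2))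

lemma smooth_isCont: "smooth f \<Longrightarrow> isCont f x"
  using smooth_DERIV DERIV_isCont by blast

lemma times_differentiable_const: "times_differentiable n (\<lambda>_. c)"
  by (induction n arbitrary: c) (auto intro!: times_differentiable_SucI[where f' = "\<lambda>_. 0"] simp del: times_differentiable.simps(2))

lemma times_differentiable_add:
  "times_differentiable n f \<Longrightarrow> times_differentiable n g \<Longrightarrow> times_differentiable n (\<lambda>x. f x + g x)"
proof (induction n arbitrary: f g)
  case (Suc n)
  then obtain f' g' where "\<And>x. (f has_real_derivative f' x) (at x)" "times_differentiable n f'"
      "\<And>x. (g has_real_derivative g' x) (at x)" "times_differentiable n g'"
    unfolding times_differentiable_Suc_iff by blast
  then show ?case using Suc.IH by (intro times_differentiable_SucI[where f' = "\<lambda>x. f' x + g' x"] DERIV_add) auto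
qed simp

lemma times_differentiable_mult:
  "times_differentiable n f \<Longrightarrow> times_differentiable n g \<Longrightarrow> times_differentiable n (\<lambda>x. f x * g x)"
proof (induction n arbitrary: f g)
  case (Suc n)
  note fg = times_differentiable_mono[OF Suc.prems(1)] times_differentiable_mono[OF Suc.prems(2)]
  from Suc.prems obtain f' g' where D: "\<And>x. (f has_real_derivative f' x) (at x)" "times_differentiable n f'"
      "\<And>x. (g has_real_derivative g' x) (at x)" "times_differentiable n g'"
    unfolding times_differentiable_Suc_iff by blast
  have "times_differentiable n (\<lambda>x. f' x * g x + g' x * f x)"
    by (intro times_differentiable_add Suc.IH D fg)
  then show ?case by (intro times_differentiable_SucI[where f' = "\<lambda>x. f' x * g x + g' x * f x"] DERIV_mult D)
qed simp

lemma times_differentiable_inverse: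
  "times_differentiable n f \<Longrightarrow> (\<And>x. f x \<noteq> 0) \<Longrightarrow> times_differentiable n (\<lambda>x. inverse (f x))"
proof (induction n)
  case (Suc n)
  note f = times_differentiable_mono[OF Suc.prems(1)]
  from Suc.prems obtain f' where D: "\<And>x. (f has_real_derivative f' x) (at x)" "times_differentiable n f'"
    unfolding times_differentiable_Suc_iff by blast
  have "times_differentiable n (\<lambda>x. (- 1) * (inverse (f x) * f' x * inverse (f x)))"
    by (intro times_differentiable_mult times_differentiable_const Suc.IH D f Suc.prems)
  then show ?case
    by (rule times_differentiable_SucI[rotated]) (use DERIV_inverse'[OF D(1) Suc.prems(2)] in simp)
qed simp

lemma times_differentiable_affine:
  "times_differentiable n f \<Longrightarrow> times_differentiable n (\<lambda>x. f (p * x + q))"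
proof (induction n arbitrary: f)
  case (Suc n)
  then obtain f' where D: "\<And>x. (f has_real_derivative f' x) (at x)" "times_differentiable n f'"
    unfolding times_differentiable_Suc_iff by blast
  have "((\<lambda>x. f (p * x + q)) has_real_derivative f' (p * x + q) * p) (at x)" for x
    by (rule DERIV_chain2[where f = f and g = "\<lambda>x. p * x + q"]) (auto intro!: derivative_eq_intros D)
  then show ?case
    by (rule times_differentiable_SucI) (intro times_differentiable_mult times_differentiable_const Suc.IH D)
qed simp

lemma times_differentiable_cos_affine: "times_differentiable n (\<lambda>x. cos (x + c))"
proof (induction n arbitrary: c)
  case (Suc n)
  have "((\<lambda>x. cos (x + c)) has_real_derivative cos (x + (c + pi / 2))) (at x)" for x
    using sin_cos_eq[of "- (x + c)"] by (auto intro!: derivative_eq_intros simp: cos_add sin_add add.assoc[symmetric])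
  then show ?case by (rule times_differentiable_SucI) (rule Suc)
qed simp

lemma smooth_intros:
  "smooth (\<lambda>_. c)" "smooth f \<Longrightarrow> smooth g \<Longrightarrow> smooth (\<lambda>x. f x + g x)"
  "smooth f \<Longrightarrow> smooth g \<Longrightarrow> smooth (\<lambda>x. f x * g x)"
  "smooth f \<Longrightarrow> (\<And>x. f x \<noteq> 0) \<Longrightarrow> smooth (\<lambda>x. inverse (f x))"
  "smooth f \<Longrightarrow> smooth (\<lambda>x. f (p * x + q))" "smooth cos"
  using times_differentiable_cos_affine[of _ 0]
  by (auto simp: smooth_def times_differentiable_const times_differentiable_add times_differentiable_mult
      times_differentiable_inverse times_differentiable_affine)

text \<open>The functions \<open>p (1/x) exp (- 1/x)\<close>, extended by zero to \<open>x \<le> 0\<close>, are closed under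
  differentiation; this makes them smooth.\<close>

definition flat :: "real poly \<Rightarrow> real \<Rightarrow> real" where
  "flat p x = (if x > 0 then poly p (1 / x) * exp (- (1 / x)) else 0)"

lemma poly_div_exp_tendsto_0: "((\<lambda>y::real. poly p y / exp y) \<longlongrightarrow> 0) at_top"
proof -
  have "((\<lambda>y::real. \<Sum>i\<le>degree p. coeff p i * (y ^ i / exp y)) \<longlongrightarrow> (\<Sum>i\<le>degree p. coeff p i * 0)) at_top"
    by (intro tendsto_intros tendsto_power_div_exp_0)
  then show ?thesis by (simp add: poly_altdef sum_divide_distrib)
qed

lemma flat_deriv: "(flat p has_real_derivative flat ([:0, 0, 1:] * (p - pderiv p)) x) (at x)"
proof -
  consider "x > 0" | "x < 0" | "x = 0" by linarith
  then show ?thesis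
  proof cases
    case 1
    have "((\<lambda>x. poly p (1 / x) * exp (- (1 / x))) has_real_derivative
        poly p (1 / x) * (exp (- (1 / x)) * (1 / x\<^sup>2)) + poly (pderiv p) (1 / x) * (- 1 / x\<^sup>2) * exp (- (1 / x))) (at x)"
      using 1 by (auto intro!: derivative_eq_intros DERIV_chain2[OF poly_DERIV] simp: power2_eq_square field_simps)
    then have "((\<lambda>x. poly p (1 / x) * exp (- (1 / x))) has_real_derivative flat ([:0, 0, 1:] * (p - pderiv p)) x) (at x)"
      by (rule DERIV_cong) (use 1 in \<open>simp add: flat_def power2_eq_square field_simps\<close>)
    then show ?thesis
      by (rule has_field_derivative_transform_within_open[where S = "{0<..}"]) (use 1 in \<open>auto simp: flat_def\<close>)
  next
    case 2
    have "((\<lambda>_. 0) has_real_derivative flat ([:0, 0, 1:] * (p - pderiv p)) x) (at x)"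
      using 2 by (simp add: flat_def)
    then show ?thesis
      by (rule has_field_derivative_transform_within_open[where S = "{..<0}"]) (use 2 in \<open>auto simp: flat_def\<close>)
  next
    case 3
    have "((\<lambda>h. flat p h / h) \<longlongrightarrow> 0) (at_right 0)"
    proof -
      have "((\<lambda>h::real. poly ([:0, 1:] * p) (inverse h) / exp (inverse h)) \<longlongrightarrow> 0) (at_right 0)"
        by (rule filterlim_compose[OF poly_div_exp_tendsto_0 filterlim_inverse_at_top_right])
      then show ?thesis
      proof (rule Lim_transform_eventually)
        show "\<forall>\<^sub>F h in at_right 0. poly ([:0, 1:] * p) (inverse h) / exp (inverse h) = flat p h / h"
          using eventually_at_right_less[of "0::real"]
          by eventually_elim (simp add: flat_def exp_minus field_simps inverse_eq_divide)
      qed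
    qed
    moreover have "((\<lambda>h. flat p h / h) \<longlongrightarrow> 0) (at_left 0)"
      by (rule Lim_transform_eventually[OF tendsto_const])
         (auto simp: flat_def eventually_at_left_field intro!: exI[of _ "- 1"])
    ultimately have "((\<lambda>h. flat p h / h) \<longlongrightarrow> 0) (at 0)" by (simp add: filterlim_split_at)
    then show ?thesis using 3 by (simp add: has_field_derivative_iff flat_def)
  qed
qed

lemma smooth_flat: "smooth (flat p)"
proof -
  have "times_differentiable n (flat p)" for n
    by (induction n arbitrary: p) (auto intro: times_differentiable_SucI[OF flat_deriv] simp del: times_differentiable.simps(2))
  then show ?thesis by (simp add: smooth_def)
qed

definition smooth_step :: "real \<Rightarrow> real" where
  "smooth_step x = flat 1 x * inverse (flat 1 x + flat 1 (- 1 * x + 1))"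

lemma flat_1: "0 \<le> flat 1 x" "x > 0 \<Longrightarrow> 0 < flat 1 x" "x \<le> 0 \<Longrightarrow> flat 1 x = 0" "x \<le> y \<Longrightarrow> flat 1 x \<le> flat 1 y"
proof -
  show "0 \<le> flat 1 x" "x > 0 \<Longrightarrow> 0 < flat 1 x" "x \<le> 0 \<Longrightarrow> flat 1 x = 0" by (auto simp: flat_def)
  show "flat 1 x \<le> flat 1 y" if "x \<le> y"
  proof (cases "x > 0")
    case True
    then have "1 / y \<le> 1 / x" using that by (intro divide_left_mono) auto
    then show ?thesis using True that by (simp add: flat_def)
  qed (auto simp: flat_def)
qed

lemma flat_sum_pos: "0 < flat 1 x + flat 1 (- 1 * x + 1)"
  using flat_1(1,2)[of x] flat_1(1,2)[of "- 1 * x + 1"] by (cases "x > 0") (auto intro: add_pos_nonneg add_nonneg_pos)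

lemma smooth_smooth_step: "smooth smooth_step"
proof -
  have "flat 1 x + flat 1 (- 1 * x + 1) \<noteq> 0" for x using flat_sum_pos[of x] by simp
  then show ?thesis unfolding smooth_step_def[abs_def] by (intro smooth_intros smooth_flat)
qed

lemma smooth_step_0: "x \<le> 0 \<Longrightarrow> smooth_step x = 0"
  and smooth_step_1: "1 \<le> x \<Longrightarrow> smooth_step x = 1"
  using flat_1(3)[of x] flat_1(3)[of "- 1 * x + 1"] flat_sum_pos[of x] by (simp_all add: smooth_step_def)

lemma smooth_step_mono:
  assumes "x \<le> y"
  shows "smooth_step x \<le> smooth_step y"
proof -
  define p q p' q' where "p = flat 1 x" and "q = flat 1 (- 1 * x + 1)" and "p' = flat 1 y" and "q' = flat 1 (- 1 * y + 1)"
  have le: "p \<le> p'" "q' \<le> q" unfolding p_def p'_def q_def q'_def using assms by (auto intro!: flat_1(4))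
  have nn: "0 \<le> p" "0 \<le> q'" unfolding p_def q'_def by (rule flat_1)+
  have pos: "0 < p + q" "0 < p' + q'" unfolding p_def p'_def q_def q'_def by (rule flat_sum_pos)+
  have "p * q' \<le> p' * q" using le nn by (intro mult_mono) auto
  then have "p / (p + q) \<le> p' / (p' + q')" using pos by (simp add: field_simps)
  then show ?thesis by (simp add: smooth_step_def p_def p'_def q_def q'_def divide_inverse)
qed

lemma smooth_step_bounds: "0 \<le> smooth_step x" "smooth_step x \<le> 1"
  using smooth_step_mono[of "min x 0" x] smooth_step_0[of "min x 0"] smooth_step_mono[of x "max x 1"] smooth_step_1[of "max x 1"]
  by auto

definition bump :: "real \<Rightarrow> real" where "bump = deriv smooth_step"

lemma smooth_step_DERIV: "(smooth_step has_real_derivative bump x) (at x)"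
  unfolding bump_def by (rule smooth_DERIV[OF smooth_smooth_step])

lemma bump_isCont: "isCont bump x"
  unfolding bump_def by (rule smooth_isCont[OF smooth_deriv[OF smooth_smooth_step]])

lemma bump_nonneg: "0 \<le> bump x"
proof (rule ccontr)
  assume "\<not> 0 \<le> bump x"
  then obtain d where d: "d > 0" "\<forall>h>0. h < d \<longrightarrow> smooth_step (x + h) < smooth_step x"
    using DERIV_neg_dec_right[OF smooth_step_DERIV] by (meson not_le)
  have "smooth_step (x + d / 2) < smooth_step x" using d(1) d(2)[THEN spec, of "d / 2"] by linarith
  then show False using smooth_step_mono[of x "x + d / 2"] d(1) by simp
qed

lemma bump_out: "x \<notin> {0<..<1} \<Longrightarrow> bump x = 0"
proof -
  assume x: "x \<notin> {0<..<1}"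
  show "bump x = 0"
  proof (cases "x \<le> 0")
    case True
    have "smooth_step x \<le> smooth_step y" for y using smooth_step_0[OF True] smooth_step_bounds by simp
    then show ?thesis using DERIV_local_min[OF smooth_step_DERIV, of 1 x] by simp
  next
    case False
    then have "1 \<le> x" using x by simp
    then have "smooth_step y \<le> smooth_step x" for y using smooth_step_1[of x] smooth_step_bounds by simp
    then show ?thesis using DERIV_local_max[OF smooth_step_DERIV, of 1 x] by simp
  qed
qed

lemma bump_bounded: "\<exists>B>0. \<forall>x. bump x \<le> B"
proof -
  have "continuous_on {0..1} bump" by (intro continuous_at_imp_continuous_on) (simp add: bump_isCont)
  then obtain B where B: "B \<ge> 0" "\<forall>x\<in>{0..1}. \<bar>bump x\<bar> \<le> B" using continuous_on_Icc_bounded by blast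
  have "bump x \<le> B + 1" for x
  proof (cases "x \<in> {0..1}")
    case True
    then have "\<bar>bump x\<bar> \<le> B" using B(2) by blast
    then show ?thesis by linarith
  qed (use B(1) bump_out[of x] in auto)
  then show ?thesis using B by (intro exI[of _ "B + 1"]) auto
qed

text \<open>A smooth step from 0 to 1 on \<open>[c, c + e]\<close>, and its derivative.\<close>

definition step_at :: "real \<Rightarrow> real \<Rightarrow> real \<Rightarrow> real" where
  "step_at e c x = smooth_step (1 / e * x + - (c / e))"

definition bump_at :: "real \<Rightarrow> real \<Rightarrow> real \<Rightarrow> real" where
  "bump_at e c x = bump (1 / e * x + - (c / e)) / e"

lemma step_at:
  assumes "e > 0"
  shows "smooth (step_at e c)" "(step_at e c has_real_derivative bump_at e c x) (at x)"
    "0 \<le> step_at e c x" "step_at e c x \<le> 1" "x \<le> c \<Longrightarrow> step_at e c x = 0" "c + e \<le> x \<Longrightarrow> step_at e c x = 1"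
    "c \<le> d \<Longrightarrow> step_at e d x \<le> step_at e c x"
    "isCont (bump_at e c) x" "0 \<le> bump_at e c x" "x \<notin> {c<..<c + e} \<Longrightarrow> bump_at e c x = 0"
proof -
  have arg: "1 / e * x + - (c / e) = (x - c) / e" for x c by (simp add: diff_divide_distrib)
  show "smooth (step_at e c)" unfolding step_at_def[abs_def] by (intro smooth_intros smooth_smooth_step)
  show "(step_at e c has_real_derivative bump_at e c x) (at x)"
    unfolding step_at_def[abs_def] bump_at_def
    by (rule DERIV_cong[OF DERIV_chain2[where f = smooth_step and g = "\<lambda>x. 1 / e * x + - (c / e)"]])
       (use assms in \<open>auto intro!: derivative_eq_intros smooth_step_DERIV\<close>)
  show "0 \<le> step_at e c x" "step_at e c x \<le> 1" by (simp_all add: step_at_def smooth_step_bounds)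
  show "step_at e c x = 0" if "x \<le> c"
    unfolding step_at_def arg using that assms by (intro smooth_step_0) (simp add: divide_nonpos_pos)
  show "step_at e c x = 1" if "c + e \<le> x"
    unfolding step_at_def arg using that assms by (intro smooth_step_1) (simp add: field_simps)
  show "step_at e d x \<le> step_at e c x" if "c \<le> d"
    unfolding step_at_def arg using that assms by (intro smooth_step_mono divide_right_mono) auto
  show "isCont (bump_at e c) x" unfolding bump_at_def[abs_def]
    by (rule isCont_divide[OF isCont_o2[OF _ bump_isCont]]) (use assms in \<open>auto intro!: continuous_intros\<close>)
  show "0 \<le> bump_at e c x" unfolding bump_at_def using assms bump_nonneg by simp
  show "bump_at e c x = 0" if "x \<notin> {c<..<c + e}"
  proof -
    have "(x - c) / e \<notin> {0<..<1}" using that assms by (auto simp: field_simps)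
    from bump_out[OF this] show ?thesis unfolding bump_at_def arg by simp
  qed
qed

lemma plateau:
  assumes "e > 0" "c + e \<le> d"
  shows "smooth (\<lambda>x. step_at e c x - step_at e d x)"
    "((\<lambda>x. step_at e c x - step_at e d x) has_real_derivative bump_at e c x - bump_at e d x) (at x)"
    "0 \<le> step_at e c x - step_at e d x" "step_at e c x - step_at e d x \<le> 1"
    "x \<notin> {c<..<d + e} \<Longrightarrow> step_at e c x - step_at e d x = 0"
    "x \<in> {c + e..d} \<Longrightarrow> step_at e c x - step_at e d x = 1"
proof -
  note s = step_at[OF assms(1)]
  have "smooth (\<lambda>x. step_at e c x + (- 1) * step_at e d x)" by (intro smooth_intros s)
  then show "smooth (\<lambda>x. step_at e c x - step_at e d x)" by simp
  show "((\<lambda>x. step_at e c x - step_at e d x) has_real_derivative bump_at e c x - bump_at e d x) (at x)"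
    by (intro DERIV_diff s)
  show "0 \<le> step_at e c x - step_at e d x" using s(7)[of c d x] assms by simp
  show "step_at e c x - step_at e d x \<le> 1" using s(4)[of c x] s(3)[of d x] by simp
  show "step_at e c x - step_at e d x = 0" if "x \<notin> {c<..<d + e}"
    using that s(5)[of x c] s(5)[of x d] s(6)[of c x] s(6)[of d x] assms by auto
  show "step_at e c x - step_at e d x = 1" if "x \<in> {c + e..d}"
    using that s(6)[of c x] s(5)[of x d] by auto
qed

lemma bump_at_integral:
  assumes "e > 0"
  shows "integrable lborel (bump_at e c)" "(LINT x|lborel. bump_at e c x) = 1"
proof -
  have "has_bochner_integral lborel (\<lambda>x. bump_at e c x * indicator {c..c + e} x) (step_at e c (c + e) - step_at e c c)"
    by (rule has_bochner_integral_FTC_Icc_real) (use assms step_at(2,8)[OF assms] in auto)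
  moreover have "(\<lambda>x. bump_at e c x * indicator {c..c + e} x) = bump_at e c"
  proof
    fix x show "bump_at e c x * indicator {c..c + e} x = bump_at e c x"
      using step_at(10)[OF assms, of x c] by (cases "x \<in> {c<..<c + e}") auto
  qed
  ultimately have "has_bochner_integral lborel (bump_at e c) 1" using step_at(5,6)[OF assms, of c] step_at(6)[OF assms, of c "c + e"] by simp
  then show "integrable lborel (bump_at e c)" "(LINT x|lborel. bump_at e c x) = 1"
    by (auto simp: has_bochner_integral_iff)
qed

text \<open>\<open>bump_at e c\<close> is a probability density on \<open>[c, c + e]\<close>, so its integral against \<open>f\<close> is an
  average of values of \<open>f\<close>.\<close>

lemma mono_bump_integral:
  fixes f :: "real \<Rightarrow> real"
  assumes e: "e > 0" and [measurable]: "f \<in> borel_measurable borel"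
    and f: "\<And>x. x \<in> {c<..<c + e} \<Longrightarrow> l \<le> f x \<and> f x \<le> r"
  shows "integrable lborel (\<lambda>x. f x * bump_at e c x)"
    "l \<le> (LINT x|lborel. f x * bump_at e c x)" "(LINT x|lborel. f x * bump_at e c x) \<le> r"
proof -
  note b = bump_at_integral[OF e, of c]
  have [measurable]: "bump_at e c \<in> borel_measurable borel" using b(1) by (simp add: borel_measurable_integrable[where M = lborel, simplified])
  have le: "l * bump_at e c x \<le> f x * bump_at e c x \<and> f x * bump_at e c x \<le> r * bump_at e c x" for x
    using f[of x] step_at(9)[OF e, of c x] step_at(10)[OF e, of x c] by (cases "x \<in> {c<..<c + e}") (auto intro!: mult_right_mono)
  show int: "integrable lborel (\<lambda>x. f x * bump_at e c x)"
  proof (rule Bochner_Integration.integrable_bound)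
    show "integrable lborel (\<lambda>x. (\<bar>l\<bar> + \<bar>r\<bar>) * bump_at e c x)" using b by simp
    show "AE x in lborel. norm (f x * bump_at e c x) \<le> norm ((\<bar>l\<bar> + \<bar>r\<bar>) * bump_at e c x)"
    proof (rule AE_I2)
      fix x show "norm (f x * bump_at e c x) \<le> norm ((\<bar>l\<bar> + \<bar>r\<bar>) * bump_at e c x)"
        using f[of x] step_at(10)[OF e, of x c] by (cases "x \<in> {c<..<c + e}") (auto simp: abs_mult intro!: mult_right_mono)
    qed
  qed simp
  have "(LINT x|lborel. l * bump_at e c x) \<le> (LINT x|lborel. f x * bump_at e c x)"
    by (rule integral_mono) (use b int le in auto)
  then show "l \<le> (LINT x|lborel. f x * bump_at e c x)" using b by simp
  have "(LINT x|lborel. f x * bump_at e c x) \<le> (LINT x|lborel. r * bump_at e c x)"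
    by (rule integral_mono) (use b int le in auto)
  then show "(LINT x|lborel. f x * bump_at e c x) \<le> r" using b by simp
qed

section \<open>The distributional derivative of a monotone function\<close>

lemma test_function_plateau:
  assumes "e > 0" "c + e \<le> d" "a < c" "d + e < b"
  shows "test_function {a<..<b} (\<lambda>x. step_at e c x - step_at e d x)"
  unfolding test_function_def
proof (intro conjI allI)
  show "(deriv ^^ n) (\<lambda>x. step_at e c x - step_at e d x) differentiable (at x)" for n x
    by (rule smooth_iter[OF plateau(1)[OF assms(1,2)]])
  show "\<exists>K. compact K \<and> K \<subseteq> {a<..<b} \<and> (\<forall>x. x \<notin> K \<longrightarrow> step_at e c x - step_at e d x = 0)"
    by (rule exI[of _ "{c..d + e}"]) (use assms plateau(5)[OF assms(1,2)] in auto)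
qed

context monotone_function
begin

context
  fixes f :: "real \<Rightarrow> real" and \<mu> :: "real measure"
  assumes f: "\<And>x. x \<in> {a<..<b} \<Longrightarrow> f x = psi x"
    and \<mu>: "has_distributional_derivative {a<..<b} f \<mu>"
begin

lemma sets_distributional_derivative [measurable_cong]: "sets \<mu> = sets (restrict_space borel {a<..<b})"
  using \<mu> by (simp add: has_distributional_derivative_def)

lemma distributional_derivative_Icc_finite: "a < c \<Longrightarrow> d < b \<Longrightarrow> emeasure \<mu> {c..d} < \<infinity>"
proof -
  assume "a < c" "d < b"
  then have "compact {c..d} \<and> {c..d} \<subseteq> {a<..<b}" by auto
  then show "emeasure \<mu> {c..d} < \<infinity>" using \<mu> unfolding has_distributional_derivative_def by blast
qed

lemma distributional_derivative_plateau:
  assumes e: "e > 0" and cd: "c + e \<le> d" "a < c" "d + e < b"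
  shows "integrable \<mu> (\<lambda>x. step_at e c x - step_at e d x)"
    "(LINT x|\<mu>. step_at e c x - step_at e d x) =
       (LINT x|lborel. psi x * bump_at e d x) - (LINT x|lborel. psi x * bump_at e c x)"
proof -
  let ?p = "\<lambda>x. step_at e c x - step_at e d x"
  have "?p \<in> borel_measurable borel"
    by (intro borel_measurable_continuous_onI continuous_at_imp_continuous_on) (auto intro!: DERIV_isCont plateau(2)[OF e cd(1)])
  then have [measurable]: "?p \<in> borel_measurable \<mu>"
    using measurable_restrict_space1 measurable_cong_sets[OF sets_distributional_derivative refl] by blast
  have fin: "emeasure \<mu> {c..d + e} < \<infinity>" by (rule distributional_derivative_Icc_finite) (use cd in auto)
  have mem: "{c..d + e} \<in> sets \<mu>" unfolding sets_distributional_derivative by (subst sets_restrict_space_iff) (use cd in auto)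
  show "integrable \<mu> ?p"
  proof (rule Bochner_Integration.integrable_bound)
    show "integrable \<mu> (\<lambda>x. indicator {c..d + e} x :: real)" by (rule integrable_real_indicator[OF mem fin])
    show "AE x in \<mu>. norm (?p x) \<le> norm (indicator {c..d + e} x :: real)"
    proof (rule AE_I2)
      fix x show "norm (?p x) \<le> norm (indicator {c..d + e} x :: real)"
        using plateau(3-5)[OF e cd(1), of x] by (cases "x \<in> {c..d + e}") auto
    qed
  qed simp
  have der: "deriv ?p = (\<lambda>x. bump_at e c x - bump_at e d x)"
    using plateau(2)[OF e cd(1)] DERIV_imp_deriv by blast
  have bd: "psi c \<le> psi x \<and> psi x \<le> psi (c + e)" if "x \<in> {c<..<c + e}" for x using that cd e by (auto intro: psi_mono)
  have bd': "psi d \<le> psi x \<and> psi x \<le> psi (d + e)" if "x \<in> {d<..<d + e}" for x using that cd e by (auto intro: psi_mono)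
  note ints = mono_bump_integral(1)[where c = c, OF e psi_measurable bd]
    mono_bump_integral(1)[where c = d, OF e psi_measurable bd']
  have "(LINT x|\<mu>. ?p x) = - (LINT x|lebesgue_borel_on {a<..<b}. f x * deriv ?p x)"
    using \<mu> test_function_plateau[OF e cd] unfolding has_distributional_derivative_def by simp
  also have "(LINT x|lebesgue_borel_on {a<..<b}. f x * deriv ?p x) =
      (LINT x|lborel. indicator {a<..<b} x *\<^sub>R (f x * deriv ?p x))"
    by (rule integral_restrict_space) simp
  also have "\<dots> = (LINT x|lborel. psi x * bump_at e c x - psi x * bump_at e d x)"
  proof (rule Bochner_Integration.integral_cong)
    fix x show "indicator {a<..<b} x *\<^sub>R (f x * deriv ?p x) = psi x * bump_at e c x - psi x * bump_at e d x"
      using f[of x] step_at(10)[OF e, of x c] step_at(10)[OF e, of x d] cd e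
      by (cases "x \<in> {a<..<b}") (auto simp: der right_diff_distrib)
  qed simp
  also have "\<dots> = (LINT x|lborel. psi x * bump_at e c x) - (LINT x|lborel. psi x * bump_at e d x)"
    by (rule Bochner_Integration.integral_diff[OF ints])
  finally show "(LINT x|\<mu>. ?p x) = (LINT x|lborel. psi x * bump_at e d x) - (LINT x|lborel. psi x * bump_at e c x)"
    by simp
qed

text \<open>A plateau function lies between the indicators of \<open>[c + e, d]\<close> and \<open>(c, d + e)\<close>, and its
  integral is the difference of two averages of \<open>psi\<close>.\<close>

lemma distributional_derivative_bounds:
  assumes e: "e > 0" and cd: "c + e \<le> d" "a < c" "d + e < b"
  shows "measure \<mu> {c + e..d} \<le> psi (d + e) - psi c" "psi d - psi (c + e) \<le> measure \<mu> {c<..<d + e}"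
proof -
  let ?p = "\<lambda>x. step_at e c x - step_at e d x"
  note p = distributional_derivative_plateau[OF e cd]
  have sp: "space \<mu> = {a<..<b}" using sets_eq_imp_space_eq[OF sets_distributional_derivative] by simp
  have fin: "emeasure \<mu> {c..d + e} < \<infinity>" by (rule distributional_derivative_Icc_finite) (use cd in auto)
  have mem: "A \<in> sets \<mu>" if "A \<in> sets borel" "A \<subseteq> {c..d + e}" for A
    unfolding sets_distributional_derivative by (subst sets_restrict_space_iff) (use cd that in auto)
  have int: "integrable \<mu> (\<lambda>x. indicator A x :: real)" if "A \<in> sets borel" "A \<subseteq> {c..d + e}" for A
    using order.strict_trans1[OF emeasure_mono[OF that(2) mem[of "{c..d + e}"]] fin] mem[OF that]
    by (intro integrable_real_indicator) auto
  have bd: "psi c \<le> psi x \<and> psi x \<le> psi (c + e)" if "x \<in> {c<..<c + e}" for x using that cd e by (auto intro: psi_mono)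
  have bd': "psi d \<le> psi x \<and> psi x \<le> psi (d + e)" if "x \<in> {d<..<d + e}" for x using that cd e by (auto intro: psi_mono)
  note bounds = mono_bump_integral(2,3)[where c = c, OF e psi_measurable bd]
    mono_bump_integral(2,3)[where c = d, OF e psi_measurable bd']
  have "measure \<mu> {c + e..d} = (LINT x|\<mu>. indicator {c + e..d} x)"
    using mem[of "{c + e..d}"] e by (simp add: sets.Int_space_eq2)
  also have "\<dots> \<le> (LINT x|\<mu>. ?p x)"
  proof (rule integral_mono[OF int p(1)])
    fix x show "indicator {c + e..d} x \<le> ?p x"
      using plateau(3,6)[OF e cd(1), of x] by (cases "x \<in> {c + e..d}") auto
  qed (use e in auto)
  finally show "measure \<mu> {c + e..d} \<le> psi (d + e) - psi c" using p(2) bounds by linarith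
  have "(LINT x|\<mu>. ?p x) \<le> (LINT x|\<mu>. indicator {c<..<d + e} x)"
  proof (rule integral_mono[OF p(1) int])
    fix x show "?p x \<le> indicator {c<..<d + e} x"
      using plateau(4)[OF e cd(1), of x] plateau(5)[OF e cd(1), of x] by (cases "x \<in> {c<..<d + e}") simp_all
  qed auto
  also have "\<dots> = measure \<mu> {c<..<d + e}"
  proof -
    have "{c<..<d + e} \<in> sets \<mu>" by (rule mem) auto
    then show ?thesis by (simp add: sets.Int_space_eq2)
  qed
  finally show "psi d - psi (c + e) \<le> measure \<mu> {c<..<d + e}" using p(2) bounds by linarith
qed

lemma distributional_derivative_Ioc:
  assumes st: "a < s" "s < t" "t < b" and cont: "isCont psi s" "isCont psi t"
  shows "emeasure \<mu> {s<..t} = ennreal (psi t - psi s)"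
proof -
  have fin: "emeasure \<mu> {s..t} < \<infinity>" by (rule distributional_derivative_Icc_finite) (use st in auto)
  have mem: "A \<in> sets \<mu>" if "A \<in> sets borel" "A \<subseteq> {s..t}" for A
    unfolding sets_distributional_derivative by (subst sets_restrict_space_iff) (use st that in auto)
  have fin': "emeasure \<mu> A \<noteq> \<infinity>" if "A \<subseteq> {s..t}" for A
    using order.strict_trans1[OF emeasure_mono[OF that mem[of "{s..t}"]] fin] by simp
  have mm: "measure \<mu> A \<le> measure \<mu> B" if "A \<in> sets borel" "A \<subseteq> B" "B \<in> sets borel" "B \<subseteq> {s..t}" for A B
    by (rule measure_mono_fmeasurable) (use that fin'[of B] mem[of A] mem[of B] in \<open>auto intro!: fmeasurableI simp: less_top\<close>)
  define r where "r = min ((t - s) / 2) (min (s - a) (b - t))"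
  have r: "r > 0" using st by (simp add: r_def)
  have ev: "\<forall>\<^sub>F e in at_right 0. 0 < e \<and> e < r" using eventually_at_right[of 0 r] r by auto
  have upper: "measure \<mu> {s<..t} \<le> psi t - psi s"
  proof (rule tendsto_lowerbound)
    have "isCont (\<lambda>e. psi (t + e) - psi (s - e)) 0"
      using isCont_o2[where f = "\<lambda>e. t + e" and a = 0 and g = psi] isCont_o2[where f = "\<lambda>e. s - e" and a = 0 and g = psi] cont by (simp add: isCont_diff)
    then show "((\<lambda>e. psi (t + e) - psi (s - e)) \<longlongrightarrow> psi t - psi s) (at_right 0)"
      by (simp add: isCont_def filterlim_at_split)
    show "\<forall>\<^sub>F e in at_right 0. measure \<mu> {s<..t} \<le> psi (t + e) - psi (s - e)"
      using ev
    proof eventually_elim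
      case (elim e)
      have "measure \<mu> {s - e + e..t} \<le> psi (t + e) - psi (s - e)"
        by (rule distributional_derivative_bounds(1)) (use elim st in \<open>auto simp: r_def\<close>)
      moreover have "measure \<mu> {s<..t} \<le> measure \<mu> {s..t}" by (rule mm) auto
      ultimately show ?case by simp
    qed
  qed simp
  have lower: "psi t - psi s \<le> measure \<mu> {s<..t}"
  proof (rule tendsto_upperbound)
    have "isCont (\<lambda>e. psi (t - e) - psi (s + e)) 0"
      using isCont_o2[where f = "\<lambda>e. t - e" and a = 0 and g = psi] isCont_o2[where f = "\<lambda>e. s + e" and a = 0 and g = psi] cont by (simp add: isCont_diff)
    then show "((\<lambda>e. psi (t - e) - psi (s + e)) \<longlongrightarrow> psi t - psi s) (at_right 0)"
      by (simp add: isCont_def filterlim_at_split)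
    show "\<forall>\<^sub>F e in at_right 0. psi (t - e) - psi (s + e) \<le> measure \<mu> {s<..t}"
      using ev
    proof eventually_elim
      case (elim e)
      have "psi (t - e) - psi (s + e) \<le> measure \<mu> {s<..<t - e + e}"
        by (rule distributional_derivative_bounds(2)) (use elim st in \<open>auto simp: r_def\<close>)
      moreover have "measure \<mu> {s<..<t} \<le> measure \<mu> {s<..t}" by (rule mm) auto
      ultimately show ?case by simp
    qed
  qed simp
  have "emeasure \<mu> {s<..t} = ennreal (measure \<mu> {s<..t})"
    by (rule emeasure_eq_ennreal_measure) (use fin'[of "{s<..t}"] greaterThanAtMost_subseteq_atLeastAtMost_iff[of s t s t] in simp)
  then show ?thesis using upper lower by (simp add: antisym)
qed

lemma emeasure_distr_distributional_derivative:
  assumes "A \<in> sets borel"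
  shows "emeasure (distr \<mu> borel (\<lambda>x. x)) A = emeasure \<mu> (A \<inter> {a<..<b})"
proof -
  have "(\<lambda>x. x) \<in> measurable \<mu> borel"
    using measurable_restrict_space1[of "\<lambda>x. x" borel borel "{a<..<b}"] measurable_cong_sets[OF sets_distributional_derivative refl] by auto
  moreover have "space \<mu> = {a<..<b}" using sets_eq_imp_space_eq[OF sets_distributional_derivative] by simp
  ultimately show ?thesis using assms by (simp add: emeasure_distr)
qed

lemma stieltjes_derivative_distributional: "stieltjes_derivative a b psi (distr \<mu> borel (\<lambda>x. x))"
proof unfold_locales
  show "emeasure (distr \<mu> borel (\<lambda>x. x)) {s<..t} = ennreal (psi t - psi s)"
    if "a < s" "s < t" "t < b" "isCont psi s" "isCont psi t" for s t
  proof -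
    have "{s<..t} \<inter> {a<..<b} = {s<..t}" using that by auto
    then show ?thesis using that by (simp add: emeasure_distr_distributional_derivative distributional_derivative_Ioc)
  qed
qed (simp_all add: emeasure_distr_distributional_derivative)

end

end

lemma nn_integral_add_measure:
  assumes sets: "sets M = sets N" "sets Q = sets N"
    and eq: "\<And>A. A \<in> sets N \<Longrightarrow> emeasure Q A = emeasure M A + emeasure N A"
    and f: "f \<in> borel_measurable N"
  shows "(\<integral>\<^sup>+x. f x \<partial>Q) = (\<integral>\<^sup>+x. f x \<partial>M) + (\<integral>\<^sup>+x. f x \<partial>N)"
  using f
proof (induction f rule: borel_measurable_induct)
  case (cong f g)
  have sp: "space M = space N" "space Q = space N" using sets sets_eq_imp_space_eq by blast+
  have "(\<integral>\<^sup>+x. f x \<partial>R) = (\<integral>\<^sup>+x. g x \<partial>R)" if "space R = space N" for R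
    by (rule nn_integral_cong) (use cong that in auto)
  then show ?case using cong sp by metis
next
  case (set A)
  then show ?case using eq sets by simp
next
  case (mult u c)
  then have "u \<in> borel_measurable M" "u \<in> borel_measurable Q" using measurable_cong_sets sets by blast+
  with mult show ?case by (simp add: nn_integral_cmult distrib_left)
next
  case (add u v)
  then have "u \<in> borel_measurable M" "u \<in> borel_measurable Q" "v \<in> borel_measurable M" "v \<in> borel_measurable Q"
    using measurable_cong_sets sets by blast+
  with add show ?case by (simp add: nn_integral_add add.assoc add.left_commute)
next
  case (seq U)
  then have m: "U i \<in> borel_measurable M" "U i \<in> borel_measurable Q" for i using measurable_cong_sets sets by blast+
  have e: "integral\<^sup>N R (Sup (range U)) = (SUP i. integral\<^sup>N R (U i))" if "\<And>i. U i \<in> borel_measurable R" for R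
  proof -
    have "Sup (range U) = (\<lambda>x. SUP i. U i x)" by (auto simp: fun_eq_iff image_image)
    then show ?thesis using nn_integral_monotone_convergence_SUP[OF \<open>incseq U\<close> that] by simp
  qed
  have inc: "incseq (\<lambda>i. \<integral>\<^sup>+x. U i x \<partial>R)" for R
    using \<open>incseq U\<close> by (auto simp: incseq_def le_fun_def intro!: nn_integral_mono)
  have "integral\<^sup>N Q (Sup (range U)) = (SUP i. integral\<^sup>N M (U i) + integral\<^sup>N N (U i))"
    using seq by (simp only: e[OF m(2)])
  also have "\<dots> = (SUP i. integral\<^sup>N M (U i)) + (SUP i. integral\<^sup>N N (U i))"
    by (rule ennreal_SUP_add[OF inc inc])
  also have "\<dots> = integral\<^sup>N M (Sup (range U)) + integral\<^sup>N N (Sup (range U))"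
    using e[OF m(1)] e[OF seq(1)] by simp
  finally show ?case .
qed

lemma open_continuous_AE_0:
  fixes f :: "real \<Rightarrow> real"
  assumes S: "open S" "continuous_on S f" and AE: "AE x in lborel. x \<in> S \<longrightarrow> f x = 0" and x: "x \<in> S"
  shows "f x = 0"
proof (rule ccontr)
  assume nz: "f x \<noteq> 0"
  have "open (S \<inter> f -` (- {0}))" by (rule continuous_open_preimage[OF S(2,1)]) auto
  moreover have "S \<inter> f -` (- {0}) = {y \<in> S. f y \<noteq> 0}" by auto
  ultimately have "open {y \<in> S. f y \<noteq> 0}" by simp
  then obtain e where e: "e > 0" "cball x e \<subseteq> {y \<in> S. f y \<noteq> 0}" using nz x open_contains_cball by blast
  then have sub: "{x - e..x + e} \<subseteq> {y \<in> S. f y \<noteq> 0}" by (auto simp: cball_def dist_real_def subset_iff)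
  have "AE y in lborel. y \<notin> {x - e..x + e}" using AE by eventually_elim (use sub in auto)
  then have "emeasure lborel {x - e..x + e} = 0" by (subst (asm) AE_iff_measurable[where N = "{x - e..x + e}"]) auto
  then show False using e by simp
qed

section \<open>From admissible functions to the form domain\<close>

lemma test_function_props:
  assumes "test_function {c<..<d} \<phi>"
  shows "(\<phi> has_real_derivative deriv \<phi> x) (at x)" "isCont (deriv \<phi>) x"
    "x \<notin> {c<..<d} \<Longrightarrow> \<phi> x = 0" "x \<notin> {c<..<d} \<Longrightarrow> deriv \<phi> x = 0"
proof -
  obtain K where K: "compact K" "K \<subseteq> {c<..<d}" "\<And>x. x \<notin> K \<Longrightarrow> \<phi> x = 0"
    and diff: "\<And>n x. (deriv ^^ n) \<phi> differentiable (at x)"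
    using assms unfolding test_function_def by blast
  show D: "(\<phi> has_real_derivative deriv \<phi> x) (at x)" for x
    using diff[of 0 x] by (simp add: DERIV_deriv_iff_real_differentiable)
  have "deriv \<phi> differentiable (at x)" using diff[of 1 x] by simp
  then show "isCont (deriv \<phi>) x" by (rule differentiable_imp_continuous_within)
  show "\<phi> x = 0" if "x \<notin> {c<..<d}" using K that by blast
  show "deriv \<phi> x = 0" if "x \<notin> {c<..<d}"
  proof (rule DERIV_imp_deriv, rule has_field_derivative_transform_within_open[where f = "\<lambda>_. 0"])
    show "open (- K)" using compact_imp_closed[OF K(1)] by (rule open_Compl)
    show "x \<in> - K" using that K(2) by auto
    show "0 = \<phi> y" if "y \<in> - K" for y using K(3)[of y] that by simp
  qed simp
qed

lemma nn_integral_square_restrict: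
  fixes f :: "real \<Rightarrow> real"
  assumes "J \<in> sets borel"
  shows "(\<integral>\<^sup>+x. ennreal ((f x)\<^sup>2) \<partial>lebesgue_borel_on J) = (\<integral>\<^sup>+x. ennreal ((indicator J x * f x)\<^sup>2) \<partial>lborel)"
proof -
  have "(\<integral>\<^sup>+x. ennreal ((f x)\<^sup>2) \<partial>lebesgue_borel_on J) = (\<integral>\<^sup>+x. ennreal ((f x)\<^sup>2) * indicator J x \<partial>lborel)"
    by (rule nn_integral_restrict_space) (use assms in simp)
  also have "\<dots> = (\<integral>\<^sup>+x. ennreal ((indicator J x * f x)\<^sup>2) \<partial>lborel)"
    by (rule nn_integral_cong) (simp split: split_indicator)
  finally show ?thesis .
qed

lemma L2_restrict:
  fixes f :: "real \<Rightarrow> real"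
  assumes "J \<in> sets borel" "f \<in> L2 (lebesgue_borel_on J)"
  shows "(\<lambda>x. indicator J x * f x) \<in> borel_measurable borel"
    "integrable lborel (\<lambda>x. (indicator J x * f x)\<^sup>2)"
proof -
  have "f \<in> borel_measurable (lebesgue_borel_on J)" using assms(2) by (simp add: L2_def)
  then show m [measurable]: "(\<lambda>x. indicator J x * f x) \<in> borel_measurable borel"
    using assms(1) by (simp add: borel_measurable_restrict_space_iff)
  have "(\<integral>\<^sup>+x. ennreal ((indicator J x * f x)\<^sup>2) \<partial>lborel) < \<infinity>"
    using assms by (simp add: L2_def nn_integral_square_restrict)
  then show "integrable lborel (\<lambda>x. (indicator J x * f x)\<^sup>2)"
    by (intro integrableI_nonneg) auto
qed

text \<open>The approximating test functions are the integrals of their derivatives. These converge in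
  \<open>L\<^sup>2\<close> to \<open>g\<close>, so the test functions converge pointwise to the integral of \<open>g\<close>. By Fatou's lemma
  this limit equals \<open>v\<close> almost everywhere, hence everywhere by continuity. At \<open>d\<close> the limit is 0,
  which gives the boundary value.\<close>

lemma H10_primitive:
  assumes cd: "c < d" and H: "H10 {c<..<d} v g" and xy: "x \<le> y"
  defines "V \<equiv> \<lambda>x. indicator {c<..<d} x * v x" and "G \<equiv> \<lambda>x. indicator {c<..<d} x * g x"
  shows "V y - V x = (LBINT t:{x..y}. G t)"
proof -
  let ?J = "{c<..<d}"
  have vg: "v \<in> L2 (lebesgue_borel_on ?J)" "g \<in> L2 (lebesgue_borel_on ?J)" and cont: "continuous_on ?J v"
    using H by (auto simp: H10_def H1_def)
  have V [measurable]: "V \<in> borel_measurable borel" unfolding V_def by (rule L2_restrict(1)[OF _ vg(1)]) simp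
  have G [measurable]: "G \<in> borel_measurable borel" and G2: "integrable lborel (\<lambda>x. (G x)\<^sup>2)"
    unfolding G_def using L2_restrict[OF _ vg(2)] by auto
  obtain \<phi> where test: "\<And>n :: nat. test_function ?J (\<phi> n)" and
    lim: "(\<lambda>n. (\<integral>\<^sup>+x. ennreal ((\<phi> n x - v x)\<^sup>2) \<partial>lebesgue_borel_on ?J) +
              (\<integral>\<^sup>+x. ennreal ((deriv (\<phi> n) x - g x)\<^sup>2) \<partial>lebesgue_borel_on ?J)) \<longlonglongrightarrow> 0"
    using H unfolding H10_def by blast
  note T = test_function_props[OF test]
  have phi_m [measurable]: "\<phi> n \<in> borel_measurable borel" "deriv (\<phi> n) \<in> borel_measurable borel" for n
    by (intro borel_measurable_continuous_onI continuous_at_imp_continuous_on; use T DERIV_isCont in blast)+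
  have diffV: "indicator ?J x * (\<phi> n x - v x) = \<phi> n x - V x" for n x
    using T(3)[of x n] by (cases "x \<in> ?J") (auto simp: V_def)
  have diffG: "indicator ?J x * (deriv (\<phi> n) x - g x) = deriv (\<phi> n) x - G x" for n x
    using T(4)[of x n] by (cases "x \<in> ?J") (auto simp: G_def)
  have lim': "(\<lambda>n. (\<integral>\<^sup>+x. ennreal ((\<phi> n x - V x)\<^sup>2) \<partial>lborel) + (\<integral>\<^sup>+x. ennreal ((deriv (\<phi> n) x - G x)\<^sup>2) \<partial>lborel)) \<longlonglongrightarrow> 0"
    using lim by (simp add: nn_integral_square_restrict diffV diffG)
  have limV: "(\<lambda>n. \<integral>\<^sup>+x. ennreal ((\<phi> n x - V x)\<^sup>2) \<partial>lborel) \<longlonglongrightarrow> 0"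
    by (rule tendsto_sandwich[OF _ _ tendsto_const lim']) (auto intro!: always_eventually)
  have limG: "(\<lambda>n. \<integral>\<^sup>+x. ennreal ((deriv (\<phi> n) x - G x)\<^sup>2) \<partial>lborel) \<longlonglongrightarrow> 0"
    by (rule tendsto_sandwich[OF _ _ tendsto_const lim']) (auto intro!: always_eventually)
  have sqint: "integrable lborel (\<lambda>x. (deriv (\<phi> n) x - G x)\<^sup>2)" for n
  proof -
    have "continuous_on {c..d} (deriv (\<phi> n))" using T(2) by (intro continuous_at_imp_continuous_on) auto
    then obtain B where B: "B \<ge> 0" "\<forall>x\<in>{c..d}. \<bar>deriv (\<phi> n) x\<bar> \<le> B" using continuous_on_Icc_bounded by blast
    have int: "integrable lborel (\<lambda>x. (deriv (\<phi> n) x)\<^sup>2)"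
    proof (rule integrable_bounded_support[where c = c and d = d and B = "B\<^sup>2"])
      show "\<bar>(deriv (\<phi> n) x)\<^sup>2\<bar> \<le> B\<^sup>2" if "x \<in> {c..d}" for x
        using B(2)[rule_format, OF that] by (simp add: power2_le_iff_abs_le[OF B(1)])
    qed (use T(4) in auto)
    show ?thesis
    proof (rule Bochner_Integration.integrable_bound)
      show "integrable lborel (\<lambda>x. 2 * (deriv (\<phi> n) x)\<^sup>2 + 2 * (G x)\<^sup>2)" using int G2 by simp
      show "AE x in lborel. norm ((deriv (\<phi> n) x - G x)\<^sup>2) \<le> norm (2 * (deriv (\<phi> n) x)\<^sup>2 + 2 * (G x)\<^sup>2)"
      proof (rule AE_I2)
        fix x
        have "0 \<le> (deriv (\<phi> n) x + G x)\<^sup>2" by simp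
        then have "(deriv (\<phi> n) x - G x)\<^sup>2 \<le> 2 * (deriv (\<phi> n) x)\<^sup>2 + 2 * (G x)\<^sup>2"
          by (simp add: power2_eq_square algebra_simps)
        then show "norm ((deriv (\<phi> n) x - G x)\<^sup>2) \<le> norm (2 * (deriv (\<phi> n) x)\<^sup>2 + 2 * (G x)\<^sup>2)"
          by (simp add: abs_of_nonneg)
      qed
    qed simp
  qed
  define eps where "eps n = (LINT x|lborel. (deriv (\<phi> n) x - G x)\<^sup>2)" for n
  have "(\<lambda>n. ennreal (eps n)) \<longlonglongrightarrow> ennreal 0"
    using limG unfolding eps_def by (simp add: nn_integral_eq_integral[OF sqint])
  then have eps: "eps \<longlonglongrightarrow> 0" by (subst (asm) tendsto_ennreal_iff) (auto simp: eps_def)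
  have G_int: "set_integrable lborel {p..q} G" for p q by (rule set_integrable_Icc_L2[OF G G2])
  have phi_lim: "(\<lambda>n. \<phi> n q - \<phi> n p) \<longlonglongrightarrow> (LBINT t:{p..q}. G t)" if pq: "p \<le> q" for p q
  proof -
    have sq: "((\<phi> n q - \<phi> n p) - (LBINT t:{p..q}. G t))\<^sup>2 \<le> (q - p) * eps n" for n
    proof -
      have ftc: "has_bochner_integral lborel (\<lambda>t. deriv (\<phi> n) t * indicator {p..q} t) (\<phi> n q - \<phi> n p)"
        by (rule has_bochner_integral_FTC_Icc_real[OF pq]) (use T in auto)
      then have si: "set_integrable lborel {p..q} (deriv (\<phi> n))" and
        eq: "(LBINT t:{p..q}. deriv (\<phi> n) t) = \<phi> n q - \<phi> n p"
        by (auto simp: has_bochner_integral_iff set_integrable_def set_lebesgue_integral_def mult.commute)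
      have "(\<phi> n q - \<phi> n p) - (LBINT t:{p..q}. G t) = (LBINT t:{p..q}. deriv (\<phi> n) t - G t)"
        by (simp add: eq set_integral_diff(2)[OF si G_int])
      then show ?thesis
        using Icc_integral_square_le[of "\<lambda>t. deriv (\<phi> n) t - G t" p q, OF _ sqint pq] by (simp add: eps_def)
    qed
    have lim0: "(\<lambda>n. (q - p) * eps n) \<longlonglongrightarrow> 0" using tendsto_mult_right_zero[OF eps] by simp
    have "(\<lambda>n. ((\<phi> n q - \<phi> n p) - (LBINT t:{p..q}. G t))\<^sup>2) \<longlonglongrightarrow> 0"
      by (rule tendsto_sandwich[OF _ _ tendsto_const lim0]) (use sq in auto)
    then have "(\<lambda>n. (\<phi> n q - \<phi> n p) - (LBINT t:{p..q}. G t)) \<longlonglongrightarrow> 0" by (simp add: power_tendsto_0_iff)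
    then show ?thesis by (simp add: LIM_zero_iff)
  qed
  define W where "W z = (LBINT t:{c..z}. G t)" for z
  have W_lim: "(\<lambda>n. \<phi> n z) \<longlonglongrightarrow> W z" if "c \<le> z" for z
    using phi_lim[OF that] T(3)[of c] by (simp add: W_def)
  have W_cont: "continuous_on {c..d} W"
  proof -
    have "continuous_on {c..d} (\<lambda>z. integral {c..z} G)"
      by (rule indefinite_integral_continuous_1) (rule set_borel_integral_eq_integral(1)[OF G_int])
    moreover have "(\<lambda>z. integral {c..z} G) = W" by (simp add: fun_eq_iff W_def set_borel_integral_eq_integral(2)[OF G_int])
    ultimately show ?thesis by (simp only:)
  qed
  have W_cont': "continuous_on ?J W" by (rule continuous_on_subset[OF W_cont]) auto
  have VW: "V z = W z" if z: "z \<in> ?J" for z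
  proof -
    have W_m [measurable]: "(\<lambda>x. indicator ?J x * W x) \<in> borel_measurable borel"
      using borel_measurable_continuous_on_indicator[OF _ W_cont'] by simp
    have "(\<integral>\<^sup>+x. ennreal ((indicator ?J x * W x - V x)\<^sup>2) \<partial>lborel) \<le>
        (\<integral>\<^sup>+x. liminf (\<lambda>n. ennreal ((\<phi> n x - V x)\<^sup>2)) \<partial>lborel)"
    proof (rule nn_integral_mono)
      fix x
      have "(\<lambda>n. \<phi> n x) \<longlonglongrightarrow> indicator ?J x * W x"
        using W_lim[of x] T(3)[of x] by (cases "x \<in> ?J") auto
      then have "(\<lambda>n. ennreal ((\<phi> n x - V x)\<^sup>2)) \<longlonglongrightarrow> ennreal ((indicator ?J x * W x - V x)\<^sup>2)"
        by (intro tendsto_intros)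
      from lim_imp_Liminf[OF _ this]
      show "ennreal ((indicator ?J x * W x - V x)\<^sup>2) \<le> liminf (\<lambda>n. ennreal ((\<phi> n x - V x)\<^sup>2))" by simp
    qed
    also have "\<dots> \<le> liminf (\<lambda>n. \<integral>\<^sup>+x. ennreal ((\<phi> n x - V x)\<^sup>2) \<partial>lborel)" by (rule nn_integral_liminf) simp
    also have "\<dots> = 0" using lim_imp_Liminf[OF _ limV] by simp
    finally have "(\<integral>\<^sup>+x. ennreal ((indicator ?J x * W x - V x)\<^sup>2) \<partial>lborel) = 0" by simp
    then have "AE x in lborel. ennreal ((indicator ?J x * W x - V x)\<^sup>2) = 0"
      by (subst (asm) nn_integral_0_iff_AE) auto
    then have AE: "AE x in lborel. x \<in> ?J \<longrightarrow> W x - v x = 0" by eventually_elim (auto simp: V_def)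
    have "W z - v z = 0"
      by (rule open_continuous_AE_0[OF _ _ AE z])
         (auto intro!: continuous_on_diff cont W_cont')
    then show ?thesis using z by (simp add: V_def)
  qed
  have V_lim: "(\<lambda>n. \<phi> n z) \<longlonglongrightarrow> V z" for z
    using T(3)[of z] W_lim[of z] VW[of z] by (cases "z \<in> ?J") (auto simp: V_def)
  show ?thesis by (rule LIMSEQ_unique[OF tendsto_diff[OF V_lim V_lim] phi_lim[OF xy]])
qed

text \<open>The interval \<open>(a, b)\<close> is the interior of the finiteness domain, and \<open>psi\<close> is extended by
  zero. The measure \<open>q\<close> is described by its values inside the interval and by the vanishing of
  continuous functions outside.\<close>

locale potential_interval = stieltjes_derivative a b psi M for a b psi M +
  fixes q :: "real measure"
  assumes sets_q: "sets q = sets (restrict_space borel I_pi)"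
    and bounds: "- (pi / 2) \<le> a" "b \<le> pi / 2"
    and psi_out: "\<And>x. x \<notin> {a<..<b} \<Longrightarrow> psi x = 0"
    and q_inside: "\<And>A. A \<in> sets borel \<Longrightarrow> A \<subseteq> {a<..<b} \<Longrightarrow>
      emeasure q A = emeasure M A + (\<integral>\<^sup>+x\<in>A. ennreal ((psi x)\<^sup>2) \<partial>lborel)"
    and q_vanish: "\<And>v x. continuous_on I_pi v \<Longrightarrow> v \<in> L2 q \<Longrightarrow> x \<in> I_pi \<Longrightarrow> x \<notin> {a<..<b} \<Longrightarrow> v x = 0"
begin

lemma nn_integral_q_ge:
  assumes [measurable]: "w \<in> borel_measurable borel" and w: "\<And>x. x \<in> I_pi \<Longrightarrow> w x \<le> f x"
    and w_out: "\<And>x. x \<notin> {a<..<b} \<Longrightarrow> w x = (0::ennreal)"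
  shows "(\<integral>\<^sup>+x. w x \<partial>M) + (\<integral>\<^sup>+x. ennreal ((psi x)\<^sup>2) * w x \<partial>lborel) \<le> (\<integral>\<^sup>+x. f x \<partial>q)"
proof -
  have sp: "space q = I_pi" using sets_eq_imp_space_eq[OF sets_q] by simp
  have id [measurable]: "(\<lambda>x. x) \<in> measurable q borel"
    using measurable_restrict_space1[of "\<lambda>x. x" borel borel I_pi] measurable_cong_sets[OF sets_q refl] by auto
  define Q where "Q = density (distr q borel (\<lambda>x. x)) (indicator {a<..<b})"
  define N where "N = density lborel (\<lambda>x. ennreal ((psi x)\<^sup>2))"
  have Q: "emeasure Q A = emeasure M A + emeasure N A" if [measurable]: "A \<in> sets borel" for A
  proof -
    have "emeasure Q A = (\<integral>\<^sup>+x. indicator {a<..<b} x * indicator A x \<partial>distr q borel (\<lambda>x. x))"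
      unfolding Q_def by (rule emeasure_density) auto
    also have "\<dots> = (\<integral>\<^sup>+x. indicator (A \<inter> {a<..<b}) x \<partial>distr q borel (\<lambda>x. x))"
      by (rule nn_integral_cong) (simp split: split_indicator)
    also have "\<dots> = emeasure (distr q borel (\<lambda>x. x)) (A \<inter> {a<..<b})" by simp
    also have "\<dots> = emeasure q (A \<inter> {a<..<b} \<inter> I_pi)" by (subst emeasure_distr) (auto simp: sp)
    also have "A \<inter> {a<..<b} \<inter> I_pi = A \<inter> {a<..<b}" using bounds by auto
    also have "emeasure q (A \<inter> {a<..<b}) = emeasure M (A \<inter> {a<..<b}) + (\<integral>\<^sup>+x\<in>A \<inter> {a<..<b}. ennreal ((psi x)\<^sup>2) \<partial>lborel)"
      by (rule q_inside) auto
    also have "emeasure M (A \<inter> {a<..<b}) = emeasure M A"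
    proof -
      have "- {a<..<b} \<in> null_sets M" by (intro null_setsI M_out) (auto simp: sets_M)
      from emeasure_Diff_null_set[OF this, of A] show ?thesis by (simp add: Diff_Compl sets_M)
    qed
    also have "(\<integral>\<^sup>+x\<in>A \<inter> {a<..<b}. ennreal ((psi x)\<^sup>2) \<partial>lborel) = (\<integral>\<^sup>+x. ennreal ((psi x)\<^sup>2) * indicator A x \<partial>lborel)"
      by (rule nn_integral_cong) (use psi_out in \<open>auto split: split_indicator\<close>)
    also have "\<dots> = emeasure N A" unfolding N_def by (rule emeasure_density[symmetric]) auto
    finally show ?thesis .
  qed
  have "(\<integral>\<^sup>+x. w x \<partial>M) + (\<integral>\<^sup>+x. ennreal ((psi x)\<^sup>2) * w x \<partial>lborel) = (\<integral>\<^sup>+x. w x \<partial>M) + (\<integral>\<^sup>+x. w x \<partial>N)"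
    unfolding N_def by (subst nn_integral_density) auto
  also have "\<dots> = (\<integral>\<^sup>+x. w x \<partial>Q)"
    by (rule nn_integral_add_measure[symmetric]) (use Q in \<open>auto simp: sets_M N_def Q_def\<close>)
  also have "\<dots> = (\<integral>\<^sup>+x. indicator {a<..<b} x * w x \<partial>distr q borel (\<lambda>x. x))"
    unfolding Q_def by (rule nn_integral_density) auto
  also have "\<dots> = (\<integral>\<^sup>+x. indicator {a<..<b} x * w x \<partial>q)" by (rule nn_integral_distr) auto
  also have "\<dots> \<le> (\<integral>\<^sup>+x. f x \<partial>q)"
    by (rule nn_integral_mono) (use w sp in \<open>auto split: split_indicator\<close>)
  finally show ?thesis .
qed

text \<open>The function \<open>v'\<close> is \<open>v\<close>, extended by zero. Cutting \<open>g\<close> off outside \<open>(a, b)\<close> can only lower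
  the numerator, and \<open>g'\<close> is still the derivative of \<open>v'\<close>, because the integral of \<open>g\<close> over an
  interval on which \<open>v\<close> vanishes is 0.\<close>

lemma rayleigh_ge:
  assumes adm: "admissible I_pi q v g"
  shows "\<exists>v' g'. form_domain v' g' \<and> 0 < mass v' \<and> ennreal (energy v' g' / mass v') \<le> rayleigh I_pi q v g"
proof -
  define v' g' where "v' x = indicator {a<..<b} x * v x" and "g' x = indicator {a<..<b} x * g x" for x
  have H: "H10 I_pi v g" and vq: "v \<in> L2 q" and nz: "\<exists>x\<in>I_pi. v x \<noteq> 0"
    using adm by (auto simp: admissible_def)
  have L2: "v \<in> L2 (lebesgue_borel_on I_pi)" "g \<in> L2 (lebesgue_borel_on I_pi)" and cont: "continuous_on I_pi v"
    using H by (auto simp: H10_def H1_def)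
  have sub: "{a<..<b} \<subseteq> I_pi" using bounds by auto
  note V = L2_restrict[OF _ L2(1), simplified] and G = L2_restrict[OF _ L2(2), simplified]
  have v'_eq: "indicator I_pi x * v x = v' x" for x
    using q_vanish[OF cont vq, of x] sub by (auto simp: v'_def split: split_indicator)
  have g'_eq: "indicator {a<..<b} x * (indicator I_pi x * g x) = g' x" for x
    using sub by (auto simp: g'_def split: split_indicator)
  have v'_m [measurable]: "v' \<in> borel_measurable borel" using V(1) by (simp add: v'_eq)
  have g'_m [measurable]: "g' \<in> borel_measurable borel"
  proof -
    have "(\<lambda>x. indicator {a<..<b} x * (indicator I_pi x * g x)) \<in> borel_measurable borel"
      by (intro borel_measurable_times borel_measurable_indicator G(1)) simp
    then show ?thesis by (simp add: g'_eq)
  qed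
  have g'2: "integrable lborel (\<lambda>x. (g' x)\<^sup>2)"
  proof (rule Bochner_Integration.integrable_bound[OF G(2)])
    show "AE x in lborel. norm ((g' x)\<^sup>2) \<le> norm ((indicator I_pi x * g x)\<^sup>2)"
      by (rule AE_I2) (simp add: g'_eq[symmetric] split: split_indicator)
  qed simp
  have diff: "v' y - v' x = (LBINT t:{x..y}. g' t)" if xy: "x \<le> y" for x y
  proof -
    \<comment> \<open>the projection onto \<open>[a, b]\<close>, which changes neither the values of \<open>v'\<close> nor the integrals of \<open>g'\<close>\<close>
    define cl where "cl z = max a (min b z)" for z
    have v'_cl: "v' (cl z) = v' z" for z using ab by (auto simp: cl_def v'_def max_def min_def)
    have cl: "cl x \<le> cl y" using xy by (auto simp: cl_def)
    have pi: "- (pi / 2) < pi / 2" by simp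
    have "v' y - v' x = (LBINT t:{cl x..cl y}. indicator I_pi t * g t)"
      using H10_primitive[OF pi H cl] by (simp add: v'_eq v'_cl)
    also have "\<dots> = (LBINT t:{x..y}. g' t)" unfolding set_lebesgue_integral_def
    proof (rule integral_cong_AE)
      show "AE t in lborel. indicator {cl x..cl y} t *\<^sub>R (indicator I_pi t * g t) = indicator {x..y} t *\<^sub>R g' t"
        using AE_lborel_singleton[of a] AE_lborel_singleton[of b]
      proof eventually_elim
        case (elim t)
        show ?case
        proof (cases "t \<in> {a<..<b}")
          case True
          then have "t \<in> {cl x..cl y} \<longleftrightarrow> t \<in> {x..y}" "t \<in> I_pi" using sub by (auto simp: cl_def)
          then show ?thesis using True by (simp add: g'_def split: split_indicator)
        next
          case False
          then have "t \<notin> {cl x..cl y}" using elim ab by (auto simp: cl_def)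
          then show ?thesis using False by (simp add: g'_def)
        qed
      qed
    qed (use G(1) in simp_all)
    finally show ?thesis .
  qed
  have q_ge: "(\<integral>\<^sup>+x. ennreal ((v' x)\<^sup>2) \<partial>M) + (\<integral>\<^sup>+x. ennreal ((psi x * v' x)\<^sup>2) \<partial>lborel) \<le> (\<integral>\<^sup>+x. ennreal ((v x)\<^sup>2) \<partial>q)"
    using nn_integral_q_ge[of "\<lambda>x. ennreal ((v' x)\<^sup>2)" "\<lambda>x. ennreal ((v x)\<^sup>2)"]
    by (simp add: ennreal_mult[symmetric] power_mult_distrib) (auto simp: v'_def split: split_indicator)
  have fin: "(\<integral>\<^sup>+x. ennreal ((v x)\<^sup>2) \<partial>q) < \<infinity>" using vq by (simp add: L2_def)
  have psi2: "integrable lborel (\<lambda>x. (psi x * v' x)\<^sup>2)"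
  proof (rule integrableI_nonneg)
    have "(\<integral>\<^sup>+x. ennreal ((psi x * v' x)\<^sup>2) \<partial>lborel) \<le> (\<integral>\<^sup>+x. ennreal ((v x)\<^sup>2) \<partial>q)"
      by (rule order_trans[OF _ q_ge]) simp
    then show "(\<integral>\<^sup>+x. ennreal ((psi x * v' x)\<^sup>2) \<partial>lborel) < \<infinity>" using fin by (rule order.strict_trans1)
  qed auto
  have "g' x = 0 \<and> v' x = 0" if "x \<notin> {a<..<b}" for x using that by (simp add: v'_def g'_def)
  then have dom: "form_domain v' g'"
    unfolding form_domain_def using g'2 psi2 diff g'_m by blast
  have mass: "(\<integral>\<^sup>+x. ennreal ((v x)\<^sup>2) \<partial>lebesgue_borel_on I_pi) = ennreal (mass v')"
    unfolding mass_def by (simp add: nn_integral_square_restrict v'_eq nn_integral_eq_integral[OF dom_v2[OF dom]])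
  have mass_pos: "0 < mass v'"
  proof (rule ccontr)
    assume "\<not> 0 < mass v'"
    then have "(\<integral>\<^sup>+x. ennreal ((v' x)\<^sup>2) \<partial>lborel) = 0"
      unfolding mass_def by (simp add: nn_integral_eq_integral[OF dom_v2[OF dom]] ennreal_neg)
    then have "AE x in lborel. ennreal ((v' x)\<^sup>2) = 0" by (subst (asm) nn_integral_0_iff_AE) auto
    then have AE: "AE x in lborel. x \<in> I_pi \<longrightarrow> v x = 0"
      by eventually_elim (auto simp: v'_eq[symmetric])
    show False using nz open_continuous_AE_0[OF _ cont AE] by auto
  qed
  have "ennreal (energy v' g') = (\<integral>\<^sup>+x. ennreal ((g' x)\<^sup>2) \<partial>lborel) +
      ((\<integral>\<^sup>+x. ennreal ((v' x)\<^sup>2) \<partial>M) + (\<integral>\<^sup>+x. ennreal ((psi x * v' x)\<^sup>2) \<partial>lborel))"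
    unfolding energy_eq[OF dom]
    by (simp add: nn_integral_eq_integral[OF g'2] nn_integral_eq_integral[OF psi2]
        nn_integral_eq_integral[OF square_integrable_M[OF dom]] add.commute)
  also have "\<dots> \<le> (\<integral>\<^sup>+x. ennreal ((g x)\<^sup>2) \<partial>lebesgue_borel_on I_pi) + (\<integral>\<^sup>+x. ennreal ((v x)\<^sup>2) \<partial>q)"
  proof (rule add_mono[OF _ q_ge])
    show "(\<integral>\<^sup>+x. ennreal ((g' x)\<^sup>2) \<partial>lborel) \<le> (\<integral>\<^sup>+x. ennreal ((g x)\<^sup>2) \<partial>lebesgue_borel_on I_pi)"
      unfolding nn_integral_square_restrict[of I_pi g, simplified]
      by (rule nn_integral_mono) (auto simp: g'_eq[symmetric] split: split_indicator)
  qed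
  finally have "ennreal (energy v' g') / ennreal (mass v') \<le> rayleigh I_pi q v g"
    unfolding rayleigh_def mass by (rule divide_right_mono_ennreal)
  then have "ennreal (energy v' g' / mass v') \<le> rayleigh I_pi q v g"
    using mass_pos by (simp add: divide_ennreal energy_def)
  then show ?thesis using dom mass_pos by blast
qed

lemma lambda1_ge_lam0: "ennreal lam0 \<le> lambda1 I_pi q"
  unfolding lambda1_def
proof (rule Inf_greatest, clarify)
  fix v g assume "admissible I_pi q v g"
  then obtain v' g' where *: "form_domain v' g'" "0 < mass v'" "ennreal (energy v' g' / mass v') \<le> rayleigh I_pi q v g"
    using rayleigh_ge by blast
  have "lam0 \<le> energy v' g' / mass v'" using lam0_le[OF *(1)] *(2) by (simp add: field_simps)
  then show "ennreal lam0 \<le> rayleigh I_pi q v g" using *(3) by (meson ennreal_leI order_trans)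
qed

end

section \<open>Potentials of functions with the tangent bound\<close>

lemma open_bounded_interval:
  fixes S :: "real set"
  assumes "open S" "is_interval S" "S \<noteq> {}" "S \<subseteq> {c<..<d}"
  shows "\<exists>a b. a < b \<and> S = {a<..<b}"
proof -
  have bdd: "bdd_above S" "bdd_below S" using assms(4) by (meson bdd_above_Ioo bdd_above_mono, meson bdd_below_Ioo bdd_below_mono)
  have "S = {Inf S<..<Sup S}"
  proof
    show "S \<subseteq> {Inf S<..<Sup S}"
    proof
      fix x assume x: "x \<in> S"
      then obtain e where e: "e > 0" "cball x e \<subseteq> S" using assms(1) open_contains_cball by blast
      then have "x - e \<in> S" "x + e \<in> S" by (auto simp: cball_def dist_real_def subset_iff)
      then have "Inf S \<le> x - e" "x + e \<le> Sup S" using bdd by (auto intro: cInf_lower cSup_upper)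
      then show "x \<in> {Inf S<..<Sup S}" using e by simp
    qed
    show "{Inf S<..<Sup S} \<subseteq> S"
    proof
      fix x assume "x \<in> {Inf S<..<Sup S}"
      then obtain p q where "p \<in> S" "p < x" "q \<in> S" "x < q"
        using cInf_less_iff[OF assms(3) bdd(2)] less_cSup_iff[OF assms(3) bdd(1)] by auto
      then show "x \<in> S" using assms(2) unfolding is_interval_1 by (meson less_imp_le)
    qed
  qed
  moreover have "Inf S < Sup S" using calculation assms(3) by (metis greaterThanLessThan_empty_iff not_le)
  ultimately show ?thesis by blast
qed

lemma is_interval_finite_dom:
  assumes "mono_on I_pi \<psi>"
  shows "is_interval (finite_dom \<psi>)"
  unfolding is_interval_1
proof (intro ballI allI impI)
  fix p q x assume pq: "p \<in> finite_dom \<psi>" "q \<in> finite_dom \<psi>" and x: "p \<le> x \<and> x \<le> q"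
  then have I: "x \<in> I_pi" by (auto simp: finite_dom_def)
  then have "\<psi> p \<le> \<psi> x" "\<psi> x \<le> \<psi> q"
    using assms pq x by (auto simp: finite_dom_def mono_on_def)
  then show "x \<in> finite_dom \<psi>" using pq I
    by (cases "\<psi> p"; cases "\<psi> q"; cases "\<psi> x") (auto simp: finite_dom_def)
qed

text \<open>The measure is infinite at every point off the finiteness domain, so \<open>w\<close> vanishes there; by
  continuity the open set where \<open>w\<close> is not 0 lies in the interior of the domain.\<close>

lemma potential_vanish:
  assumes pot: "is_potential \<psi> q" and w: "continuous_on I_pi w" "w \<in> L2 q"
    and x: "x \<in> I_pi" "x \<notin> interior (finite_dom \<psi>)"
  shows "w x = 0"
proof (rule ccontr)
  assume nz: "w x \<noteq> 0"
  have sets_q: "sets q = sets (restrict_space borel I_pi)" using pot by (simp add: is_potential_def)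
  have off: "w y = 0" if y: "y \<in> I_pi" "y \<notin> finite_dom \<psi>" for y
  proof (rule ccontr)
    assume wy: "w y \<noteq> 0"
    have mem: "{y} \<in> sets q" unfolding sets_q by (subst sets_restrict_space_iff) (use y in auto)
    have "emeasure q {y} = \<infinity>" using pot mem y(2) unfolding is_potential_def by auto
    then have "\<infinity> = (\<integral>\<^sup>+z. ennreal ((w y)\<^sup>2) * indicator {y} z \<partial>q)"
      using mem wy by (simp add: nn_integral_cmult_indicator ennreal_mult_top)
    also have "\<dots> \<le> (\<integral>\<^sup>+z. ennreal ((w z)\<^sup>2) \<partial>q)"
      by (rule nn_integral_mono) (simp split: split_indicator)
    finally show False using w(2) by (simp add: L2_def top_unique)
  qed
  have "open (I_pi \<inter> w -` (- {0}))" by (rule continuous_open_preimage[OF w(1)]) auto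
  moreover have "I_pi \<inter> w -` (- {0}) \<subseteq> finite_dom \<psi>" using off by blast
  ultimately have "I_pi \<inter> w -` (- {0}) \<subseteq> interior (finite_dom \<psi>)" by (rule interior_maximal[rotated])
  then show False using nz x by auto
qed

lemma ex_potential_interval:
  assumes A: "\<psi> \<in> class_A" and pot: "is_potential \<psi> q" and adm: "admissible I_pi q v g"
  shows "\<exists>a b psi M. potential_interval a b psi M q \<and>
    (\<forall>x y. a < x \<longrightarrow> x < y \<longrightarrow> y < b \<longrightarrow> 2 * tan ((y - x) / 2) \<le> psi y - psi x)"
proof -
  have mono: "mono_on I_pi \<psi>" using A by (simp add: class_A_def)
  let ?D = "finite_dom \<psi>"
  have D: "?D \<subseteq> I_pi" by (auto simp: finite_dom_def)
  have "interior ?D \<noteq> {}"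
  proof
    assume "interior ?D = {}"
    then have "v x = 0" if "x \<in> I_pi" for x
      using potential_vanish[OF pot, of v x] adm that by (auto simp: admissible_def H10_def)
    then show False using adm by (auto simp: admissible_def)
  qed
  moreover have "is_interval (interior ?D)"
    using is_interval_finite_dom[OF mono] by (simp add: is_interval_convex_1 convex_interior)
  moreover have "interior ?D \<subseteq> I_pi" using D interior_subset by blast
  ultimately obtain a b where ab: "a < b" and int: "interior ?D = {a<..<b}"
    using open_bounded_interval[of "interior ?D"] by (metis open_interior)
  have sub: "{a<..<b} \<subseteq> ?D" unfolding int[symmetric] by (rule interior_subset)
  then have bounds: "- (pi / 2) \<le> a" "b \<le> pi / 2"
    using D ab greaterThanLessThan_subseteq_greaterThanLessThan[of a b "- (pi / 2)" "pi / 2"] by auto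
  define psi where "psi x = (if x \<in> {a<..<b} then real_of_ereal (\<psi> x) else 0)" for x
  have psi_mono: "psi x \<le> psi y" if xy: "a < x" "x \<le> y" "y < b" for x y
  proof -
    have "x \<in> ?D" "y \<in> ?D" using xy sub by auto
    moreover from this have "x \<in> I_pi" "y \<in> I_pi" using D by blast+
    then have "\<psi> x \<le> \<psi> y" by (rule mono_onD[OF mono]) (rule xy)
    ultimately show ?thesis using xy
      by (cases "\<psi> x"; cases "\<psi> y") (auto simp: psi_def finite_dom_def)
  qed
  have psi_m: "psi \<in> borel_measurable borel"
  proof -
    have "mono_on {a<..<b} psi" by (auto simp: mono_on_def intro: psi_mono)
    then have "psi \<in> borel_measurable (restrict_space borel {a<..<b})" by (rule borel_measurable_mono_on_fnc)
    then have "(\<lambda>x. indicator {a<..<b} x *\<^sub>R psi x) \<in> borel_measurable borel"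
      by (subst (asm) borel_measurable_restrict_space_iff) auto
    moreover have "(\<lambda>x. indicator {a<..<b} x *\<^sub>R psi x) = psi" by (auto simp: psi_def fun_eq_iff)
    ultimately show ?thesis by simp
  qed
  have mf: "monotone_function a b psi" by unfold_locales (use ab psi_mono psi_m in auto)
  obtain \<mu> where \<mu>: "has_distributional_derivative {a<..<b} (\<lambda>x. real_of_ereal (\<psi> x)) \<mu>"
    and q: "\<And>A. A \<in> sets q \<Longrightarrow> emeasure q A =
           (if A \<subseteq> ?D then emeasure \<mu> (A \<inter> {a<..<b}) + (\<integral>\<^sup>+x\<in>A. ennreal ((real_of_ereal (\<psi> x))\<^sup>2) \<partial>lborel) else \<infinity>)"
    and sets_q: "sets q = sets (restrict_space borel I_pi)"
    using pot unfolding is_potential_def int by blast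
  define M where "M = distr \<mu> borel (\<lambda>x. x)"
  have psi_eq: "real_of_ereal (\<psi> x) = psi x" if "x \<in> {a<..<b}" for x using that by (simp add: psi_def)
  have M: "emeasure M A = emeasure \<mu> (A \<inter> {a<..<b})" if "A \<in> sets borel" for A
    unfolding M_def by (rule monotone_function.emeasure_distr_distributional_derivative[OF mf psi_eq \<mu> that])
  have sd: "stieltjes_derivative a b psi M"
    unfolding M_def by (rule monotone_function.stieltjes_derivative_distributional[OF mf psi_eq \<mu>])
  have "potential_interval a b psi M q"
  proof (intro potential_interval.intro sd potential_interval_axioms.intro sets_q bounds)
    show "psi x = 0" if "x \<notin> {a<..<b}" for x unfolding psi_def by (rule if_not_P[OF that])
    show "emeasure q A = emeasure M A + (\<integral>\<^sup>+x\<in>A. ennreal ((psi x)\<^sup>2) \<partial>lborel)"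
      if A: "A \<in> sets borel" "A \<subseteq> {a<..<b}" for A
    proof -
      have AD: "A \<subseteq> ?D" using A sub by blast
      have "A \<in> sets q" unfolding sets_q by (subst sets_restrict_space_iff) (use A AD D in auto)
      from q[OF this] have "emeasure q A = emeasure \<mu> (A \<inter> {a<..<b}) + (\<integral>\<^sup>+x\<in>A. ennreal ((real_of_ereal (\<psi> x))\<^sup>2) \<partial>lborel)"
        using AD by simp
      also have "(\<integral>\<^sup>+x\<in>A. ennreal ((real_of_ereal (\<psi> x))\<^sup>2) \<partial>lborel) = (\<integral>\<^sup>+x\<in>A. ennreal ((psi x)\<^sup>2) \<partial>lborel)"
        by (rule nn_integral_cong) (use A psi_eq in \<open>auto split: split_indicator\<close>)
      finally show ?thesis using M[OF A(1)] by simp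
    qed
    show "w x = 0" if "continuous_on I_pi w" "w \<in> L2 q" "x \<in> I_pi" "x \<notin> {a<..<b}" for w x
      by (rule potential_vanish[OF pot that(1-3)]) (simp only: int that not_False_eq_True)
  qed
  moreover have "2 * tan ((y - x) / 2) \<le> psi y - psi x" if xy: "a < x" "x < y" "y < b" for x y
  proof -
    have "x \<in> ?D" "y \<in> ?D" using xy sub by auto
    then show ?thesis using A xy by (auto simp: class_A_def psi_def)
  qed
  ultimately show ?thesis by blast
qed

lemma nn_integral_tan_derivative:
  assumes "- (pi / 2) < s" "s \<le> t" "t < pi / 2"
  shows "(\<integral>\<^sup>+x. ennreal (1 + (tan x)\<^sup>2) * indicator {s<..t} x \<partial>lborel) = ennreal (tan t - tan s)"
proof -
  have [measurable]: "(tan :: real \<Rightarrow> real) \<in> borel_measurable borel" unfolding tan_def[abs_def] by measurable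
  have "(\<integral>\<^sup>+x. ennreal (1 + (tan x)\<^sup>2) * indicator {s<..t} x \<partial>lborel) = (\<integral>\<^sup>+x. ennreal (1 + (tan x)\<^sup>2) * indicator {s..t} x \<partial>lborel)"
  proof (rule nn_integral_cong_AE)
    show "AE x in lborel. ennreal (1 + (tan x)\<^sup>2) * indicator {s<..t} x = ennreal (1 + (tan x)\<^sup>2) * indicator {s..t} x"
      using AE_lborel_singleton[of s] by eventually_elim (auto split: split_indicator)
  qed
  also have "\<dots> = ennreal (tan t - tan s)"
  proof (rule nn_integral_FTC_Icc)
    fix x assume "x \<in> {s..t}"
    then have "cos x \<noteq> 0" using assms cos_gt_zero_pi[of x] by auto
    then show "(tan has_real_derivative 1 + (tan x)\<^sup>2) (at x)"
      using DERIV_tan[of x] tan_sec[of x] by (simp add: power_inverse)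
  qed (use assms in auto)
  finally show ?thesis .
qed

context potential_interval
begin

text \<open>The two measures agree on half-open intervals. They are infinite near the ends, so
  uniqueness is applied to their restrictions to \<open>(s, t]\<close>, and the general case follows by
  exhaustion.\<close>

lemma M_tan_derivative:
  assumes tan: "a = - (pi / 2)" "b = pi / 2" "\<And>x. x \<in> I_pi \<Longrightarrow> psi x = tan x"
    and A: "A \<in> sets borel" "A \<subseteq> I_pi"
  shows "emeasure M A = (\<integral>\<^sup>+x. ennreal (1 + (tan x)\<^sup>2) * indicator A x \<partial>lborel)"
proof -
  have [measurable]: "(tan :: real \<Rightarrow> real) \<in> borel_measurable borel" unfolding tan_def[abs_def] by measurable
  have cont: "isCont psi x" if x: "x \<in> I_pi" for x
  proof -
    have "\<forall>\<^sub>F y in nhds x. psi y = tan y"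
      using eventually_nhds_in_open[OF open_greaterThanLessThan x] by eventually_elim (rule tan(3))
    moreover have "isCont tan x" using cos_gt_zero_pi[of x] x by (intro isCont_tan) auto
    ultimately show ?thesis using isCont_cong by blast
  qed
  have Ioc: "emeasure M {s<..t} = (\<integral>\<^sup>+x. ennreal (1 + (tan x)\<^sup>2) * indicator {s<..t} x \<partial>lborel)"
    if st: "- (pi / 2) < s" "t < pi / 2" for s t
  proof (cases "s < t")
    case True
    then have "emeasure M {s<..t} = ennreal (psi t - psi s)" using st tan by (intro M_Ioc cont) auto
    then show ?thesis using nn_integral_tan_derivative[of s t] True st tan(3)[of s] tan(3)[of t] by simp
  qed simp
  define N where "N = density lborel (\<lambda>x. ennreal (1 + (tan x)\<^sup>2))"
  have N: "emeasure N B = (\<integral>\<^sup>+x. ennreal (1 + (tan x)\<^sup>2) * indicator B x \<partial>lborel)" if "B \<in> sets borel" for B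
    unfolding N_def by (rule emeasure_density) (use that in auto)
  have K_eq: "emeasure M (B \<inter> {s<..t}) = emeasure N (B \<inter> {s<..t})"
    if st: "- (pi / 2) < s" "t < pi / 2" and [measurable]: "B \<in> sets borel" for s t B
  proof -
    have dens: "emeasure (density R (indicator {s<..t})) C = emeasure R (C \<inter> {s<..t})"
      if R: "sets R = sets borel" and C: "C \<in> sets borel" for R C
    proof -
      have ind: "(indicator {s<..t} :: real \<Rightarrow> ennreal) \<in> borel_measurable R"
        by (rule borel_measurable_indicator) (simp add: R)
      have "emeasure (density R (indicator {s<..t})) C = (\<integral>\<^sup>+x. indicator {s<..t} x * indicator C x \<partial>R)"
        by (rule emeasure_density[OF ind]) (simp add: R C)
      also have "\<dots> = (\<integral>\<^sup>+x. indicator (C \<inter> {s<..t}) x \<partial>R)"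
        by (rule nn_integral_cong) (simp split: split_indicator)
      also have "\<dots> = emeasure R (C \<inter> {s<..t})" by (rule nn_integral_indicator) (use R C in auto)
      finally show ?thesis .
    qed
    have sN: "sets N = sets borel" by (simp add: N_def)
    have inter: "{x<..} \<inter> {s<..t} = {max x s<..t}" for x by auto
    have MN: "emeasure M {max x s<..t} = emeasure N {max x s<..t}" for x
      using Ioc[of "max x s" t] N[of "{max x s<..t}"] st by simp
    have "density M (indicator {s<..t}) = density N (indicator {s<..t})"
    proof (rule measure_eqI_lessThan)
      show "emeasure (density M (indicator {s<..t})) {x<..} < \<infinity>" for x
      proof -
        have "emeasure M {max x s<..t} < \<infinity>"
        proof (cases "max x s < t")
          case True
          then have "emeasure M {max x s<..t} = ennreal (psi t - psi (max x s))" using st tan by (intro M_Ioc cont) auto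
          then show ?thesis by simp
        next
          case False
          then have "{max x s<..t} = {}" by auto
          then show ?thesis by (simp only: emeasure_empty) simp
        qed
        then show ?thesis using dens[OF sets_M, of "{x<..}"] by (simp add: inter)
      qed
      show "emeasure (density M (indicator {s<..t})) {x<..} = emeasure (density N (indicator {s<..t})) {x<..}" for x
        using dens[OF sets_M, of "{x<..}"] dens[OF sN, of "{x<..}"] MN[of x] by (simp add: inter)
    qed (simp_all add: sets_M sN)
    then show ?thesis using dens[OF sets_M, of B] dens[OF sN, of B] that(3) by simp
  qed
  define r where "r n = pi / 2 - 1 / real (Suc n)" for n
  define K where "K n = A \<inter> {- r n<..r n}" for n
  have inc: "incseq K"
  proof (rule incseq_SucI)
    fix n
    have "1 / real (Suc (Suc n)) \<le> 1 / real (Suc n)" by (intro divide_left_mono) auto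
    then have "r n \<le> r (Suc n)" by (simp add: r_def)
    then show "K n \<subseteq> K (Suc n)" by (auto simp: K_def)
  qed
  have un: "(\<Union>n. K n) = A"
  proof
    show "A \<subseteq> (\<Union>n. K n)"
    proof
      fix x assume x: "x \<in> A"
      then have "0 < min (pi / 2 - x) (pi / 2 + x)" using A by auto
      then obtain n where "inverse (real (Suc n)) < min (pi / 2 - x) (pi / 2 + x)" using reals_Archimedean by blast
      then have "x \<in> K n" using x by (auto simp: K_def r_def inverse_eq_divide)
      then show "x \<in> (\<Union>n. K n)" by blast
    qed
  qed (auto simp: K_def)
  have K_sets: "K n \<in> sets borel" for n using A by (simp add: K_def)
  have "(\<lambda>n. emeasure R (K n)) \<longlonglongrightarrow> emeasure R A" if "sets R = sets borel" for R
    using Lim_emeasure_incseq[of K R] inc K_sets un that by auto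
  from this[OF sets_M] this[of N] have "(\<lambda>n. emeasure M (K n)) \<longlonglongrightarrow> emeasure M A" "(\<lambda>n. emeasure N (K n)) \<longlonglongrightarrow> emeasure N A"
    by (auto simp: N_def)
  moreover have "emeasure M (K n) = emeasure N (K n)" for n
    unfolding K_def by (rule K_eq) (use A in \<open>auto simp: r_def\<close>)
  ultimately have "emeasure M A = emeasure N A" using LIMSEQ_unique by simp
  then show ?thesis using N[OF A(1)] by simp
qed

lemma potential_tan:
  assumes tan: "a = - (pi / 2)" "b = pi / 2" "\<And>x. x \<in> I_pi \<Longrightarrow> psi x = tan x"
  shows "q = density (lebesgue_borel_on I_pi) (\<lambda>x. ennreal (1 + 2 * (tan x)\<^sup>2))"
proof (rule measure_eqI)
  have [measurable]: "(tan :: real \<Rightarrow> real) \<in> borel_measurable borel" unfolding tan_def[abs_def] by measurable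
  have "sets (lebesgue_borel_on I_pi) = sets (restrict_space borel I_pi)" by (rule sets_restrict_space_cong) simp
  then show "sets q = sets (density (lebesgue_borel_on I_pi) (\<lambda>x. ennreal (1 + 2 * (tan x)\<^sup>2)))"
    by (simp add: sets_q)
  fix A assume "A \<in> sets q"
  then have A: "A \<in> sets borel" "A \<subseteq> I_pi" and A': "A \<in> sets (lebesgue_borel_on I_pi)"
    unfolding sets_q by (auto simp: sets_restrict_space_iff)
  have "emeasure q A = emeasure M A + (\<integral>\<^sup>+x\<in>A. ennreal ((psi x)\<^sup>2) \<partial>lborel)"
    by (rule q_inside) (use A tan in auto)
  also have "(\<integral>\<^sup>+x\<in>A. ennreal ((psi x)\<^sup>2) \<partial>lborel) = (\<integral>\<^sup>+x. ennreal ((tan x)\<^sup>2) * indicator A x \<partial>lborel)"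
    by (rule nn_integral_cong) (use A tan(3) in \<open>auto split: split_indicator\<close>)
  also have "emeasure M A = (\<integral>\<^sup>+x. ennreal (1 + (tan x)\<^sup>2) * indicator A x \<partial>lborel)"
    by (rule M_tan_derivative[OF tan A])
  also have "(\<integral>\<^sup>+x. ennreal (1 + (tan x)\<^sup>2) * indicator A x \<partial>lborel) + (\<integral>\<^sup>+x. ennreal ((tan x)\<^sup>2) * indicator A x \<partial>lborel) =
      (\<integral>\<^sup>+x. ennreal (1 + (tan x)\<^sup>2) * indicator A x + ennreal ((tan x)\<^sup>2) * indicator A x \<partial>lborel)"
    by (rule nn_integral_add[symmetric]) (use A in auto)
  also have "\<dots> = (\<integral>\<^sup>+x. ennreal (1 + 2 * (tan x)\<^sup>2) * indicator A x * indicator I_pi x \<partial>lborel)"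
    by (rule nn_integral_cong) (use A in \<open>auto simp: ennreal_plus[symmetric] simp del: ennreal_plus split: split_indicator\<close>)
  also have "\<dots> = (\<integral>\<^sup>+x. ennreal (1 + 2 * (tan x)\<^sup>2) * indicator A x \<partial>lebesgue_borel_on I_pi)"
    by (rule nn_integral_restrict_space[symmetric]) simp
  also have "\<dots> = emeasure (density (lebesgue_borel_on I_pi) (\<lambda>x. ennreal (1 + 2 * (tan x)\<^sup>2))) A"
    by (rule emeasure_density[symmetric, OF measurable_restrict_space1 A']) simp
  finally show "emeasure q A = emeasure (density (lebesgue_borel_on I_pi) (\<lambda>x. ennreal (1 + 2 * (tan x)\<^sup>2))) A" .
qed

end

text \<open>Without admissible functions \<open>lambda1\<close> is \<open>\<infinity>\<close>. Otherwise \<open>lam0\<close> is a lower bound, and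
  \<open>lam0 \<le> 3\<close> leads to the tangent.\<close>

lemma lambda1_ge_3:
  assumes A: "\<psi> \<in> class_A" and pot: "is_potential \<psi> q"
  shows "3 \<le> lambda1 I_pi q"
    "lambda1 I_pi q = 3 \<Longrightarrow> q = density (lebesgue_borel_on I_pi) (\<lambda>x. ennreal (1 + 2 * (tan x)\<^sup>2))"
proof -
  have "3 \<le> lambda1 I_pi q \<and>
    (lambda1 I_pi q = 3 \<longrightarrow> q = density (lebesgue_borel_on I_pi) (\<lambda>x. ennreal (1 + 2 * (tan x)\<^sup>2)))"
  proof (cases "\<exists>v g. admissible I_pi q v g")
    case False
    then have "{rayleigh I_pi q v g | v g. admissible I_pi q v g} = {}" by blast
    then have "lambda1 I_pi q = top" unfolding lambda1_def by (simp only: Inf_empty)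
    then show ?thesis by simp
  next
    case True
    then obtain v g where adm: "admissible I_pi q v g" by blast
    obtain a b psi M where "potential_interval a b psi M q" and
      psi_tan: "\<And>x y. a < x \<Longrightarrow> x < y \<Longrightarrow> y < b \<Longrightarrow> 2 * tan ((y - x) / 2) \<le> psi y - psi x"
      using ex_potential_interval[OF A pot adm] by blast
    then interpret potential_interval a b psi M q by simp
    have "\<exists>v g. form_domain v g \<and> 0 < mass v" using rayleigh_ge[OF adm] by blast
    note rig = lam0_le_3_rigidity[OF this bounds psi_tan]
    have three: "3 \<le> lam0" using rig(1) by (cases "lam0 \<le> 3") auto
    then have "ennreal 3 \<le> ennreal lam0" by (rule ennreal_leI)
    from order_trans[OF this lambda1_ge_lam0] have "3 \<le> lambda1 I_pi q" by simp
    moreover have "q = density (lebesgue_borel_on I_pi) (\<lambda>x. ennreal (1 + 2 * (tan x)\<^sup>2))" if "lambda1 I_pi q = 3"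
    proof -
      have "ennreal lam0 \<le> ennreal 3" using lambda1_ge_lam0 that by simp
      then have "lam0 \<le> 3" by (subst (asm) ennreal_le_iff) auto
      from rig(2-4)[OF _ _ _ this] show ?thesis by (intro potential_tan) auto
    qed
    ultimately show ?thesis by blast
  qed
  then show "3 \<le> lambda1 I_pi q"
    "lambda1 I_pi q = 3 \<Longrightarrow> q = density (lebesgue_borel_on I_pi) (\<lambda>x. ennreal (1 + 2 * (tan x)\<^sup>2))" by auto
qed

section \<open>The eigenfunction \<open>cos\<^sup>2\<close>\<close>

lemma nn_integral_cos4_sin2cos2:
  assumes "0 \<le> \<alpha>" "0 \<le> \<beta>"
  shows "(\<integral>\<^sup>+x. ennreal (\<alpha> * (cos x) ^ 4 + \<beta> * ((sin x)\<^sup>2 * (cos x)\<^sup>2)) \<partial>lebesgue_borel_on I_pi) =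
    ennreal (\<alpha> * (3 * pi / 8) + \<beta> * (pi / 8))"
proof -
  define f where "f x = \<alpha> * (cos x) ^ 4 + \<beta> * ((sin x)\<^sup>2 * (cos x)\<^sup>2)" for x :: real
  define F where "F x = \<alpha> * (3 * x / 8 + sin x * (cos x) ^ 3 / 4 + 3 * (sin x * cos x) / 8) +
    \<beta> * (x / 8 - sin x * cos x * ((cos x)\<^sup>2 - (sin x)\<^sup>2) / 8)" for x :: real
  have [measurable]: "f \<in> borel_measurable borel"
    unfolding f_def by (intro borel_measurable_continuous_onI continuous_intros)
  have D: "(F has_real_derivative f x) (at x)" for x
  proof -
    define s c where "s = sin x" and "c = cos x"
    have s2: "s\<^sup>2 = 1 - c\<^sup>2" by (simp add: s_def c_def sin_squared_eq)
    have "(F has_real_derivative \<alpha> * (3 / 8 + (c * c ^ 3 - s * (3 * c\<^sup>2 * s)) / 4 + 3 * (c * c - s * s) / 8) +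
        \<beta> * (1 / 8 - ((c * c - s * s) * (c\<^sup>2 - s\<^sup>2) + s * c * (- (2 * c * s) - 2 * s * c)) / 8)) (at x)"
      unfolding F_def[abs_def] s_def c_def by (auto intro!: derivative_eq_intros simp: power2_eq_square power3_eq_cube field_simps)
    moreover have "3 / 8 + (c * c ^ 3 - s * (3 * c\<^sup>2 * s)) / 4 + 3 * (c * c - s * s) / 8 = c ^ 4"
    proof -
      have "3 / 8 + (c * c ^ 3 - s * (3 * c\<^sup>2 * s)) / 4 + 3 * (c * c - s * s) / 8 =
          3 / 8 + (c ^ 4 - 3 * c\<^sup>2 * s\<^sup>2) / 4 + 3 * (c\<^sup>2 - s\<^sup>2) / 8"
        by (simp add: power2_eq_square power4_eq_xxxx power3_eq_cube)
      also have "\<dots> = c ^ 4" unfolding s2 by (simp add: power2_eq_square power4_eq_xxxx field_simps)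
      finally show ?thesis .
    qed
    moreover have "1 / 8 - ((c * c - s * s) * (c\<^sup>2 - s\<^sup>2) + s * c * (- (2 * c * s) - 2 * s * c)) / 8 = s\<^sup>2 * c\<^sup>2"
    proof -
      have "1 / 8 - ((c * c - s * s) * (c\<^sup>2 - s\<^sup>2) + s * c * (- (2 * c * s) - 2 * s * c)) / 8 =
          1 / 8 - ((c\<^sup>2 - s\<^sup>2)\<^sup>2 - 4 * s\<^sup>2 * c\<^sup>2) / 8"
        by (simp add: power2_eq_square algebra_simps)
      also have "\<dots> = s\<^sup>2 * c\<^sup>2" unfolding s2 by (simp add: power2_eq_square field_simps)
      finally show ?thesis .
    qed
    ultimately show ?thesis by (simp add: f_def s_def c_def)
  qed
  have "(\<integral>\<^sup>+x. ennreal (f x) \<partial>lebesgue_borel_on I_pi) = (\<integral>\<^sup>+x. ennreal (f x) * indicator I_pi x \<partial>lborel)"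
    by (rule nn_integral_restrict_space) simp
  also have "\<dots> = (\<integral>\<^sup>+x. ennreal (f x) * indicator {- (pi / 2)..pi / 2} x \<partial>lborel)"
  proof (rule nn_integral_cong_AE)
    show "AE x in lborel. ennreal (f x) * indicator I_pi x = ennreal (f x) * indicator {- (pi / 2)..pi / 2} x"
      using AE_lborel_singleton[of "pi / 2"] AE_lborel_singleton[of "- (pi / 2)"]
      by eventually_elim (auto split: split_indicator)
  qed
  also have "\<dots> = ennreal (F (pi / 2) - F (- (pi / 2)))"
    by (rule nn_integral_FTC_Icc) (use D assms in \<open>auto simp: f_def\<close>)
  also have "F (pi / 2) - F (- (pi / 2)) = \<alpha> * (3 * pi / 8) + \<beta> * (pi / 8)"
    by (simp add: F_def field_simps)
  finally show ?thesis unfolding f_def .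
qed

lemma cos_sq_nn_integrals:
  defines "J \<equiv> lebesgue_borel_on I_pi"
  shows "(\<integral>\<^sup>+x. ennreal (((cos x)\<^sup>2)\<^sup>2) \<partial>J) = ennreal (3 * pi / 8)"
    "(\<integral>\<^sup>+x. ennreal ((- 2 * sin x * cos x)\<^sup>2) \<partial>J) = ennreal (pi / 2)"
    "(\<integral>\<^sup>+x. ennreal (((cos x)\<^sup>2)\<^sup>2) \<partial>density J (\<lambda>x. ennreal (1 + 2 * (tan x)\<^sup>2))) = ennreal (5 * pi / 8)"
proof -
  have "((cos x)\<^sup>2)\<^sup>2 = 1 * (cos x) ^ 4 + 0 * ((sin x)\<^sup>2 * (cos x)\<^sup>2)" for x :: real by simp
  then show "(\<integral>\<^sup>+x. ennreal (((cos x)\<^sup>2)\<^sup>2) \<partial>J) = ennreal (3 * pi / 8)"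
    unfolding J_def using nn_integral_cos4_sin2cos2[of 1 0] by simp
  have "(- 2 * sin x * cos x)\<^sup>2 = 0 * (cos x) ^ 4 + 4 * ((sin x)\<^sup>2 * (cos x)\<^sup>2)" for x :: real
    by (simp add: power_mult_distrib)
  then show "(\<integral>\<^sup>+x. ennreal ((- 2 * sin x * cos x)\<^sup>2) \<partial>J) = ennreal (pi / 2)"
    unfolding J_def using nn_integral_cos4_sin2cos2[of 0 4] by simp
  have [measurable]: "(tan :: real \<Rightarrow> real) \<in> borel_measurable borel" unfolding tan_def[abs_def] by measurable
  have sq: "(\<lambda>x. ennreal (1 + 2 * (tan x)\<^sup>2)) \<in> borel_measurable J" "(\<lambda>x. ennreal (((cos x)\<^sup>2)\<^sup>2)) \<in> borel_measurable J"
    unfolding J_def by (intro measurable_restrict_space1; simp)+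
  have "(\<integral>\<^sup>+x. ennreal (((cos x)\<^sup>2)\<^sup>2) \<partial>density J (\<lambda>x. ennreal (1 + 2 * (tan x)\<^sup>2))) =
      (\<integral>\<^sup>+x. ennreal (1 + 2 * (tan x)\<^sup>2) * ennreal (((cos x)\<^sup>2)\<^sup>2) \<partial>J)"
    by (rule nn_integral_density[OF sq])
  also have "\<dots> = (\<integral>\<^sup>+x. ennreal (1 * (cos x) ^ 4 + 2 * ((sin x)\<^sup>2 * (cos x)\<^sup>2)) \<partial>J)"
  proof (rule nn_integral_cong)
    fix x assume "x \<in> space J"
    then have "cos x \<noteq> 0" using cos_gt_zero_pi[of x] by (simp add: J_def)
    then have "(1 + 2 * (tan x)\<^sup>2) * ((cos x)\<^sup>2)\<^sup>2 = 1 * (cos x) ^ 4 + 2 * ((sin x)\<^sup>2 * (cos x)\<^sup>2)"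
      by (simp add: tan_def power_divide field_simps power2_eq_square power4_eq_xxxx)
    moreover have "ennreal (1 + 2 * (tan x)\<^sup>2) * ennreal (((cos x)\<^sup>2)\<^sup>2) = ennreal ((1 + 2 * (tan x)\<^sup>2) * ((cos x)\<^sup>2)\<^sup>2)"
      by (rule ennreal_mult[symmetric]) simp_all
    ultimately show "ennreal (1 + 2 * (tan x)\<^sup>2) * ennreal (((cos x)\<^sup>2)\<^sup>2) = ennreal (1 * (cos x) ^ 4 + 2 * ((sin x)\<^sup>2 * (cos x)\<^sup>2))"
      by (simp only:)
  qed
  also have "\<dots> = ennreal (5 * pi / 8)" unfolding J_def by (subst nn_integral_cos4_sin2cos2) (simp_all add: field_simps)
  finally show "(\<integral>\<^sup>+x. ennreal (((cos x)\<^sup>2)\<^sup>2) \<partial>density J (\<lambda>x. ennreal (1 + 2 * (tan x)\<^sup>2))) = ennreal (5 * pi / 8)" .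
qed

lemma cos_sq_DERIV: "((\<lambda>x. (cos x)\<^sup>2) has_real_derivative - 2 * sin x * cos x) (at x)"
  by (auto intro!: derivative_eq_intros)

lemma H1_cos_sq: "H1 I_pi (\<lambda>x. (cos x)\<^sup>2) (\<lambda>x. - 2 * sin x * cos x)"
  unfolding H1_def L2_def
proof (intro conjI allI impI CollectI)
  show "(\<lambda>x. (cos x)\<^sup>2) \<in> borel_measurable (lebesgue_borel_on I_pi)"
    "(\<lambda>x. - 2 * sin x * cos x) \<in> borel_measurable (lebesgue_borel_on I_pi)"
    by (intro measurable_restrict_space1; simp)+
  show "(\<integral>\<^sup>+x. ennreal (((cos x)\<^sup>2)\<^sup>2) \<partial>lebesgue_borel_on I_pi) < \<infinity>"
    "(\<integral>\<^sup>+x. ennreal ((- 2 * sin x * cos x)\<^sup>2) \<partial>lebesgue_borel_on I_pi) < \<infinity>"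
    unfolding cos_sq_nn_integrals by simp_all
  fix \<phi> assume test: "test_function I_pi \<phi>"
  note T = test_function_props[OF test]
  let ?v = "\<lambda>x::real. (cos x)\<^sup>2" and ?g = "\<lambda>x::real. - 2 * sin x * cos x"
  have cont: "continuous_on UNIV \<phi>" "continuous_on UNIV (deriv \<phi>)"
    by (intro continuous_at_imp_continuous_on; use T DERIV_isCont in blast)+
  have int: "integrable lborel f" if f: "continuous_on UNIV f" "\<And>x. x \<notin> I_pi \<Longrightarrow> f x = 0" for f :: "real \<Rightarrow> real"
  proof -
    obtain B where "\<forall>x\<in>{- (pi / 2)..pi / 2}. \<bar>f x\<bar> \<le> B"
      using continuous_on_Icc_bounded[OF continuous_on_subset[OF f(1) subset_UNIV]] by blast
    then show ?thesis
      by (intro integrable_bounded_support[where c = "- (pi / 2)" and d = "pi / 2" and B = B] borel_measurable_continuous_onI f(1))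
         (auto intro!: f(2))
  qed
  have ints: "integrable lborel (\<lambda>x. ?v x * deriv \<phi> x)" "integrable lborel (\<lambda>x. ?g x * \<phi> x)"
    by (intro int continuous_intros cont; use T in auto)+
  have ind: "(LINT x|lebesgue_borel_on I_pi. f x) = (LINT x|lborel. f x)" if "\<And>x. x \<notin> I_pi \<Longrightarrow> f x = 0" for f :: "real \<Rightarrow> real"
  proof -
    have "(LINT x|lebesgue_borel_on I_pi. f x) = (LINT x|lborel. indicator I_pi x *\<^sub>R f x)"
      by (rule integral_restrict_space) simp
    also have "\<dots> = (LINT x|lborel. f x)"
      by (rule Bochner_Integration.integral_cong[OF refl]) (use that in \<open>auto split: split_indicator\<close>)
    finally show ?thesis .
  qed
  have "has_bochner_integral lborel (\<lambda>x. (?v x * deriv \<phi> x + ?g x * \<phi> x) * indicator {- (pi / 2)..pi / 2} x)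
      (?v (pi / 2) * \<phi> (pi / 2) - ?v (- (pi / 2)) * \<phi> (- (pi / 2)))"
  proof (rule has_bochner_integral_FTC_Icc_real)
    show "((\<lambda>x. ?v x * \<phi> x) has_real_derivative ?v x * deriv \<phi> x + ?g x * \<phi> x) (at x)" for x
      using DERIV_mult[OF cos_sq_DERIV T(1), of x] by (simp add: algebra_simps)
    show "isCont (\<lambda>x. ?v x * deriv \<phi> x + ?g x * \<phi> x) x" for x
      using T(2)[of x] DERIV_isCont[OF T(1), of x] by (intro continuous_intros)
  qed simp
  moreover have "(\<lambda>x. (?v x * deriv \<phi> x + ?g x * \<phi> x) * indicator {- (pi / 2)..pi / 2} x) = (\<lambda>x. ?v x * deriv \<phi> x + ?g x * \<phi> x)"
  proof
    fix x show "(?v x * deriv \<phi> x + ?g x * \<phi> x) * indicator {- (pi / 2)..pi / 2} x = ?v x * deriv \<phi> x + ?g x * \<phi> x"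
      using T(3,4)[of x] by (cases "x \<in> I_pi") auto
  qed
  ultimately have "(LINT x|lborel. ?v x * deriv \<phi> x + ?g x * \<phi> x) = 0"
    using T(3)[of "pi / 2"] T(3)[of "- (pi / 2)"] by (simp add: has_bochner_integral_iff)
  then have "(LINT x|lborel. ?v x * deriv \<phi> x) = - (LINT x|lborel. ?g x * \<phi> x)"
    using Bochner_Integration.integral_add[OF ints] by linarith
  moreover have "(LINT x|lebesgue_borel_on I_pi. ?v x * deriv \<phi> x) = (LINT x|lborel. ?v x * deriv \<phi> x)"
    "(LINT x|lebesgue_borel_on I_pi. ?g x * \<phi> x) = (LINT x|lborel. ?g x * \<phi> x)"
    by (rule ind; use T in simp)+
  ultimately show "(LINT x|lebesgue_borel_on I_pi. ?v x * deriv \<phi> x) = - (LINT x|lebesgue_borel_on I_pi. ?g x * \<phi> x)"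
    by simp
qed

lemma cos_near_boundary:
  assumes "x \<in> I_pi" "x \<notin> {- (pi / 2) + d..pi / 2 - d}"
  shows "0 \<le> cos x" "cos x \<le> d"
proof -
  show "0 \<le> cos x" using assms(1) cos_gt_zero_pi[of x] by auto
  have "cos x \<le> pi / 2 - x" using sin_x_le_x[of "pi / 2 - x"] assms(1) by (simp add: sin_cos_eq)
  moreover have "cos x \<le> pi / 2 + x" using sin_x_le_x[of "pi / 2 + x"] assms(1) by (simp add: sin_add)
  ultimately show "cos x \<le> d" using assms(2) by auto
qed

lemma nn_integral_square_le:
  fixes f :: "real \<Rightarrow> real"
  assumes "\<And>x. x \<in> I_pi \<Longrightarrow> \<bar>f x\<bar> \<le> C" "0 \<le> C"
  shows "(\<integral>\<^sup>+x. ennreal ((f x)\<^sup>2) \<partial>lebesgue_borel_on I_pi) \<le> ennreal (C\<^sup>2 * pi)"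
proof -
  have "(\<integral>\<^sup>+x. ennreal ((f x)\<^sup>2) \<partial>lebesgue_borel_on I_pi) \<le> (\<integral>\<^sup>+x. ennreal (C\<^sup>2) \<partial>lebesgue_borel_on I_pi)"
    by (rule nn_integral_mono) (use assms in \<open>auto intro!: ennreal_leI simp: power2_le_iff_abs_le\<close>)
  also have "\<dots> = ennreal (C\<^sup>2 * pi)"
    by (simp add: emeasure_restrict_space ennreal_mult[symmetric])
  finally show ?thesis .
qed

text \<open>The cut-off functions differ from 1 only within \<open>2 e\<close> of the ends, where \<open>cos \<le> 2 e\<close>, and
  their derivatives are of order \<open>1 / e\<close>. So the errors \<open>(cut - 1) cos\<^sup>2\<close> and
  \<open>cut' cos\<^sup>2 + (cut - 1) (cos\<^sup>2)'\<close> are of order \<open>e\<close> uniformly.\<close>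

lemma H10_cos_sq: "H10 I_pi (\<lambda>x. (cos x)\<^sup>2) (\<lambda>x. - 2 * sin x * cos x)"
  unfolding H10_def
proof (intro conjI H1_cos_sq)
  show "continuous_on I_pi (\<lambda>x. (cos x)\<^sup>2)" by (intro continuous_intros)
  obtain B where B: "B > 0" "\<And>x. bump x \<le> B" using bump_bounded by blast
  \<comment> \<open>starting from \<open>1 / 3\<close> makes \<open>4 e \<le> pi\<close>, so that the two smooth steps are disjoint\<close>
  define e where "e n = 1 / (real n + 3)" for n
  have e: "0 < e n" "4 * e n \<le> pi" for n
  proof -
    have "e n \<le> 1 / 3" unfolding e_def by (intro divide_left_mono) auto
    then show "4 * e n \<le> pi" using pi_gt3 by linarith
  qed (simp add: e_def)
  define c d where "c n = - (pi / 2) + e n" and "d n = pi / 2 - 2 * e n" for n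
  define cut where "cut n x = step_at (e n) (c n) x - step_at (e n) (d n) x" for n x
  define cut' where "cut' n x = bump_at (e n) (c n) x - bump_at (e n) (d n) x" for n x
  define \<phi> where "\<phi> n x = cut n x * (cos x * cos x)" for n x
  have cd: "c n + e n \<le> d n" for n using e(2)[of n] by (simp add: c_def d_def)
  note P = plateau[OF e(1) cd, folded cut_def cut'_def]
  have chi_D: "(cut n has_real_derivative cut' n x) (at x)" for n x
    using P(2) by (simp add: cut_def[abs_def])
  have phi_D: "deriv (\<phi> n) x = cut' n x * (cos x)\<^sup>2 + cut n x * (- 2 * sin x * cos x)" for n x
  proof (rule DERIV_imp_deriv)
    show "(\<phi> n has_real_derivative cut' n x * (cos x)\<^sup>2 + cut n x * (- 2 * sin x * cos x)) (at x)"
      unfolding \<phi>_def[abs_def]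
      using DERIV_mult[OF chi_D cos_sq_DERIV, of n x] by (simp add: power2_eq_square algebra_simps)
  qed
  have test: "test_function I_pi (\<phi> n)" for n
    unfolding test_function_def
  proof (intro conjI allI)
    have "smooth (\<phi> n)" unfolding \<phi>_def[abs_def] cut_def
      by (intro smooth_intros plateau(1)[OF e(1) cd])
    then show "(deriv ^^ m) (\<phi> n) differentiable (at x)" for m x by (rule smooth_iter)
    show "\<exists>K. compact K \<and> K \<subseteq> I_pi \<and> (\<forall>x. x \<notin> K \<longrightarrow> \<phi> n x = 0)"
    proof (intro exI conjI allI impI)
      show "compact {c n..d n + e n}" by simp
      show "{c n..d n + e n} \<subseteq> I_pi" using e(1)[of n] by (auto simp: c_def d_def)
      fix x assume "x \<notin> {c n..d n + e n}"
      then have "x \<notin> {c n<..<d n + e n}" by auto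
      then show "\<phi> n x = 0" using P(5)[of x n] by (simp add: \<phi>_def)
    qed
  qed
  have chi'_bound: "\<bar>cut' n x\<bar> \<le> B / e n" for n x
  proof -
    have b: "0 \<le> bump_at (e n) y x \<and> bump_at (e n) y x \<le> B / e n" for y
      using step_at(9)[OF e(1), of n y x] B(2) e(1)[of n] by (auto simp: bump_at_def divide_right_mono)
    then show ?thesis using b[of "c n"] b[of "d n"] unfolding cut'_def by linarith
  qed
  have inner: "cut n x = 1 \<and> cut' n x = 0" if "x \<in> {- (pi / 2) + 2 * e n..pi / 2 - 2 * e n}" for n x
  proof -
    have x: "x \<in> {c n + e n..d n}" using that by (simp add: c_def d_def)
    then have "x \<notin> {c n<..<c n + e n}" "x \<notin> {d n<..<d n + e n}" by auto
    then show ?thesis using P(6)[OF x] step_at(10)[OF e(1)] by (simp add: cut'_def)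
  qed
  have close: "\<bar>\<phi> n x - (cos x)\<^sup>2\<bar> \<le> 4 * e n \<and> \<bar>deriv (\<phi> n) x - - 2 * sin x * cos x\<bar> \<le> 4 * (B + 1) * e n"
    if x: "x \<in> I_pi" for n x
  proof (cases "x \<in> {- (pi / 2) + 2 * e n..pi / 2 - 2 * e n}")
    case True
    then show ?thesis using inner[OF True] e(1)[of n] B(1) by (simp add: \<phi>_def phi_D power2_eq_square)
  next
    case False
    note cs = cos_near_boundary[OF x False]
    have chi: "\<bar>cut n x - 1\<bar> \<le> 1" using P(3)[of n x] P(4)[of n x] by linarith
    have c2: "(cos x)\<^sup>2 \<le> (2 * e n)\<^sup>2" using cs by (intro power_mono)
    have "\<bar>\<phi> n x - (cos x)\<^sup>2\<bar> = \<bar>cut n x - 1\<bar> * (cos x)\<^sup>2"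
    proof -
      have "\<phi> n x - (cos x)\<^sup>2 = (cut n x - 1) * (cos x)\<^sup>2" by (simp add: \<phi>_def power2_eq_square algebra_simps)
      then show ?thesis by (simp add: abs_mult)
    qed
    also have "\<dots> \<le> 1 * (2 * e n * 1)"
    proof (rule mult_mono[OF chi])
      have "cos x * cos x \<le> (2 * e n) * 1" using cs by (intro mult_mono) auto
      then show "(cos x)\<^sup>2 \<le> 2 * e n * 1" by (simp add: power2_eq_square)
    qed auto
    also have "\<dots> \<le> 4 * e n" using e(1)[of n] by simp
    finally have 1: "\<bar>\<phi> n x - (cos x)\<^sup>2\<bar> \<le> 4 * e n" .
    have "\<bar>cut' n x * (cos x)\<^sup>2\<bar> \<le> B / e n * (2 * e n)\<^sup>2"
      unfolding abs_mult using chi'_bound[of n x] c2 B(1) e(1)[of n] by (intro mult_mono) auto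
    also have "\<dots> = 4 * B * e n" using e(1)[of n] by (simp add: power2_eq_square)
    finally have 2: "\<bar>cut' n x * (cos x)\<^sup>2\<bar> \<le> 4 * B * e n" .
    have "\<bar>(cut n x - 1) * (- 2 * sin x * cos x)\<bar> = \<bar>cut n x - 1\<bar> * (2 * \<bar>sin x\<bar> * cos x)"
      using cs(1) by (simp add: abs_mult)
    also have "\<dots> \<le> 1 * (2 * 1 * (2 * e n))"
      using chi cs abs_sin_le_one[of x] e(1)[of n] by (intro mult_mono) auto
    finally have 3: "\<bar>(cut n x - 1) * (- 2 * sin x * cos x)\<bar> \<le> 4 * e n" by simp
    have "deriv (\<phi> n) x - - 2 * sin x * cos x = cut' n x * (cos x)\<^sup>2 + (cut n x - 1) * (- 2 * sin x * cos x)"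
      unfolding phi_D by (simp add: algebra_simps)
    then have "\<bar>deriv (\<phi> n) x - - 2 * sin x * cos x\<bar> \<le> 4 * B * e n + 4 * e n" using 2 3 by linarith
    then show ?thesis using 1 by (simp add: algebra_simps)
  qed
  define r where "r n = (4 * e n)\<^sup>2 * pi + (4 * (B + 1) * e n)\<^sup>2 * pi" for n
  have le: "(\<integral>\<^sup>+x. ennreal ((\<phi> n x - (cos x)\<^sup>2)\<^sup>2) \<partial>lebesgue_borel_on I_pi) +
      (\<integral>\<^sup>+x. ennreal ((deriv (\<phi> n) x - - 2 * sin x * cos x)\<^sup>2) \<partial>lebesgue_borel_on I_pi) \<le> ennreal (r n)" for n
  proof -
    have "(\<integral>\<^sup>+x. ennreal ((\<phi> n x - (cos x)\<^sup>2)\<^sup>2) \<partial>lebesgue_borel_on I_pi) \<le> ennreal ((4 * e n)\<^sup>2 * pi)"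
      by (rule nn_integral_square_le) (use close e(1)[of n] in auto)
    moreover have "(\<integral>\<^sup>+x. ennreal ((deriv (\<phi> n) x - - 2 * sin x * cos x)\<^sup>2) \<partial>lebesgue_borel_on I_pi) \<le>
        ennreal ((4 * (B + 1) * e n)\<^sup>2 * pi)"
      by (rule nn_integral_square_le) (use close e(1)[of n] B(1) in auto)
    ultimately show ?thesis unfolding r_def by (subst ennreal_plus) (auto intro: add_mono)
  qed
  have e_lim: "e \<longlonglongrightarrow> 0" unfolding e_def[abs_def] by real_asymp
  have "r \<longlonglongrightarrow> (4 * 0)\<^sup>2 * pi + (4 * (B + 1) * 0)\<^sup>2 * pi"
    unfolding r_def[abs_def] by (intro tendsto_intros e_lim)
  then have "(\<lambda>n. ennreal (r n)) \<longlonglongrightarrow> ennreal 0" by (intro tendsto_ennrealI) simp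
  then have lim: "(\<lambda>n. ennreal (r n)) \<longlonglongrightarrow> 0" by simp
  have "(\<lambda>n. (\<integral>\<^sup>+x. ennreal ((\<phi> n x - (cos x)\<^sup>2)\<^sup>2) \<partial>lebesgue_borel_on I_pi) +
      (\<integral>\<^sup>+x. ennreal ((deriv (\<phi> n) x - - 2 * sin x * cos x)\<^sup>2) \<partial>lebesgue_borel_on I_pi)) \<longlonglongrightarrow> 0"
    by (rule tendsto_sandwich[OF _ _ tendsto_const lim]) (use le in auto)
  with test show "\<exists>\<phi>. (\<forall>n. test_function I_pi (\<phi> n)) \<and>
      (\<lambda>n. (\<integral>\<^sup>+x. ennreal ((\<phi> n x - (cos x)\<^sup>2)\<^sup>2) \<partial>lebesgue_borel_on I_pi) +
         (\<integral>\<^sup>+x. ennreal ((deriv (\<phi> n) x - - 2 * sin x * cos x)\<^sup>2) \<partial>lebesgue_borel_on I_pi)) \<longlonglongrightarrow> 0"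
    by blast
qed

lemma admissible_cos_sq:
  assumes "q = density (lebesgue_borel_on I_pi) (\<lambda>x. ennreal (1 + 2 * (tan x)\<^sup>2))"
  shows "admissible I_pi q (\<lambda>x. (cos x)\<^sup>2) (\<lambda>x. - 2 * sin x * cos x)"
    "rayleigh I_pi q (\<lambda>x. (cos x)\<^sup>2) (\<lambda>x. - 2 * sin x * cos x) = 3"
proof -
  have "(\<lambda>x. (cos x)\<^sup>2) \<in> L2 q"
    unfolding L2_def assms using cos_sq_nn_integrals(3) by (auto intro!: measurable_restrict_space1)
  then show "admissible I_pi q (\<lambda>x. (cos x)\<^sup>2) (\<lambda>x. - 2 * sin x * cos x)"
    unfolding admissible_def using H10_cos_sq by (auto intro!: bexI[of _ 0])
  have "rayleigh I_pi q (\<lambda>x. (cos x)\<^sup>2) (\<lambda>x. - 2 * sin x * cos x) =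
      (ennreal (pi / 2) + ennreal (5 * pi / 8)) / ennreal (3 * pi / 8)"
    unfolding rayleigh_def assms cos_sq_nn_integrals ..
  also have "\<dots> = ennreal (9 * pi / 8) / ennreal (3 * pi / 8)" by (simp add: ennreal_plus[symmetric] del: ennreal_plus)
  also have "\<dots> = ennreal 3" by (subst divide_ennreal) simp_all
  finally show "rayleigh I_pi q (\<lambda>x. (cos x)\<^sup>2) (\<lambda>x. - 2 * sin x * cos x) = 3" by simp
qed

theorem theorem8:
  fixes \<psi> :: "real \<Rightarrow> ereal" and q :: "real measure"
  assumes "\<psi> \<in> class_A" and "is_potential \<psi> q"
  shows "lambda1 I_pi q \<ge> 3 \<and>
    (lambda1 I_pi q = 3 \<longleftrightarrow>
       q = density (lebesgue_borel_on I_pi) (\<lambda>x. ennreal (1 + 2 * (tan x)\<^sup>2))) \<and>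
    (q = density (lebesgue_borel_on I_pi) (\<lambda>x. ennreal (1 + 2 * (tan x)\<^sup>2)) \<longrightarrow>
       eigenfunction I_pi q (\<lambda>x. (cos x)\<^sup>2))"
proof -
  note lower = lambda1_ge_3[OF assms]
  have eq: "lambda1 I_pi q = 3 \<and> eigenfunction I_pi q (\<lambda>x. (cos x)\<^sup>2)"
    if q: "q = density (lebesgue_borel_on I_pi) (\<lambda>x. ennreal (1 + 2 * (tan x)\<^sup>2))"
  proof -
    note adm = admissible_cos_sq[OF q]
    have "lambda1 I_pi q \<le> rayleigh I_pi q (\<lambda>x. (cos x)\<^sup>2) (\<lambda>x. - 2 * sin x * cos x)"
      unfolding lambda1_def by (rule Inf_lower) (use adm(1) in blast)
    then have "lambda1 I_pi q = 3" using lower(1) adm(2) by simp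
    then show ?thesis unfolding eigenfunction_def using adm by metis
  qed
  show ?thesis using lower eq by blast
qed

end
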